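(* Let $F:U\times\mathbb T^d\times\Lambda\to\mathbb R^2\times\mathbb T^d$ be an analytic map in the reduced form described in the context, i.e. $$F(x,y,\theta,\lambda)=\begin{pmatrix} x+c(\theta,\lambda)y\\ y+a_k(\theta,\lambda)x^k+A(x,y,\theta,\lambda)\\ \theta+\omega+d_p(\theta,\lambda)x^p+B(x,y,\theta,\lambda)\end{pmatrix}.$$ Assume that $2p>k-1$, that $\bar c(\lambda),\bar a_k(\lambda)>0$ for $\lambda\in\Lambda$, and that $\omega$ is Diophantine (in the map setting). Then, for all $n\ge2$, there exist two pairs of maps $\mathcal K_n:\mathbb R\times\mathbb T^d\times\Lambda\to\mathbb R^2\times\mathbb T^d$ and $\mathcal R_n:\mathbb R\times\mathbb T^d\times\Lambda\to\mathbb R\times\mathbb T^d$ of the form $$\mathcal K_n(u,\theta,\lambda)=\begin{pmatrix}u^2+\sum_{i=3}^{n}\bar K^x_i(\lambda)u^i+\sum_{i=k+1}^{n+k-1}\tilde K^x_i(\theta,\lambda)u^i\\ \sum_{i=k+1}^{n+k-1}\bar K^y_i(\lambda)u^i+\sum_{i=2k}^{n+2k-2}\tilde K^y_i(\theta,\lambda)u^i\\ \theta+\sum_{i=2p-k+1}^{n+2p-k-1}\bar K^\theta_i(\lambda)u^i+\sum_{i=2p}^{n+2p-2}\tilde K^\theta_i(\theta,\lambda)u^i\end{pmatrix}$$ and $$\mathcal R_n(u,\theta,\lambda)=\begin{cases}\begin{pmatrix}u+\bar R^x_k(\lambda)u^k\\ \theta+\omega\end{pmatrix}&\text{if }2\le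 n\le k,\\[2ex] \begin{pmatrix}u+\bar R^x_k(\lambda)u^k+\bar R^x_{2k-1}(\lambda)u^{2k-1}\\ \theta+\omega\end{pmatrix}&\text{if }n\ge k+1,\end{cases}$$ such that $$\mathcal G_n(u,\theta,\lambda):=F(\mathcal K_n(u,\theta,\lambda),\lambda)-\mathcal K_n(\mathcal R_n(u,\theta,\lambda),\lambda)=\big(O(u^{n+k}),O(u^{n+2k-1}),O(u^{n+2p-1})\big).$$ Moreover, for the lowest order coefficients we have (with the same choice of sign, $+$ or $-$, in all formulas, each choice giving one of the two pairs) $$\bar K^y_{k+1}(\lambda)=\pm\sqrt{\frac{2\,\bar a_k(\lambda)}{\bar c(\lambda)(k+1)}},\quad \bar K^\theta_{2p-k+1}(\lambda)=\pm\frac{\bar d_p(\lambda)}{2p-k+1}\sqrt{\frac{2(k+1)}{\bar c(\lambda)\,\bar a_k(\lambda)}},\quad \bar R^x_k(\lambda)=\pm\sqrt{\frac{\bar c(\lambda)\,\bar a_k(\lambda)}{2(k+1)}},$$ $$\tilde K^x_{k+1}(\theta,\lambda)=\mathcal{SD}(\tilde c(\theta,\lambda))\,\bar K^y_{k+1}(\lambda),\quad \tilde K^y_{2k}(\theta,\lambda)=\mathcal{SD}(\tilde a_k(\theta,\lambda)),\quad \tilde K^\theta_{2p}(\theta,\lambda)=\mathcal{SD}(\tilde d_p(\theta,\lambda)).$$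
   Context: $\mathbb T^d=(\mathbb R/\mathbb Z)^d$; $U\subset\mathbb R^2$ is a neighbourhood of $(0,0)$; $\Lambda\subset\mathbb R^m$ is a parameter set; $\omega\in\mathbb R^d$. For a function $h$ of $\theta\in\mathbb T^d$ (and possibly other variables), $\bar h=\frac1{\mathrm{vol}(\mathbb T^d)}\int_{\mathbb T^d}h\,d\theta$ is its average and $\tilde h=h-\bar h$ its oscillatory part. In the coefficients of $\mathcal K_n,\mathcal R_n$, a bar indicates independence of $\theta$ and a tilde indicates dependence on $\theta$ (zero average). Reduced form: $k\ge2$, $p\ge1$ are integers, $F$ is as displayed with $c,a_k,d_p,A,B$ analytic, and $$A=y\,O(\|(x,y)\|^{k-1})+O(\|(x,y)\|^{k+1}),\qquad B=y\,O(\|(x,y)\|^{p-1})+O(\|(x,y)\|^{p+1}).$$ It is assumed throughout that $\bar d_p(\lambda)\ne0$. The estimate of $\mathcal G_n$ is understood as $u\to0$ (where $F\circ\mathcal K_n$ is defined); $\mathcal K_n$ and $\mathcal R_n$ are polynomial in $u$ and are considered for $u\ge0$. $\omega\in\mathbb R^d$ is Diophantine (map setting) if there exist $C>0$ and $\tau\ge d$ with $|\omega\cdot q-l|\ge C|q|^{-\tau}$ for all $q\in\mathbb Z^d\setminus\{0\}$, $l\in\mathbb Z$, where $|q|=|q_1|+\dots+|q_d|$. For an analytic $h(\theta,\lambda)$ with zero average in $\theta$, $\mathcal{SD}(h)$ denotes the unique analytic solution $\varphi$ with zero average of $\varphi(\theta+\omega,\lambda)-\varphi(\theta,\lambda)=h(\theta,\lambda)$.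 *)

theory Defs
  imports "HOL-Analysis.Analysis" "HOL-Library.Landau_Symbols"
begin

text \<open>
  Points of the torus are represented by their lifts to \<open>real ^ 'd\<close>, functions on the torus by
  functions that are 1-periodic in every coordinate, and torus-valued maps by lifts of the form
  \<open>\<theta> + (periodic function)\<close>. The parameter (\<open>\<lambda>\<close> in the mathematics) is called \<open>\<mu>\<close>.
\<close>

text \<open>
  Real analyticity: around every point of \<open>S\<close>, \<open>f\<close> is the sum of a (necessarily absolutely)
  convergent multivariate power series. The multi-indices are the functions
  \<open>\<alpha> \<in> Basis \<rightarrow>\<^sub>E UNIV\<close>, i.e. exponents attached to the coordinates.
\<close>

definition real_analytic_on :: "('a::euclidean_space \<Rightarrow> 'b::euclidean_space) \<Rightarrow> 'a set \<Rightarrow> bool" where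
  "real_analytic_on f S \<longleftrightarrow>
     (\<forall>a\<in>S. \<exists>r>0. \<exists>c. \<forall>x\<in>ball a r.
        ((\<lambda>\<alpha>. (\<Prod>b\<in>Basis. ((x - a) \<bullet> b) ^ \<alpha> b) *\<^sub>R c \<alpha>) has_sum f x)
          (Basis \<rightarrow>\<^sub>E (UNIV :: nat set)))"

definition torus_periodic :: "(real ^ 'd \<Rightarrow> 'b) \<Rightarrow> bool" where
  "torus_periodic f \<longleftrightarrow> (\<forall>\<theta> (q :: int ^ 'd). f (\<theta> + (\<chi> i. of_int (q $ i))) = f \<theta>)"

text \<open>
  Analyticity of a function on \<open>\<T>\<^sup>d \<times> P\<close>. As \<open>P\<close> need not be open, this means (as usual) that the
  function extends to an analytic function on \<open>\<T>\<^sup>d \<times> V\<close> for some open \<open>V \<supseteq> P\<close>. The values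
  of \<open>f\<close> off \<open>P\<close> are irrelevant.
\<close>

definition torus_analytic_on ::
    "(real ^ 'd \<Rightarrow> 'p::euclidean_space \<Rightarrow> 'b::euclidean_space) \<Rightarrow> 'p set \<Rightarrow> bool" where
  "torus_analytic_on f P \<longleftrightarrow>
     (\<exists>V g. open V \<and> P \<subseteq> V \<and>
        (\<forall>\<theta>. \<forall>\<mu>\<in>P. f \<theta> \<mu> = g \<theta> \<mu>) \<and>
        (\<forall>\<mu>\<in>V. torus_periodic (\<lambda>\<theta>. g \<theta> \<mu>)) \<and>
        real_analytic_on (\<lambda>(\<theta>, \<mu>). g \<theta> \<mu>) (UNIV \<times> V))"

text \<open>The unit cube is a fundamental domain of the torus, which has volume 1.\<close>

definition torus_avg :: "(real ^ 'd \<Rightarrow> 'p \<Rightarrow> 'b::euclidean_space) \<Rightarrow> 'p \<Rightarrow> 'b" where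
  "torus_avg h \<mu> = integral (cbox 0 1) (\<lambda>\<theta>. h \<theta> \<mu>)"

definition torus_osc ::
    "(real ^ 'd \<Rightarrow> 'p \<Rightarrow> 'b::euclidean_space) \<Rightarrow> real ^ 'd \<Rightarrow> 'p \<Rightarrow> 'b" where
  "torus_osc h \<theta> \<mu> = h \<theta> \<mu> - torus_avg h \<mu>"

definition diophantine :: "real ^ 'd \<Rightarrow> bool" where
  "diophantine \<omega> \<longleftrightarrow>
     (\<exists>C \<tau>. C > 0 \<and> \<tau> \<ge> real CARD('d) \<and>
        (\<forall>(q :: int ^ 'd) (l :: int). q \<noteq> 0 \<longrightarrow>
           \<bar>(\<Sum>i\<in>UNIV. \<omega> $ i * of_int (q $ i)) - of_int l\<bar>
             \<ge> C * (\<Sum>i\<in>UNIV. of_int \<bar>q $ i\<bar>) powr (- \<tau>)))"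

text \<open>
  The solution of the small divisors equation is unique only on \<open>\<T>\<^sup>d \<times> \<Lambda>\<close>; the value 0 is
  prescribed for parameters off \<open>\<Lambda>\<close> so that the description is definite.
\<close>

definition SD :: "real ^ 'd \<Rightarrow> 'p set \<Rightarrow> (real ^ 'd \<Rightarrow> 'p::euclidean_space \<Rightarrow> 'b::euclidean_space)
    \<Rightarrow> real ^ 'd \<Rightarrow> 'p \<Rightarrow> 'b" where
  "SD \<omega> \<Lambda> h =
     (THE \<phi>. torus_analytic_on \<phi> \<Lambda> \<and>
        (\<forall>\<mu>\<in>\<Lambda>. torus_avg \<phi> \<mu> = 0) \<and>
        (\<forall>\<mu>\<in>\<Lambda>. \<forall>\<theta>. \<phi> (\<theta> + \<omega>) \<mu> - \<phi> \<theta> \<mu> = h \<theta> \<mu>) \<and>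
        (\<forall>\<mu>. \<mu> \<notin> \<Lambda> \<longrightarrow> (\<forall>\<theta>. \<phi> \<theta> \<mu> = 0)))"

text \<open>\<open>f(x, y) = y O(\<parallel>(x, y)\<parallel>\<^sup>j\<^sup>-\<^sup>1) + O(\<parallel>(x, y)\<parallel>\<^sup>j\<^sup>+\<^sup>1)\<close> on \<open>U\<close>, as \<open>(x, y) \<rightarrow> (0, 0)\<close>.\<close>

definition remainder_order ::
    "nat \<Rightarrow> (real \<times> real) set \<Rightarrow> (real \<Rightarrow> real \<Rightarrow> 'b::real_normed_vector) \<Rightarrow> bool" where
  "remainder_order j U f \<longleftrightarrow>
     (\<exists>g h. (\<forall>(x, y)\<in>U. f x y = y *\<^sub>R g (x, y) + h (x, y)) \<and>
        (\<lambda>z. norm (g z)) \<in> O[at (0, 0)](\<lambda>z. norm z ^ (j - 1)) \<and>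
        (\<lambda>z. norm (h z)) \<in> O[at (0, 0)](\<lambda>z. norm z ^ (j + 1)))"

text \<open>
  The orders of \<open>A\<close> and \<open>B\<close> are only required for each \<open>(\<theta>, \<mu>)\<close> separately; by analyticity
  they then hold locally uniformly.
\<close>

definition reduced_form ::
    "nat \<Rightarrow> nat \<Rightarrow> real ^ 'd \<Rightarrow> (real \<times> real) set \<Rightarrow> (real ^ 'm) set \<Rightarrow>
     (real ^ 'd \<Rightarrow> real ^ 'm \<Rightarrow> real) \<Rightarrow> (real ^ 'd \<Rightarrow> real ^ 'm \<Rightarrow> real) \<Rightarrow>
     (real ^ 'd \<Rightarrow> real ^ 'm \<Rightarrow> real ^ 'd) \<Rightarrow>
     (real \<Rightarrow> real \<Rightarrow> real ^ 'd \<Rightarrow> real ^ 'm \<Rightarrow> real) \<Rightarrow>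
     (real \<Rightarrow> real \<Rightarrow> real ^ 'd \<Rightarrow> real ^ 'm \<Rightarrow> real ^ 'd) \<Rightarrow>
     (real \<times> real \<times> (real ^ 'd) \<Rightarrow> real ^ 'm \<Rightarrow> real \<times> real \<times> (real ^ 'd)) \<Rightarrow> bool" where
  "reduced_form k p \<omega> U \<Lambda> c a d A B F \<longleftrightarrow>
     torus_analytic_on c \<Lambda> \<and> torus_analytic_on a \<Lambda> \<and> torus_analytic_on d \<Lambda> \<and>
     torus_analytic_on (\<lambda>\<theta> ((x, y), \<mu>). A x y \<theta> \<mu>) (U \<times> \<Lambda>) \<and>
     torus_analytic_on (\<lambda>\<theta> ((x, y), \<mu>). B x y \<theta> \<mu>) (U \<times> \<Lambda>) \<and>
     (\<forall>\<theta>. \<forall>\<mu>\<in>\<Lambda>. remainder_order k U (\<lambda>x y. A x y \<theta> \<mu>)) \<and>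
     (\<forall>\<theta>. \<forall>\<mu>\<in>\<Lambda>. remainder_order p U (\<lambda>x y. B x y \<theta> \<mu>)) \<and>
     (\<forall>(x, y)\<in>U. \<forall>\<theta>. \<forall>\<mu>\<in>\<Lambda>. F (x, y, \<theta>) \<mu> =
        (x + c \<theta> \<mu> * y,
         y + a \<theta> \<mu> * x ^ k + A x y \<theta> \<mu>,
         \<theta> + \<omega> + x ^ p *\<^sub>R d \<theta> \<mu> + B x y \<theta> \<mu>))"

definition bar_coeff :: "(real ^ 'm) set \<Rightarrow> (real ^ 'm \<Rightarrow> 'b::euclidean_space) \<Rightarrow> bool" where
  "bar_coeff \<Lambda> h \<longleftrightarrow>
     (\<exists>V g. open V \<and> \<Lambda> \<subseteq> V \<and> (\<forall>\<mu>\<in>\<Lambda>. h \<mu> = g \<mu>) \<and> real_analytic_on g V)"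

definition tilde_coeff ::
    "(real ^ 'm) set \<Rightarrow> (real ^ 'd \<Rightarrow> real ^ 'm \<Rightarrow> 'b::euclidean_space) \<Rightarrow> bool" where
  "tilde_coeff \<Lambda> h \<longleftrightarrow> torus_analytic_on h \<Lambda> \<and> (\<forall>\<mu>\<in>\<Lambda>. torus_avg h \<mu> = 0)"

text \<open>
  The bounds of summation are ordered so that truncated subtraction is exact for \<open>k \<le> 2 p\<close>,
  \<open>n \<ge> 2\<close>.
\<close>

definition K_poly ::
    "nat \<Rightarrow> nat \<Rightarrow> nat \<Rightarrow>
     (nat \<Rightarrow> real ^ 'm \<Rightarrow> real) \<Rightarrow> (nat \<Rightarrow> real ^ 'd \<Rightarrow> real ^ 'm \<Rightarrow> real) \<Rightarrow>
     (nat \<Rightarrow> real ^ 'm \<Rightarrow> real) \<Rightarrow> (nat \<Rightarrow> real ^ 'd \<Rightarrow> real ^ 'm \<Rightarrow> real) \<Rightarrow>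
     (nat \<Rightarrow> real ^ 'm \<Rightarrow> real ^ 'd) \<Rightarrow> (nat \<Rightarrow> real ^ 'd \<Rightarrow> real ^ 'm \<Rightarrow> real ^ 'd) \<Rightarrow>
     real \<times> (real ^ 'd) \<Rightarrow> real ^ 'm \<Rightarrow> real \<times> real \<times> (real ^ 'd)" where
  "K_poly k p n Kx Kx' Ky Ky' Kt Kt' = (\<lambda>(u, \<theta>) \<mu>.
     (u ^ 2 + (\<Sum>i = 3..n. Kx i \<mu> * u ^ i) + (\<Sum>i = k + 1..n + k - 1. Kx' i \<theta> \<mu> * u ^ i),
      (\<Sum>i = k + 1..n + k - 1. Ky i \<mu> * u ^ i)
        + (\<Sum>i = 2 * k..n + 2 * k - 2. Ky' i \<theta> \<mu> * u ^ i),
      \<theta> + (\<Sum>i = 2 * p + 1 - k..n + 2 * p - k - 1. u ^ i *\<^sub>R Kt i \<mu>)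
        + (\<Sum>i = 2 * p..n + 2 * p - 2. u ^ i *\<^sub>R Kt' i \<theta> \<mu>)))"

definition R_poly ::
    "nat \<Rightarrow> nat \<Rightarrow> real ^ 'd \<Rightarrow> (nat \<Rightarrow> real ^ 'm \<Rightarrow> real) \<Rightarrow>
     real \<times> (real ^ 'd) \<Rightarrow> real ^ 'm \<Rightarrow> real \<times> (real ^ 'd)" where
  "R_poly k n \<omega> Rx = (\<lambda>(u, \<theta>) \<mu>.
     if n \<le> k then (u + Rx k \<mu> * u ^ k, \<theta> + \<omega>)
     else (u + Rx k \<mu> * u ^ k + Rx (2 * k - 1) \<mu> * u ^ (2 * k - 1), \<theta> + \<omega>))"

text \<open>\<open>G(u, \<theta>, \<mu>) = O(u\<^sup>N)\<close> as \<open>u \<rightarrow> 0\<^sup>+\<close>, uniformly in \<open>\<theta>\<close> and locally uniformly in \<open>\<mu>\<close>.\<close>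

definition O_pow ::
    "(real ^ 'm) set \<Rightarrow> nat \<Rightarrow>
     (real \<Rightarrow> real ^ 'd \<Rightarrow> real ^ 'm \<Rightarrow> 'b::real_normed_vector) \<Rightarrow> bool" where
  "O_pow \<Lambda> N G \<longleftrightarrow>
     (\<forall>L. compact L \<and> L \<subseteq> \<Lambda> \<longrightarrow>
        (\<lambda>(u, \<theta>, \<mu>). norm (G u \<theta> \<mu>))
          \<in> O[at_right 0 \<times>\<^sub>F principal (UNIV \<times> L)](\<lambda>(u, \<theta>, \<mu>). u ^ N))"

end

theory Submission
  imports Defs
begin

text \<open>
  The parametrizations are built by induction on \<open>n\<close>, one order in \<open>u\<close> at a time. Write
  \<open>R\<close>, \<open>Y\<close>, \<open>T\<close> for the lowest coefficients of the reduced dynamics and of the second and third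
  components of the parametrization. If the residual has the orders claimed for \<open>n\<close>, then it has leading
  coefficients \<open>g\<^sub>x\<close>, \<open>g\<^sub>y\<close>, \<open>g\<^sub>t\<close> at the orders \<open>n + k\<close>, \<open>n + 2 k - 1\<close>, \<open>n + 2 p - 1\<close>, because it has an
  asymptotic expansion with coefficients analytic on the torus (\<open>xpd_leading\<close>). Add
  \<open>x u\<^sup>n\<^sup>+\<^sup>1 + x' u\<^sup>n\<^sup>+\<^sup>k\<close>, \<open>y u\<^sup>n\<^sup>+\<^sup>k + y' u\<^sup>n\<^sup>+\<^sup>2\<^sup>k\<^sup>-\<^sup>1\<close> and \<open>t u\<^sup>n\<^sup>+\<^sup>2\<^sup>p\<^sup>-\<^sup>k + t' u\<^sup>n\<^sup>+\<^sup>2\<^sup>p\<^sup>-\<^sup>1\<close> to the components of the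
  parametrization, where primes mark functions of the angles of average zero, and \<open>\<sigma> u\<^sup>2\<^sup>k\<^sup>-\<^sup>1\<close> to the
  reduced dynamics if \<open>n = k\<close>. By \<open>residual_increment\<close> the leading coefficients vanish if and only if
  \<^item> \<open>g\<^sub>x + x' - x'(\<theta> + \<omega>) + c y - (n + 1) R x - 2 \<sigma> = 0\<close>,
  \<^item> \<open>g\<^sub>y + y' - y'(\<theta> + \<omega>) + k a x - (n + k) R y - (k + 1) Y \<sigma> = 0\<close>,
  \<^item> \<open>g\<^sub>t + t' - t'(\<theta> + \<omega>) + p d x - (n + 2 p - k) R t - (2 p - k + 1) T \<sigma> = 0\<close>.

  The averages of the first two equations form a linear system for \<open>x\<close> and \<open>y\<close>, which is regular for
  \<open>n \<noteq> k\<close>; for \<open>n = k\<close> the unknown \<open>\<sigma>\<close> replaces \<open>x\<close> (\<open>averaged_equations\<close>). The average of the third one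
  gives \<open>t\<close>, since \<open>R \<noteq> 0\<close>. The oscillatory parts are small divisors equations for \<open>x'\<close>, \<open>y'\<close>, \<open>t'\<close>.

  Two analytic facts support this. The first is the solvability of the small divisors equation among
  analytic functions. The Fourier coefficients of an analytic function decay exponentially, locally
  uniformly and analytically in the parameters (\<open>fco_bound\<close>), the small divisors cost a power of the
  frequency, and so the formal solution converges (\<open>fmult_analytic\<close>,
  \<open>cohomological_solution_complex\<close>); it is unique by the completeness of the characters
  (\<open>fourier_null_imp_zero\<close>). The second is the Taylor expansion of the nonlinear terms with bounds
  uniform in the angles (\<open>taylor_expansion\<close>). It turns the pointwise orders of the remainders into the
  vanishing of Taylor coefficients (\<open>remainder_order_coeff_zero\<close>), and thereby into orders in \<open>u\<close>.
\<close>

section \<open>Convergent multivariate power series\<close>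

text \<open>
  Exponents are functions on the basis vectors, as in the definition of real analyticity. They
  are fixed to be \<open>undefined\<close> elsewhere, so that equality of exponents is equality of functions.
\<close>

definition midx :: "('a::euclidean_space => nat) set" where
  "midx = Basis \<rightarrow>\<^sub>E UNIV"

definition mdeg :: "('a::euclidean_space => nat) => nat" where
  "mdeg \<alpha> = (\<Sum>b\<in>Basis. \<alpha> b)"

definition mon :: "'a::euclidean_space => ('a => nat) => real" where
  "mon x \<alpha> = (\<Prod>b\<in>Basis. (x \<bullet> b) ^ \<alpha> b)"

definition pbox :: "real => 'a::euclidean_space set" where
  "pbox \<rho> = {x. \<forall>b\<in>Basis. \<bar>x \<bullet> b\<bar> \<le> \<rho>}"

text \<open>
  On the box of radius \<open>\<rho>\<close>, \<open>f\<close> is the sum of the power series with coefficients \<open>c\<close>, whose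
  weighted \<open>l\<^sup>1\<close>-norm is at most \<open>M\<close>. This norm is submultiplicative, passes to infinite sums and
  controls substitution, so that all majorant arguments reduce to bounds on \<open>M\<close>.
\<close>

definition psf :: "real => real => (('a::euclidean_space => nat) => 'b::banach) => ('a => 'b) => bool" where
  "psf \<rho> M c f \<longleftrightarrow>
     (\<lambda>\<alpha>. norm (c \<alpha>) * \<rho> ^ mdeg \<alpha>) summable_on midx \<and>
     (\<Sum>\<^sub>\<infinity>\<alpha>\<in>midx. norm (c \<alpha>) * \<rho> ^ mdeg \<alpha>) \<le> M \<and>
     (\<forall>x\<in>pbox \<rho>. ((\<lambda>\<alpha>. mon x \<alpha> *\<^sub>R c \<alpha>) has_sum f x) midx)"

definition psum :: "real => real => ('a::euclidean_space => 'b::banach) => bool" where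
  "psum \<rho> M f \<longleftrightarrow> (\<exists>c. psf \<rho> M c f)"

lemma abs_mon_le: "x \<in> pbox \<rho> ==> \<bar>mon x \<alpha>\<bar> \<le> \<rho> ^ mdeg \<alpha>"
  unfolding mon_def mdeg_def pbox_def power_sum abs_prod power_abs
  by (intro prod_mono) (auto intro: power_mono)

lemma zero_in_pbox [simp]: "0 \<le> \<rho> ==> 0 \<in> pbox \<rho>"
  by (simp add: pbox_def)

lemma mon_0_right [simp]: "mon x (\<lambda>b\<in>Basis. 0) = 1"
  by (simp add: mon_def)

lemma mdeg_0 [simp]: "mdeg (\<lambda>b\<in>Basis. 0) = 0"
  by (simp add: mdeg_def)

lemma zero_midx [simp]: "(\<lambda>b\<in>Basis. 0) \<in> midx"
  by (simp add: midx_def)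

lemma midx_0: assumes "\<alpha> \<in> midx" "mdeg \<alpha> = 0" shows "\<alpha> = (\<lambda>b\<in>Basis. 0)"
proof
  fix b :: 'a
  have "\<forall>b\<in>Basis. \<alpha> b = 0" using assms(2) unfolding mdeg_def by simp
  moreover have "b \<notin> Basis ==> \<alpha> b = undefined" using assms(1) unfolding midx_def by (rule PiE_arb)
  ultimately show "\<alpha> b = (\<lambda>b\<in>Basis. 0) b" by simp
qed

lemma mon_0_left: assumes "\<alpha> \<in> midx" shows "mon 0 \<alpha> = (if \<alpha> = (\<lambda>b\<in>Basis. 0) then 1 else 0)"
proof (cases "\<alpha> = (\<lambda>b\<in>Basis. 0)")
  case False
  then have "mdeg \<alpha> \<noteq> 0" using midx_0 assms by blast
  then obtain b where "b \<in> Basis" "\<alpha> b \<noteq> 0" by (auto simp: mdeg_def)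
  then have "mon 0 \<alpha> = 0" unfolding mon_def
    by (intro prod_zero) (auto intro: bexI[of _ b] simp: power_0_left)
  then show ?thesis using False by simp
qed simp

text \<open>
  A series of monomials in any order and with repetitions can be collected by exponents, because
  absolute convergence permits the interchange of summations. Products, infinite sums and
  compositions of power series are all instances.
\<close>

lemma psf_regroup:
  fixes \<phi> :: "'j => ('a::euclidean_space => nat)" and w :: "'j => 'b::banach"
  assumes "\<rho> > 0" and \<phi>: "\<And>j. j \<in> J ==> \<phi> j \<in> midx"
    and s: "(\<lambda>j. norm (w j) * \<rho> ^ mdeg (\<phi> j)) summable_on J"
    and M: "(\<Sum>\<^sub>\<infinity>j\<in>J. norm (w j) * \<rho> ^ mdeg (\<phi> j)) \<le> M"
    and f: "\<And>x. x \<in> pbox \<rho> ==> ((\<lambda>j. mon x (\<phi> j) *\<^sub>R w j) has_sum f x) J"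
  shows "psf \<rho> M (\<lambda>\<alpha>. \<Sum>\<^sub>\<infinity>j\<in>{j\<in>J. \<phi> j = \<alpha>}. w j) f"
proof -
  define fib where "fib \<alpha> = {j\<in>J. \<phi> j = \<alpha>}" for \<alpha>
  define c where "c \<alpha> = (\<Sum>\<^sub>\<infinity>j\<in>fib \<alpha>. w j)" for \<alpha>
  define d where "d \<alpha> = (\<Sum>\<^sub>\<infinity>j\<in>fib \<alpha>. norm (w j))" for \<alpha>
  have bij: "bij_betw snd (Sigma midx fib) J"
    by (rule bij_betwI[of _ _ _ "\<lambda>j. (\<phi> j, j)"]) (use \<phi> in \<open>auto simp: fib_def\<close>)
  have ns: "(\<lambda>j. norm (w j)) summable_on fib \<alpha>" for \<alpha>
  proof -
    have "(\<lambda>j. norm (w j) * \<rho> ^ mdeg (\<phi> j)) summable_on fib \<alpha>"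
      by (rule summable_on_subset_banach[OF s]) (auto simp: fib_def)
    then have "(\<lambda>j. norm (w j) * \<rho> ^ mdeg \<alpha>) summable_on fib \<alpha>"
      by (rule summable_on_cong[THEN iffD1, rotated]) (auto simp: fib_def)
    then show ?thesis using \<open>\<rho> > 0\<close> by (subst (asm) summable_on_cmult_left') auto
  qed
  have wc: "(w has_sum c \<alpha>) (fib \<alpha>)" for \<alpha>
    unfolding c_def by (rule has_sum_infsum, rule abs_summable_summable, rule ns)
  have wd: "((\<lambda>j. norm (w j)) has_sum d \<alpha>) (fib \<alpha>)" for \<alpha>
    unfolding d_def by (intro has_sum_infsum ns)
  have nle: "norm (c \<alpha>) \<le> d \<alpha>" for \<alpha>
    using norm_has_sum_bound[OF wd wc] .
  have S1: "((\<lambda>(\<alpha>, j). norm (w j) * \<rho> ^ mdeg \<alpha>) has_sum (\<Sum>\<^sub>\<infinity>j\<in>J. norm (w j) * \<rho> ^ mdeg (\<phi> j))) (Sigma midx fib)"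
    using has_sum_reindex_bij_betw[OF bij, of "\<lambda>j. norm (w j) * \<rho> ^ mdeg (\<phi> j)"] has_sum_infsum[OF s]
    by (subst has_sum_cong[where g = "\<lambda>x. norm (w (snd x)) * \<rho> ^ mdeg (\<phi> (snd x))"]) (auto simp: fib_def)
  have D: "((\<lambda>\<alpha>. d \<alpha> * \<rho> ^ mdeg \<alpha>) has_sum (\<Sum>\<^sub>\<infinity>j\<in>J. norm (w j) * \<rho> ^ mdeg (\<phi> j))) midx"
    by (rule has_sum_SigmaD[OF S1]) (auto intro: has_sum_cmult_left wd)
  have C: "(\<lambda>\<alpha>. norm (c \<alpha>) * \<rho> ^ mdeg \<alpha>) summable_on midx"
    by (rule summable_on_comparison_test[OF has_sum_imp_summable[OF D]])
       (use \<open>\<rho> > 0\<close> nle in \<open>auto intro!: mult_right_mono\<close>)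
  have "(\<Sum>\<^sub>\<infinity>\<alpha>\<in>midx. norm (c \<alpha>) * \<rho> ^ mdeg \<alpha>) \<le> (\<Sum>\<^sub>\<infinity>j\<in>J. norm (w j) * \<rho> ^ mdeg (\<phi> j))"
    by (rule has_sum_mono[OF has_sum_infsum[OF C] D])
       (use \<open>\<rho> > 0\<close> nle in \<open>auto intro!: mult_right_mono\<close>)
  moreover have "((\<lambda>\<alpha>. mon x \<alpha> *\<^sub>R c \<alpha>) has_sum f x) midx" if "x \<in> pbox \<rho>" for x
  proof -
    have "((\<lambda>(\<alpha>, j). mon x \<alpha> *\<^sub>R w j) has_sum f x) (Sigma midx fib)"
      using has_sum_reindex_bij_betw[OF bij, of "\<lambda>j. mon x (\<phi> j) *\<^sub>R w j"] f[OF that]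
      by (subst has_sum_cong[where g = "\<lambda>z. mon x (\<phi> (snd z)) *\<^sub>R w (snd z)"]) (auto simp: fib_def)
    then show ?thesis
      by (rule has_sum_SigmaD) (auto intro!: has_sum_scaleR wc)
  qed
  ultimately have "psf \<rho> M c f" using C M unfolding psf_def by auto
  then show ?thesis unfolding c_def fib_def .
qed

lemma psum_regroup:
  fixes \<phi> :: "'j => ('a::euclidean_space => nat)" and w :: "'j => 'b::banach"
  assumes "\<rho> > 0" and "\<And>j. j \<in> J ==> \<phi> j \<in> midx"
    and "((\<lambda>j. norm (w j) * \<rho> ^ mdeg (\<phi> j)) has_sum S) J" and "S \<le> M"
    and "\<And>x. x \<in> pbox \<rho> ==> ((\<lambda>j. mon x (\<phi> j) *\<^sub>R w j) has_sum f x) J"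
  shows "psum \<rho> M f"
  unfolding psum_def
  using psf_regroup[OF assms(1,2) has_sum_imp_summable[OF assms(3)] _ assms(5), of M]
    infsumI[OF assms(3)] assms(4) by auto

lemma psf_imp_psum: "psf \<rho> M c f ==> psum \<rho> M f"
  by (auto simp: psum_def)

lemma psf_has_sum: "psf \<rho> M c f ==> x \<in> pbox \<rho> ==> ((\<lambda>\<alpha>. mon x \<alpha> *\<^sub>R c \<alpha>) has_sum f x) midx"
  by (simp add: psf_def)

lemma psf_nonneg: assumes "psf \<rho> M c f" "\<rho> \<ge> 0" shows "0 \<le> M"
proof -
  have "0 \<le> (\<Sum>\<^sub>\<infinity>\<alpha>\<in>midx. norm (c \<alpha>) * \<rho> ^ mdeg \<alpha>)" using assms by (intro infsum_nonneg) auto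
  then show ?thesis using assms(1) by (auto simp: psf_def)
qed

lemma psf_coeff_le:
  assumes "psf \<rho> M c f" "\<rho> \<ge> 0" "\<alpha> \<in> midx"
  shows "norm (c \<alpha>) * \<rho> ^ mdeg \<alpha> \<le> M"
proof -
  have "sum (\<lambda>\<alpha>. norm (c \<alpha>) * \<rho> ^ mdeg \<alpha>) {\<alpha>} \<le> (\<Sum>\<^sub>\<infinity>\<alpha>\<in>midx. norm (c \<alpha>) * \<rho> ^ mdeg \<alpha>)"
    by (rule finite_sum_le_infsum) (use assms in \<open>auto simp: psf_def\<close>)
  then show ?thesis using assms(1) by (auto simp: psf_def)
qed

lemma psf_bound:
  assumes "psf \<rho> M c f" "x \<in> pbox \<rho>"
  shows "norm (f x) \<le> M"
proof -
  have "norm (f x) \<le> (\<Sum>\<^sub>\<infinity>\<alpha>\<in>midx. norm (c \<alpha>) * \<rho> ^ mdeg \<alpha>)"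
    by (rule norm_infsum_le[OF psf_has_sum[OF assms]])
       (use assms in \<open>auto simp: psf_def mult.commute intro!: has_sum_infsum mult_left_mono abs_mon_le\<close>)
  then show ?thesis using assms(1) by (auto simp: psf_def)
qed

lemma psum_bound: "psum \<rho> M f ==> x \<in> pbox \<rho> ==> norm (f x) \<le> M"
  by (auto simp: psum_def intro: psf_bound)

lemma psf_mono: "psf \<rho> M c f ==> M \<le> M' ==> psf \<rho> M' c f"
  by (auto simp: psf_def)

lemma psum_mono: "psum \<rho> M f ==> M \<le> M' ==> psum \<rho> M' f"
  by (auto simp: psum_def intro: psf_mono)

lemma psf_cong: "psf \<rho> M c f ==> (\<And>x. x \<in> pbox \<rho> ==> f x = g x) ==> psf \<rho> M c g"
  by (simp add: psf_def)

lemma psum_cong: "psum \<rho> M f ==> (\<And>x. x \<in> pbox \<rho> ==> f x = g x) ==> psum \<rho> M g"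
  by (auto simp: psum_def intro: psf_cong)

lemma pbox_mono: "\<rho>' \<le> \<rho> ==> pbox \<rho>' \<subseteq> pbox \<rho>"
  by (fastforce simp: pbox_def)

lemma psf_radius_mono:
  assumes "psf \<rho> M c f" "0 \<le> \<rho>'" "\<rho>' \<le> \<rho>" shows "psf \<rho>' M c f"
proof -
  have le: "norm (c \<alpha>) * \<rho>' ^ mdeg \<alpha> \<le> norm (c \<alpha>) * \<rho> ^ mdeg \<alpha>" for \<alpha>
    using assms by (intro mult_left_mono power_mono) auto
  have s: "(\<lambda>\<alpha>. norm (c \<alpha>) * \<rho> ^ mdeg \<alpha>) summable_on midx" using assms by (simp add: psf_def)
  have s': "(\<lambda>\<alpha>. norm (c \<alpha>) * \<rho>' ^ mdeg \<alpha>) summable_on midx"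
    by (rule summable_on_comparison_test[OF s]) (use le assms in auto)
  have "(\<Sum>\<^sub>\<infinity>\<alpha>\<in>midx. norm (c \<alpha>) * \<rho>' ^ mdeg \<alpha>) \<le> (\<Sum>\<^sub>\<infinity>\<alpha>\<in>midx. norm (c \<alpha>) * \<rho> ^ mdeg \<alpha>)"
    by (rule infsum_mono[OF s' s le])
  then show ?thesis using assms s' pbox_mono[OF assms(3)] by (auto simp: psf_def)
qed

lemma psum_radius_mono: "psum \<rho> M f ==> 0 \<le> \<rho>' ==> \<rho>' \<le> \<rho> ==> psum \<rho>' M f"
  by (auto simp: psum_def intro: psf_radius_mono)

lemma psum_const: assumes "\<rho> > 0" shows "psum \<rho> (norm v) (\<lambda>_. v)"
  by (rule psum_regroup[where J = "{()}" and w = "\<lambda>_. v" and \<phi> = "\<lambda>_. (\<lambda>b\<in>Basis. 0)"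
        and S = "norm v"])
     (use assms in \<open>auto intro!: has_sum_finiteI\<close>)

lemma psum_coord: assumes "\<rho> > 0" "b \<in> Basis" shows "psum \<rho> \<rho> (\<lambda>x. x \<bullet> b)"
proof (rule psum_regroup[where J = "{()}" and w = "\<lambda>_. 1" and \<phi> = "\<lambda>_. (\<lambda>i\<in>Basis. if i = b then 1 else 0)"
        and S = "\<rho>"])
  have m: "mon x (\<lambda>i\<in>Basis. if i = b then 1 else 0) = x \<bullet> b" for x
    using assms by (simp add: mon_def if_distrib[of "\<lambda>n. _ ^ n"] prod.If_cases cong: if_cong)
  show "((\<lambda>_. mon x (\<lambda>i\<in>Basis. if i = b then 1 else 0) *\<^sub>R 1) has_sum x \<bullet> b) {()}" for x
    unfolding m by (auto intro!: has_sum_finiteI)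
qed (use assms in \<open>auto simp: midx_def mdeg_def intro!: has_sum_finiteI\<close>)

lemma psf_linear:
  assumes c: "psf \<rho> M c f" and "\<rho> \<ge> 0" and T: "bounded_linear T" and K: "\<And>v. norm (T v) \<le> K * norm v" "K \<ge> 0"
  shows "psf \<rho> (K * M) (\<lambda>\<alpha>. T (c \<alpha>)) (\<lambda>x. T (f x))"
proof -
  interpret T: bounded_linear T by fact
  have s: "(\<lambda>\<alpha>. norm (c \<alpha>) * \<rho> ^ mdeg \<alpha>) summable_on midx"
    and sM: "(\<Sum>\<^sub>\<infinity>\<alpha>\<in>midx. norm (c \<alpha>) * \<rho> ^ mdeg \<alpha>) \<le> M" using c by (auto simp: psf_def)
  have le: "norm (T (c \<alpha>)) * \<rho> ^ mdeg \<alpha> \<le> K * (norm (c \<alpha>) * \<rho> ^ mdeg \<alpha>)" for \<alpha>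
    using mult_right_mono[OF K(1)[of "c \<alpha>"], of "\<rho> ^ mdeg \<alpha>"] \<open>\<rho> \<ge> 0\<close> by (simp add: mult.assoc)
  have sK: "(\<lambda>\<alpha>. K * (norm (c \<alpha>) * \<rho> ^ mdeg \<alpha>)) summable_on midx"
    by (intro summable_on_cmult_right s)
  have s': "(\<lambda>\<alpha>. norm (T (c \<alpha>)) * \<rho> ^ mdeg \<alpha>) summable_on midx"
    by (rule summable_on_comparison_test[OF sK]) (use le assms in auto)
  have "(\<Sum>\<^sub>\<infinity>\<alpha>\<in>midx. norm (T (c \<alpha>)) * \<rho> ^ mdeg \<alpha>) \<le> K * (\<Sum>\<^sub>\<infinity>\<alpha>\<in>midx. norm (c \<alpha>) * \<rho> ^ mdeg \<alpha>)"
    using infsum_mono[OF s' sK le] by (simp add: infsum_cmult_right')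
  also have "\<dots> \<le> K * M" using sM K by (simp add: mult_left_mono)
  finally show ?thesis
    using s' has_sum_bounded_linear[OF T psf_has_sum[OF c]]
    by (auto simp: psf_def T.scaleR)
qed

lemma psum_linear:
  assumes "psum \<rho> M f" "\<rho> \<ge> 0" "bounded_linear T" "\<And>v. norm (T v) \<le> K * norm v" "K \<ge> 0"
  shows "psum \<rho> (K * M) (\<lambda>x. T (f x))"
  using assms psf_linear unfolding psum_def by blast

lemma abs_has_sum_times:
  fixes f :: "'i => 'b::{real_normed_field,banach}" and g :: "'j => 'b"
  assumes f: "(f has_sum a) A" "(\<lambda>i. norm (f i)) summable_on A"
    and g: "(g has_sum b) B" "(\<lambda>i. norm (g i)) summable_on B"
  shows "((\<lambda>(i, j). f i * g j) has_sum a * b) (A \<times> B)"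
proof -
  have 1: "((\<lambda>j. f i * g j) has_sum f i * b) B" for i
    by (intro has_sum_cmult_right g)
  have "(\<lambda>(i, j). norm (f i) * norm (g j)) summable_on A \<times> B"
  proof (rule summable_on_SigmaI)
    show "((\<lambda>j. case (i, j) of (i, j) => norm (f i) * norm (g j)) has_sum norm (f i) * infsum (\<lambda>j. norm (g j)) B) B" for i
      using has_sum_cmult_right[OF has_sum_infsum[OF g(2)]] by simp
  qed (auto intro: summable_on_cmult_left f)
  then have s: "(\<lambda>(i, j). f i * g j) summable_on A \<times> B"
    by (rule abs_summable_summable[OF summable_on_cong[THEN iffD1, rotated]]) (auto simp: norm_mult)
  show ?thesis
    by (rule has_sum_SigmaI[OF _ _ s, where g = "\<lambda>i. f i * b"]) (use 1 f has_sum_cmult_left in auto)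
qed

definition madd :: "('a::euclidean_space => nat) => ('a => nat) => ('a => nat)" where
  "madd \<alpha> \<beta> = (\<lambda>b\<in>Basis. \<alpha> b + \<beta> b)"

lemma madd_midx [simp]: "madd \<alpha> \<beta> \<in> midx"
  by (simp add: madd_def midx_def)

lemma mdeg_madd: "mdeg (madd \<alpha> \<beta>) = mdeg \<alpha> + mdeg \<beta>"
  by (simp add: mdeg_def madd_def sum.distrib)

lemma mon_madd: "mon x (madd \<alpha> \<beta>) = mon x \<alpha> * mon x \<beta>"
  by (simp add: mon_def madd_def power_add prod.distrib)

lemma psf_abs_summable:
  assumes "psf \<rho> M c f" "x \<in> pbox \<rho>" "\<rho> \<ge> 0"
  shows "(\<lambda>\<alpha>. norm (mon x \<alpha> *\<^sub>R c \<alpha>)) summable_on midx"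
proof (rule summable_on_comparison_test)
  show "(\<lambda>\<alpha>. norm (c \<alpha>) * \<rho> ^ mdeg \<alpha>) summable_on midx" using assms by (simp add: psf_def)
  show "norm (mon x \<alpha> *\<^sub>R c \<alpha>) \<le> norm (c \<alpha>) * \<rho> ^ mdeg \<alpha>" for \<alpha>
    using abs_mon_le[OF assms(2), of \<alpha>] by (simp add: mult.commute mult_left_mono)
qed auto

lemma psum_mult:
  fixes f g :: "'a::euclidean_space => 'b::{real_normed_field,banach}"
  assumes f: "psum \<rho> M f" and g: "psum \<rho> N g" and \<rho>: "\<rho> > 0"
  shows "psum \<rho> (M * N) (\<lambda>x. f x * g x)"
proof -
  obtain c d where c: "psf \<rho> M c f" and d: "psf \<rho> N d g" using f g by (auto simp: psum_def)
  let ?C = "\<Sum>\<^sub>\<infinity>\<alpha>\<in>midx. norm (c \<alpha>) * \<rho> ^ mdeg \<alpha>" and ?D = "\<Sum>\<^sub>\<infinity>\<alpha>\<in>midx. norm (d \<alpha>) * \<rho> ^ mdeg \<alpha>"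
  have sc: "((\<lambda>\<alpha>. norm (c \<alpha>) * \<rho> ^ mdeg \<alpha>) has_sum ?C) midx" "?C \<le> M"
    and sd: "((\<lambda>\<alpha>. norm (d \<alpha>) * \<rho> ^ mdeg \<alpha>) has_sum ?D) midx" "?D \<le> N"
    using c d by (auto simp: psf_def)
  have C0: "?C \<ge> 0" "?D \<ge> 0" using \<rho> by (auto intro!: infsum_nonneg)
  show ?thesis
  proof (rule psum_regroup[where J = "midx \<times> midx" and \<phi> = "\<lambda>(\<alpha>, \<beta>). madd \<alpha> \<beta>"
        and w = "\<lambda>(\<alpha>, \<beta>). c \<alpha> * d \<beta>" and S = "?C * ?D"])
    show "?C * ?D \<le> M * N" using sc sd C0 by (intro mult_mono) auto
    have "((\<lambda>(\<alpha>, \<beta>). (norm (c \<alpha>) * \<rho> ^ mdeg \<alpha>) * (norm (d \<beta>) * \<rho> ^ mdeg \<beta>)) has_sum ?C * ?D) (midx \<times> midx)"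
      by (rule abs_has_sum_times[OF sc(1) _ sd(1)])
         (use \<rho> has_sum_imp_summable[OF sc(1)] has_sum_imp_summable[OF sd(1)] in \<open>auto simp: abs_mult\<close>)
    then show "((\<lambda>j. norm (case j of (\<alpha>, \<beta>) => c \<alpha> * d \<beta>) * \<rho> ^ mdeg (case j of (\<alpha>, \<beta>) => madd \<alpha> \<beta>)) has_sum ?C * ?D) (midx \<times> midx)"
      by (rule has_sum_cong[THEN iffD1, rotated]) (auto simp: norm_mult mdeg_madd power_add)
  next
    fix x :: 'a assume x: "x \<in> pbox \<rho>"
    have "((\<lambda>(\<alpha>, \<beta>). (mon x \<alpha> *\<^sub>R c \<alpha>) * (mon x \<beta> *\<^sub>R d \<beta>)) has_sum f x * g x) (midx \<times> midx)"
      by (rule abs_has_sum_times) (use c d x \<rho> in \<open>auto intro!: psf_has_sum psf_abs_summable simp del: norm_scaleR\<close>)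
    then show "((\<lambda>j. mon x (case j of (\<alpha>, \<beta>) => madd \<alpha> \<beta>) *\<^sub>R (case j of (\<alpha>, \<beta>) => c \<alpha> * d \<beta>)) has_sum f x * g x) (midx \<times> midx)"
      by (rule has_sum_cong[THEN iffD1, rotated]) (auto simp: mon_madd)
  qed (use \<rho> in auto)
qed

lemma psum_infsum:
  fixes f :: "'i => 'a::euclidean_space => 'b::banach"
  assumes f: "\<And>i. i \<in> I ==> psum \<rho> (M i) (f i)" and M: "(M has_sum S) I" and \<rho>: "\<rho> > 0"
  shows "psum \<rho> S (\<lambda>x. \<Sum>\<^sub>\<infinity>i\<in>I. f i x)"
    and "\<And>x. x \<in> pbox \<rho> ==> ((\<lambda>i. f i x) has_sum (\<Sum>\<^sub>\<infinity>i\<in>I. f i x)) I"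
proof -
  have "\<forall>i. \<exists>c. i \<in> I \<longrightarrow> psf \<rho> (M i) c (f i)" using f by (auto simp: psum_def)
  then obtain c where c: "\<And>i. i \<in> I ==> psf \<rho> (M i) (c i) (f i)" by metis
  define N where "N i = (\<Sum>\<^sub>\<infinity>\<alpha>\<in>midx. norm (c i \<alpha>) * \<rho> ^ mdeg \<alpha>)" for i
  have N: "((\<lambda>\<alpha>. norm (c i \<alpha>) * \<rho> ^ mdeg \<alpha>) has_sum N i) midx" "N i \<le> M i" if "i \<in> I" for i
    using c[OF that] by (auto simp: psf_def N_def)
  have N0: "N i \<ge> 0" for i unfolding N_def using \<rho> by (intro infsum_nonneg) auto
  have M0: "M i \<ge> 0" if "i \<in> I" for i using N(2)[OF that] N0[of i] by linarith
  have sN: "N summable_on I"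
    by (rule summable_on_comparison_test[OF has_sum_imp_summable[OF M]]) (use N N0 in auto)
  have NS: "infsum N I \<le> S" using has_sum_mono[OF has_sum_infsum[OF sN] M] N by auto
  have sJ: "(\<lambda>(i, \<alpha>). norm (c i \<alpha>) * \<rho> ^ mdeg \<alpha>) summable_on (I \<times> midx)"
    by (rule summable_on_SigmaI[where g = N]) (use N sN \<rho> in auto)
  have hJ: "((\<lambda>(i, \<alpha>). norm (c i \<alpha>) * \<rho> ^ mdeg \<alpha>) has_sum infsum N I) (I \<times> midx)"
    by (rule has_sum_SigmaI[where g = N, OF _ _ sJ]) (use N sN in auto)
  show *: "((\<lambda>i. f i x) has_sum (\<Sum>\<^sub>\<infinity>i\<in>I. f i x)) I" if x: "x \<in> pbox \<rho>" for x
    by (rule has_sum_infsum, rule abs_summable_summable,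
        rule summable_on_comparison_test[OF has_sum_imp_summable[OF M]])
       (use psf_bound[OF c x] in auto)
  have "((\<lambda>(i, \<alpha>). mon x \<alpha> *\<^sub>R c i \<alpha>) has_sum (\<Sum>\<^sub>\<infinity>i\<in>I. f i x)) (I \<times> midx)" if x: "x \<in> pbox \<rho>" for x
  proof (rule has_sum_SigmaI[where g = "\<lambda>i. f i x"])
    show "(\<lambda>(i, \<alpha>). mon x \<alpha> *\<^sub>R c i \<alpha>) summable_on (I \<times> midx)"
      by (rule abs_summable_summable, rule summable_on_comparison_test[OF sJ])
         (use abs_mon_le[OF x] in \<open>auto simp: mult.commute intro!: mult_right_mono\<close>)
  qed (use c x * in \<open>auto intro: psf_has_sum\<close>)
  then show "psum \<rho> S (\<lambda>x. \<Sum>\<^sub>\<infinity>i\<in>I. f i x)"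
    by (intro psum_regroup[where J = "I \<times> midx" and \<phi> = snd and w = "\<lambda>(i, \<alpha>). c i \<alpha>" and S = "infsum N I"])
       (use \<rho> hJ NS in \<open>auto simp: case_prod_unfold\<close>)
qed

lemma psum_sum:
  assumes "finite I" "\<And>i. i \<in> I ==> psum \<rho> (M i) (f i)" "\<rho> > 0"
  shows "psum \<rho> (sum M I) (\<lambda>x. \<Sum>i\<in>I. f i x)"
  using psum_infsum(1)[of I \<rho> M f "sum M I"] assms by (simp add: has_sum_finiteI)

lemma psum_add:
  assumes "psum \<rho> M f" "psum \<rho> N g" "\<rho> > 0"
  shows "psum \<rho> (M + N) (\<lambda>x. f x + g x)"
  using psum_sum[of "UNIV :: bool set" \<rho> "\<lambda>b. if b then M else N" "\<lambda>b. if b then f else g"] assms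
  by (simp add: UNIV_bool add.commute)

lemma psum_power:
  fixes f :: "'a::euclidean_space => 'b::{real_normed_field,banach}"
  assumes "psum \<rho> M f" "\<rho> > 0"
  shows "psum \<rho> (M ^ n) (\<lambda>x. f x ^ n)"
proof (induction n)
  case 0 show ?case using psum_const[OF assms(2), of "1::'b"] by simp
next
  case (Suc n) then show ?case using psum_mult[OF assms(1) Suc assms(2)] by simp
qed

lemma psum_prod:
  fixes f :: "'i => 'a::euclidean_space => 'b::{real_normed_field,banach}"
  assumes "finite I" "\<And>i. i \<in> I ==> psum \<rho> (M i) (f i)" "\<rho> > 0"
  shows "psum \<rho> (prod M I) (\<lambda>x. \<Prod>i\<in>I. f i x)"
  using assms
proof (induction I)
  case empty show ?case using psum_const[OF assms(3), of "1::'b"] by simp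
next
  case (insert i I)
  then have "psum \<rho> (M i * prod M I) (\<lambda>x. f i x * (\<Prod>i\<in>I. f i x))"
    by (intro psum_mult) auto
  then show ?case using insert by simp
qed

text \<open>
  By submultiplicativity, substituting \<open>g\<close> in a monomial gives a function of norm at most
  \<open>\<sigma>\<close> to the power of its degree; these bounds add up to the norm of \<open>f\<close> at radius \<open>\<sigma>\<close>.
\<close>

lemma psum_compose:
  fixes f :: "'e::euclidean_space => 'b::banach" and g :: "'a::euclidean_space => 'e"
  assumes f: "psum \<sigma> M f" and g: "\<And>e. e \<in> Basis ==> psum \<rho> \<sigma> (\<lambda>x. g x \<bullet> e)" and "\<rho> > 0"
  shows "psum \<rho> M (\<lambda>x. f (g x))"
proof -
  obtain c where c: "psf \<sigma> M c f" using f by (auto simp: psum_def)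
  have gb: "g x \<in> pbox \<sigma>" if "x \<in> pbox \<rho>" for x
    using psum_bound[OF g that] by (auto simp: pbox_def)
  have m: "psum \<rho> (\<sigma> ^ mdeg \<alpha>) (\<lambda>x. mon (g x) \<alpha>)" for \<alpha>
    unfolding mon_def mdeg_def power_sum
    by (intro psum_prod psum_power g assms) auto
  have t: "psum \<rho> (norm (c \<alpha>) * \<sigma> ^ mdeg \<alpha>) (\<lambda>x. mon (g x) \<alpha> *\<^sub>R c \<alpha>)" for \<alpha>
    by (rule psum_linear[OF m]) (use \<open>\<rho> > 0\<close> in \<open>auto intro: bounded_linear_scaleR_left\<close>)
  have s: "((\<lambda>\<alpha>. norm (c \<alpha>) * \<sigma> ^ mdeg \<alpha>) has_sum (\<Sum>\<^sub>\<infinity>\<alpha>\<in>midx. norm (c \<alpha>) * \<sigma> ^ mdeg \<alpha>)) midx"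
    using c by (auto simp: psf_def)
  have "psum \<rho> M (\<lambda>x. \<Sum>\<^sub>\<infinity>\<alpha>\<in>midx. mon (g x) \<alpha> *\<^sub>R c \<alpha>)"
    using psum_mono[OF psum_infsum(1)[OF t s \<open>\<rho> > 0\<close>]] c by (auto simp: psf_def)
  then show ?thesis
    by (rule psum_cong) (use psf_has_sum[OF c gb] in \<open>auto simp: infsumI\<close>)
qed

lemma psf_at_0:
  assumes "psf \<rho> M c f" "\<rho> \<ge> 0" shows "f 0 = c (\<lambda>b\<in>Basis. 0)"
proof -
  have "((\<lambda>\<alpha>. mon 0 \<alpha> *\<^sub>R c \<alpha>) has_sum f 0) midx" by (rule psf_has_sum[OF assms(1)]) (use assms in auto)
  moreover have "((\<lambda>\<alpha>. mon 0 \<alpha> *\<^sub>R c \<alpha>) has_sum c (\<lambda>b\<in>Basis. 0)) midx"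
    by (rule has_sum_finite_neutralI[where B = "{\<lambda>b\<in>Basis. 0}"]) (auto simp: mon_0_left)
  ultimately show ?thesis by (rule has_sum_unique)
qed

text \<open>
  In the absence of a constant term each monomial gains a factor \<open>\<rho>' / \<rho>\<close>. This makes the inner
  function of a composition small enough for the outer series.
\<close>

lemma psum_shrink:
  assumes f: "psum \<rho> M f" "f 0 = 0" and \<rho>: "\<rho> > 0" and "\<rho>' > 0" "\<rho>' \<le> \<rho>"
  shows "psum \<rho>' (\<rho>' / \<rho> * M) f"
proof -
  obtain c where c: "psf \<rho> M c f" using f by (auto simp: psum_def)
  have c0: "c (\<lambda>b\<in>Basis. 0) = 0" using psf_at_0[OF c] f \<rho> by simp
  have c': "psf \<rho>' M c f" using psf_radius_mono[OF c] assms by simp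
  have le: "norm (c \<alpha>) * \<rho>' ^ mdeg \<alpha> \<le> \<rho>' / \<rho> * (norm (c \<alpha>) * \<rho> ^ mdeg \<alpha>)" if "\<alpha> \<in> midx" for \<alpha>
  proof (cases "mdeg \<alpha> = 0")
    case True then show ?thesis using midx_0[OF that] c0 by simp
  next
    case False
    then obtain n where n: "mdeg \<alpha> = Suc n" using not0_implies_Suc by blast
    have "\<rho>' ^ n \<le> \<rho> ^ n" using assms by (intro power_mono) auto
    then have "\<rho>' ^ mdeg \<alpha> \<le> \<rho>' / \<rho> * \<rho> ^ mdeg \<alpha>" using assms n by (simp add: mult_left_mono)
    from mult_left_mono[OF this norm_ge_zero[of "c \<alpha>"]] show ?thesis by (simp add: mult.left_commute)
  qed
  have s: "(\<lambda>\<alpha>. norm (c \<alpha>) * \<rho>' ^ mdeg \<alpha>) summable_on midx" "(\<lambda>\<alpha>. norm (c \<alpha>) * \<rho> ^ mdeg \<alpha>) summable_on midx"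
    using c c' by (auto simp: psf_def)
  have "(\<Sum>\<^sub>\<infinity>\<alpha>\<in>midx. norm (c \<alpha>) * \<rho>' ^ mdeg \<alpha>) \<le> (\<Sum>\<^sub>\<infinity>\<alpha>\<in>midx. \<rho>' / \<rho> * (norm (c \<alpha>) * \<rho> ^ mdeg \<alpha>))"
    by (rule infsum_mono[OF s(1) summable_on_cmult_right[OF s(2)] le])
  also have "\<dots> = \<rho>' / \<rho> * (\<Sum>\<^sub>\<infinity>\<alpha>\<in>midx. norm (c \<alpha>) * \<rho> ^ mdeg \<alpha>)" by (simp only: infsum_cmult_right')
  also have "\<dots> \<le> \<rho>' / \<rho> * M" using c assms by (intro mult_left_mono) (auto simp: psf_def)
  finally have "psf \<rho>' (\<rho>' / \<rho> * M) c f" using c' by (auto simp: psf_def)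
  then show ?thesis by (rule psf_imp_psum)
qed

section \<open>Splitting the variables, uniqueness of the coefficients\<close>

definition mpair :: "('a::euclidean_space => nat) => ('b::euclidean_space => nat) => ('a \<times> 'b => nat)" where
  "mpair \<gamma> \<delta> = (\<lambda>b\<in>Basis. if snd b = 0 then \<gamma> (fst b) else \<delta> (snd b))"

lemma mpair_midx [simp]: "mpair \<gamma> \<delta> \<in> midx"
  by (simp add: mpair_def midx_def)

lemma mpair_simps [simp]:
  "u \<in> Basis ==> mpair \<gamma> \<delta> (u, 0) = \<gamma> u"
  "v \<in> Basis ==> mpair \<gamma> \<delta> (0, v) = \<delta> v"
  by (auto simp: mpair_def Basis_prod_def nonzero_Basis)

lemma prod_Basis_prod:
  fixes f :: "'a::euclidean_space \<times> 'b::euclidean_space => 'c::comm_monoid_mult"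
  shows "(\<Prod>b\<in>Basis. f b) = (\<Prod>u\<in>Basis. f (u, 0)) * (\<Prod>v\<in>Basis. f (0, v))"
proof -
  have "inj_on (\<lambda>u. (u::'a,0::'b)) Basis" "inj_on (\<lambda>u. (0::'a,u::'b)) Basis"
    by (auto intro!: inj_onI)
  then show ?thesis
    unfolding Basis_prod_def
    by (subst prod.union_disjoint) (auto simp: Basis_prod_def prod.reindex)
qed

lemma sum_Basis_prod:
  fixes f :: "'a::euclidean_space \<times> 'b::euclidean_space => 'c::comm_monoid_add"
  shows "(\<Sum>b\<in>Basis. f b) = (\<Sum>u\<in>Basis. f (u, 0)) + (\<Sum>v\<in>Basis. f (0, v))"
proof -
  have "inj_on (\<lambda>u. (u::'a,0::'b)) Basis" "inj_on (\<lambda>u. (0::'a,u::'b)) Basis"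
    by (auto intro!: inj_onI)
  then show ?thesis
    unfolding Basis_prod_def
    by (subst sum.union_disjoint) (auto simp: Basis_prod_def sum.reindex)
qed

lemma mdeg_mpair: "mdeg (mpair \<gamma> \<delta>) = mdeg \<gamma> + mdeg \<delta>"
  by (simp add: mdeg_def sum_Basis_prod)

lemma mon_mpair: "mon (x, y) (mpair \<gamma> \<delta>) = mon x \<gamma> * mon y \<delta>"
  by (simp add: mon_def prod_Basis_prod)

lemma pbox_Pair [simp]: "(x, y) \<in> pbox \<rho> \<longleftrightarrow> x \<in> pbox \<rho> \<and> y \<in> pbox \<rho>"
  unfolding pbox_def by (simp add: Basis_prod_def ball_Un)

lemma bij_mpair: "bij_betw (\<lambda>(\<gamma> :: 'a::euclidean_space => nat, \<delta> :: 'b::euclidean_space => nat). mpair \<gamma> \<delta>) (midx \<times> midx) midx"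
proof (rule bij_betwI[of _ _ _ "\<lambda>\<alpha>. (\<lambda>u\<in>Basis. \<alpha> (u, 0), \<lambda>v\<in>Basis. \<alpha> (0, v))"])
  show "(\<lambda>(\<gamma> :: 'a => nat, \<delta> :: 'b => nat). mpair \<gamma> \<delta>) \<in> midx \<times> midx \<rightarrow> midx" by auto
  show "(\<lambda>\<alpha> :: 'a \<times> 'b => nat. (\<lambda>u\<in>Basis. \<alpha> (u, 0), \<lambda>v\<in>Basis. \<alpha> (0, v))) \<in> midx \<rightarrow> midx \<times> midx"
    by (auto simp: midx_def)
  show "(\<lambda>u\<in>Basis. (case x of (\<gamma>, \<delta>) => mpair \<gamma> \<delta>) (u, 0), \<lambda>v\<in>Basis. (case x of (\<gamma>, \<delta>) => mpair \<gamma> \<delta>) (0, v)) = x"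
    if "x \<in> midx \<times> midx" for x :: "('a => nat) \<times> ('b => nat)"
  proof -
    obtain \<gamma> \<delta> where x: "x = (\<gamma>, \<delta>)" by (cases x)
    have "\<gamma> u = undefined" if "u \<notin> Basis" for u using \<open>x \<in> _\<close> that PiE_arb[of \<gamma> Basis "\<lambda>_. UNIV" u] by (simp add: x midx_def)
    moreover have "\<delta> u = undefined" if "u \<notin> Basis" for u using \<open>x \<in> _\<close> that PiE_arb[of \<delta> Basis "\<lambda>_. UNIV" u] by (simp add: x midx_def)
    ultimately show ?thesis unfolding x by (auto simp: fun_eq_iff)
  qed
  show "(case (\<lambda>u\<in>Basis. y (u, 0), \<lambda>v\<in>Basis. y (0, v)) of (\<gamma>, \<delta>) => mpair \<gamma> \<delta>) = y"
    if "y \<in> midx" for y :: "'a \<times> 'b => nat"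
  proof
    fix b :: "'a \<times> 'b"
    have "b \<notin> Basis ==> y b = undefined" using that PiE_arb[of y Basis "\<lambda>_. UNIV" b] by (simp add: midx_def)
    moreover have "b \<in> Basis ==> mpair (\<lambda>u\<in>Basis. y (u, 0)) (\<lambda>v\<in>Basis. y (0, v)) b = y b"
      by (subst (asm) Basis_prod_def) auto
    ultimately show "(case (\<lambda>u\<in>Basis. y (u, 0), \<lambda>v\<in>Basis. y (0, v)) of (\<gamma>, \<delta>) => mpair \<gamma> \<delta>) b = y b"
      by (cases "b \<in> Basis") (auto simp: mpair_def)
  qed
qed

text \<open>
  Collecting the powers of \<open>x\<close> in a series in \<open>(x, y)\<close> leaves coefficients that are power series
  in \<open>y\<close>: partial Taylor coefficients depend analytically on the remaining variables.
\<close>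

lemma psf_extract:
  fixes f :: "'a::euclidean_space \<times> 'b::euclidean_space => 'c::banach"
  assumes f: "psf \<rho> M c f" and \<rho>: "\<rho> > 0"
  shows "y \<in> pbox \<rho> ==> psf \<rho> M (\<lambda>\<gamma>. \<Sum>\<^sub>\<infinity>\<delta>\<in>midx. mon y \<delta> *\<^sub>R c (mpair \<gamma> \<delta>)) (\<lambda>x. f (x, y))"
    and "\<gamma> \<in> midx ==> psf \<rho> (M / \<rho> ^ mdeg \<gamma>) (\<lambda>\<delta>. c (mpair \<gamma> \<delta>)) (\<lambda>y. \<Sum>\<^sub>\<infinity>\<delta>\<in>midx. mon y \<delta> *\<^sub>R c (mpair \<gamma> \<delta>))"
proof -
  let ?S = "\<Sum>\<^sub>\<infinity>\<alpha>\<in>midx. norm (c \<alpha>) * \<rho> ^ mdeg \<alpha>"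
  have SM: "?S \<le> M" using f by (simp add: psf_def)
  have S: "((\<lambda>(\<gamma>, \<delta>). norm (c (mpair \<gamma> \<delta>)) * \<rho> ^ mdeg \<gamma> * \<rho> ^ mdeg \<delta>) has_sum ?S) (midx \<times> midx)"
  proof -
    have "((\<lambda>\<alpha>. norm (c \<alpha>) * \<rho> ^ mdeg \<alpha>) has_sum ?S) midx" using f by (simp add: psf_def)
    then show ?thesis
      unfolding has_sum_reindex_bij_betw[OF bij_mpair, symmetric]
      by (rule has_sum_cong[THEN iffD1, rotated]) (auto simp: mdeg_mpair power_add)
  qed
  have fib: "(\<lambda>\<delta>. norm (c (mpair \<gamma> \<delta>)) * \<rho> ^ mdeg \<delta>) summable_on midx"
    "(\<Sum>\<^sub>\<infinity>\<delta>\<in>midx. norm (c (mpair \<gamma> \<delta>)) * \<rho> ^ mdeg \<delta>) \<le> M / \<rho> ^ mdeg \<gamma>" if "\<gamma> \<in> midx" for \<gamma> :: "'a => nat"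
  proof -
    have "(\<lambda>(\<gamma>, \<delta>). norm (c (mpair \<gamma> \<delta>)) * \<rho> ^ mdeg \<gamma> * \<rho> ^ mdeg \<delta>) summable_on (Pair \<gamma> ` midx)"
      by (rule summable_on_subset_banach[OF has_sum_imp_summable[OF S]]) (use that in auto)
    then have "((\<lambda>(\<gamma>, \<delta>). norm (c (mpair \<gamma> \<delta>)) * \<rho> ^ mdeg \<gamma> * \<rho> ^ mdeg \<delta>) \<circ> (\<lambda>\<delta>. (\<gamma>, \<delta>))) summable_on midx"
      by (subst summable_on_reindex[symmetric]) (auto simp: inj_on_def)
    then have s1: "(\<lambda>\<delta>. \<rho> ^ mdeg \<gamma> * (norm (c (mpair \<gamma> \<delta>)) * \<rho> ^ mdeg \<delta>)) summable_on midx"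
      by (simp add: o_def mult_ac)
    then show s2: "(\<lambda>\<delta>. norm (c (mpair \<gamma> \<delta>)) * \<rho> ^ mdeg \<delta>) summable_on midx"
      using \<rho> by (subst (asm) summable_on_cmult_right') auto
    have "((\<lambda>\<delta>. norm (c (mpair \<gamma> \<delta>)) * \<rho> ^ mdeg \<gamma> * \<rho> ^ mdeg \<delta>) has_sum (\<rho> ^ mdeg \<gamma> * (\<Sum>\<^sub>\<infinity>\<delta>\<in>midx. norm (c (mpair \<gamma> \<delta>)) * \<rho> ^ mdeg \<delta>))) midx"
      using has_sum_cmult_right[OF has_sum_infsum[OF s2], of "\<rho> ^ mdeg \<gamma>"] by (simp add: mult_ac)
    then have "((\<lambda>(\<gamma>, \<delta>). norm (c (mpair \<gamma> \<delta>)) * \<rho> ^ mdeg \<gamma> * \<rho> ^ mdeg \<delta>) has_sum (\<rho> ^ mdeg \<gamma> * (\<Sum>\<^sub>\<infinity>\<delta>\<in>midx. norm (c (mpair \<gamma> \<delta>)) * \<rho> ^ mdeg \<delta>))) (Pair \<gamma> ` midx)"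
      by (subst has_sum_reindex) (auto simp: inj_on_def o_def)
    then have "\<rho> ^ mdeg \<gamma> * (\<Sum>\<^sub>\<infinity>\<delta>\<in>midx. norm (c (mpair \<gamma> \<delta>)) * \<rho> ^ mdeg \<delta>) \<le> ?S"
      by (rule has_sum_mono2[OF _ S]) (use \<rho> that in auto)
    then show "(\<Sum>\<^sub>\<infinity>\<delta>\<in>midx. norm (c (mpair \<gamma> \<delta>)) * \<rho> ^ mdeg \<delta>) \<le> M / \<rho> ^ mdeg \<gamma>"
      using SM \<rho> by (simp add: field_simps)
  qed
  have le: "norm (mon y \<delta> *\<^sub>R c (mpair \<gamma> \<delta>)) \<le> norm (c (mpair \<gamma> \<delta>)) * \<rho> ^ mdeg \<delta>" if "y \<in> pbox \<rho>"
    for y \<gamma> \<delta>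
    using abs_mon_le[OF that, of \<delta>] by (simp add: mult.commute mult_right_mono)
  show "psf \<rho> (M / \<rho> ^ mdeg \<gamma>) (\<lambda>\<delta>. c (mpair \<gamma> \<delta>)) (\<lambda>y. \<Sum>\<^sub>\<infinity>\<delta>\<in>midx. mon y \<delta> *\<^sub>R c (mpair \<gamma> \<delta>))" if \<gamma>: "\<gamma> \<in> midx"
  proof -
    have "(\<lambda>\<delta>. mon y \<delta> *\<^sub>R c (mpair \<gamma> \<delta>)) summable_on midx" if "y \<in> pbox \<rho>" for y
      by (rule abs_summable_summable, rule summable_on_comparison_test[OF fib(1)[OF \<gamma>] le]) (use that in auto)
    then show ?thesis using fib[OF \<gamma>] unfolding psf_def by auto
  qed
  assume y: "y \<in> pbox \<rho>"
  have s: "(\<lambda>j. norm (case j of (\<gamma>, \<delta>) => mon y \<delta> *\<^sub>R c (mpair \<gamma> \<delta>)) * \<rho> ^ mdeg (fst j)) summable_on midx \<times> midx"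
    by (rule summable_on_comparison_test[OF has_sum_imp_summable[OF S]])
       (use \<rho> mult_right_mono[OF le[OF y], of "\<rho> ^ _"] in \<open>auto simp: mult_ac\<close>)
  have "(\<Sum>\<^sub>\<infinity>j\<in>midx \<times> midx. norm (case j of (\<gamma>, \<delta>) => mon y \<delta> *\<^sub>R c (mpair \<gamma> \<delta>)) * \<rho> ^ mdeg (fst j)) \<le> ?S"
    by (rule has_sum_mono[OF has_sum_infsum[OF s] S])
       (use \<rho> mult_right_mono[OF le[OF y], of "\<rho> ^ _"] in \<open>auto simp: mult_ac\<close>)
  with SM have s': "(\<Sum>\<^sub>\<infinity>j\<in>midx \<times> midx. norm (case j of (\<gamma>, \<delta>) => mon y \<delta> *\<^sub>R c (mpair \<gamma> \<delta>)) * \<rho> ^ mdeg (fst j)) \<le> M"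
    by linarith
  have "psf \<rho> M (\<lambda>\<alpha>. \<Sum>\<^sub>\<infinity>j\<in>{j \<in> midx \<times> midx. fst j = \<alpha>}. case j of (\<gamma>, \<delta>) => mon y \<delta> *\<^sub>R c (mpair \<gamma> \<delta>)) (\<lambda>x. f (x, y))"
  proof (rule psf_regroup[OF \<rho> _ s s'])
    fix x :: 'a assume "x \<in> pbox \<rho>"
    with y have "((\<lambda>\<alpha>. mon (x, y) \<alpha> *\<^sub>R c \<alpha>) has_sum f (x, y)) midx" by (intro psf_has_sum[OF f]) auto
    then show "((\<lambda>j. mon x (fst j) *\<^sub>R (case j of (\<gamma>, \<delta>) => mon y \<delta> *\<^sub>R c (mpair \<gamma> \<delta>))) has_sum f (x, y)) (midx \<times> midx)"
      unfolding has_sum_reindex_bij_betw[OF bij_mpair, symmetric]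
      by (rule has_sum_cong[THEN iffD1, rotated]) (auto simp: mon_mpair)
  qed auto
  moreover have "(\<Sum>\<^sub>\<infinity>j\<in>{j \<in> midx \<times> midx. fst j = \<alpha>}. case j of (\<gamma>, \<delta>) => mon y \<delta> *\<^sub>R c (mpair \<gamma> \<delta>))
      = (\<Sum>\<^sub>\<infinity>\<delta>\<in>midx. mon y \<delta> *\<^sub>R c (mpair \<alpha> \<delta>))" if "\<alpha> \<in> midx" for \<alpha>
  proof -
    have "{j \<in> midx \<times> midx. fst j = \<alpha>} = Pair \<alpha> ` (midx :: ('b => nat) set)" using that by auto
    then show ?thesis by (simp add: infsum_reindex inj_on_def o_def)
  qed
  ultimately show "psf \<rho> M (\<lambda>\<gamma>. \<Sum>\<^sub>\<infinity>\<delta>\<in>midx. mon y \<delta> *\<^sub>R c (mpair \<gamma> \<delta>)) (\<lambda>x. f (x, y))"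
    unfolding psf_def by (simp cong: summable_on_cong infsum_cong has_sum_cong)
qed

lemma powser_zero_imp_coeff_zero:
  fixes a :: "nat => real"
  assumes "\<rho> > 0" and z: "\<And>t. \<bar>t\<bar> < \<rho> ==> (\<lambda>n. a n * t ^ n) sums 0"
  shows "a n = 0"
proof (induction n rule: less_induct)
  case (less n)
  have "(\<lambda>m. a (m + n) * t ^ m) sums 0" if "t \<noteq> 0" "norm t < \<rho>" for t
  proof -
    have "(\<lambda>m. a (m + n) * t ^ (m + n)) sums (0 - (\<Sum>m<n. a m * t ^ m))"
      using z[of t] that by (intro sums_split_initial_segment) auto
    also have "(\<Sum>m<n. a m * t ^ m) = 0" using less by simp
    finally have "(\<lambda>m. t ^ n * (a (m + n) * t ^ m)) sums (t ^ n * 0)" by (simp add: power_add mult_ac)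
    then show ?thesis using that by (subst (asm) sums_mult_iff) auto
  qed
  from powser_limit_0_strong[OF \<open>\<rho> > 0\<close> this]
  have "((\<lambda>_. 0) \<longlongrightarrow> a (0 + n)) (at (0::real))" by simp
  then show ?case using LIM_const_eq by fastforce
qed

text \<open>
  Induction on the number of variables: for fixed values of the others, the series is a power
  series in the new variable, and its coefficients vanish by the case of one variable.
\<close>

lemma multi_powser_zero:
  fixes c :: "('i => nat) => real"
  assumes "finite S" "\<rho> > 0"
    and "(\<lambda>\<alpha>. \<bar>c \<alpha>\<bar> * \<rho> ^ (\<Sum>b\<in>S. \<alpha> b)) summable_on (S \<rightarrow>\<^sub>E UNIV)"
    and "\<And>x. (\<And>b. b \<in> S ==> \<bar>x b\<bar> \<le> \<rho>) ==> ((\<lambda>\<alpha>. (\<Prod>b\<in>S. x b ^ \<alpha> b) * c \<alpha>) has_sum 0) (S \<rightarrow>\<^sub>E UNIV)"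
    and "\<alpha> \<in> S \<rightarrow>\<^sub>E UNIV"
  shows "c \<alpha> = 0"
  using assms
proof (induction S arbitrary: c \<alpha>)
  case empty
  have "((\<lambda>\<alpha>. c \<alpha>) has_sum 0) {\<lambda>_. undefined}" using empty(3)[of "\<lambda>_. 0"] by simp
  moreover have "(c has_sum c (\<lambda>_. undefined)) {\<lambda>_. undefined}" by (intro has_sum_finiteI) auto
  ultimately have "c (\<lambda>_. undefined) = 0" using has_sum_unique by metis
  then show ?case using empty by simp
next
  case (insert i S)
  have bij: "bij_betw (\<lambda>(n, \<beta>). \<beta>(i := n)) (UNIV \<times> (S \<rightarrow>\<^sub>E UNIV)) (insert i S \<rightarrow>\<^sub>E (UNIV :: nat set))"
  proof (rule bij_betwI[of _ _ _ "\<lambda>\<alpha>. (\<alpha> i, \<alpha>(i := undefined))"])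
    show "(\<lambda>(n, \<beta>). \<beta>(i := n)) \<in> UNIV \<times> (S \<rightarrow>\<^sub>E UNIV) \<rightarrow> insert i S \<rightarrow>\<^sub>E (UNIV :: nat set)"
      by (auto simp: PiE_iff extensional_def split: if_splits)
    show "(\<lambda>\<alpha>. (\<alpha> i, \<alpha>(i := undefined))) \<in> (insert i S \<rightarrow>\<^sub>E (UNIV :: nat set)) \<rightarrow> UNIV \<times> (S \<rightarrow>\<^sub>E UNIV)"
      by (auto simp: PiE_iff extensional_def)
    show "((case z of (n, \<beta>) => \<beta>(i := n)) i, (case z of (n, \<beta>) => \<beta>(i := n))(i := undefined)) = z"
      if "z \<in> UNIV \<times> (S \<rightarrow>\<^sub>E UNIV)" for z :: "nat \<times> ('i => nat)"
      using that PiE_arb[OF _ \<open>i \<notin> S\<close>, of "snd z" "\<lambda>_. UNIV"] by (cases z) (auto simp: fun_upd_idem)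
  qed auto
  have upd: "(\<Sum>b\<in>insert i S. (\<beta>(i := n)) b) = n + (\<Sum>b\<in>S. \<beta> b)" for n and \<beta> :: "'i => nat"
    using insert.hyps by (auto intro!: sum.cong)
  have updp: "(\<Prod>b\<in>insert i S. x b ^ (\<beta>(i := n)) b) = x i ^ n * (\<Prod>b\<in>S. x b ^ \<beta> b)" for x :: "'i => real" and n \<beta>
    using insert.hyps by (auto intro!: prod.cong split: if_splits)
  have s: "(\<lambda>(n, \<beta>). \<bar>c (\<beta>(i := n))\<bar> * \<rho> ^ (n + (\<Sum>b\<in>S. \<beta> b))) summable_on (UNIV \<times> (S \<rightarrow>\<^sub>E UNIV))"
    using insert.prems(2) unfolding summable_on_reindex_bij_betw[OF bij, symmetric]
    by (rule summable_on_cong[THEN iffD1, rotated]) (clarsimp simp del: sum.insert fun_upd_apply simp: upd)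
  have sn: "(\<lambda>\<beta>. \<bar>c (\<beta>(i := n))\<bar> * \<rho> ^ (\<Sum>b\<in>S. \<beta> b)) summable_on (S \<rightarrow>\<^sub>E UNIV)" for n
  proof -
    have "(\<lambda>\<beta>. \<bar>c (\<beta>(i := n))\<bar> * \<rho> ^ (n + (\<Sum>b\<in>S. \<beta> b))) summable_on (S \<rightarrow>\<^sub>E UNIV)"
      using summable_on_SigmaD1[OF s, of n] by simp
    then have "(\<lambda>\<beta>. \<rho> ^ n * (\<bar>c (\<beta>(i := n))\<bar> * \<rho> ^ (\<Sum>b\<in>S. \<beta> b))) summable_on (S \<rightarrow>\<^sub>E UNIV)"
      by (simp add: power_add mult_ac)
    then show ?thesis using \<open>\<rho> > 0\<close> by (subst (asm) summable_on_cmult_right') auto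
  qed
  have ple: "\<bar>\<Prod>b\<in>S. x b ^ \<beta> b\<bar> \<le> \<rho> ^ (\<Sum>b\<in>S. \<beta> b)" if "\<And>b. b \<in> S ==> \<bar>x b\<bar> \<le> \<rho>" for x :: "'i => real" and \<beta>
    unfolding power_sum abs_prod power_abs by (intro prod_mono) (use that in \<open>auto intro: power_mono\<close>)
  have main: "((\<lambda>\<beta>. (\<Prod>b\<in>S. x b ^ \<beta> b) * c (\<beta>(i := n))) has_sum 0) (S \<rightarrow>\<^sub>E UNIV)"
    if x: "\<And>b. b \<in> S ==> \<bar>x b\<bar> \<le> \<rho>" for x n
  proof -
    define g where "g n = (\<Sum>\<^sub>\<infinity>\<beta>\<in>S \<rightarrow>\<^sub>E UNIV. (\<Prod>b\<in>S. x b ^ \<beta> b) * c (\<beta>(i := n)))" for n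
    have g: "((\<lambda>\<beta>. (\<Prod>b\<in>S. x b ^ \<beta> b) * c (\<beta>(i := n))) has_sum g n) (S \<rightarrow>\<^sub>E UNIV)" for n
      unfolding g_def
      by (rule has_sum_infsum, rule abs_summable_summable, rule summable_on_comparison_test[OF sn[of n]])
         (use x in \<open>auto simp: mult.commute[of _ "c _"] abs_mult intro!: mult_left_mono ple\<close>)
    have "(\<lambda>n. g n * t ^ n) sums 0" if t: "\<bar>t\<bar> < \<rho>" for t
    proof -
      have "((\<lambda>\<alpha>. (\<Prod>b\<in>insert i S. (x(i := t)) b ^ \<alpha> b) * c \<alpha>) has_sum 0) (insert i S \<rightarrow>\<^sub>E UNIV)"
        by (rule insert.prems(3)) (use x t in auto)
      then have "((\<lambda>(n, \<beta>). t ^ n * ((\<Prod>b\<in>S. x b ^ \<beta> b) * c (\<beta>(i := n)))) has_sum 0) (UNIV \<times> (S \<rightarrow>\<^sub>E UNIV))"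
        unfolding has_sum_reindex_bij_betw[OF bij, symmetric]
      proof (rule has_sum_cong[THEN iffD1, rotated])
        fix z :: "nat \<times> ('i => nat)"
        obtain n \<beta> where z: "z = (n, \<beta>)" by (cases z)
        have "(\<Prod>b\<in>S. (x(i := t)) b ^ \<beta> b) = (\<Prod>b\<in>S. x b ^ \<beta> b)"
          using insert.hyps by (intro prod.cong) auto
        then show "(\<Prod>b\<in>insert i S. (x(i := t)) b ^ (case z of (n, \<beta>) => \<beta>(i := n)) b) * c (case z of (n, \<beta>) => \<beta>(i := n))
           = (case z of (n, \<beta>) => t ^ n * ((\<Prod>b\<in>S. x b ^ \<beta> b) * c (\<beta>(i := n))))"
          unfolding z prod.case updp by simp
      qed
      then have "((\<lambda>n. t ^ n * g n) has_sum 0) UNIV"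
        by (rule has_sum_SigmaD) (auto intro!: has_sum_cmult_right g)
      then show ?thesis using has_sum_imp_sums by (simp add: mult.commute)
    qed
    from powser_zero_imp_coeff_zero[OF \<open>\<rho> > 0\<close> this] have "g n = 0" by simp
    then show ?thesis using g[of n] by simp
  qed
  have z: "c (\<beta>(i := n)) = 0" if "\<beta> \<in> S \<rightarrow>\<^sub>E UNIV" for \<beta> n
    by (rule insert.IH[where c = "\<lambda>\<beta>. c (\<beta>(i := n))", OF \<open>\<rho> > 0\<close> sn main that])
  from insert.prems(4) obtain n \<beta> where "\<alpha> = \<beta>(i := n)" "\<beta> \<in> S \<rightarrow>\<^sub>E UNIV"
    using bij_betw_imp_surj_on[OF bij] by (smt (verit, best) case_prod_conv imageE mem_Sigma_iff surj_pair)
  then show ?case using z by (simp del: fun_upd_apply)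
qed

lemma psf_zero_coeff:
  fixes f :: "'a::euclidean_space => 'b::euclidean_space"
  assumes f: "psf \<rho> M c f" and \<rho>: "\<rho> > 0" and z: "\<And>x. x \<in> pbox \<rho> ==> f x = 0" and "\<alpha> \<in> midx"
  shows "c \<alpha> = 0"
proof (rule euclidean_eqI)
  fix e :: 'b assume e: "e \<in> Basis"
  have "c \<alpha> \<bullet> e = 0"
  proof (rule multi_powser_zero[of "Basis :: 'a set" \<rho> "\<lambda>\<alpha>. c \<alpha> \<bullet> e"])
    have "(\<lambda>\<alpha>. norm (c \<alpha>) * \<rho> ^ mdeg \<alpha>) summable_on midx" using f by (simp add: psf_def)
    then show "(\<lambda>\<alpha>. \<bar>c \<alpha> \<bullet> e\<bar> * \<rho> ^ sum \<alpha> Basis) summable_on (Basis \<rightarrow>\<^sub>E UNIV)"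
      unfolding mdeg_def midx_def
      by (rule summable_on_comparison_test) (use \<rho> Basis_le_norm[OF e] in \<open>auto intro!: mult_right_mono\<close>)
    fix x :: "'a => real" assume x: "\<And>b. b \<in> Basis ==> \<bar>x b\<bar> \<le> \<rho>"
    define y where "y = (\<Sum>b\<in>Basis. x b *\<^sub>R b)"
    have y: "y \<bullet> b = x b" if "b \<in> Basis" for b unfolding y_def using that by simp
    then have "y \<in> pbox \<rho>" using x by (auto simp: pbox_def)
    from has_sum_bounded_linear[OF bounded_linear_inner_left[of e] psf_has_sum[OF f this]]
    have "((\<lambda>\<alpha>. mon y \<alpha> * (c \<alpha> \<bullet> e)) has_sum 0) midx" using z[OF \<open>y \<in> _\<close>] by simp
    then show "((\<lambda>\<alpha>. (\<Prod>b\<in>Basis. x b ^ \<alpha> b) * (c \<alpha> \<bullet> e)) has_sum 0) (Basis \<rightarrow>\<^sub>E UNIV)"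
      by (simp add: mon_def midx_def y)
  qed (use assms in \<open>auto simp: midx_def\<close>)
  then show "c \<alpha> \<bullet> e = 0 \<bullet> e" by simp
qed

lemma psf_unique:
  fixes f :: "'a::euclidean_space => 'b::euclidean_space"
  assumes f: "psf \<rho> M c f" "\<rho> > 0" and g: "psf \<rho>' M' c' g" "\<rho>' > 0"
    and eq: "\<And>x. x \<in> pbox \<rho> ==> x \<in> pbox \<rho>' ==> f x = g x" and "\<alpha> \<in> midx"
  shows "c \<alpha> = c' \<alpha>"
proof -
  define r where "r = min \<rho> \<rho>'"
  have r: "r > 0" "r \<le> \<rho>" "r \<le> \<rho>'" using f g by (auto simp: r_def)
  have c: "psf r M c f" and d: "psf r M' c' g"
    using psf_radius_mono[OF f(1)] psf_radius_mono[OF g(1)] r by auto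
  have s: "(\<lambda>\<alpha>. norm (c \<alpha>) * r ^ mdeg \<alpha> + norm (c' \<alpha>) * r ^ mdeg \<alpha>) summable_on midx"
    by (intro summable_on_add) (use c d in \<open>auto simp: psf_def\<close>)
  have "psf r (\<Sum>\<^sub>\<infinity>\<alpha>\<in>midx. norm (c \<alpha> - c' \<alpha>) * r ^ mdeg \<alpha>) (\<lambda>\<alpha>. c \<alpha> - c' \<alpha>) (\<lambda>x. f x - g x)"
    unfolding psf_def
  proof (intro conjI ballI)
    show "(\<lambda>\<alpha>. norm (c \<alpha> - c' \<alpha>) * r ^ mdeg \<alpha>) summable_on midx"
      by (rule summable_on_comparison_test[OF s])
         (use r norm_triangle_ineq4 in \<open>auto simp: distrib_right[symmetric] intro!: mult_right_mono\<close>)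
    show "((\<lambda>\<alpha>. mon x \<alpha> *\<^sub>R (c \<alpha> - c' \<alpha>)) has_sum f x - g x) midx" if "x \<in> pbox r" for x
      using has_sum_add[OF psf_has_sum[OF c that] has_sum_scaleR[OF psf_has_sum[OF d that], of "-1"]]
      by (simp add: scaleR_diff_right)
  qed simp
  from psf_zero_coeff[OF this r(1) _ \<open>\<alpha> \<in> midx\<close>] eq r pbox_mono[of r] show ?thesis by force
qed

section \<open>Analytic functions\<close>

definition an_at :: "('a::euclidean_space => 'b::banach) => 'a => bool" where
  "an_at f a \<longleftrightarrow> (\<exists>\<rho>>0. \<exists>M. psum \<rho> M (\<lambda>z. f (a + z)))"

lemma an_atI: "psum \<rho> M (\<lambda>z. f (a + z)) ==> \<rho> > 0 ==> an_at f a"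
  by (auto simp: an_at_def)

lemma ball_subset_pbox: "ball 0 \<rho> \<subseteq> (pbox \<rho> :: 'a::euclidean_space set)"
proof
  fix x :: 'a assume "x \<in> ball 0 \<rho>"
  then show "x \<in> pbox \<rho>" using Basis_le_norm[of _ x] by (force simp: pbox_def)
qed

lemma norm_le_pbox: assumes "x \<in> pbox \<rho>" shows "norm (x::'a::euclidean_space) \<le> real DIM('a) * \<rho>"
proof -
  have "norm x \<le> (\<Sum>b\<in>Basis. \<bar>x \<bullet> b\<bar>)" by (rule norm_le_l1)
  also have "\<dots> \<le> (\<Sum>b\<in>(Basis::'a set). \<rho>)" by (rule sum_mono) (use assms in \<open>auto simp: pbox_def\<close>)
  finally show ?thesis by simp
qed

lemma abs_summable_euclidean:
  fixes f :: "'i => 'b::euclidean_space"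
  assumes "f summable_on A" shows "(\<lambda>i. norm (f i)) summable_on A"
proof (rule summable_on_comparison_test)
  have *: "(\<lambda>i. \<bar>f i \<bullet> b\<bar>) summable_on A" for b
    using summable_on_iff_abs_summable_on_real[THEN iffD1, OF
        summable_on_bounded_linear[OF bounded_linear_inner_left[of b] assms]] by simp
  have "(\<lambda>i. \<Sum>b\<in>B. \<bar>f i \<bullet> b\<bar>) summable_on A" if "finite B" for B
    using that by (induction B rule: finite_induct) (auto intro: summable_on_add *)
  then show "(\<lambda>i. \<Sum>b\<in>Basis. \<bar>f i \<bullet> b\<bar>) summable_on A" by simp
qed (auto intro: norm_le_l1)

text \<open>
  Summability at a point all of whose coordinates are positive bounds the weighted norm, since
  summability in a finite dimensional space is absolute.
\<close>

lemma real_analytic_on_iff: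
  fixes f :: "'a::euclidean_space => 'b::euclidean_space"
  shows "real_analytic_on f S \<longleftrightarrow> (\<forall>a\<in>S. an_at f a)"
  unfolding real_analytic_on_def
proof (intro ball_cong refl iffI)
  fix a
  assume "\<exists>r>0. \<exists>c. \<forall>x\<in>ball a r. ((\<lambda>\<alpha>. (\<Prod>b\<in>Basis. ((x - a) \<bullet> b) ^ \<alpha> b) *\<^sub>R c \<alpha>) has_sum f x) (Basis \<rightarrow>\<^sub>E UNIV)"
  then obtain r c where r: "r > 0"
    and h: "\<And>x. x \<in> ball a r ==> ((\<lambda>\<alpha>. mon (x - a) \<alpha> *\<^sub>R c \<alpha>) has_sum f x) midx"
    unfolding mon_def midx_def by blast
  define \<rho> where "\<rho> = r / (DIM('a) + 1)"
  have \<rho>: "\<rho> > 0" "DIM('a) * \<rho> < r" using r by (auto simp: \<rho>_def field_simps)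
  have hz: "((\<lambda>\<alpha>. mon z \<alpha> *\<^sub>R c \<alpha>) has_sum f (a + z)) midx" if "z \<in> pbox \<rho>" for z
  proof -
    have "norm z < r" using norm_le_pbox[OF that] \<rho> by linarith
    then show ?thesis using h[of "a + z"] by (simp add: dist_norm)
  qed
  define e :: 'a where "e = (\<Sum>b\<in>Basis. \<rho> *\<^sub>R b)"
  have e: "e \<bullet> b = \<rho>" if "b \<in> Basis" for b using that by (simp add: e_def)
  then have "e \<in> pbox \<rho>" using \<rho> by (simp add: pbox_def)
  from abs_summable_euclidean[OF has_sum_imp_summable[OF hz[OF this]]]
  have "(\<lambda>\<alpha>. norm (c \<alpha>) * \<rho> ^ mdeg \<alpha>) summable_on midx"
    using \<rho> by (simp add: mon_def e mdeg_def power_sum abs_prod mult.commute)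
  with hz have "psf \<rho> (\<Sum>\<^sub>\<infinity>\<alpha>\<in>midx. norm (c \<alpha>) * \<rho> ^ mdeg \<alpha>) c (\<lambda>z. f (a + z))"
    by (auto simp: psf_def)
  then show "an_at f a" using \<rho> an_atI psf_imp_psum by blast
next
  fix a assume "an_at f a"
  then obtain \<rho> M c where \<rho>: "\<rho> > 0" and c: "psf \<rho> M c (\<lambda>z. f (a + z))"
    by (auto simp: an_at_def psum_def)
  have "((\<lambda>\<alpha>. mon (x - a) \<alpha> *\<^sub>R c \<alpha>) has_sum f x) midx" if "x \<in> ball a \<rho>" for x
  proof -
    have "x - a \<in> ball 0 \<rho>" using that by (simp add: dist_norm norm_minus_commute)
    then have "x - a \<in> pbox \<rho>" using ball_subset_pbox by blast
    from psf_has_sum[OF c this] show ?thesis by simp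
  qed
  then show "\<exists>r>0. \<exists>c. \<forall>x\<in>ball a r. ((\<lambda>\<alpha>. (\<Prod>b\<in>Basis. ((x - a) \<bullet> b) ^ \<alpha> b) *\<^sub>R c \<alpha>) has_sum f x) (Basis \<rightarrow>\<^sub>E UNIV)"
    using \<rho> unfolding mon_def midx_def by blast
qed

lemma an_at_psum2:
  assumes "an_at f a" "an_at g a"
  obtains \<rho> M N where "\<rho> > 0" "psum \<rho> M (\<lambda>z. f (a + z))" "psum \<rho> N (\<lambda>z. g (a + z))"
proof -
  from assms obtain \<rho> M \<rho>' N where h: "\<rho> > 0" "psum \<rho> M (\<lambda>z. f (a + z))" "\<rho>' > 0" "psum \<rho>' N (\<lambda>z. g (a + z))"
    by (auto simp: an_at_def)
  have "psum (min \<rho> \<rho>') M (\<lambda>z. f (a + z))" by (rule psum_radius_mono[OF h(2)]) (use h in auto)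
  moreover have "psum (min \<rho> \<rho>') N (\<lambda>z. g (a + z))" by (rule psum_radius_mono[OF h(4)]) (use h in auto)
  ultimately show ?thesis using that[of "min \<rho> \<rho>'"] h by auto
qed

lemma an_at_const [intro, simp]: "an_at (\<lambda>_. c) a"
  using psum_const[of 1 c] by (auto simp: an_at_def intro: exI[of _ 1])

lemma an_at_add: assumes "an_at f a" "an_at g a" shows "an_at (\<lambda>x. f x + g x) a"
  by (rule an_at_psum2[OF assms]) (auto intro: an_atI psum_add)

lemma an_at_mult:
  fixes f g :: "'a::euclidean_space => 'b::{real_normed_field,banach}"
  assumes "an_at f a" "an_at g a" shows "an_at (\<lambda>x. f x * g x) a"
  by (rule an_at_psum2[OF assms]) (auto intro: an_atI psum_mult)

lemma an_at_linear: assumes "an_at f a" "bounded_linear T" shows "an_at (\<lambda>x. T (f x)) a"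
proof -
  obtain K where "K \<ge> 0" "\<And>v. norm (T v) \<le> K * norm v"
    using bounded_linear.nonneg_bounded[OF assms(2)] by (auto simp: mult.commute)
  moreover obtain \<rho> M where "\<rho> > 0" "psum \<rho> M (\<lambda>z. f (a + z))" using assms by (auto simp: an_at_def)
  ultimately show ?thesis using psum_linear[of \<rho> M _ T K] assms by (intro an_atI[of \<rho> "K * M"]) auto
qed

lemma an_at_sum:
  assumes "\<And>i. i \<in> I ==> an_at (f i) a" shows "an_at (\<lambda>x. \<Sum>i\<in>I. f i x) a"
  using assms by (induction I rule: infinite_finite_induct) (auto intro: an_at_add)

lemma an_at_scaleR:
  fixes f :: "'a::euclidean_space => real" and g :: "'a => 'b::euclidean_space"
  assumes f: "an_at f a" and g: "an_at g a" shows "an_at (\<lambda>x. f x *\<^sub>R g x) a"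
proof -
  have "an_at (\<lambda>x. \<Sum>b\<in>Basis. (f x * (g x \<bullet> b)) *\<^sub>R b) a"
    by (intro an_at_sum an_at_linear[OF _ bounded_linear_scaleR_left] an_at_mult f
        an_at_linear[OF g bounded_linear_inner_left])
  moreover have "(\<Sum>b\<in>Basis. (f x * (g x \<bullet> b)) *\<^sub>R b) = f x *\<^sub>R g x" for x
    unfolding scaleR_scaleR[symmetric] scaleR_sum_right[symmetric] euclidean_representation ..
  ultimately show ?thesis by simp
qed

lemma an_at_minus: "an_at f a ==> an_at (\<lambda>x. - f x) a"
  by (rule an_at_linear[OF _ bounded_linear_minus[OF bounded_linear_ident]])

lemma an_at_diff: "an_at f a ==> an_at g a ==> an_at (\<lambda>x. f x - g x) a"
  using an_at_add[of f a "\<lambda>x. - g x"] an_at_minus by auto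

lemma an_at_ident: "an_at (\<lambda>x. x) (a::'a::euclidean_space)"
proof -
  have "psum 1 (\<Sum>b\<in>(Basis::'a set). norm b * 1) (\<lambda>z::'a. \<Sum>b\<in>Basis. (z \<bullet> b) *\<^sub>R b)"
    by (intro psum_sum psum_linear[OF psum_coord _ bounded_linear_scaleR_left]) auto
  then have "psum 1 (norm a + DIM('a)) (\<lambda>z. a + z)"
    using psum_add[OF psum_const[of 1 a], of "DIM('a)" "\<lambda>z. z"] by (simp add: euclidean_representation)
  then show ?thesis by (rule an_atI) simp
qed

lemma an_at_bl: "bounded_linear T ==> an_at T (a::'a::euclidean_space)"
  using an_at_linear[OF an_at_ident] by blast

lemma an_at_Pair: assumes "an_at f a" "an_at g a" shows "an_at (\<lambda>x. (f x, g x)) a"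
proof -
  have "an_at (\<lambda>x. (f x, 0) + (0, g x)) a"
    by (intro an_at_add an_at_linear[OF assms(1)] an_at_linear[OF assms(2)] bounded_linear_Pair
        bounded_linear_ident bounded_linear_zero)
  then show ?thesis by simp
qed

lemma an_at_compose:
  fixes f :: "'e::euclidean_space => 'b::banach" and g :: "'a::euclidean_space => 'e"
  assumes g: "an_at g a" and f: "an_at f (g a)"
  shows "an_at (\<lambda>x. f (g x)) a"
proof -
  obtain \<sigma> M where \<sigma>: "\<sigma> > 0" and f: "psum \<sigma> M (\<lambda>z. f (g a + z))" using f by (auto simp: an_at_def)
  have "an_at (\<lambda>x. g x - g a) a" by (intro an_at_diff g an_at_const)
  then obtain \<rho> N where \<rho>: "\<rho> > 0" and N: "psum \<rho> N (\<lambda>z. g (a + z) - g a)" by (auto simp: an_at_def)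
  have N0: "N \<ge> 0" using psum_bound[OF N, of 0] \<rho> by simp
  define r where "r = min \<rho> (\<sigma> * \<rho> / (N + 1))"
  have r: "r > 0" "r \<le> \<rho>" using \<sigma> \<rho> N0 by (auto simp: r_def)
  have "r * N \<le> \<sigma> * \<rho> / (N + 1) * (N + 1)" unfolding r_def using N0 \<sigma> \<rho> by (intro mult_mono) auto
  also have "\<dots> = \<sigma> * \<rho>" using N0 by simp
  finally have rN: "r / \<rho> * N \<le> \<sigma>" using \<rho> by (simp add: field_simps)
  have "psum r \<sigma> (\<lambda>z. (g (a + z) - g a) \<bullet> e)" if "e \<in> Basis" for e
  proof -
    have "psum \<rho> (1 * N) (\<lambda>z. (g (a + z) - g a) \<bullet> e)"
      by (rule psum_linear[OF N _ bounded_linear_inner_left])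
         (use \<rho> Basis_le_norm[OF that] in auto)
    then have "psum r (r / \<rho> * (1 * N)) (\<lambda>z. (g (a + z) - g a) \<bullet> e)"
      by (rule psum_shrink[OF _ _ \<rho> r]) simp
    then show ?thesis by (rule psum_mono) (use rN in simp)
  qed
  from psum_compose[OF f this r(1)] have "psum r M (\<lambda>z. f (g (a + z)))" by simp
  then show ?thesis using r(1) by (rule an_atI)
qed

lemma an_at_transfer:
  assumes f: "an_at f a" and ev: "eventually (\<lambda>x. f x = g x) (nhds a)"
  shows "an_at g a"
proof -
  obtain \<rho> M where \<rho>: "\<rho> > 0" and p: "psum \<rho> M (\<lambda>z. f (a + z))" using f by (auto simp: an_at_def)
  obtain e where e: "e > 0" "\<And>x. dist x a < e ==> f x = g x"
    using ev by (auto simp: eventually_nhds_metric)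
  define r where "r = min \<rho> (e / (DIM('a) + 1))"
  have r: "r > 0" "r \<le> \<rho>" using \<rho> e by (auto simp: r_def)
  have "DIM('a) * r \<le> DIM('a) * (e / (DIM('a) + 1))" by (intro mult_left_mono) (auto simp: r_def)
  also have "\<dots> < e" using e by (simp add: field_simps)
  finally have "f (a + z) = g (a + z)" if "z \<in> pbox r" for z
    using norm_le_pbox[OF that] by (intro e) (simp add: dist_norm)
  with psum_radius_mono[OF p _ r(2)] r show ?thesis by (intro an_atI[of r M]) (auto elim: psum_cong)
qed

lemma an_at_isCont: assumes "an_at f a" shows "isCont f a"
proof -
  have "an_at (\<lambda>x. f x - f a) a" by (intro an_at_diff assms an_at_const)
  then obtain \<rho> N where \<rho>: "\<rho> > 0" and N: "psum \<rho> N (\<lambda>z. f (a + z) - f a)" by (auto simp: an_at_def)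
  have N0: "N \<ge> 0" using psum_bound[OF N, of 0] \<rho> by simp
  show ?thesis unfolding continuous_at_eps_delta
  proof (intro allI impI)
    fix e :: real assume e: "e > 0"
    define r where "r = min \<rho> (e * \<rho> / (2 * (N + 1)))"
    have r: "r > 0" "r \<le> \<rho>" using e \<rho> N0 by (auto simp: r_def)
    have "r * N \<le> e * \<rho> / (2 * (N + 1)) * (N + 1)" unfolding r_def using N0 e \<rho> by (intro mult_mono) auto
    also have "\<dots> = e * \<rho> / 2" using N0 by (simp add: field_simps)
    also have "\<dots> < e * \<rho>" using e \<rho> by simp
    finally have rN: "r / \<rho> * N < e" using N0 \<rho> by (simp add: field_simps)
    have "dist (f x) (f a) < e" if "dist x a < r" for x
    proof -
      have "x - a \<in> pbox r" using that ball_subset_pbox[of r] by (auto simp: dist_norm subset_iff)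
      from psum_bound[OF psum_shrink[OF N _ \<rho> r] this] rN show ?thesis by (simp add: dist_norm)
    qed
    then show "\<exists>d>0. \<forall>x'. dist x' a < d \<longrightarrow> dist (f x') (f a) < e" using r by blast
  qed
qed

lemma an_at_powr_real:
  fixes a e :: real assumes "a > 0" shows "an_at (\<lambda>x. x powr e) a"
proof -
  define w where "w n = (e gchoose n) * a powr (e - real n)" for n
  have "(\<lambda>n. w n * (3 * a / 4) ^ n) sums ((3 * a / 4 + a) powr e)"
    using gen_binomial_real'[of "3 * a / 4" a e] assms by (simp add: w_def mult_ac)
  then have "summable (\<lambda>n. norm (w n * (a / 2) ^ n))"
    using assms by (intro powser_insidea[of _ "3 * a / 4"]) (auto simp: sums_iff)
  then have "(\<lambda>n. norm (w n) * (a / 2) ^ n) summable_on UNIV"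
    using assms by (subst summable_on_UNIV_nonneg_real_iff) (auto simp: abs_mult)
  then have hs: "((\<lambda>n. norm (w n) * (a / 2) ^ n) has_sum (\<Sum>\<^sub>\<infinity>n. norm (w n) * (a / 2) ^ n)) UNIV"
    by simp
  have p: "psum (a / 2) (norm (w n) * (a / 2) ^ n) (\<lambda>z. w n * z ^ n)" for n
  proof -
    have "psum (a / 2) (a / 2) (\<lambda>z::real. z)" using psum_coord[of "a/2" "1::real"] assms by simp
    then show ?thesis using assms by (intro psum_mult psum_const psum_power) auto
  qed
  note P = psum_infsum[OF p hs]
  have "psum (a / 2) (\<Sum>\<^sub>\<infinity>n. norm (w n) * (a / 2) ^ n) (\<lambda>z. (a + z) powr e)"
  proof (rule psum_cong[OF P(1)])
    show "(\<Sum>\<^sub>\<infinity>n. w n * x ^ n) = (a + x) powr e" if x: "x \<in> pbox (a / 2)" for x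
    proof -
      have "\<bar>x\<bar> < a" using x assms by (auto simp: pbox_def)
      from gen_binomial_real'[OF this, of e] have "(\<lambda>n. w n * x ^ n) sums (x + a) powr e"
        by (simp add: w_def mult_ac)
      moreover have "(\<lambda>n. w n * x ^ n) sums (\<Sum>\<^sub>\<infinity>n. w n * x ^ n)"
        by (rule has_sum_imp_sums, rule P(2)) (use x assms in auto)
      ultimately show ?thesis by (simp add: sums_unique2 add.commute)
    qed
  qed (use assms in auto)
  then show ?thesis by (rule an_atI) (use assms in auto)
qed

lemma an_at_powr:
  fixes f :: "'a::euclidean_space => real"
  assumes "an_at f a" "f a > 0" shows "an_at (\<lambda>x. f x powr e) a"
  by (rule an_at_compose[OF assms(1) an_at_powr_real[OF assms(2)]])

text \<open>
  The choice is immaterial: the coefficients are unique (\<open>psf_tcoef\<close>).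
\<close>

definition tcoef :: "('a::euclidean_space => 'b::euclidean_space) => ('a => nat) => 'b" where
  "tcoef f = (SOME c. \<exists>\<rho>>0. \<exists>M. psf \<rho> M c f)"

lemma psf_tcoef:
  assumes "psf \<rho> M c f" "\<rho> > 0" shows "psf \<rho> M (tcoef f) f" and "\<And>\<alpha>. \<alpha> \<in> midx ==> tcoef f \<alpha> = c \<alpha>"
proof -
  have "\<exists>\<rho>>0. \<exists>M. psf \<rho> M (tcoef f) f" unfolding tcoef_def by (rule someI[of _ c]) (use assms in auto)
  then obtain \<rho>' M' where "\<rho>' > 0" "psf \<rho>' M' (tcoef f) f" by blast
  then show eq: "\<And>\<alpha>. \<alpha> \<in> midx ==> tcoef f \<alpha> = c \<alpha>" using psf_unique[OF _ _ assms] by blast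
  show "psf \<rho> M (tcoef f) f" using assms(1) unfolding psf_def
    by (simp add: eq cong: summable_on_cong infsum_cong has_sum_cong)
qed

text \<open>
  For a function of \<open>(z, w)\<close>, the Taylor expansion in \<open>z\<close> at \<open>0\<close> has a radius and a bound that are
  locally uniform in \<open>w\<close>, and its coefficients are analytic in \<open>w\<close>.
\<close>

lemma an_at_extract:
  fixes \<Phi> :: "'a::euclidean_space \<times> 'b::euclidean_space => 'c::euclidean_space"
  assumes "an_at \<Phi> (0, w)"
  obtains \<rho> M where "\<rho> > 0"
    and "\<And>y. y \<in> pbox \<rho> ==> psf \<rho> M (tcoef (\<lambda>z. \<Phi> (z, w + y))) (\<lambda>z. \<Phi> (z, w + y))"
    and "\<And>\<gamma>. \<gamma> \<in> midx ==> an_at (\<lambda>w. tcoef (\<lambda>z. \<Phi> (z, w)) \<gamma>) w"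
proof -
  obtain \<rho> M c where \<rho>: "\<rho> > 0" and c: "psf \<rho> M c (\<lambda>z. \<Phi> ((0, w) + z))"
    using assms by (auto simp: an_at_def psum_def)
  have 1: "psf \<rho> M (\<lambda>\<gamma>. \<Sum>\<^sub>\<infinity>\<delta>\<in>midx. mon y \<delta> *\<^sub>R c (mpair \<gamma> \<delta>)) (\<lambda>z. \<Phi> (z, w + y))" if "y \<in> pbox \<rho>" for y
    using psf_extract(1)[OF c \<rho> that] by simp
  show ?thesis
  proof (rule that[OF \<rho>])
    show "psf \<rho> M (tcoef (\<lambda>z. \<Phi> (z, w + y))) (\<lambda>z. \<Phi> (z, w + y))" if "y \<in> pbox \<rho>" for y
      by (rule psf_tcoef(1)[OF 1[OF that] \<rho>])
    fix \<gamma> :: "'a => nat" assume \<gamma>: "\<gamma> \<in> midx"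
    show "an_at (\<lambda>w. tcoef (\<lambda>z. \<Phi> (z, w)) \<gamma>) w"
      by (rule an_atI[OF psum_cong[OF psf_imp_psum[OF psf_extract(2)[OF c \<rho> \<gamma>]]] \<rho>])
         (use psf_tcoef(2)[OF 1 \<rho> \<gamma>] in simp)
  qed
qed

section \<open>Fourier analysis on the torus\<close>

abbreviation ivec :: "int ^ 'd => real ^ 'd" where
  "ivec q \<equiv> (\<chi> i. of_int (q $ i))"

lemma torus_periodicD: "torus_periodic f ==> f (\<theta> + ivec q) = f \<theta>"
  by (simp add: torus_periodic_def)

lemma torus_periodic_shift: "torus_periodic f ==> torus_periodic (\<lambda>\<theta>. f (\<theta> + t))"
  unfolding torus_periodic_def by (metis add.assoc add.commute)

lemma periodic_cube_rep:
  fixes \<theta> :: "real ^ 'd"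
  obtains \<theta>' q where "\<theta>' \<in> cbox 0 1" "\<theta> = \<theta>' + ivec q"
proof
  show "(\<chi> i. frac (\<theta> $ i)) \<in> cbox 0 (1 :: real ^ 'd)"
    by (auto simp: mem_box_cart frac_lt_1 less_imp_le)
  show "\<theta> = (\<chi> i. frac (\<theta> $ i)) + ivec (\<chi> i. \<lfloor>\<theta> $ i\<rfloor>)"
    by (simp add: vec_eq_iff frac_def)
qed

lemma torus_periodic_bounded_by:
  assumes "torus_periodic f" "\<And>\<theta>. \<theta> \<in> cbox 0 1 ==> P (f \<theta>)"
  shows "P (f \<theta>)"
  by (metis periodic_cube_rep torus_periodicD assms)

text \<open>
  The slab that leaves the cube on one side is, by periodicity, the one that is missing on the
  opposite side.
\<close>

lemma torus_int_shift_axis: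
  fixes f :: "real ^ 'd => 'b::banach"
  assumes f: "continuous_on UNIV f" and per: "torus_periodic f" and s: "0 \<le> s" "s \<le> 1"
  shows "integral (cbox 0 1) (\<lambda>\<theta>. f (\<theta> + s *\<^sub>R axis i 1)) = integral (cbox 0 1) f"
proof -
  define k :: "real ^ 'd" where "k = axis i 1"
  have k: "k \<in> Basis" by (simp add: k_def)
  have xk: "x \<bullet> k = x $ i" for x by (simp add: k_def inner_axis)
  have kj: "k $ j = (if j = i then 1 else 0)" for j by (simp add: k_def axis_def)
  have int: "f integrable_on cbox a b" for a b
    by (intro integrable_continuous continuous_on_subset[OF f]) auto
  define a' :: "real ^ 'd" where "a' = (\<chi> j. if j = i then s else 1)"
  have all: "(\<forall>j. Q j) \<longleftrightarrow> Q i \<and> (\<forall>j. j \<noteq> i \<longrightarrow> Q j)" for Q by metis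
  have A: "cbox 0 1 \<inter> {x. x \<bullet> k \<le> s} = cbox 0 a'"
    by (rule set_eqI, unfold Int_iff mem_Collect_eq mem_box_cart xk, subst (1 2) all)
       (use s in \<open>auto simp: a'_def kj\<close>)
  have B: "cbox 0 1 \<inter> {x. x \<bullet> k \<ge> s} = cbox (s *\<^sub>R k) 1"
    by (rule set_eqI, unfold Int_iff mem_Collect_eq mem_box_cart xk, subst (1 2) all)
       (use s in \<open>auto simp: a'_def kj\<close>)
  have C: "cbox (s *\<^sub>R k) (1 + s *\<^sub>R k) \<inter> {x. x \<bullet> k \<le> 1} = cbox (s *\<^sub>R k) 1"
    by (rule set_eqI, unfold Int_iff mem_Collect_eq mem_box_cart xk, subst (1 2) all)
       (use s in \<open>auto simp: a'_def kj\<close>)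
  have D: "cbox (s *\<^sub>R k) (1 + s *\<^sub>R k) \<inter> {x. x \<bullet> k \<ge> 1} = cbox (0 + k) (a' + k)"
    by (rule set_eqI, unfold Int_iff mem_Collect_eq mem_box_cart xk, subst (1 2) all)
       (use s in \<open>auto simp: a'_def kj\<close>)
  have "ivec (axis i 1) = k" by (simp add: vec_eq_iff kj axis_def)
  then have fk: "f (k + x) = f x" for x
    using torus_periodicD[OF per, of x "axis i 1"] by (simp add: add.commute)
  have "integral (cbox 0 1) (\<lambda>\<theta>. f (\<theta> + s *\<^sub>R k)) = integral (cbox (0 + s *\<^sub>R k) (1 + s *\<^sub>R k)) f"
    unfolding integral_shift_cbox_plus[symmetric] by (simp add: o_def add.commute)
  also have "\<dots> = integral (cbox (s *\<^sub>R k) 1) f + integral (cbox (0 + k) (a' + k)) f"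
    using integral_split[OF int k, of "s *\<^sub>R k" "1 + s *\<^sub>R k" 1] unfolding C D by simp
  also have "integral (cbox (0 + k) (a' + k)) f = integral (cbox 0 a') f"
    unfolding integral_shift_cbox_plus[symmetric] by (simp add: o_def fk)
  also have "integral (cbox (s *\<^sub>R k) 1) f + integral (cbox 0 a') f = integral (cbox 0 1) f"
    using integral_split[OF int k, of 0 1 s] unfolding A B by (simp add: add.commute)
  finally show ?thesis by (simp add: k_def)
qed

lemma torus_int_shift:
  fixes f :: "real ^ 'd => 'b::banach"
  assumes f: "continuous_on UNIV f" and per: "torus_periodic f"
  shows "integral (cbox 0 1) (\<lambda>\<theta>. f (\<theta> + t)) = integral (cbox 0 1) f"
proof -
  have one: "integral (cbox 0 1) (\<lambda>\<theta>. g (\<theta> + s *\<^sub>R axis i 1)) = integral (cbox 0 1) g"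
    if g: "continuous_on UNIV g" "torus_periodic g" for g :: "real ^ 'd => 'b" and s i
  proof -
    have "s *\<^sub>R axis i 1 = frac s *\<^sub>R axis i 1 + ivec (axis i \<lfloor>s\<rfloor>)"
      by (simp add: vec_eq_iff axis_def frac_def)
    then have "g (\<theta> + s *\<^sub>R axis i 1) = g (\<theta> + frac s *\<^sub>R axis i 1)" for \<theta>
      using torus_periodicD[OF g(2)] by (simp add: add.assoc[symmetric])
    then show ?thesis using torus_int_shift_axis[OF g, of "frac s" i] by (simp add: frac_lt_1 less_imp_le)
  qed
  have "integral (cbox 0 1) (\<lambda>\<theta>. f (\<theta> + (\<Sum>i\<in>J. t $ i *\<^sub>R axis i 1))) = integral (cbox 0 1) f" if "finite J" for J
    using that
  proof (induction J)
    case (insert i J)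
    let ?g = "\<lambda>\<theta>. f (\<theta> + (\<Sum>i\<in>J. t $ i *\<^sub>R axis i 1))"
    have "continuous_on UNIV ?g" by (intro continuous_on_compose2[OF f] continuous_intros) auto
    from one[OF this torus_periodic_shift[OF per], of "t $ i" i] insert show ?case
      by (simp add: add.assoc)
  qed simp
  from this[of UNIV] show ?thesis using basis_expansion[of t] by (simp add: scalar_mult_eq_scaleR)
qed

lemma torus_int_const: "integral (cbox 0 (1 :: real ^ 'd)) (\<lambda>_. c) = (c :: 'b::euclidean_space)"
proof -
  have "Henstock_Kurzweil_Integration.content (cbox 0 (1 :: real ^ 'd)) = 1"
    by (subst content_cbox_cart) (auto simp: interval_ne_empty_cart)
  then show ?thesis by simp
qed

definition chr :: "int ^ 'd => real ^ 'd => complex" where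
  "chr q \<theta> = cis (2 * pi * (\<Sum>i\<in>UNIV. of_int (q $ i) * \<theta> $ i))"

lemma chr_add: "chr q (\<theta> + t) = chr q \<theta> * chr q t"
  by (simp add: chr_def cis_mult distrib_left sum.distrib)

lemma chr_add_left: "chr (q + r) \<theta> = chr q \<theta> * chr r \<theta>"
  by (simp add: chr_def cis_mult distrib_left distrib_right sum.distrib)

lemma chr_0 [simp]: "chr 0 \<theta> = 1" "chr q 0 = 1"
  by (simp_all add: chr_def)

lemma norm_chr [simp]: "norm (chr q \<theta>) = 1"
  by (simp add: chr_def)

lemma chr_minus: "chr (- q) \<theta> = cnj (chr q \<theta>)"
  by (simp add: chr_def cis_cnj sum_negf)

lemma chr_cnj_mult [simp]: "cnj (chr q \<theta>) * chr q \<theta> = 1" "chr q \<theta> * cnj (chr q \<theta>) = 1"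
  by (simp_all add: chr_def cis_cnj cis_mult)

lemma cis_2pi_int: "cis (2 * pi * of_int n) = 1"
  by (metis cis_multiple_2pi Ints_of_int mult.assoc mult.commute)

lemma chr_ivec [simp]: "chr q (ivec r) = 1"
proof -
  have "(\<Sum>i\<in>UNIV. of_int (q $ i) * ivec r $ i) = real_of_int (\<Sum>i\<in>UNIV. q $ i * r $ i)"
    by simp
  then show ?thesis by (simp only: chr_def cis_2pi_int)
qed

lemma chr_periodic: "torus_periodic (chr q)"
  by (simp add: torus_periodic_def chr_add)

lemma chr_continuous [continuous_intros]: "continuous_on S (chr q)"
  unfolding chr_def by (intro continuous_intros)

lemma integral_chr:
  fixes q :: "int ^ 'd"
  shows "integral (cbox 0 1) (chr q) = (if q = 0 then 1 else 0)"
proof (cases "q = 0")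
  case True
  then have "chr q = (\<lambda>_. 1)" by auto
  then show ?thesis using True torus_int_const[of "1::complex"] by simp
next
  case False
  then obtain i where i: "q $ i \<noteq> 0" by (auto simp: vec_eq_iff)
  define t :: "real ^ 'd" where "t = axis i (1 / (2 * of_int (q $ i)))"
  have "(\<Sum>j\<in>UNIV. of_int (q $ j) * t $ j) = (\<Sum>j\<in>UNIV. if j = i then 1 / 2 else 0)"
    using i by (intro sum.cong) (auto simp: t_def axis_def)
  also have "\<dots> = 1 / 2" by simp
  finally have t0: "(\<Sum>j\<in>UNIV. of_int (q $ j) * t $ j) = 1 / 2" .
  have "chr q t = cis (2 * pi * (1 / 2))" unfolding chr_def t0 ..
  then have t: "chr q t = -1" by simp
  have "integral (cbox 0 1) (chr q) = integral (cbox 0 1) (\<lambda>\<theta>. chr q (\<theta> + t))"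
    by (rule torus_int_shift[symmetric]) (auto intro: continuous_intros chr_periodic)
  also have "\<dots> = - integral (cbox 0 1) (chr q)" by (simp add: chr_add t)
  finally show ?thesis using False by simp
qed

definition fourier_null :: "(real ^ 'd => complex) => bool" where
  "fourier_null f \<longleftrightarrow> continuous_on UNIV f \<and> torus_periodic f \<and>
     (\<forall>q. integral (cbox 0 1) (\<lambda>\<theta>. f \<theta> * chr q \<theta>) = 0)"

text \<open>
  The embedding of the torus in Euclidean space, to which the theorem of Stone and Weierstrass
  applies.
\<close>

definition circ :: "real ^ 'd => (real ^ 'd) \<times> (real ^ 'd)" where
  "circ \<theta> = (\<chi> i. cos (2 * pi * \<theta> $ i), \<chi> i. sin (2 * pi * \<theta> $ i))"

lemma circ_continuous: "continuous_on S circ"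
  unfolding circ_def by (intro continuous_intros)

lemma circ_eq_iff: "circ \<theta> = circ \<theta>' \<longleftrightarrow> (\<exists>q. \<theta> = \<theta>' + ivec q)"
proof
  assume "circ \<theta> = circ \<theta>'"
  then have "sin (2 * pi * \<theta> $ i) = sin (2 * pi * \<theta>' $ i) \<and> cos (2 * pi * \<theta> $ i) = cos (2 * pi * \<theta>' $ i)" for i
    by (auto simp: circ_def vec_eq_iff)
  then have "\<exists>n::int. 2 * pi * \<theta> $ i = 2 * pi * \<theta>' $ i + 2 * pi * n" for i
    by (subst (asm) sin_cos_eq_iff) blast
  then have "\<exists>n::int. \<theta> $ i = \<theta>' $ i + n" for i
    by (metis distrib_left mult_cancel_left mult_eq_0_iff pi_neq_zero zero_neq_numeral)
  then obtain n where "\<And>i. \<theta> $ i = \<theta>' $ i + of_int (n i)" by metis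
  then have "\<theta> = \<theta>' + ivec (\<chi> i. n i)" by (simp add: vec_eq_iff)
  then show "\<exists>q. \<theta> = \<theta>' + ivec q" ..
next
  assume "\<exists>q. \<theta> = \<theta>' + ivec q"
  then obtain q where q: "\<theta> = \<theta>' + ivec q" ..
  have "sin (2 * pi * \<theta> $ i) = sin (2 * pi * \<theta>' $ i) \<and> cos (2 * pi * \<theta> $ i) = cos (2 * pi * \<theta>' $ i)" for i
    by (subst sin_cos_eq_iff) (auto simp: q distrib_left)
  then show "circ \<theta> = circ \<theta>'" by (simp add: circ_def)
qed

lemma fourier_null_add: "fourier_null f ==> fourier_null g ==> fourier_null (\<lambda>\<theta>. f \<theta> + g \<theta>)"
  unfolding fourier_null_def torus_periodic_def distrib_right
  by (subst integral_add) (auto intro!: integrable_continuous continuous_intros intro: continuous_on_subset)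

lemma fourier_null_chr: "fourier_null f ==> fourier_null (\<lambda>\<theta>. f \<theta> * chr q \<theta>)"
  unfolding fourier_null_def
  by (auto intro!: continuous_intros simp: torus_periodic_def chr_add mult.assoc simp flip: chr_add_left)

lemma fourier_null_cmult:
  assumes "fourier_null f" shows "fourier_null (\<lambda>\<theta>. f \<theta> * c)"
proof -
  have "integral (cbox 0 1) (\<lambda>\<theta>. f \<theta> * c * chr q \<theta>) = integral (cbox 0 1) (\<lambda>\<theta>. f \<theta> * chr q \<theta> * c)" for q
    by (simp add: mult_ac)
  then show ?thesis using assms unfolding fourier_null_def
    by (auto intro!: continuous_intros simp: torus_periodic_def integral_mult_left)
qed

lemma fourier_null_chr2:
  assumes "fourier_null f" shows "fourier_null (\<lambda>\<theta>. f \<theta> * (chr q \<theta> * c + chr r \<theta> * d))"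
  using fourier_null_add[OF fourier_null_cmult[OF fourier_null_chr[OF assms, of q], of c]
      fourier_null_cmult[OF fourier_null_chr[OF assms, of r], of d]]
  by (simp add: distrib_left mult.assoc)

text \<open>
  Polynomials in the coordinates of \<open>circ\<close> are trigonometric polynomials. Of these, only the
  property that is used below is recorded: multiplication by them preserves the orthogonality to
  all characters.
\<close>

lemma trig_dense:
  fixes g :: "real ^ 'd => real"
  assumes g: "continuous_on UNIV g" "torus_periodic g" and "e > 0"
  obtains h where "continuous_on UNIV h" "torus_periodic h"
    "\<And>f. fourier_null f ==> fourier_null (\<lambda>\<theta>. f \<theta> * of_real (h \<theta>))" "\<And>\<theta>. \<bar>g \<theta> - h \<theta>\<bar> < e"
proof -
  define P :: "((real ^ 'd) \<times> (real ^ 'd) => real) => bool" where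
    "P h \<longleftrightarrow> continuous_on UNIV h \<and> (\<forall>f. fourier_null f \<longrightarrow> fourier_null (\<lambda>\<theta>. f \<theta> * of_real (h (circ \<theta>))))" for h
  define S where "S = circ ` cbox 0 (1 :: real ^ 'd)"
  have cpt: "compact S" unfolding S_def by (intro compact_continuous_image circ_continuous compact_cbox)
  have circS: "circ \<theta> \<in> S" for \<theta> :: "real ^ 'd"
    using periodic_cube_rep[of \<theta>] circ_eq_iff unfolding S_def by (metis imageI)
  define G where "G z = g (SOME \<theta>. circ \<theta> = z)" for z
  have G: "G (circ \<theta>) = g \<theta>" for \<theta>
  proof -
    have "circ (SOME \<theta>'. circ \<theta>' = circ \<theta>) = circ \<theta>" by (rule someI[of _ \<theta>]) simp
    then show ?thesis unfolding G_def circ_eq_iff using torus_periodicD[OF g(2)] by metis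
  qed
  have contG: "continuous_on S G"
  proof (subst continuous_on_closed_vimage)
    show "closed S" using cpt by (rule compact_imp_closed)
    show "\<forall>B. closed B \<longrightarrow> closed (G -` B \<inter> S)"
    proof (intro allI impI)
      fix B :: "real set" assume "closed B"
      then have "closed (g -` B)" using g(1) continuous_on_closed_vimage[of UNIV g] by simp
      then have "compact (circ ` (cbox 0 1 \<inter> g -` B))"
        by (intro compact_continuous_image circ_continuous compact_Int_closed compact_cbox)
      moreover have "G -` B \<inter> S = circ ` (cbox 0 1 \<inter> g -` B)" by (auto simp: S_def G)
      ultimately show "closed (G -` B \<inter> S)" by (simp add: compact_imp_closed)
    qed
  qed
  have Pcoord: "P (\<lambda>z. fst z $ i)" "P (\<lambda>z. snd z $ i)" for i
  proof -
    have s: "(\<Sum>j\<in>UNIV. of_int ((axis i 1 :: int ^ 'd) $ j) * \<theta> $ j) = \<theta> $ i" for \<theta> :: "real ^ 'd"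
      by (simp add: axis_def if_distrib[of of_int] if_distrib[of "\<lambda>x. x * _"] cong: if_cong)
    have c: "complex_of_real (cos (2 * pi * \<theta> $ i)) = chr (axis i 1) \<theta> * (1 / 2) + chr (- axis i 1) \<theta> * (1 / 2)" for \<theta> :: "real ^ 'd"
      by (simp add: chr_minus) (simp add: chr_def s complex_eq_iff)
    have d: "complex_of_real (sin (2 * pi * \<theta> $ i)) = chr (axis i 1) \<theta> * (1 / (2 * \<i>)) + chr (- axis i 1) \<theta> * (- 1 / (2 * \<i>))" for \<theta> :: "real ^ 'd"
      by (simp add: chr_minus) (simp add: chr_def s complex_eq_iff)
    show "P (\<lambda>z. fst z $ i)" unfolding P_def circ_def fst_conv vec_lambda_beta c
      by (intro conjI allI impI fourier_null_chr2) (auto intro!: continuous_intros)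
    show "P (\<lambda>z. snd z $ i)" unfolding P_def circ_def snd_conv vec_lambda_beta d
      by (intro conjI allI impI fourier_null_chr2) (auto intro!: continuous_intros)
  qed
  have "\<exists>h. P h \<and> (\<forall>x\<in>S. \<bar>G x - h x\<bar> < e)"
  proof (rule Stone_Weierstrass_HOL[OF cpt _ _ _ _ _ contG \<open>e > 0\<close>])
    show "P (\<lambda>x. c)" for c unfolding P_def by (auto intro: fourier_null_cmult)
    show "continuous_on S f" if "P f" for f using that unfolding P_def by (auto intro: continuous_on_subset)
    show "P (\<lambda>x. f x + g x)" if "P f \<and> P g" for f g
      using that unfolding P_def by (auto simp: distrib_left intro!: continuous_intros fourier_null_add)
    show "P (\<lambda>x. f x * g x)" if "P f \<and> P g" for f g
      using that unfolding P_def by (auto intro!: continuous_intros simp flip: mult.assoc)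
    show "\<exists>f. P f \<and> f x \<noteq> f y" if "x \<in> S \<and> y \<in> S \<and> x \<noteq> y" for x y
    proof -
      from that obtain i where "fst x $ i \<noteq> fst y $ i \<or> snd x $ i \<noteq> snd y $ i"
        by (auto simp: prod_eq_iff vec_eq_iff)
      then show ?thesis using Pcoord by blast
    qed
  qed
  then obtain h where h: "P h" "\<And>x. x \<in> S ==> \<bar>G x - h x\<bar> < e" by blast
  show ?thesis
  proof (rule that[of "\<lambda>\<theta>. h (circ \<theta>)"])
    show "continuous_on UNIV (\<lambda>\<theta>. h (circ \<theta>))"
      using h(1) unfolding P_def by (auto intro: continuous_on_compose2[OF _ circ_continuous])
    show "torus_periodic (\<lambda>\<theta>. h (circ \<theta>))"
      unfolding torus_periodic_def using circ_eq_iff by metis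
    show "fourier_null (\<lambda>\<theta>. f \<theta> * of_real (h (circ \<theta>)))" if "fourier_null f" for f
      using h(1) that unfolding P_def by blast
    show "\<bar>g \<theta> - h (circ \<theta>)\<bar> < e" for \<theta> using h(2)[OF circS[of \<theta>]] by (simp add: G)
  qed
qed

text \<open>
  Approximating the conjugate of \<open>f\<close> uniformly by trigonometric polynomials shows that the integral
  of \<open>\<bar>f\<bar>\<^sup>2\<close> is zero.
\<close>

lemma fourier_null_imp_zero:
  assumes f: "fourier_null f" shows "f \<theta> = 0"
proof -
  have cf: "continuous_on UNIV f" and pf: "torus_periodic f" using f by (auto simp: fourier_null_def)
  have cc: "continuous_on (cbox 0 1) f" by (rule continuous_on_subset[OF cf]) auto
  obtain B where B: "B > 0" "\<And>\<theta>. \<theta> \<in> cbox 0 1 ==> norm (f \<theta>) \<le> B"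
    using compact_imp_bounded[OF compact_continuous_image[OF cc compact_cbox]] unfolding bounded_pos by auto
  have re: "continuous_on UNIV (\<lambda>\<theta>. Re (f \<theta>))" "torus_periodic (\<lambda>\<theta>. Re (f \<theta>))"
    "continuous_on UNIV (\<lambda>\<theta>. Im (f \<theta>))" "torus_periodic (\<lambda>\<theta>. Im (f \<theta>))"
    using cf pf by (auto intro!: continuous_intros simp: torus_periodic_def)
  have "norm (integral (cbox 0 1) (\<lambda>\<theta>. f \<theta> * cnj (f \<theta>))) \<le> B * (2 * e)" if e: "e > 0" for e
  proof -
    obtain h where h: "continuous_on UNIV h" "fourier_null (\<lambda>\<theta>. f \<theta> * of_real (h \<theta>))" "\<And>\<theta>. \<bar>Re (f \<theta>) - h \<theta>\<bar> < e"
      using trig_dense[OF re(1,2) e] f by metis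
    obtain k where k: "continuous_on UNIV k" "fourier_null (\<lambda>\<theta>. f \<theta> * of_real (k \<theta>))" "\<And>\<theta>. \<bar>Im (f \<theta>) - k \<theta>\<bar> < e"
      using trig_dense[OF re(3,4) e] f by metis
    have hk: "continuous_on (cbox 0 1) h" "continuous_on (cbox 0 1) k"
      using h(1) k(1) by (auto intro: continuous_on_subset)
    have "fourier_null (\<lambda>\<theta>. f \<theta> * of_real (h \<theta>) + f \<theta> * of_real (k \<theta>) * (- \<i>))"
      by (intro fourier_null_add fourier_null_cmult h k)
    then have z: "integral (cbox 0 1) (\<lambda>\<theta>. f \<theta> * of_real (h \<theta>) + f \<theta> * of_real (k \<theta>) * (- \<i>)) = 0"
      unfolding fourier_null_def by (auto dest: spec[of _ 0])
    have "integral (cbox 0 1) (\<lambda>\<theta>. f \<theta> * cnj (f \<theta>)) =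
        integral (cbox 0 1) (\<lambda>\<theta>. f \<theta> * cnj (f \<theta>)) - integral (cbox 0 1) (\<lambda>\<theta>. f \<theta> * of_real (h \<theta>) + f \<theta> * of_real (k \<theta>) * (- \<i>))"
      by (simp only: z diff_zero)
    also have "\<dots> = integral (cbox 0 1) (\<lambda>\<theta>. f \<theta> * cnj (f \<theta>) - (f \<theta> * of_real (h \<theta>) + f \<theta> * of_real (k \<theta>) * (- \<i>)))"
      by (intro integral_diff[symmetric] integrable_continuous continuous_intros cc hk)
    also have "norm \<dots> \<le> integral (cbox 0 1) (\<lambda>\<theta>::real^'a. B * (2 * e))"
    proof (rule integral_norm_bound_integral)
      fix \<theta> :: "real ^ 'a" assume \<theta>: "\<theta> \<in> cbox 0 1"
      have "f \<theta> * cnj (f \<theta>) - (f \<theta> * of_real (h \<theta>) + f \<theta> * of_real (k \<theta>) * (- \<i>))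
          = f \<theta> * (of_real (Re (f \<theta>) - h \<theta>) - \<i> * of_real (Im (f \<theta>) - k \<theta>))"
        by (simp add: algebra_simps complex_eq_iff)
      also have "norm \<dots> \<le> B * (\<bar>Re (f \<theta>) - h \<theta>\<bar> + \<bar>Im (f \<theta>) - k \<theta>\<bar>)"
        unfolding norm_mult
        by (intro mult_mono order_trans[OF norm_triangle_ineq4]) (use B \<theta> in \<open>auto simp: norm_mult simp flip: of_real_diff\<close>)
      also have "\<dots> \<le> B * (2 * e)" using h(3)[of \<theta>] k(3)[of \<theta>] B by (intro mult_left_mono) auto
      finally show "norm (f \<theta> * cnj (f \<theta>) - (f \<theta> * of_real (h \<theta>) + f \<theta> * of_real (k \<theta>) * (- \<i>))) \<le> B * (2 * e)" .
    qed (intro integrable_continuous continuous_intros cc hk)+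
    finally show ?thesis by (simp only: torus_int_const)
  qed
  then have "norm (integral (cbox 0 1) (\<lambda>\<theta>. f \<theta> * cnj (f \<theta>))) \<le> 0 + e" if "e > 0" for e
    using that B(1) spec[of "\<lambda>e. e > 0 \<longrightarrow> norm (integral (cbox 0 1) (\<lambda>\<theta>. f \<theta> * cnj (f \<theta>))) \<le> B * (2 * e)" "e / (2 * B)"]
    by auto
  then have "integral (cbox 0 1) (\<lambda>\<theta>. f \<theta> * cnj (f \<theta>)) = 0"
    using field_le_epsilon[of "norm (integral (cbox 0 1) (\<lambda>\<theta>. f \<theta> * cnj (f \<theta>)))" 0] by auto
  moreover have "integral (cbox 0 1) (\<lambda>\<theta>. f \<theta> * cnj (f \<theta>)) = of_real (integral (cbox 0 1) (\<lambda>\<theta>. (norm (f \<theta>))\<^sup>2))"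
    unfolding complex_norm_square[symmetric] of_real_power[symmetric]
    using integral_linear[OF integrable_continuous[OF continuous_on_power[OF continuous_on_norm[OF cc], of 2]]
        bounded_linear_of_real]
    by (simp only: o_def)
  ultimately have "integral (cbox 0 1) (\<lambda>\<theta>. (norm (f \<theta>))\<^sup>2) = 0" by simp
  then have "\<forall>\<theta>\<in>cbox 0 1. (norm (f \<theta>))\<^sup>2 = 0"
    by (subst (asm) integral_cbox_eq_0_iff) (auto intro!: continuous_intros cc simp: interval_ne_empty_cart)
  then have "f \<theta> = 0" if "\<theta> \<in> cbox 0 1" for \<theta> using that by simp
  from torus_periodic_bounded_by[OF pf, of "\<lambda>x. x = 0"] this show ?thesis by blast
qed

section \<open>Uniform Taylor expansions on the torus\<close>

text \<open>
  Analyticity on the torus times an open set of parameters. Values at parameters off \<open>V\<close> are free, so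
  periodicity can be demanded for all of them.
\<close>

definition tan_on :: "(real ^ 'd => 'p::euclidean_space => 'b::euclidean_space) => 'p set => bool" where
  "tan_on g V \<longleftrightarrow> open V \<and> (\<forall>\<mu>. torus_periodic (\<lambda>\<theta>. g \<theta> \<mu>)) \<and>
     (\<forall>\<theta>. \<forall>\<mu>\<in>V. an_at (\<lambda>z. g (fst z) (snd z)) (\<theta>, \<mu>))"

lemma torus_analytic_on_iff:
  "torus_analytic_on f P \<longleftrightarrow> (\<exists>V g. P \<subseteq> V \<and> tan_on g V \<and> (\<forall>\<theta>. \<forall>\<mu>\<in>P. f \<theta> \<mu> = g \<theta> \<mu>))"
proof
  assume "torus_analytic_on f P"
  then obtain V g where V: "open V" "P \<subseteq> V" and eq: "\<forall>\<theta>. \<forall>\<mu>\<in>P. f \<theta> \<mu> = g \<theta> \<mu>"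
    and per: "\<And>\<mu>. \<mu> \<in> V ==> torus_periodic (\<lambda>\<theta>. g \<theta> \<mu>)"
    and an: "real_analytic_on (\<lambda>(\<theta>, \<mu>). g \<theta> \<mu>) (UNIV \<times> V)"
    unfolding torus_analytic_on_def by blast
  define g' where "g' \<theta> \<mu> = (if \<mu> \<in> V then g \<theta> \<mu> else 0)" for \<theta> \<mu>
  have "tan_on g' V" unfolding tan_on_def
  proof (intro conjI allI ballI V)
    show "torus_periodic (\<lambda>\<theta>. g' \<theta> \<mu>)" for \<mu>
      using per by (cases "\<mu> \<in> V") (auto simp: g'_def torus_periodic_def)
    fix \<theta> \<mu> assume "\<mu> \<in> V"
    have "an_at (\<lambda>(\<theta>, \<mu>). g \<theta> \<mu>) (\<theta>, \<mu>)" using an \<open>\<mu> \<in> V\<close> by (auto simp: real_analytic_on_iff)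
    then show "an_at (\<lambda>z. g' (fst z) (snd z)) (\<theta>, \<mu>)"
    proof (rule an_at_transfer)
      have "eventually (\<lambda>z. z \<in> UNIV \<times> V) (nhds (\<theta>, \<mu>))"
        using V \<open>\<mu> \<in> V\<close> by (intro eventually_nhds_in_open open_Times) auto
      then show "\<forall>\<^sub>F x in nhds (\<theta>, \<mu>). (case x of (\<theta>, \<mu>) => g \<theta> \<mu>) = g' (fst x) (snd x)"
        by eventually_elim (auto simp: g'_def)
    qed
  qed
  then show "\<exists>V g. P \<subseteq> V \<and> tan_on g V \<and> (\<forall>\<theta>. \<forall>\<mu>\<in>P. f \<theta> \<mu> = g \<theta> \<mu>)"
    using V eq by (intro exI[of _ V] exI[of _ g']) (auto simp: g'_def)
next
  assume "\<exists>V g. P \<subseteq> V \<and> tan_on g V \<and> (\<forall>\<theta>. \<forall>\<mu>\<in>P. f \<theta> \<mu> = g \<theta> \<mu>)"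
  then obtain V g where "P \<subseteq> V" "tan_on g V" "\<forall>\<theta>. \<forall>\<mu>\<in>P. f \<theta> \<mu> = g \<theta> \<mu>" by blast
  then show "torus_analytic_on f P"
    unfolding torus_analytic_on_def tan_on_def real_analytic_on_iff
    by (intro exI[of _ V] exI[of _ g]) (auto simp: case_prod_unfold)
qed

lemma tan_on_continuous:
  assumes "tan_on g V" "\<mu> \<in> V" shows "continuous_on S (\<lambda>\<theta>. g \<theta> \<mu>)"
proof -
  have "isCont (\<lambda>\<theta>. g (fst (\<theta>, \<mu>)) (snd (\<theta>, \<mu>))) \<theta>" for \<theta>
  proof (rule isCont_o2[where g = "\<lambda>z. g (fst z) (snd z)" and f = "\<lambda>\<theta>. (\<theta>, \<mu>)"])
    show "isCont (\<lambda>z. g (fst z) (snd z)) (\<theta>, \<mu>)"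
      by (rule an_at_isCont) (use assms in \<open>auto simp: tan_on_def\<close>)
  qed (intro continuous_intros)
  then show ?thesis by (intro continuous_at_imp_continuous_on) simp
qed

text \<open>
  Local expansions with uniform bounds around each point of a compact set have, by a finite
  subcover, a common radius and a common bound.
\<close>

lemma pbox_compact_cover_uniform:
  fixes K :: "'a::euclidean_space set"
  assumes "compact K" and "\<And>w. w \<in> K ==> \<exists>\<rho>>0. \<exists>M. \<forall>y\<in>pbox \<rho>. psf \<rho> M (C (w + y)) (f (w + y))"
  obtains \<rho> M where "\<rho> > 0" "\<And>w. w \<in> K ==> psf \<rho> M (C w) (f w)"
proof -
  from assms(2) obtain r m where r: "\<And>w. w \<in> K ==> r w > 0"
    and m: "\<And>w y. w \<in> K ==> y \<in> pbox (r w) ==> psf (r w) (m w) (C (w + y)) (f (w + y))"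
    by metis
  obtain T where T: "T \<subseteq> K" "finite T" "K \<subseteq> (\<Union>w\<in>T. ball w (r w))"
  proof (rule compactE_image[OF assms(1), of K "\<lambda>w. ball w (r w)"])
    show "K \<subseteq> (\<Union>w\<in>K. ball w (r w))" using r by force
  qed auto
  define \<rho> where "\<rho> = Min (insert 1 (r ` T))"
  define M where "M = Max (insert 0 (m ` T))"
  show ?thesis
  proof (rule that)
    show \<rho>: "\<rho> > 0" unfolding \<rho>_def using T r by (subst Min_gr_iff) auto
    fix w assume "w \<in> K"
    then obtain v where v: "v \<in> T" "w \<in> ball v (r v)" using T by auto
    have "w - v \<in> pbox (r v)" using v ball_subset_pbox by (force simp: dist_norm norm_minus_commute)
    then have "psf (r v) (m v) (C w) (f w)" using m[of v "w - v"] v T by auto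
    moreover have "\<rho> \<le> r v" "m v \<le> M" unfolding \<rho>_def M_def using T v by (auto intro!: Min_le Max_ge)
    ultimately show "psf \<rho> M (C w) (f w)" using \<rho> by (blast intro: psf_mono psf_radius_mono less_imp_le)
  qed
qed

lemma an_at_affine:
  assumes "bounded_linear T" shows "an_at (\<lambda>z. v + T z) (a::'a::euclidean_space)"
  by (intro an_at_add an_at_const an_at_bl assms)

text \<open>
  Periodicity reduces the torus to the compact cube, whence one radius and one bound for the Taylor
  expansions at all angles.
\<close>

lemma tan_uniform:
  fixes g :: "real ^ 'd => 'p::euclidean_space => 'b::euclidean_space"
  assumes g: "tan_on g V" and "\<mu>0 \<in> V"
  defines "F \<equiv> \<lambda>\<theta> z. g (\<theta> + fst z) (\<mu>0 + snd z)"
  obtains \<rho> M where "\<rho> > 0" "\<And>\<theta>. psf \<rho> M (tcoef (F \<theta>)) (F \<theta>)"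
    "\<And>\<gamma> S. \<gamma> \<in> midx ==> continuous_on S (\<lambda>\<theta>. tcoef (F \<theta>) \<gamma>)"
proof -
  define \<Phi> where "\<Phi> x = g (fst ((0, \<mu>0) + (snd x + fst (fst x), snd (fst x)))) (snd ((0, \<mu>0) + (snd x + fst (fst x), snd (fst x))))"
    for x :: "((real ^ 'd) \<times> 'p) \<times> (real ^ 'd)"
  have \<Phi>F: "(\<lambda>z. \<Phi> (z, \<theta>)) = F \<theta>" for \<theta> by (auto simp: \<Phi>_def F_def)
  have an: "an_at \<Phi> (0, \<theta>)" for \<theta>
    unfolding \<Phi>_def
    by (rule an_at_compose[where f = "\<lambda>z. g (fst z) (snd z)"], rule an_at_affine)
       (use assms in \<open>auto simp: tan_on_def intro!: bounded_linear_intros\<close>)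
  have per: "F (\<theta> + ivec q) = F \<theta>" for \<theta> q
  proof
    fix z :: "(real ^ 'd) \<times> 'p"
    have eq: "\<theta> + ivec q + fst z = (\<theta> + fst z) + ivec q" by (simp add: ac_simps)
    have p: "torus_periodic (\<lambda>\<theta>. g \<theta> (\<mu>0 + snd z))" using g by (simp add: tan_on_def)
    show "F (\<theta> + ivec q) z = F \<theta> z"
      unfolding F_def eq by (rule torus_periodicD[OF p])
  qed
  have "\<exists>\<rho>>0. \<exists>M. \<forall>y\<in>pbox \<rho>. psf \<rho> M (tcoef (F (\<theta> + y))) (F (\<theta> + y))" for \<theta>
    by (rule an_at_extract[OF an, of \<theta>]) (auto simp: \<Phi>F)
  then obtain \<rho> M where \<rho>: "\<rho> > 0" and u: "\<And>\<theta>. \<theta> \<in> cbox 0 1 ==> psf \<rho> M (tcoef (F \<theta>)) (F \<theta>)"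
    using pbox_compact_cover_uniform[OF compact_cbox, of 0 1 "\<lambda>\<theta>. tcoef (F \<theta>)" F] by blast
  show ?thesis
  proof (rule that[OF \<rho>])
    show "psf \<rho> M (tcoef (F \<theta>)) (F \<theta>)" for \<theta>
      using periodic_cube_rep[of \<theta>] u per by metis
    fix \<gamma> S assume "\<gamma> \<in> (midx :: ((real ^ 'd) \<times> 'p => nat) set)"
    then have "an_at (\<lambda>\<theta>. tcoef (F \<theta>) \<gamma>) \<theta>" for \<theta>
      using an_at_extract[OF an, of \<theta>] unfolding \<Phi>F by metis
    then show "continuous_on S (\<lambda>\<theta>. tcoef (F \<theta>) \<gamma>)"
      by (intro continuous_at_imp_continuous_on ballI an_at_isCont)
  qed
qed

lemma has_sum_integral:
  fixes f :: "'i => 'a::euclidean_space => 'b::banach"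
  assumes c: "\<And>i. i \<in> I ==> continuous_on (cbox a b) (f i)"
    and B: "\<And>i x. i \<in> I ==> x \<in> cbox a b ==> norm (f i x) \<le> B i" and s: "B summable_on I"
  shows "((\<lambda>i. integral (cbox a b) (f i)) has_sum integral (cbox a b) (\<lambda>x. \<Sum>\<^sub>\<infinity>i\<in>I. f i x)) I"
    and "continuous_on (cbox a b) (\<lambda>x. \<Sum>\<^sub>\<infinity>i\<in>I. f i x)"
proof -
  define F where "F X = (if X \<subseteq> I then X else {})" for X
  have ul0: "uniform_limit (cbox a b) (\<lambda>X x. \<Sum>i\<in>X. f i x) (\<lambda>x. \<Sum>\<^sub>\<infinity>i\<in>I. f i x) (finite_subsets_at_top I)"
    by (rule Weierstrass_m_test_general[OF B s])
  have ev: "eventually (\<lambda>X. F X = X) (finite_subsets_at_top I)"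
    using eventually_finite_subsets_at_top_weakI[of I "\<lambda>X. X \<subseteq> I"] by (auto simp: F_def elim!: eventually_mono)
  have ul: "uniform_limit (cbox a b) (\<lambda>X x. \<Sum>i\<in>F X. f i x) (\<lambda>x. \<Sum>\<^sub>\<infinity>i\<in>I. f i x) (finite_subsets_at_top I)"
    by (rule uniform_limit_cong[THEN iffD1, OF _ _ ul0]) (use ev in \<open>auto elim!: eventually_mono\<close>)
  have cF: "continuous_on (cbox a b) (\<lambda>x. \<Sum>i\<in>F X. f i x)" for X
    by (intro continuous_on_sum c) (auto simp: F_def split: if_splits)
  show "continuous_on (cbox a b) (\<lambda>x. \<Sum>\<^sub>\<infinity>i\<in>I. f i x)"
    by (rule uniform_limit_theorem[OF _ ul]) (auto intro: cF)
  obtain J K where J: "\<And>X. ((\<lambda>x. \<Sum>i\<in>F X. f i x) has_integral J X) (cbox a b)"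
    and K: "((\<lambda>x. \<Sum>\<^sub>\<infinity>i\<in>I. f i x) has_integral K) (cbox a b)" and lim: "(J \<longlongrightarrow> K) (finite_subsets_at_top I)"
    by (rule uniform_limit_integral_cbox[OF ul cF]) auto
  have JX: "J X = (\<Sum>i\<in>F X. integral (cbox a b) (f i))" for X
  proof -
    have "f i integrable_on cbox a b" if "i \<in> F X" for i
      using that by (intro integrable_continuous c) (auto simp: F_def split: if_splits)
    then show ?thesis using integral_unique[OF J[of X]]
      by (cases "finite (F X)") (auto simp: integral_sum)
  qed
  have "((\<lambda>X. \<Sum>i\<in>X. integral (cbox a b) (f i)) \<longlongrightarrow> K) (finite_subsets_at_top I)"
    by (rule Lim_transform_eventually[OF lim]) (use ev in \<open>auto simp: JX elim!: eventually_mono\<close>)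
  then show "((\<lambda>i. integral (cbox a b) (f i)) has_sum integral (cbox a b) (\<lambda>x. \<Sum>\<^sub>\<infinity>i\<in>I. f i x)) I"
    using integral_unique[OF K] by (simp add: has_sum_def)
qed

lemma summable_on_prod_PiE:
  fixes f :: "'a => 'b => real"
  assumes A: "finite A" and f: "\<And>x. x \<in> A ==> f x summable_on B x" "\<And>x y. x \<in> A ==> y \<in> B x ==> f x y \<ge> 0"
  shows "(\<lambda>g. \<Prod>x\<in>A. f x (g x)) summable_on (PiE A B)"
proof (rule nonneg_bdd_above_summable_on)
  show "0 \<le> (\<Prod>x\<in>A. f x (g x))" if "g \<in> PiE A B" for g
    using that f by (intro prod_nonneg) auto
  show "bdd_above (sum (\<lambda>g. \<Prod>x\<in>A. f x (g x)) ` {F. F \<subseteq> PiE A B \<and> finite F})"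
  proof (rule bdd_aboveI2)
    fix F assume "F \<in> {F. F \<subseteq> PiE A B \<and> finite F}"
    then have F: "F \<subseteq> PiE A B" "finite F" by auto
    define D where "D x = (\<lambda>g. g x) ` F" for x
    have D: "finite (D x)" "x \<in> A ==> D x \<subseteq> B x" for x using F by (auto simp: D_def)
    have "(\<Sum>g\<in>F. \<Prod>x\<in>A. f x (g x)) \<le> (\<Sum>g\<in>PiE A D. \<Prod>x\<in>A. f x (g x))"
    proof (rule sum_mono2)
      show "finite (PiE A D)" using A D by (intro finite_PiE) auto
      show "F \<subseteq> PiE A D"
      proof
        fix g assume g: "g \<in> F"
        then have "g \<in> PiE A B" using F by auto
        then show "g \<in> PiE A D" using g unfolding D_def by (auto simp: PiE_iff)
      qed
      show "0 \<le> (\<Prod>x\<in>A. f x (g x))" if "g \<in> PiE A D - F" for g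
        using that D f by (intro prod_nonneg) (auto simp: PiE_iff subset_iff)
    qed
    also have "\<dots> = (\<Prod>x\<in>A. \<Sum>y\<in>D x. f x y)" using A D by (intro prod_sum_PiE[symmetric]) auto
    also have "\<dots> \<le> (\<Prod>x\<in>A. infsum (f x) (B x))"
      by (intro prod_mono conjI sum_nonneg finite_sum_le_infsum) (use D f in \<open>auto simp: subset_iff\<close>)
    finally show "(\<Sum>g\<in>F. \<Prod>x\<in>A. f x (g x)) \<le> (\<Prod>x\<in>A. infsum (f x) (B x))" .
  qed
qed

lemma has_sum_prod_PiE:
  fixes f :: "'a => 'b => 'c::{real_normed_field, banach}"
  assumes A: "finite A" and f: "\<And>x. x \<in> A ==> (\<lambda>y. norm (f x y)) summable_on B x"
    "\<And>x. x \<in> A ==> (f x has_sum s x) (B x)"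
  shows "((\<lambda>g. \<Prod>x\<in>A. f x (g x)) has_sum (\<Prod>x\<in>A. s x)) (PiE A B)"
proof -
  have "(\<lambda>g. norm (\<Prod>x\<in>A. f x (g x))) summable_on (PiE A B)"
    unfolding prod_norm[symmetric] by (intro summable_on_prod_PiE A f) auto
  then have "((\<lambda>g. \<Prod>x\<in>A. f x (g x)) has_sum infsum (\<lambda>g. \<Prod>x\<in>A. f x (g x)) (PiE A B)) (PiE A B)"
    by (intro has_sum_infsum) (rule abs_summable_summable)
  also have "infsum (\<lambda>g. \<Prod>x\<in>A. f x (g x)) (PiE A B) = (\<Prod>x\<in>A. infsum (f x) (B x))"
    by (intro infsum_prod_PiE_abs A f)
  also have "\<dots> = (\<Prod>x\<in>A. s x)" using f by (intro prod.cong) (auto simp: infsumI)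
  finally show ?thesis .
qed

definition qnorm :: "int ^ 'd => real" where
  "qnorm q = (\<Sum>i\<in>UNIV. of_int \<bar>q $ i\<bar>)"

text \<open>
  The Taylor coefficients of the exponential function, distributed over the coordinates.
\<close>

definition chr_coef :: "int ^ 'd => (real ^ 'd => nat) => complex" where
  "chr_coef q \<alpha> = (\<Prod>b\<in>Basis. (2 * pi * \<i> * of_real (ivec q \<bullet> b)) ^ \<alpha> b / fact (\<alpha> b))"

lemma qnorm_eq: "qnorm q = (\<Sum>b\<in>Basis. \<bar>ivec q \<bullet> b\<bar>)"
  unfolding qnorm_def Basis_vec_def
  by (simp add: sum.reindex[of "\<lambda>i. axis i 1"] inj_on_def axis_eq_axis inner_axis UNION_singleton_eq_range)

lemma exp_has_sum:
  fixes z :: complex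
  shows "((\<lambda>n. z ^ n / fact n) has_sum exp z) UNIV" "(\<lambda>n. norm (z ^ n / fact n)) summable_on UNIV"
proof -
  have s: "summable (\<lambda>n. norm (z ^ n / fact n))"
    using summable_norm_exp[of z] by (simp add: divide_inverse mult.commute scaleR_conv_of_real)
  then show "(\<lambda>n. norm (z ^ n / fact n)) summable_on UNIV"
    by (rule summable_on_UNIV_nonneg_real_iff[THEN iffD2, rotated]) simp
  have "(\<lambda>n. z ^ n / fact n) sums exp z"
    using exp_converges[of z] by (simp add: divide_inverse mult.commute scaleR_conv_of_real)
  then show "((\<lambda>n. z ^ n / fact n) has_sum exp z) UNIV"
    by (rule norm_summable_imp_has_sum[OF s])
qed

text \<open>
  The second part is an equality: the norm of a character of frequency \<open>q\<close> grows exponentially in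
  \<open>qnorm q\<close>. This growth is what forces the decay in \<open>fco_bound\<close>.
\<close>

lemma chr_psf:
  fixes q :: "int ^ 'd"
  assumes "\<rho> \<ge> 0"
  shows "psf \<rho> (exp (2 * pi * \<rho> * qnorm q)) (chr_coef q) (chr q)"
    and "((\<lambda>\<alpha>. norm (chr_coef q \<alpha>) * \<rho> ^ mdeg \<alpha>) has_sum exp (2 * pi * \<rho> * qnorm q)) midx"
proof -
  define e where "e b = 2 * pi * \<i> * of_real (ivec q \<bullet> b)" for b :: "real ^ 'd"
  have e: "chr_coef q \<alpha> = (\<Prod>b\<in>Basis. e b ^ \<alpha> b / fact (\<alpha> b))" for \<alpha> by (simp add: chr_coef_def e_def)
  have H: "((\<lambda>\<alpha>. \<Prod>b\<in>Basis. z b ^ \<alpha> b / fact (\<alpha> b)) has_sum (\<Prod>b\<in>Basis. exp (z b))) midx"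
    for z :: "real ^ 'd => complex" unfolding midx_def
    by (rule has_sum_prod_PiE[where f = "\<lambda>b n. z b ^ n / fact n"]) (auto intro: exp_has_sum)
  have H2: "((\<lambda>\<alpha>. complex_of_real (norm (chr_coef q \<alpha>) * \<rho> ^ mdeg \<alpha>)) has_sum of_real (exp (2 * pi * \<rho> * qnorm q))) midx"
  proof -
    have "(\<Prod>b\<in>Basis. exp (complex_of_real (norm (e b) * \<rho>))) = of_real (exp (2 * pi * \<rho> * qnorm q))"
      by (simp add: qnorm_eq e_def exp_sum[symmetric] norm_mult sum_distrib_left mult_ac exp_of_real[symmetric])
    moreover have "complex_of_real (norm (chr_coef q \<alpha>) * \<rho> ^ mdeg \<alpha>) = (\<Prod>b\<in>Basis. of_real (norm (e b) * \<rho>) ^ \<alpha> b / fact (\<alpha> b))" for \<alpha>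
      by (simp add: e mdeg_def power_sum prod.distrib[symmetric] prod_norm[symmetric] norm_divide norm_power power_mult_distrib)
    ultimately show ?thesis using H[of "\<lambda>b. of_real (norm (e b) * \<rho>)"] by simp
  qed
  then show S: "((\<lambda>\<alpha>. norm (chr_coef q \<alpha>) * \<rho> ^ mdeg \<alpha>) has_sum exp (2 * pi * \<rho> * qnorm q)) midx"
    by (subst (asm) has_sum_of_real_iff)
  have "((\<lambda>\<alpha>. mon x \<alpha> *\<^sub>R chr_coef q \<alpha>) has_sum chr q x) midx" for x
  proof -
    have "(\<Prod>b\<in>Basis. exp (of_real (x \<bullet> b) * e b)) = exp (\<i> * of_real (2 * pi * (\<Sum>b\<in>Basis. (ivec q \<bullet> b) * (x \<bullet> b))))"
      by (simp add: e_def exp_sum[symmetric] sum_distrib_left mult_ac)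
    also have "(\<Sum>b\<in>Basis. (ivec q \<bullet> b) * (x \<bullet> b)) = ivec q \<bullet> x" by (rule euclidean_inner[symmetric])
    also have "exp (\<i> * of_real (2 * pi * (ivec q \<bullet> x))) = chr q x"
      by (simp add: chr_def cis_conv_exp inner_vec_def)
    finally have "(\<Prod>b\<in>Basis. exp (of_real (x \<bullet> b) * e b)) = chr q x" .
    moreover have "mon x \<alpha> *\<^sub>R chr_coef q \<alpha> = (\<Prod>b\<in>Basis. (of_real (x \<bullet> b) * e b) ^ \<alpha> b / fact (\<alpha> b))" for \<alpha>
      by (simp add: e mon_def scaleR_conv_of_real prod.distrib[symmetric] power_mult_distrib)
    ultimately show ?thesis using H[of "\<lambda>b. of_real (x \<bullet> b) * e b"] by simp
  qed
  then show "psf \<rho> (exp (2 * pi * \<rho> * qnorm q)) (chr_coef q) (chr q)"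
    using has_sum_imp_summable[OF S] infsumI[OF S] by (simp add: psf_def)
qed

section \<open>Decay of the Fourier coefficients of analytic functions\<close>

lemma pbox_in_open:
  fixes x :: "'a::euclidean_space"
  assumes "open V" "x \<in> V"
  obtains \<delta> where "\<delta> > 0" "\<And>s. s \<in> pbox \<delta> ==> x + s \<in> V"
proof -
  obtain e where e: "e > 0" "ball x e \<subseteq> V" using assms openE by blast
  define \<delta> where "\<delta> = e / (DIM('a) + 1)"
  have d: "\<delta> > 0" "real DIM('a) * \<delta> < e" using e by (auto simp: \<delta>_def field_simps)
  have "x + s \<in> V" if "s \<in> pbox \<delta>" for s
  proof -
    have "norm s < e" using norm_le_pbox[OF that] d by linarith
    then have "x + s \<in> ball x e" by (simp add: dist_norm)
    then show ?thesis using e by blast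
  qed
  then show ?thesis using that d by blast
qed

lemma geometric_midx:
  fixes r :: real
  assumes "0 \<le> r" "r < 1"
  shows "(\<lambda>\<gamma>. r ^ mdeg \<gamma>) summable_on (midx :: ('a::euclidean_space => nat) set)"
proof -
  have "(\<lambda>n. r ^ n) summable_on UNIV"
    by (rule summable_on_UNIV_nonneg_real_iff[THEN iffD2]) (use assms in \<open>auto intro: summable_geometric\<close>)
  then have "(\<lambda>\<gamma>. \<Prod>b\<in>(Basis::'a set). r ^ \<gamma> b) summable_on (PiE Basis (\<lambda>_. UNIV))"
    using assms by (intro summable_on_prod_PiE) auto
  then show ?thesis by (simp add: mdeg_def midx_def power_sum)
qed

definition fco :: "(real ^ 'd => 'p => complex) => int ^ 'd => 'p => complex" where
  "fco g q \<mu> = integral (cbox 0 1) (\<lambda>\<theta>. g \<theta> \<mu> * cnj (chr q \<theta>))"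

lemma fco_shift:
  fixes g :: "real ^ 'd => 'p::euclidean_space => complex"
  assumes g: "tan_on g V" "\<mu> \<in> V"
  shows "integral (cbox 0 1) (\<lambda>\<theta>. g (\<theta> + t) \<mu> * cnj (chr q \<theta>)) = chr q t * fco g q \<mu>"
proof -
  have "g (\<theta> + t) \<mu> * cnj (chr q \<theta>) = chr q t * (g (\<theta> + t) \<mu> * cnj (chr q (\<theta> + t)))" for \<theta>
  proof -
    have "chr q t * (g (\<theta> + t) \<mu> * cnj (chr q (\<theta> + t)))
        = (chr q t * cnj (chr q t)) * (g (\<theta> + t) \<mu> * cnj (chr q \<theta>))"
      by (simp only: chr_add complex_cnj_mult mult_ac)
    then show ?thesis by (simp only: chr_cnj_mult mult_1_left)
  qed
  then have "integral (cbox 0 1) (\<lambda>\<theta>. g (\<theta> + t) \<mu> * cnj (chr q \<theta>))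
      = integral (cbox 0 1) (\<lambda>\<theta>. chr q t * (g (\<theta> + t) \<mu> * cnj (chr q (\<theta> + t))))"
    by (rule integral_cong)
  also have "\<dots> = chr q t * integral (cbox 0 1) (\<lambda>\<theta>. g (\<theta> + t) \<mu> * cnj (chr q (\<theta> + t)))"
    by (rule integral_mult_right)
  also have "integral (cbox 0 1) (\<lambda>\<theta>. g (\<theta> + t) \<mu> * cnj (chr q (\<theta> + t))) = fco g q \<mu>"
    unfolding fco_def
    by (rule torus_int_shift[where f = "\<lambda>\<theta>. g \<theta> \<mu> * cnj (chr q \<theta>)"])
       (use g chr_periodic[of q] in \<open>auto simp: torus_periodic_def tan_on_def intro!: continuous_intros tan_on_continuous[OF g]\<close>)
  finally show ?thesis .
qed

text \<open>
  Translating \<open>g\<close> by \<open>t\<close> multiplies its Fourier coefficient by \<open>chr q t\<close> (\<open>fco_shift\<close>). As a function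
  of \<open>t\<close> and of the parameter, the translated coefficient is a power series of norm at most \<open>M\<close>,
  whatever \<open>q\<close> is. It is the product of the character, a function of \<open>t\<close> of norm
  \<open>exp (2 * pi * \<rho> * qnorm q)\<close>, and of the coefficient, a function of the parameter. For separated
  variables norms multiply, so the norm of the coefficient is smaller than \<open>M\<close> by that factor.
\<close>

lemma fco_bound:
  fixes g :: "real ^ 'd => 'p::euclidean_space => complex"
  assumes g: "tan_on g V" and \<mu>0: "\<mu>0 \<in> V"
  obtains \<rho> M where "\<rho> > 0" "M \<ge> 0"
    "\<And>q. psum \<rho> (M * exp (- (2 * pi * \<rho> * qnorm q))) (\<lambda>s. fco g q (\<mu>0 + s))"
proof -
  define F where "F = (\<lambda>\<theta> z. g (\<theta> + fst z) (\<mu>0 + snd z))"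
  obtain \<rho>0 M where \<rho>0: "\<rho>0 > 0" and C: "\<And>\<theta>. psf \<rho>0 M (tcoef (F \<theta>)) (F \<theta>)"
    and cont: "\<And>\<gamma> S. \<gamma> \<in> midx ==> continuous_on S (\<lambda>\<theta>. tcoef (F \<theta>) \<gamma>)"
    using tan_uniform[OF g \<mu>0] unfolding F_def by blast
  obtain \<delta> where \<delta>: "\<delta> > 0" "\<And>s. s \<in> pbox \<delta> ==> \<mu>0 + s \<in> V"
    using pbox_in_open g \<mu>0 unfolding tan_on_def by metis
  define \<rho> where "\<rho> = min (\<rho>0 / 2) \<delta>"
  have \<rho>: "\<rho> > 0" "\<rho> \<le> \<rho>0 / 2" "\<rho> \<le> \<rho>0" "\<rho> \<le> \<delta>" using \<rho>0 \<delta> by (auto simp: \<rho>_def)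
  have M0: "M \<ge> 0" using psf_nonneg[OF C] \<rho>0 by simp
  show ?thesis
  proof (rule that[OF \<rho>(1) M0])
    fix q :: "int ^ 'd"
    define D where "D \<gamma> = integral (cbox 0 1) (\<lambda>\<theta>. tcoef (F \<theta>) \<gamma> * cnj (chr q \<theta>))" for \<gamma>
    define h where "h s = fco g q (\<mu>0 + s)" for s
    have cD: "continuous_on S (\<lambda>\<theta>. tcoef (F \<theta>) \<gamma> * cnj (chr q \<theta>))" if "\<gamma> \<in> midx" for \<gamma> S
      by (intro continuous_intros cont that)
    have "((\<lambda>\<gamma>. mon z \<gamma> *\<^sub>R D \<gamma>) has_sum chr q (fst z) * h (snd z)) midx" if z: "z \<in> pbox \<rho>" for z
    proof -
      define f where "f \<gamma> \<theta> = mon z \<gamma> *\<^sub>R (tcoef (F \<theta>) \<gamma> * cnj (chr q \<theta>))" for \<gamma> \<theta>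
      have z0: "z \<in> pbox \<rho>0" using z pbox_mono[OF \<rho>(3)] by blast
      have "((\<lambda>\<gamma>. integral (cbox 0 1) (f \<gamma>)) has_sum integral (cbox 0 1) (\<lambda>\<theta>. \<Sum>\<^sub>\<infinity>\<gamma>\<in>midx. f \<gamma> \<theta>)) midx"
      proof (rule has_sum_integral(1))
        show "continuous_on (cbox 0 1) (f \<gamma>)" if "\<gamma> \<in> midx" for \<gamma>
          unfolding f_def by (intro continuous_intros cont that)
        show "norm (f \<gamma> \<theta>) \<le> M * (1 / 2) ^ mdeg \<gamma>" if "\<gamma> \<in> midx" for \<gamma> \<theta>
        proof -
          have "norm (f \<gamma> \<theta>) = \<bar>mon z \<gamma>\<bar> * norm (tcoef (F \<theta>) \<gamma>)" by (simp add: f_def norm_mult)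
          also have "\<bar>mon z \<gamma>\<bar> \<le> (\<rho>0 / 2) ^ mdeg \<gamma>"
            by (rule abs_mon_le) (use z pbox_mono[OF \<rho>(2)] in blast)
          also have "(\<rho>0 / 2) ^ mdeg \<gamma> * norm (tcoef (F \<theta>) \<gamma>) = (norm (tcoef (F \<theta>) \<gamma>) * \<rho>0 ^ mdeg \<gamma>) * (1 / 2) ^ mdeg \<gamma>"
            by (simp add: power_divide)
          also have "\<dots> \<le> M * (1 / 2) ^ mdeg \<gamma>"
            by (intro mult_right_mono psf_coeff_le[OF C]) (use \<rho>0 that in auto)
          finally show ?thesis by (simp add: mult_right_mono)
        qed
        show "(\<lambda>\<gamma>. M * (1 / 2) ^ mdeg \<gamma>) summable_on (midx :: ((real ^ 'd) \<times> 'p => nat) set)"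
          by (intro summable_on_cmult_right geometric_midx) auto
      qed
      moreover have "integral (cbox 0 1) (f \<gamma>) = mon z \<gamma> *\<^sub>R D \<gamma>" for \<gamma>
        unfolding f_def D_def by (rule integral_cmul)
      moreover have "(\<Sum>\<^sub>\<infinity>\<gamma>\<in>midx. f \<gamma> \<theta>) = g (\<theta> + fst z) (\<mu>0 + snd z) * cnj (chr q \<theta>)" for \<theta>
        using has_sum_cmult_left[OF psf_has_sum[OF C z0], of \<theta> "cnj (chr q \<theta>)"]
        unfolding f_def F_def by (intro infsumI) simp
      moreover have "integral (cbox 0 1) (\<lambda>\<theta>. g (\<theta> + fst z) (\<mu>0 + snd z) * cnj (chr q \<theta>)) = chr q (fst z) * h (snd z)"
      proof -
        have "snd z \<in> pbox \<delta>" using z pbox_mono[OF \<rho>(4)] by (cases z) auto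
        then show ?thesis unfolding h_def by (intro fco_shift[OF g] \<delta>)
      qed
      ultimately show ?thesis by simp
    qed
    moreover have fin: "(\<Sum>\<gamma>\<in>X. norm (D \<gamma>) * \<rho> ^ mdeg \<gamma>) \<le> M" if X: "X \<subseteq> midx" "finite X" for X
    proof -
      have ci: "(\<lambda>\<theta>. norm (tcoef (F \<theta>) \<gamma> * cnj (chr q \<theta>))) integrable_on cbox 0 1" if "\<gamma> \<in> midx" for \<gamma>
        by (intro integrable_continuous continuous_on_norm cD that)
      have "norm (D \<gamma>) \<le> integral (cbox 0 1) (\<lambda>\<theta>. norm (tcoef (F \<theta>) \<gamma> * cnj (chr q \<theta>)))" if "\<gamma> \<in> midx" for \<gamma>
        unfolding D_def
        by (rule integral_norm_bound_integral) (use ci that in \<open>auto intro!: integrable_continuous cD\<close>)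
      then have "(\<Sum>\<gamma>\<in>X. norm (D \<gamma>) * \<rho> ^ mdeg \<gamma>)
          \<le> (\<Sum>\<gamma>\<in>X. integral (cbox 0 1) (\<lambda>\<theta>. norm (tcoef (F \<theta>) \<gamma> * cnj (chr q \<theta>))) * \<rho> ^ mdeg \<gamma>)"
        using X \<rho> by (intro sum_mono mult_right_mono) auto
      also have "\<dots> = (\<Sum>\<gamma>\<in>X. integral (cbox 0 1) (\<lambda>\<theta>. norm (tcoef (F \<theta>) \<gamma>) * \<rho> ^ mdeg \<gamma>))"
        by (simp add: norm_mult)
      also have "\<dots> = integral (cbox 0 1) (\<lambda>\<theta>. \<Sum>\<gamma>\<in>X. norm (tcoef (F \<theta>) \<gamma>) * \<rho> ^ mdeg \<gamma>)"
        by (rule integral_sum[symmetric]) (use X in \<open>auto intro!: integrable_continuous continuous_intros cont\<close>)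
      also have "\<dots> \<le> integral (cbox 0 (1 :: real ^ 'd)) (\<lambda>_. M)"
      proof (rule integral_le)
        show "(\<Sum>\<gamma>\<in>X. norm (tcoef (F \<theta>) \<gamma>) * \<rho> ^ mdeg \<gamma>) \<le> M" for \<theta>
        proof -
          have "psf \<rho> M (tcoef (F \<theta>)) (F \<theta>)" using psf_radius_mono[OF C] \<rho> by simp
          then have "(\<lambda>\<gamma>. norm (tcoef (F \<theta>) \<gamma>) * \<rho> ^ mdeg \<gamma>) summable_on midx"
            "(\<Sum>\<^sub>\<infinity>\<gamma>\<in>midx. norm (tcoef (F \<theta>) \<gamma>) * \<rho> ^ mdeg \<gamma>) \<le> M" by (auto simp: psf_def)
          then show ?thesis using finite_sum_le_infsum[of _ midx X] X \<rho> by fastforce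
        qed
      qed (use X in \<open>auto intro!: integrable_continuous continuous_intros cont\<close>)
      finally show ?thesis by (simp only: torus_int_const)
    qed
    moreover have sD: "(\<lambda>\<gamma>. norm (D \<gamma>) * \<rho> ^ mdeg \<gamma>) summable_on midx"
      by (rule nonneg_bdd_above_summable_on) (use fin \<rho> in \<open>auto intro!: bdd_aboveI2\<close>)
    moreover have sDM: "(\<Sum>\<^sub>\<infinity>\<gamma>\<in>midx. norm (D \<gamma>) * \<rho> ^ mdeg \<gamma>) \<le> M"
      by (rule infsum_le_finite_sums[OF sD]) (use fin in auto)
    ultimately have P: "psf \<rho> M D (\<lambda>z. chr q (fst z) * h (snd z))" by (simp add: psf_def)
    \<comment> \<open>By uniqueness the coefficients of the product are the products of those of the factors,
      so that the norms multiply.\<close>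
    define E where "E = exp (2 * pi * \<rho> * qnorm q)"
    have E: "psf \<rho> E (chr_coef q) (chr q)" "((\<lambda>\<alpha>. norm (chr_coef q \<alpha>) * \<rho> ^ mdeg \<alpha>) has_sum E) midx"
      unfolding E_def using chr_psf[of \<rho> q] \<rho> by auto
    have inner: "(\<Sum>\<^sub>\<infinity>\<delta>\<in>midx. mon s \<delta> *\<^sub>R D (mpair \<alpha> \<delta>)) = chr_coef q \<alpha> * h s"
      if "s \<in> pbox \<rho>" "\<alpha> \<in> midx" for s \<alpha>
    proof -
      have 1: "psf \<rho> M (\<lambda>\<gamma>. \<Sum>\<^sub>\<infinity>\<delta>\<in>midx. mon s \<delta> *\<^sub>R D (mpair \<gamma> \<delta>)) (\<lambda>t. chr q t * h s)"
        using psf_extract(1)[OF P \<rho>(1) that(1)] by simp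
      have 2: "psf \<rho> (norm (h s) * E) (\<lambda>\<alpha>. chr_coef q \<alpha> * h s) (\<lambda>t. chr q t * h s)"
        by (rule psf_linear[OF E(1) _ bounded_linear_mult_left]) (use \<rho> in \<open>auto simp: norm_mult mult.commute\<close>)
      show ?thesis by (rule psf_unique[OF 1 \<rho>(1) 2 \<rho>(1) refl that(2)])
    qed
    have X: "psf \<rho> (M / \<rho> ^ mdeg \<alpha>) (\<lambda>\<delta>. D (mpair \<alpha> \<delta>)) (\<lambda>s. chr_coef q \<alpha> * h s)" if "\<alpha> \<in> midx" for \<alpha>
      by (rule psf_cong[OF psf_extract(2)[OF P \<rho>(1) that]]) (rule inner[OF _ that])
    define z0 :: "real ^ 'd => nat" where "z0 = (\<lambda>b\<in>Basis. 0)"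
    have c0: "chr_coef q z0 = 1" by (simp add: chr_coef_def z0_def)
    have z0m: "z0 \<in> midx" "mdeg z0 = 0" by (simp_all add: z0_def)
    have X0: "psf \<rho> M (\<lambda>\<delta>. D (mpair z0 \<delta>)) h" using X[OF z0m(1)] by (simp add: c0 z0m)
    have fact: "D (mpair \<alpha> \<delta>) = chr_coef q \<alpha> * D (mpair z0 \<delta>)" if "\<alpha> \<in> midx" "\<delta> \<in> midx" for \<alpha> \<delta>
    proof -
      have "psf \<rho> (norm (chr_coef q \<alpha>) * M) (\<lambda>\<delta>. chr_coef q \<alpha> * D (mpair z0 \<delta>)) (\<lambda>s. chr_coef q \<alpha> * h s)"
        by (rule psf_linear[OF X0 _ bounded_linear_mult_right]) (use \<rho> in \<open>auto simp: norm_mult\<close>)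
      from psf_unique[OF X[OF that(1)] \<rho>(1) this \<rho>(1) refl that(2)] show ?thesis .
    qed
    define N where "N = (\<Sum>\<^sub>\<infinity>\<delta>\<in>midx. norm (D (mpair z0 \<delta>)) * \<rho> ^ mdeg \<delta>)"
    have N: "((\<lambda>\<delta>. norm (D (mpair z0 \<delta>)) * \<rho> ^ mdeg \<delta>) has_sum N) midx"
      unfolding N_def using X0 by (auto simp: psf_def)
    have "((\<lambda>(\<alpha>, \<delta>). (norm (chr_coef q \<alpha>) * \<rho> ^ mdeg \<alpha>) * (norm (D (mpair z0 \<delta>)) * \<rho> ^ mdeg \<delta>)) has_sum E * N) (midx \<times> midx)"
      by (rule abs_has_sum_times[OF E(2) _ N])
         (use \<rho> has_sum_imp_summable[OF E(2)] has_sum_imp_summable[OF N] in auto)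
    then have "((\<lambda>x. norm (D (case x of (\<alpha>, \<delta>) => mpair \<alpha> \<delta>)) * \<rho> ^ mdeg (case x of (\<alpha>, \<delta>) => mpair \<alpha> \<delta>)) has_sum E * N) (midx \<times> midx)"
      by (rule has_sum_cong[THEN iffD1, rotated]) (auto simp: fact norm_mult mdeg_mpair power_add)
    then have "((\<lambda>\<gamma>. norm (D \<gamma>) * \<rho> ^ mdeg \<gamma>) has_sum E * N) midx"
      using has_sum_reindex_bij_betw[OF bij_mpair, of "\<lambda>\<gamma>. norm (D \<gamma>) * \<rho> ^ mdeg \<gamma>"] by simp
    then have "E * N \<le> M" using sDM infsumI by metis
    then have "N \<le> M * exp (- (2 * pi * \<rho> * qnorm q))"
      by (simp add: E_def exp_minus field_simps)
    then have "psf \<rho> (M * exp (- (2 * pi * \<rho> * qnorm q))) (\<lambda>\<delta>. D (mpair z0 \<delta>)) h"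
      using X0 unfolding psf_def N_def by auto
    then show "psum \<rho> (M * exp (- (2 * pi * \<rho> * qnorm q))) (\<lambda>s. fco g q (\<mu>0 + s))"
      unfolding h_def by (rule psf_imp_psum)
  qed
qed

section \<open>Fourier multipliers and small divisors\<close>

lemma exp_qnorm_summable:
  assumes "\<epsilon> > 0" shows "(\<lambda>q :: int ^ 'd. exp (- (\<epsilon> * qnorm q))) summable_on UNIV"
proof -
  have pos: "(\<lambda>n::nat. exp (- \<epsilon>) ^ n) summable_on UNIV"
    by (rule summable_on_UNIV_nonneg_real_iff[THEN iffD2]) (use assms in \<open>auto intro: summable_geometric\<close>)
  have e: "exp (- (\<epsilon> * real n)) = exp (- \<epsilon>) ^ n" for n
    by (simp add: exp_of_nat_mult[symmetric] mult.commute)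
  have "(\<lambda>n. exp (- (\<epsilon> * of_int \<bar>n\<bar>))) \<circ> int = (\<lambda>n. exp (- \<epsilon>) ^ n)"
    "(\<lambda>n. exp (- (\<epsilon> * of_int \<bar>n\<bar>))) \<circ> (\<lambda>n. - int n) = (\<lambda>n. exp (- \<epsilon>) ^ n)"
    by (simp_all add: fun_eq_iff e)
  then have 1: "(\<lambda>n. exp (- (\<epsilon> * of_int \<bar>n\<bar>))) summable_on (range int)"
    and 2: "(\<lambda>n. exp (- (\<epsilon> * of_int \<bar>n\<bar>))) summable_on (range (\<lambda>n. - int n))"
    using pos summable_on_reindex[of int UNIV "\<lambda>n. exp (- (\<epsilon> * of_int \<bar>n\<bar>))"]
      summable_on_reindex[of "\<lambda>n. - int n" UNIV "\<lambda>n. exp (- (\<epsilon> * of_int \<bar>n\<bar>))"]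
    by (simp_all add: inj_def)
  have "n \<in> range int \<union> range (\<lambda>n. - int n)" for n by (cases n rule: int_cases2) auto
  then have "range int \<union> range (\<lambda>n. - int n) = UNIV" by blast
  with summable_on_union[OF 1 2] have s: "(\<lambda>n::int. exp (- (\<epsilon> * of_int \<bar>n\<bar>))) summable_on UNIV" by simp
  have "(\<lambda>f. \<Prod>i\<in>(UNIV::'d set). exp (- (\<epsilon> * of_int \<bar>f i\<bar>))) summable_on (PiE UNIV (\<lambda>_. UNIV))"
    by (intro summable_on_prod_PiE s) auto
  then have "(\<lambda>f. exp (- (\<epsilon> * qnorm (vec_lambda f :: int ^ 'd)))) summable_on UNIV"
    by (simp add: exp_sum[symmetric] sum_negf qnorm_def sum_distrib_left)
  moreover have bij: "bij_betw vec_lambda UNIV (UNIV :: (int ^ 'd) set)"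
    by (rule bij_betwI[of _ _ _ vec_nth]) auto
  ultimately show ?thesis
    using summable_on_reindex_bij_betw[OF bij, of "\<lambda>q. exp (- (\<epsilon> * qnorm q))"] by simp
qed

text \<open>
  Subexponential growth: multipliers that the exponential decay of the coefficients absorbs.
\<close>

definition slow_weight :: "(int ^ 'd => complex) => bool" where
  "slow_weight w \<longleftrightarrow> (\<forall>\<epsilon>>0. \<exists>K. \<forall>q. norm (w q) \<le> K * exp (\<epsilon> * qnorm q))"

text \<open>
  The Fourier multiplier with symbol \<open>w\<close>.
\<close>

definition fmult :: "(int ^ 'd => complex) => (real ^ 'd => 'p => complex) => real ^ 'd => 'p => complex" where
  "fmult w g \<theta> \<mu> = (\<Sum>\<^sub>\<infinity>q. w q * fco g q \<mu> * chr q \<theta>)"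

lemma psum_fst:
  assumes "psum \<rho> M f" "\<rho> > 0" shows "psum \<rho> M (\<lambda>z :: 'a::euclidean_space \<times> 'b::euclidean_space. f (fst z))"
proof (rule psum_compose[OF assms(1) _ assms(2)])
  fix e :: 'a assume e: "e \<in> Basis"
  have "psum \<rho> \<rho> (\<lambda>z :: 'a \<times> 'b. z \<bullet> (e, 0))" using e by (intro psum_coord assms) (auto simp: Basis_prod_def)
  then show "psum \<rho> \<rho> (\<lambda>z :: 'a \<times> 'b. fst z \<bullet> e)" by (simp add: inner_prod_def)
qed

lemma psum_snd:
  assumes "psum \<rho> M f" "\<rho> > 0" shows "psum \<rho> M (\<lambda>z :: 'a::euclidean_space \<times> 'b::euclidean_space. f (snd z))"
proof (rule psum_compose[OF assms(1) _ assms(2)])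
  fix e :: 'b assume e: "e \<in> Basis"
  have "psum \<rho> \<rho> (\<lambda>z :: 'a \<times> 'b. z \<bullet> (0, e))" using e by (intro psum_coord assms) (auto simp: Basis_prod_def)
  then show "psum \<rho> \<rho> (\<lambda>z :: 'a \<times> 'b. snd z \<bullet> e)" by (simp add: inner_prod_def)
qed

text \<open>
  At a radius smaller than that of the decay, the decay of the Fourier coefficients beats the growth
  of the norm of the characters together with that of the symbol.
\<close>

lemma fmult_analytic:
  fixes g :: "real ^ 'd => 'p::euclidean_space => complex"
  assumes g: "tan_on g V" and w: "slow_weight w" and \<mu>: "\<mu> \<in> V"
  shows "an_at (\<lambda>z. fmult w g (fst z) (snd z)) (\<theta>, \<mu>)"
    and "(\<lambda>q. norm (w q * fco g q \<mu>)) summable_on UNIV"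
proof -
  obtain \<rho> M where \<rho>: "\<rho> > 0" "M \<ge> 0"
    and P: "\<And>q. psum \<rho> (M * exp (- (2 * pi * \<rho> * qnorm q))) (\<lambda>s. fco g q (\<mu> + s))"
    using fco_bound[OF g \<mu>] by blast
  have "pi * \<rho> / 2 > 0" using \<rho> by simp
  then obtain K where K: "\<And>q. norm (w q) \<le> K * exp (pi * \<rho> / 2 * qnorm q)"
    using w unfolding slow_weight_def by blast
  have "0 \<le> norm (w 0)" by simp
  also have "\<dots> \<le> K" using K[of 0] by (simp add: qnorm_def)
  finally have K0: "K \<ge> 0" .
  define r where "r = \<rho> / 2"
  have r: "r > 0" "r \<le> \<rho>" using \<rho> by (auto simp: r_def)
  define N where "N q = K * M * exp (- (pi * \<rho> / 2 * qnorm q))" for q :: "int ^ 'd"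
  have sN: "(N has_sum infsum N UNIV) UNIV"
    unfolding N_def by (intro has_sum_infsum summable_on_cmult_right exp_qnorm_summable) (use \<rho> in simp)
  have T: "psum r (N q) (\<lambda>z. w q * fco g q (\<mu> + snd z) * chr q (\<theta> + fst z))" for q
  proof -
    have 1: "psum r (M * exp (- (2 * pi * \<rho> * qnorm q))) (\<lambda>z :: (real ^ 'd) \<times> 'p. fco g q (\<mu> + snd z))"
      by (rule psum_snd[OF psum_radius_mono[OF P]]) (use r in auto)
    have 2: "psum r (exp (2 * pi * r * qnorm q)) (\<lambda>z :: (real ^ 'd) \<times> 'p. chr q (fst z))"
      by (rule psum_fst[OF psf_imp_psum[OF chr_psf(1)]]) (use r in auto)
    have 3: "psum r (norm (w q * chr q \<theta>)) (\<lambda>z :: (real ^ 'd) \<times> 'p. w q * chr q \<theta>)"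
      using r by (intro psum_const)
    have "psum r (norm (w q * chr q \<theta>) * (M * exp (- (2 * pi * \<rho> * qnorm q)) * exp (2 * pi * r * qnorm q)))
        (\<lambda>z. (w q * chr q \<theta>) * (fco g q (\<mu> + snd z) * chr q (fst z)))"
      by (intro psum_mult 1 2 3 r)
    then show ?thesis
    proof (rule psum_mono[OF psum_cong])
      have "norm (w q * chr q \<theta>) * (M * exp (- (2 * pi * \<rho> * qnorm q)) * exp (2 * pi * r * qnorm q))
          \<le> (K * exp (pi * \<rho> / 2 * qnorm q)) * (M * exp (- (2 * pi * \<rho> * qnorm q)) * exp (2 * pi * r * qnorm q))"
        using K[of q] \<rho> by (intro mult_right_mono) (auto simp: norm_mult)
      also have "\<dots> = K * M * (exp (pi * \<rho> / 2 * qnorm q) * exp (- (2 * pi * \<rho> * qnorm q)) * exp (2 * pi * r * qnorm q))"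
        by (simp only: mult_ac)
      also have "\<dots> = N q" unfolding N_def exp_add[symmetric] by (simp add: r_def field_simps)
      finally show "norm (w q * chr q \<theta>) * (M * exp (- (2 * pi * \<rho> * qnorm q)) * exp (2 * pi * r * qnorm q)) \<le> N q" .
    qed (simp add: chr_add mult_ac)
  qed
  have "psum r (infsum N UNIV) (\<lambda>z. fmult w g (\<theta> + fst z) (\<mu> + snd z))"
    unfolding fmult_def by (rule psum_infsum(1)[OF T sN r(1)])
  then show "an_at (\<lambda>z. fmult w g (fst z) (snd z)) (\<theta>, \<mu>)"
    using r by (intro an_atI[of r]) auto
  show "(\<lambda>q. norm (w q * fco g q \<mu>)) summable_on UNIV"
  proof (rule summable_on_comparison_test[OF has_sum_imp_summable[OF sN]])
    show "norm (w q * fco g q \<mu>) \<le> N q" for q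
      using psum_bound[OF T[of q], of 0] r by (simp add: norm_mult)
  qed auto
qed

lemma fmult_has_sum:
  fixes g :: "real ^ 'd => 'p::euclidean_space => complex"
  assumes g: "tan_on g V" and w: "slow_weight w" and \<mu>: "\<mu> \<in> V"
  shows "((\<lambda>q. w q * fco g q \<mu> * chr q \<theta>) has_sum fmult w g \<theta> \<mu>) UNIV"
  unfolding fmult_def
  by (rule has_sum_infsum, rule abs_summable_summable)
     (use fmult_analytic(2)[OF assms] in \<open>simp add: norm_mult\<close>)

lemma fmult_tan_on:
  fixes g :: "real ^ 'd => 'p::euclidean_space => complex"
  assumes g: "tan_on g V" and w: "slow_weight w"
  shows "tan_on (fmult w g) V"
  using fmult_analytic(1)[OF assms] g
  by (auto simp: tan_on_def torus_periodic_def fmult_def chr_add)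

lemma fco_fmult:
  fixes g :: "real ^ 'd => 'p::euclidean_space => complex"
  assumes g: "tan_on g V" and w: "slow_weight w" and \<mu>: "\<mu> \<in> V"
  shows "fco (fmult w g) r \<mu> = w r * fco g r \<mu>"
proof -
  define f where "f q \<theta> = w q * fco g q \<mu> * chr q \<theta> * cnj (chr r \<theta>)" for q \<theta>
  have "((\<lambda>q. integral (cbox 0 1) (f q)) has_sum integral (cbox 0 1) (\<lambda>\<theta>. \<Sum>\<^sub>\<infinity>q. f q \<theta>)) UNIV"
    by (rule has_sum_integral(1)[OF _ _ fmult_analytic(2)[OF assms]])
       (auto simp: f_def norm_mult intro!: continuous_intros)
  moreover have "(\<Sum>\<^sub>\<infinity>q. f q \<theta>) = fmult w g \<theta> \<mu> * cnj (chr r \<theta>)" for \<theta>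
    unfolding f_def by (rule infsumI, rule has_sum_cmult_left, rule fmult_has_sum[OF assms])
  moreover have "integral (cbox 0 1) (f q) = (if q = r then w r * fco g r \<mu> else 0)" for q
  proof -
    have "f q = (\<lambda>\<theta>. (w q * fco g q \<mu>) * chr (q - r) \<theta>)"
      using chr_add_left[of q "- r"] by (auto simp: f_def chr_minus mult_ac)
    then have "integral (cbox 0 1) (f q) = (w q * fco g q \<mu>) * integral (cbox 0 1) (chr (q - r))"
      by simp
    then show ?thesis by (simp add: integral_chr)
  qed
  ultimately have "((\<lambda>q. if q = r then w r * fco g r \<mu> else 0) has_sum fco (fmult w g) r \<mu>) UNIV"
    by (simp add: fco_def)
  moreover have "((\<lambda>q. if q = r then w r * fco g r \<mu> else 0) has_sum w r * fco g r \<mu>) UNIV"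
    by (rule has_sum_finite_neutralI[where B = "{r}"]) auto
  ultimately show ?thesis by (rule has_sum_unique)
qed

lemma fco_all_eq_imp_eq:
  fixes g h :: "real ^ 'd => 'p::euclidean_space => complex"
  assumes g: "continuous_on UNIV (\<lambda>\<theta>. g \<theta> \<mu>)" "torus_periodic (\<lambda>\<theta>. g \<theta> \<mu>)"
    and h: "continuous_on UNIV (\<lambda>\<theta>. h \<theta> \<mu>)" "torus_periodic (\<lambda>\<theta>. h \<theta> \<mu>)"
    and eq: "\<And>q. fco g q \<mu> = fco h q \<mu>"
  shows "g \<theta> \<mu> = h \<theta> \<mu>"
proof -
  have int: "(\<lambda>\<theta>. f \<theta> * chr q \<theta>) integrable_on cbox 0 1" if "continuous_on UNIV f"
    for f :: "real ^ 'd => complex" and q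
    by (intro integrable_continuous continuous_intros continuous_on_subset[OF that]) auto
  have "integral (cbox 0 1) (\<lambda>\<theta>. (g \<theta> \<mu> - h \<theta> \<mu>) * chr q \<theta>) = fco g (- q) \<mu> - fco h (- q) \<mu>" for q
    using integral_diff[OF int[OF g(1), of q] int[OF h(1), of q]]
    by (simp add: fco_def chr_minus left_diff_distrib)
  then have "fourier_null (\<lambda>\<theta>. g \<theta> \<mu> - h \<theta> \<mu>)"
    using g h eq by (auto simp: fourier_null_def torus_periodic_def intro!: continuous_intros)
  from fourier_null_imp_zero[OF this, of \<theta>] show ?thesis by simp
qed

lemma fco_rotate:
  fixes g :: "real ^ 'd => 'p::euclidean_space => complex"
  assumes "continuous_on UNIV (\<lambda>\<theta>. g \<theta> \<mu>)" "torus_periodic (\<lambda>\<theta>. g \<theta> \<mu>)"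
  shows "fco (\<lambda>\<theta>. g (\<theta> + t)) q \<mu> = chr q t * fco g q \<mu>"
proof -
  have *: "chr q t * (z * cnj (chr q (\<theta> + t))) = z * cnj (chr q \<theta>)" for \<theta> z
  proof -
    have "chr q t * (z * cnj (chr q (\<theta> + t))) = (chr q t * cnj (chr q t)) * (z * cnj (chr q \<theta>))"
      by (simp only: chr_add complex_cnj_mult mult_ac)
    then show ?thesis by (simp only: chr_cnj_mult mult_1_left)
  qed
  have "chr q t * fco g q \<mu> = chr q t * integral (cbox 0 1) (\<lambda>\<theta>. g (\<theta> + t) \<mu> * cnj (chr q (\<theta> + t)))"
    unfolding fco_def
    by (subst torus_int_shift[where f = "\<lambda>\<theta>. g \<theta> \<mu> * cnj (chr q \<theta>)" and t = t])
       (use assms chr_periodic[of q] in \<open>auto simp: torus_periodic_def intro!: continuous_intros\<close>)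
  also have "\<dots> = fco (\<lambda>\<theta>. g (\<theta> + t)) q \<mu>"
    unfolding fco_def integral_mult_right[symmetric] * ..
  finally show ?thesis by simp
qed

lemma norm_cis_minus_1_ge:
  assumes "\<bar>y\<bar> \<le> 1 / 2" shows "norm (cis (2 * pi * y) - 1) \<ge> \<bar>y\<bar>"
proof -
  define z where "z = pi * \<bar>y\<bar>"
  have z: "0 \<le> z" "z \<le> 2" using assms pi_less_4 mult_mono[of pi 4 "\<bar>y\<bar>" "1/2"] by (auto simp: z_def)
  have "\<bar>sin z - (\<Sum>m<3. sin_coeff m * z ^ m)\<bar> \<le> inverse (fact 3) * \<bar>z\<bar> ^ 3"
    by (rule Maclaurin_sin_bound)
  moreover have "(\<Sum>m<3. sin_coeff m * z ^ m) = z" by (simp add: sin_coeff_def eval_nat_numeral)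
  moreover have "inverse (fact 3) * \<bar>z\<bar> ^ 3 \<le> 2 / 3 * z"
  proof -
    have "z ^ 2 \<le> 4" using z power_mono[of z 2 2] by simp
    then have "z ^ 2 * z \<le> 4 * z" using z by (intro mult_right_mono) auto
    then show ?thesis using z by (simp add: eval_nat_numeral)
  qed
  ultimately have s: "sin z \<ge> z / 3" by linarith
  have "cis (2 * pi * y) - 1 = cis (pi * y) * (cis (pi * y) - cis (- (pi * y)))"
    by (simp add: right_diff_distrib cis_mult mult.assoc)
  also have "cis (pi * y) - cis (- (pi * y)) = 2 * \<i> * of_real (sin (pi * y))"
    by (simp add: complex_eq_iff)
  finally have "norm (cis (2 * pi * y) - 1) = 2 * \<bar>sin (pi * y)\<bar>" by (simp add: norm_mult)
  also have "\<bar>sin (pi * y)\<bar> = \<bar>sin z\<bar>" by (cases "y \<ge> 0") (auto simp: z_def abs_if)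
  finally have "norm (cis (2 * pi * y) - 1) \<ge> 2 * z / 3" using s by linarith
  moreover have "3 * \<bar>y\<bar> \<le> pi * \<bar>y\<bar>" using pi_gt3 by (intro mult_right_mono) auto
  ultimately show ?thesis unfolding z_def by linarith
qed

lemma qnorm_ge_1: assumes "q \<noteq> 0" shows "qnorm q \<ge> 1"
proof -
  obtain i where "q $ i \<noteq> 0" using assms by (auto simp: vec_eq_iff)
  then have "1 \<le> real_of_int \<bar>q $ i\<bar>" by linarith
  also have "\<dots> \<le> qnorm q" unfolding qnorm_def by (rule member_le_sum) auto
  finally show ?thesis .
qed

text \<open>
  Modulo an integer, \<open>\<omega> \<bullet> q\<close> lies within distance \<open>1 / 2\<close> of zero, where \<open>\<bar>e\<^sup>2\<^sup>\<pi>\<^sup>i\<^sup>y - 1\<bar> \<ge> \<bar>y\<bar>\<close>; the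
  Diophantine condition bounds that distance from below.
\<close>

lemma diophantine_small_divisor:
  fixes \<omega> :: "real ^ 'd"
  assumes "diophantine \<omega>"
  obtains C \<tau> where "C > 0" "\<tau> > 0" "\<And>q. q \<noteq> 0 ==> norm (chr q \<omega> - 1) \<ge> C * qnorm q powr (- \<tau>)"
proof -
  obtain C \<tau> where C: "C > 0" and \<tau>: "\<tau> \<ge> real CARD('d)"
    and D: "\<And>(q :: int ^ 'd) (l :: int). q \<noteq> 0 ==>
       \<bar>(\<Sum>i\<in>UNIV. \<omega> $ i * of_int (q $ i)) - of_int l\<bar> \<ge> C * qnorm q powr (- \<tau>)"
    using assms unfolding diophantine_def qnorm_def of_int_sum[symmetric] of_int_abs[symmetric] by auto
  have "norm (chr q \<omega> - 1) \<ge> C * qnorm q powr (- \<tau>)" if q: "q \<noteq> 0" for q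
  proof -
    define x where "x = (\<Sum>i\<in>UNIV. of_int (q $ i) * \<omega> $ i)"
    define y where "y = x - of_int (round x)"
    have "\<bar>y\<bar> \<le> 1 / 2" using of_int_round_abs_le[of x] by (simp add: y_def abs_minus_commute)
    have "chr q \<omega> = cis (2 * pi * (y + of_int (round x)))" by (simp add: chr_def x_def y_def)
    also have "\<dots> = cis (2 * pi * y) * cis (2 * pi * of_int (round x))" by (simp only: cis_mult distrib_left)
    also have "\<dots> = cis (2 * pi * y)" by (simp only: cis_2pi_int mult_1_right)
    finally have "norm (chr q \<omega> - 1) \<ge> \<bar>y\<bar>" using norm_cis_minus_1_ge[OF \<open>\<bar>y\<bar> \<le> 1 / 2\<close>] by simp
    moreover have "\<bar>y\<bar> \<ge> C * qnorm q powr (- \<tau>)"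
      using D[OF q, of "round x"] by (simp add: y_def x_def mult.commute)
    ultimately show ?thesis by linarith
  qed
  moreover have "\<tau> > 0" using \<tau> zero_less_card_finite[where 'a = 'd] by linarith
  ultimately show ?thesis using that C by blast
qed

lemma small_divisor_slow_weight:
  assumes "diophantine \<omega>"
  shows "slow_weight (\<lambda>q. if q = 0 then 0 else 1 / (chr q \<omega> - 1))"
    and "q \<noteq> 0 ==> chr q \<omega> \<noteq> 1"
proof -
  obtain C \<tau> where C: "C > 0" "\<tau> > 0" and D: "\<And>q. q \<noteq> 0 ==> norm (chr q \<omega> - 1) \<ge> C * qnorm q powr (- \<tau>)"
    using diophantine_small_divisor[OF assms] by blast
  have pos: "q \<noteq> 0 ==> C * qnorm q powr (- \<tau>) > 0" for q using C qnorm_ge_1[of q] by simp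
  show "q \<noteq> 0 ==> chr q \<omega> \<noteq> 1" using D[of q] pos[of q] by auto
  show "slow_weight (\<lambda>q. if q = 0 then 0 else 1 / (chr q \<omega> - 1))"
    unfolding slow_weight_def
  proof (intro allI impI)
    fix \<epsilon> :: real assume \<epsilon>: "\<epsilon> > 0"
    define n where "n = nat \<lceil>\<tau>\<rceil>"
    have n: "real n \<ge> \<tau>" unfolding n_def by (rule real_nat_ceiling_ge)
    then have n: "real n \<ge> \<tau>" "n > 0" using C by (auto intro!: Nat.gr0I)
    define K where "K = (real n / \<epsilon>) ^ n / C"
    have "norm (if q = 0 then 0 else 1 / (chr q \<omega> - 1)) \<le> K * exp (\<epsilon> * qnorm q)" for q
    proof (cases "q = 0")
      case True then show ?thesis using C \<epsilon> by (simp add: K_def)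
    next
      case False
      have Q: "qnorm q \<ge> 1" using qnorm_ge_1 False .
      have p: "norm (chr q \<omega> - 1) > 0" using D[OF False] pos[OF False] by linarith
      have "norm (1 / (chr q \<omega> - 1)) \<le> 1 / (C * qnorm q powr (- \<tau>))"
        unfolding norm_divide norm_one using D[OF False]
        by (intro divide_left_mono mult_pos_pos[OF p pos[OF False]]) auto
      also have "\<dots> = qnorm q powr \<tau> / C" by (simp add: powr_minus field_simps)
      also have "\<dots> \<le> qnorm q ^ n / C"
        using C Q powr_mono[OF n(1) Q] by (intro divide_right_mono) (auto simp: powr_realpow)
      also have "qnorm q ^ n \<le> (real n / \<epsilon>) ^ n * exp (\<epsilon> * qnorm q)"
      proof -
        have "\<epsilon> * qnorm q / n \<le> exp (\<epsilon> * qnorm q / n)" using exp_ge_add_one_self[of "\<epsilon> * qnorm q / n"] by linarith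
        then have "(\<epsilon> * qnorm q / n) ^ n \<le> exp (\<epsilon> * qnorm q / n) ^ n" using \<epsilon> Q by (intro power_mono) auto
        also have "\<dots> = exp (\<epsilon> * qnorm q)" using n by (simp add: exp_of_nat_mult[symmetric])
        finally have "(real n / \<epsilon>) ^ n * (\<epsilon> * qnorm q / n) ^ n \<le> (real n / \<epsilon>) ^ n * exp (\<epsilon> * qnorm q)"
          using \<epsilon> by (intro mult_left_mono) auto
        then show ?thesis using n \<epsilon> by (simp add: power_mult_distrib[symmetric])
      qed
      finally show ?thesis using False C by (simp add: K_def divide_right_mono)
    qed
    then show "\<exists>K. \<forall>q. norm (if q = 0 then 0 else 1 / (chr q \<omega> - 1)) \<le> K * exp (\<epsilon> * qnorm q)" by blast
  qed
qed

text \<open>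
  The operator \<open>\<phi> \<mapsto> \<phi>(\<theta> + \<omega>) - \<phi>(\<theta>)\<close> multiplies the coefficient of frequency \<open>q\<close> by
  \<open>chr q \<omega> - 1\<close>. The multiplier with the inverse symbol, and with \<open>0\<close> at \<open>q = 0\<close>, inverts it on functions
  of average zero.
\<close>

lemma cohomological_solution_complex:
  fixes g :: "real ^ 'd => 'p::euclidean_space => complex"
  assumes g: "tan_on g V" and \<omega>: "diophantine \<omega>"
  obtains \<phi> where "tan_on \<phi> V" "\<And>\<mu>. \<mu> \<in> V ==> integral (cbox 0 1) (\<lambda>\<theta>. \<phi> \<theta> \<mu>) = 0"
    "\<And>\<theta> \<mu>. \<mu> \<in> V ==> \<phi> (\<theta> + \<omega>) \<mu> - \<phi> \<theta> \<mu> = g \<theta> \<mu> - integral (cbox 0 1) (\<lambda>\<theta>. g \<theta> \<mu>)"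
proof -
  define w where "w q = (if q = 0 then 0 else 1 / (chr q \<omega> - 1))" for q
  have w: "slow_weight w" unfolding w_def using small_divisor_slow_weight(1)[OF \<omega>] .
  have f0: "fco h 0 \<mu> = integral (cbox 0 1) (\<lambda>\<theta>. h \<theta> \<mu>)" for h :: "real ^ 'd => 'p => complex" and \<mu> by (simp add: fco_def)
  let ?\<phi> = "fmult w g"
  have \<phi>: "tan_on ?\<phi> V" by (rule fmult_tan_on[OF g w])
  have avg: "integral (cbox 0 1) (\<lambda>\<theta>. ?\<phi> \<theta> \<mu>) = 0" if "\<mu> \<in> V" for \<mu>
    using fco_fmult[OF g w that, of 0] by (simp add: f0 w_def)
  have eq: "?\<phi> (\<theta> + \<omega>) \<mu> - ?\<phi> \<theta> \<mu> = g \<theta> \<mu> - integral (cbox 0 1) (\<lambda>\<theta>. g \<theta> \<mu>)" if \<mu>: "\<mu> \<in> V" for \<theta> \<mu>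
  proof -
    have c: "continuous_on UNIV (\<lambda>\<theta>. ?\<phi> \<theta> \<mu>)" "torus_periodic (\<lambda>\<theta>. ?\<phi> \<theta> \<mu>)"
      "continuous_on UNIV (\<lambda>\<theta>. g \<theta> \<mu>)" "torus_periodic (\<lambda>\<theta>. g \<theta> \<mu>)"
      using tan_on_continuous[OF \<phi> \<mu>] tan_on_continuous[OF g \<mu>] \<phi> g by (auto simp: tan_on_def)
    have cs: "continuous_on UNIV (\<lambda>\<theta>. ?\<phi> (\<theta> + \<omega>) \<mu>)"
      by (intro continuous_on_compose2[OF c(1)] continuous_intros) auto
    have int: "(\<lambda>\<theta>. f \<theta> * cnj (chr q \<theta>)) integrable_on cbox 0 1" if "continuous_on UNIV f"
      for f :: "real ^ 'd => complex" and q
      by (intro integrable_continuous continuous_intros continuous_on_subset[OF that]) auto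
    have "(\<lambda>\<theta> \<mu>. ?\<phi> (\<theta> + \<omega>) \<mu> - ?\<phi> \<theta> \<mu>) \<theta> \<mu> = (\<lambda>\<theta> \<mu>. g \<theta> \<mu> - fco g 0 \<mu>) \<theta> \<mu>"
    proof (rule fco_all_eq_imp_eq[where g = "\<lambda>\<theta> \<mu>. ?\<phi> (\<theta> + \<omega>) \<mu> - ?\<phi> \<theta> \<mu>" and h = "\<lambda>\<theta> \<mu>. g \<theta> \<mu> - fco g 0 \<mu>"])
      show "continuous_on UNIV (\<lambda>\<theta>. ?\<phi> (\<theta> + \<omega>) \<mu> - ?\<phi> \<theta> \<mu>)" "continuous_on UNIV (\<lambda>\<theta>. g \<theta> \<mu> - fco g 0 \<mu>)"
        by (intro continuous_intros c cs)+
      show "torus_periodic (\<lambda>\<theta>. ?\<phi> (\<theta> + \<omega>) \<mu> - ?\<phi> \<theta> \<mu>)" "torus_periodic (\<lambda>\<theta>. g \<theta> \<mu> - fco g 0 \<mu>)"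
        using c torus_periodic_shift[OF c(2), of \<omega>] by (auto simp: torus_periodic_def)
      fix q
      have "fco (\<lambda>\<theta> \<mu>. ?\<phi> (\<theta> + \<omega>) \<mu> - ?\<phi> \<theta> \<mu>) q \<mu> = fco (\<lambda>\<theta>. ?\<phi> (\<theta> + \<omega>)) q \<mu> - fco ?\<phi> q \<mu>"
        using integral_diff[OF int[OF cs, of q] int[OF c(1), of q]] by (simp add: fco_def left_diff_distrib)
      also have "\<dots> = (chr q \<omega> - 1) * w q * fco g q \<mu>"
        using fco_rotate[of ?\<phi> \<mu>, OF c(1,2)] fco_fmult[OF g w \<mu>] by (simp add: left_diff_distrib)
      also have "\<dots> = (if q = 0 then 0 else fco g q \<mu>)"
        using small_divisor_slow_weight(2)[OF \<omega>, of q] by (simp add: w_def)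
      also have "\<dots> = fco (\<lambda>\<theta> \<mu>. g \<theta> \<mu> - fco g 0 \<mu>) q \<mu>"
      proof -
        have "fco (\<lambda>\<theta> \<mu>. g \<theta> \<mu> - fco g 0 \<mu>) q \<mu> = fco g q \<mu> - integral (cbox 0 1) (\<lambda>\<theta>. fco g 0 \<mu> * chr (- q) \<theta>)"
          using integral_diff[OF int[OF c(3), of q] int[OF continuous_on_const, of "fco g 0 \<mu>" q]]
          by (simp add: fco_def left_diff_distrib chr_minus)
        also have "integral (cbox 0 1) (\<lambda>\<theta>. fco g 0 \<mu> * chr (- q) \<theta>) = fco g 0 \<mu> * (if q = 0 then 1 else 0)"
          by (simp add: integral_chr)
        finally show ?thesis by auto
      qed
      finally show "fco (\<lambda>\<theta> \<mu>. ?\<phi> (\<theta> + \<omega>) \<mu> - ?\<phi> \<theta> \<mu>) q \<mu> = fco (\<lambda>\<theta> \<mu>. g \<theta> \<mu> - fco g 0 \<mu>) q \<mu>" .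
    qed
    then show ?thesis by (simp add: f0)
  qed
  show ?thesis using that[OF \<phi>] avg eq by blast
qed

section \<open>Calculus of analytic functions on the torus with parameters\<close>

lemma tan_onI:
  assumes "open V" "\<And>\<mu>. torus_periodic (\<lambda>\<theta>. g \<theta> \<mu>)"
    "\<And>\<theta> \<mu>. \<mu> \<in> V ==> an_at (\<lambda>z. g (fst z) (snd z)) (\<theta>, \<mu>)"
  shows "tan_on g V"
  using assms by (simp add: tan_on_def)

lemma tan_onD:
  assumes "tan_on g V"
  shows "open V" "torus_periodic (\<lambda>\<theta>. g \<theta> \<mu>)" "\<mu> \<in> V ==> an_at (\<lambda>z. g (fst z) (snd z)) (\<theta>, \<mu>)"
  using assms by (auto simp: tan_on_def)

lemma tan_on_apply:
  assumes g: "tan_on g V" and h: "\<And>y. an_at h y"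
  shows "tan_on (\<lambda>\<theta> \<mu>. h (g \<theta> \<mu>)) V"
proof (rule tan_onI)
  show "torus_periodic (\<lambda>\<theta>. h (g \<theta> \<mu>))" for \<mu> using tan_onD(2)[OF g, of \<mu>] by (simp add: torus_periodic_def)
  show "an_at (\<lambda>z. h (g (fst z) (snd z))) (\<theta>, \<mu>)" if "\<mu> \<in> V" for \<theta> \<mu>
    by (rule an_at_compose[OF tan_onD(3)[OF g that] h])
qed (rule tan_onD(1)[OF g])

lemma tan_on_Pair:
  assumes g: "tan_on g V" and h: "tan_on h W"
  shows "tan_on (\<lambda>\<theta> \<mu>. (g \<theta> \<mu>, h \<theta> \<mu>)) (V \<inter> W)"
proof (rule tan_onI)
  show "torus_periodic (\<lambda>\<theta>. (g \<theta> \<mu>, h \<theta> \<mu>))" for \<mu>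
    using tan_onD(2)[OF g, of \<mu>] tan_onD(2)[OF h, of \<mu>] by (simp add: torus_periodic_def)
  show "an_at (\<lambda>z. (g (fst z) (snd z), h (fst z) (snd z))) (\<theta>, \<mu>)" if "\<mu> \<in> V \<inter> W" for \<theta> \<mu>
    using that by (intro an_at_Pair tan_onD(3)[OF g] tan_onD(3)[OF h]) auto
qed (use tan_onD(1)[OF g] tan_onD(1)[OF h] in auto)

lemma ta_apply:
  assumes "torus_analytic_on f P" "\<And>y. an_at h y"
  shows "torus_analytic_on (\<lambda>\<theta> \<mu>. h (f \<theta> \<mu>)) P"
proof -
  obtain V g where "P \<subseteq> V" "tan_on g V" "\<forall>\<theta>. \<forall>\<mu>\<in>P. f \<theta> \<mu> = g \<theta> \<mu>"
    using assms(1) unfolding torus_analytic_on_iff by blast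
  then show ?thesis unfolding torus_analytic_on_iff
    by (intro exI[of _ V] exI[of _ "\<lambda>\<theta> \<mu>. h (g \<theta> \<mu>)"]) (auto intro: tan_on_apply assms)
qed

lemma ta_Pair:
  assumes "torus_analytic_on f P" "torus_analytic_on f' P"
  shows "torus_analytic_on (\<lambda>\<theta> \<mu>. (f \<theta> \<mu>, f' \<theta> \<mu>)) P"
proof -
  obtain V g where "P \<subseteq> V" "tan_on g V" "\<forall>\<theta>. \<forall>\<mu>\<in>P. f \<theta> \<mu> = g \<theta> \<mu>"
    using assms(1) unfolding torus_analytic_on_iff by blast
  moreover obtain V' g' where "P \<subseteq> V'" "tan_on g' V'" "\<forall>\<theta>. \<forall>\<mu>\<in>P. f' \<theta> \<mu> = g' \<theta> \<mu>"
    using assms(2) unfolding torus_analytic_on_iff by blast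
  ultimately show ?thesis unfolding torus_analytic_on_iff
    by (intro exI[of _ "V \<inter> V'"] exI[of _ "\<lambda>\<theta> \<mu>. (g \<theta> \<mu>, g' \<theta> \<mu>)"]) (auto intro: tan_on_Pair)
qed

lemma ta_cong:
  assumes "torus_analytic_on f P" "\<And>\<theta> \<mu>. \<mu> \<in> P ==> f \<theta> \<mu> = g \<theta> \<mu>"
  shows "torus_analytic_on g P"
  using assms unfolding torus_analytic_on_iff by (metis (no_types, opaque_lifting))

lemma ta_const [simp, intro]: "torus_analytic_on (\<lambda>_ _. c) P"
  unfolding torus_analytic_on_iff
  by (intro exI[of _ UNIV] exI[of _ "\<lambda>_ _. c"]) (auto intro!: tan_onI simp: torus_periodic_def)

lemma ta_linear: "torus_analytic_on f P ==> bounded_linear T ==> torus_analytic_on (\<lambda>\<theta> \<mu>. T (f \<theta> \<mu>)) P"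
  by (rule ta_apply) (auto intro: an_at_bl)

lemma ta_add: "torus_analytic_on f P ==> torus_analytic_on g P ==> torus_analytic_on (\<lambda>\<theta> \<mu>. f \<theta> \<mu> + g \<theta> \<mu>) P"
  using ta_linear[OF ta_Pair bounded_linear_add[OF bounded_linear_fst bounded_linear_snd], of f P g] by simp

lemma ta_minus: "torus_analytic_on f P ==> torus_analytic_on (\<lambda>\<theta> \<mu>. - f \<theta> \<mu>) P"
  by (rule ta_linear[OF _ bounded_linear_minus[OF bounded_linear_ident]])

lemma ta_diff: "torus_analytic_on f P ==> torus_analytic_on g P ==> torus_analytic_on (\<lambda>\<theta> \<mu>. f \<theta> \<mu> - g \<theta> \<mu>) P"
  using ta_add[of f P "\<lambda>\<theta> \<mu>. - g \<theta> \<mu>"] ta_minus by auto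

lemma ta_scaleR:
  fixes f :: "real ^ 'd => 'p::euclidean_space => real" and g :: "real ^ 'd => 'p => 'b::euclidean_space"
  assumes "torus_analytic_on f P" "torus_analytic_on g P"
  shows "torus_analytic_on (\<lambda>\<theta> \<mu>. f \<theta> \<mu> *\<^sub>R g \<theta> \<mu>) P"
  using ta_apply[OF ta_Pair[OF assms], of "\<lambda>z. fst z *\<^sub>R snd z"]
  by (simp add: an_at_scaleR an_at_bl bounded_linear_fst bounded_linear_snd)

lemma ta_mult:
  fixes f g :: "real ^ 'd => 'p::euclidean_space => real"
  shows "torus_analytic_on f P ==> torus_analytic_on g P ==> torus_analytic_on (\<lambda>\<theta> \<mu>. f \<theta> \<mu> * g \<theta> \<mu>) P"
  using ta_scaleR[of f P g] by simp

lemma ta_sum: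
  assumes "\<And>i. i \<in> I ==> torus_analytic_on (f i) P"
  shows "torus_analytic_on (\<lambda>\<theta> \<mu>. \<Sum>i\<in>I. f i \<theta> \<mu>) P"
  using assms by (induction I rule: infinite_finite_induct) (auto intro: ta_add)

lemma ta_shift:
  assumes "torus_analytic_on f P" shows "torus_analytic_on (\<lambda>\<theta> \<mu>. f (\<theta> + t) \<mu>) P"
proof -
  obtain V g where g: "P \<subseteq> V" "tan_on g V" "\<forall>\<theta>. \<forall>\<mu>\<in>P. f \<theta> \<mu> = g \<theta> \<mu>"
    using assms(1) unfolding torus_analytic_on_iff by blast
  have "tan_on (\<lambda>\<theta> \<mu>. g (\<theta> + t) \<mu>) V"
  proof (rule tan_onI)
    show "an_at (\<lambda>z. g (fst z + t) (snd z)) (\<theta>, \<mu>)" if "\<mu> \<in> V" for \<theta> \<mu>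
    proof -
      have "an_at (\<lambda>z. g (fst (z + (t, 0))) (snd (z + (t, 0)))) (\<theta>, \<mu>)"
        by (rule an_at_compose[where f = "\<lambda>z. g (fst z) (snd z)"])
           (use tan_onD(3)[OF g(2) that] in \<open>auto intro!: an_at_add an_at_ident\<close>)
      then show ?thesis by simp
    qed
  qed (use tan_onD[OF g(2)] in \<open>auto intro: torus_periodic_shift\<close>)
  then show ?thesis using g unfolding torus_analytic_on_iff by blast
qed

lemma ta_continuous:
  assumes "torus_analytic_on f P" "\<mu> \<in> P"
  shows "continuous_on S (\<lambda>\<theta>. f \<theta> \<mu>)" "torus_periodic (\<lambda>\<theta>. f \<theta> \<mu>)" "(\<lambda>\<theta>. f \<theta> \<mu>) integrable_on cbox 0 1"
proof -
  obtain V g where g: "P \<subseteq> V" "tan_on g V" "\<And>\<theta> \<mu>. \<mu> \<in> P ==> f \<theta> \<mu> = g \<theta> \<mu>"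
    using assms(1) unfolding torus_analytic_on_iff by blast
  show c: "continuous_on S (\<lambda>\<theta>. f \<theta> \<mu>)" for S
    using tan_on_continuous[OF g(2), of \<mu>] g assms(2) by auto
  show "torus_periodic (\<lambda>\<theta>. f \<theta> \<mu>)" using tan_onD(2)[OF g(2), of \<mu>] g assms(2) by simp
  show "(\<lambda>\<theta>. f \<theta> \<mu>) integrable_on cbox 0 1" by (intro integrable_continuous c)
qed

text \<open>
  The average is the Fourier multiplier whose symbol is the indicator of \<open>q = 0\<close>; hence it is analytic
  in the parameter.
\<close>

lemma tan_on_avg:
  fixes g :: "real ^ 'd => 'p::euclidean_space => real"
  assumes g: "tan_on g V"
  shows "tan_on (\<lambda>\<theta> \<mu>. Re (fmult (\<lambda>q. if q = 0 then 1 else 0) (\<lambda>\<theta> \<mu>. of_real (g \<theta> \<mu>)) \<theta> \<mu>)) V"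
    and "\<mu> \<in> V ==> Re (fmult (\<lambda>q. if q = 0 then 1 else 0) (\<lambda>\<theta> \<mu>. of_real (g \<theta> \<mu>)) \<theta> \<mu>) = integral (cbox 0 1) (\<lambda>\<theta>. g \<theta> \<mu>)"
proof -
  let ?g = "\<lambda>\<theta> \<mu>. complex_of_real (g \<theta> \<mu>)"
  let ?w = "\<lambda>q :: int ^ 'd. if q = 0 then 1 else (0::complex)"
  have tg: "tan_on ?g V" by (rule tan_on_apply[OF g]) (rule an_at_bl[OF bounded_linear_of_real])
  have w: "slow_weight ?w" unfolding slow_weight_def
  proof (intro allI impI exI[of _ 1])
    fix \<epsilon> :: real and q :: "int ^ 'd" assume "\<epsilon> > 0"
    moreover have "0 \<le> qnorm q" unfolding qnorm_def by (intro sum_nonneg) simp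
    ultimately have "1 \<le> exp (\<epsilon> * qnorm q)" by simp
    moreover have "norm (if b then 1 else (0::complex)) \<le> 1" for b by simp
    ultimately show "norm (?w q) \<le> 1 * exp (\<epsilon> * qnorm q)" unfolding mult_1_left by (meson order_trans)
  qed
  show "tan_on (\<lambda>\<theta> \<mu>. Re (fmult ?w ?g \<theta> \<mu>)) V"
    by (rule tan_on_apply[OF fmult_tan_on[OF tg w]]) (rule an_at_bl[OF bounded_linear_Re])
  assume \<mu>: "\<mu> \<in> V"
  have "((\<lambda>q. ?w q * fco ?g q \<mu> * chr q \<theta>) has_sum fco ?g 0 \<mu>) UNIV"
    by (rule has_sum_finite_neutralI[where B = "{0}"]) auto
  then have "fmult ?w ?g \<theta> \<mu> = fco ?g 0 \<mu>"
    using has_sum_unique fmult_has_sum[OF tg w \<mu>] by blast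
  also have "\<dots> = of_real (integral (cbox 0 1) (\<lambda>\<theta>. g \<theta> \<mu>))"
    using integral_linear[OF integrable_continuous[OF tan_on_continuous[OF g \<mu>]] bounded_linear_of_real]
    by (simp add: fco_def o_def)
  finally show "Re (fmult ?w ?g \<theta> \<mu>) = integral (cbox 0 1) (\<lambda>\<theta>. g \<theta> \<mu>)" by simp
qed

lemma torus_avg_inner:
  assumes "torus_analytic_on f P" "\<mu> \<in> P"
  shows "torus_avg f \<mu> \<bullet> b = torus_avg (\<lambda>\<theta> \<mu>. f \<theta> \<mu> \<bullet> b) \<mu>"
  unfolding torus_avg_def by (rule integral_component_eq[symmetric, OF ta_continuous(3)[OF assms]])

lemma ta_avg:
  fixes f :: "real ^ 'd => 'p::euclidean_space => 'b::euclidean_space"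
  assumes "torus_analytic_on f P"
  shows "torus_analytic_on (\<lambda>\<theta>::real^'d. torus_avg f) P"
proof -
  have r: "torus_analytic_on (\<lambda>\<theta>::real^'d. torus_avg h) P" if th: "torus_analytic_on h P" for h :: "real ^ 'd => 'p => real"
  proof -
    obtain V g where g: "P \<subseteq> V" "tan_on g V" "\<And>\<theta> \<mu>. \<mu> \<in> P ==> h \<theta> \<mu> = g \<theta> \<mu>"
      using th unfolding torus_analytic_on_iff by blast
    show ?thesis unfolding torus_analytic_on_iff
    proof (intro exI conjI)
      show "P \<subseteq> V" by fact
      show "tan_on (\<lambda>\<theta> \<mu>. Re (fmult (\<lambda>q. if q = 0 then 1 else 0) (\<lambda>\<theta> \<mu>. of_real (g \<theta> \<mu>)) \<theta> \<mu>)) V"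
        by (rule tan_on_avg(1)[OF g(2)])
      show "\<forall>\<theta>. \<forall>\<mu>\<in>P. torus_avg h \<mu> = Re (fmult (\<lambda>q. if q = 0 then 1 else 0) (\<lambda>\<theta> \<mu>. of_real (g \<theta> \<mu>)) \<theta> \<mu>)"
        using tan_on_avg(2)[OF g(2)] g by (auto simp: torus_avg_def subset_iff)
    qed
  qed
  have "torus_analytic_on (\<lambda>(\<theta>::real^'d) \<mu>. \<Sum>b\<in>Basis. torus_avg (\<lambda>\<theta> \<mu>. f \<theta> \<mu> \<bullet> b) \<mu> *\<^sub>R b) P"
    by (intro ta_sum ta_scaleR r ta_const ta_linear[OF assms bounded_linear_inner_left])
  then show ?thesis
    by (rule ta_cong) (simp add: torus_avg_inner[OF assms, symmetric] euclidean_representation)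
qed

lemma ta_osc: "torus_analytic_on f P ==> torus_analytic_on (torus_osc f) P"
  unfolding torus_osc_def by (intro ta_diff ta_avg)

lemma torus_avg_add:
  assumes "torus_analytic_on f P" "torus_analytic_on g P" "\<mu> \<in> P"
  shows "torus_avg (\<lambda>\<theta> \<mu>. f \<theta> \<mu> + g \<theta> \<mu>) \<mu> = torus_avg f \<mu> + torus_avg g \<mu>"
  unfolding torus_avg_def by (intro integral_add ta_continuous(3)[OF assms(1,3)] ta_continuous(3)[OF assms(2,3)])

lemma torus_avg_diff:
  assumes "torus_analytic_on f P" "torus_analytic_on g P" "\<mu> \<in> P"
  shows "torus_avg (\<lambda>\<theta> \<mu>. f \<theta> \<mu> - g \<theta> \<mu>) \<mu> = torus_avg f \<mu> - torus_avg g \<mu>"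
  unfolding torus_avg_def by (intro integral_diff ta_continuous(3)[OF assms(1,3)] ta_continuous(3)[OF assms(2,3)])

lemma torus_avg_mult_right: "torus_avg (\<lambda>\<theta> \<mu>. (f \<theta> \<mu> :: real) * c \<mu>) \<mu> = torus_avg f \<mu> * c \<mu>"
  unfolding torus_avg_def by (rule integral_mult_left)

lemma torus_avg_bar: "torus_avg (\<lambda>\<theta>::real^'d. h) \<mu> = h \<mu>"
  unfolding torus_avg_def by (rule torus_int_const)

lemma torus_avg_osc: "torus_analytic_on f P ==> \<mu> \<in> P ==> torus_avg (torus_osc f) \<mu> = 0"
  unfolding torus_osc_def[abs_def]
  by (subst torus_avg_diff) (auto intro: ta_avg simp: torus_avg_bar)

section \<open>The small divisors equation\<close>

text \<open>
  An extension to an open set of parameters is solved for each component separately, and the solution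
  is cut off outside \<open>\<Lambda>\<close>.
\<close>

lemma SD_exists:
  fixes h :: "real ^ 'd => 'p::euclidean_space => 'b::euclidean_space"
  assumes h: "torus_analytic_on h \<Lambda>" and avg: "\<And>\<mu>. \<mu> \<in> \<Lambda> ==> torus_avg h \<mu> = 0" and \<omega>: "diophantine \<omega>"
  shows "\<exists>\<phi>. torus_analytic_on \<phi> \<Lambda> \<and> (\<forall>\<mu>\<in>\<Lambda>. torus_avg \<phi> \<mu> = 0) \<and>
     (\<forall>\<mu>\<in>\<Lambda>. \<forall>\<theta>. \<phi> (\<theta> + \<omega>) \<mu> - \<phi> \<theta> \<mu> = h \<theta> \<mu>) \<and> (\<forall>\<mu>. \<mu> \<notin> \<Lambda> \<longrightarrow> (\<forall>\<theta>. \<phi> \<theta> \<mu> = 0))"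
proof -
  obtain V g where g: "\<Lambda> \<subseteq> V" "tan_on g V" "\<And>\<theta> \<mu>. \<mu> \<in> \<Lambda> ==> h \<theta> \<mu> = g \<theta> \<mu>"
    using h unfolding torus_analytic_on_iff by blast
  have "\<exists>\<phi>. tan_on \<phi> V \<and> (\<forall>\<mu>\<in>V. integral (cbox 0 1) (\<lambda>\<theta>. \<phi> \<theta> \<mu>) = 0) \<and>
      (\<forall>\<mu>\<in>V. \<forall>\<theta>. \<phi> (\<theta> + \<omega>) \<mu> - \<phi> \<theta> \<mu> = g \<theta> \<mu> \<bullet> b - integral (cbox 0 1) (\<lambda>\<theta>. g \<theta> \<mu> \<bullet> b))" for b
  proof -
    have gb: "tan_on (\<lambda>\<theta> \<mu>. g \<theta> \<mu> \<bullet> b) V" by (rule tan_on_apply[OF g(2)]) (rule an_at_bl[OF bounded_linear_inner_left])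
    then have gc: "tan_on (\<lambda>\<theta> \<mu>. complex_of_real (g \<theta> \<mu> \<bullet> b)) V"
      by (rule tan_on_apply) (rule an_at_bl[OF bounded_linear_of_real])
    obtain \<phi> where \<phi>: "tan_on \<phi> V" "\<And>\<mu>. \<mu> \<in> V ==> integral (cbox 0 1) (\<lambda>\<theta>. \<phi> \<theta> \<mu>) = 0"
      "\<And>\<theta> \<mu>. \<mu> \<in> V ==> \<phi> (\<theta> + \<omega>) \<mu> - \<phi> \<theta> \<mu> = complex_of_real (g \<theta> \<mu> \<bullet> b) - integral (cbox 0 1) (\<lambda>\<theta>. complex_of_real (g \<theta> \<mu> \<bullet> b))"
      by (rule cohomological_solution_complex[OF gc \<omega>]) (rule that)
    have i: "integral (cbox 0 1) (\<lambda>\<theta>. complex_of_real (g \<theta> \<mu> \<bullet> b)) = of_real (integral (cbox 0 1) (\<lambda>\<theta>. g \<theta> \<mu> \<bullet> b))" if "\<mu> \<in> V" for \<mu>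
      using integral_linear[OF integrable_continuous[OF tan_on_continuous[OF gb that]] bounded_linear_of_real]
      by (simp add: o_def)
    show ?thesis
    proof (intro exI[of _ "\<lambda>\<theta> \<mu>. Re (\<phi> \<theta> \<mu>)"] conjI ballI allI)
      show "tan_on (\<lambda>\<theta> \<mu>. Re (\<phi> \<theta> \<mu>)) V" by (rule tan_on_apply[OF \<phi>(1)]) (rule an_at_bl[OF bounded_linear_Re])
      fix \<mu> assume \<mu>: "\<mu> \<in> V"
      show "integral (cbox 0 1) (\<lambda>\<theta>. Re (\<phi> \<theta> \<mu>)) = 0"
        using integral_linear[OF integrable_continuous[OF tan_on_continuous[OF \<phi>(1) \<mu>]] bounded_linear_Re] \<phi>(2)[OF \<mu>]
        by (simp add: o_def)
      show "Re (\<phi> (\<theta> + \<omega>) \<mu>) - Re (\<phi> \<theta> \<mu>) = g \<theta> \<mu> \<bullet> b - integral (cbox 0 1) (\<lambda>\<theta>. g \<theta> \<mu> \<bullet> b)" for \<theta>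
        using arg_cong[OF \<phi>(3)[OF \<mu>, of \<theta>], of Re] i[OF \<mu>] by simp
    qed
  qed
  then obtain \<Phi> where \<Phi>: "\<And>b. tan_on (\<Phi> b) V" "\<And>b \<mu>. \<mu> \<in> V ==> integral (cbox 0 1) (\<lambda>\<theta>. \<Phi> b \<theta> \<mu>) = 0"
    "\<And>b \<mu> \<theta>. \<mu> \<in> V ==> \<Phi> b (\<theta> + \<omega>) \<mu> - \<Phi> b \<theta> \<mu> = g \<theta> \<mu> \<bullet> b - integral (cbox 0 1) (\<lambda>\<theta>. g \<theta> \<mu> \<bullet> b)"
    by metis
  define \<phi> where "\<phi> \<theta> \<mu> = (if \<mu> \<in> \<Lambda> then \<Sum>b\<in>Basis. \<Phi> b \<theta> \<mu> *\<^sub>R b else 0)" for \<theta> \<mu>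
  have t\<Phi>: "torus_analytic_on (\<Phi> b) \<Lambda>" for b using \<Phi>(1) g(1) unfolding torus_analytic_on_iff by blast
  have "torus_analytic_on (\<lambda>\<theta> \<mu>. \<Sum>b\<in>Basis. \<Phi> b \<theta> \<mu> *\<^sub>R b) \<Lambda>"
    by (intro ta_sum ta_scaleR t\<Phi> ta_const)
  then have t: "torus_analytic_on \<phi> \<Lambda>" by (rule ta_cong) (simp add: \<phi>_def)
  moreover have "torus_avg \<phi> \<mu> = 0" if \<mu>: "\<mu> \<in> \<Lambda>" for \<mu>
  proof (rule euclidean_eqI)
    fix b :: 'b assume b: "b \<in> Basis"
    have "torus_avg \<phi> \<mu> \<bullet> b = integral (cbox 0 1) (\<lambda>\<theta>. \<phi> \<theta> \<mu> \<bullet> b)"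
      using torus_avg_inner[OF t \<mu>] by (simp add: torus_avg_def)
    also have "\<dots> = integral (cbox 0 1) (\<lambda>\<theta>. \<Phi> b \<theta> \<mu>)" using \<mu> b by (simp add: \<phi>_def)
    finally show "torus_avg \<phi> \<mu> \<bullet> b = 0 \<bullet> b" using \<Phi>(2)[of \<mu> b] \<mu> g(1) by auto
  qed
  moreover have "\<phi> (\<theta> + \<omega>) \<mu> - \<phi> \<theta> \<mu> = h \<theta> \<mu>" if \<mu>: "\<mu> \<in> \<Lambda>" for \<mu> \<theta>
  proof (rule euclidean_eqI)
    fix b :: 'b assume b: "b \<in> Basis"
    have "integral (cbox 0 1) (\<lambda>\<theta>. g \<theta> \<mu> \<bullet> b) = torus_avg h \<mu> \<bullet> b"
      using torus_avg_inner[OF h \<mu>] g(3)[OF \<mu>] by (simp add: torus_avg_def)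
    then have "\<Phi> b (\<theta> + \<omega>) \<mu> - \<Phi> b \<theta> \<mu> = h \<theta> \<mu> \<bullet> b" using \<Phi>(3)[of \<mu> b \<theta>] \<mu> g avg by auto
    then show "(\<phi> (\<theta> + \<omega>) \<mu> - \<phi> \<theta> \<mu>) \<bullet> b = h \<theta> \<mu> \<bullet> b"
      using \<mu> b by (simp add: \<phi>_def inner_diff_left)
  qed
  ultimately show ?thesis by (intro exI[of _ \<phi>]) (auto simp: \<phi>_def)
qed

text \<open>
  Invariance gives \<open>(chr q \<omega> - 1) * f\<^sub>q = 0\<close> for the Fourier coefficients \<open>f\<^sub>q\<close>, and \<open>chr q \<omega> \<noteq> 1\<close> for
  \<open>q \<noteq> 0\<close>.
\<close>

lemma invariant_zero_avg_imp_zero: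
  fixes f :: "real ^ 'd => 'b::euclidean_space"
  assumes c: "continuous_on UNIV f" and p: "torus_periodic f" and inv: "\<And>\<theta>. f (\<theta> + \<omega>) = f \<theta>"
    and avg: "integral (cbox 0 1) f = 0" and \<omega>: "diophantine \<omega>"
  shows "f \<theta> = 0"
proof (rule euclidean_eqI)
  fix b :: 'b assume b: "b \<in> Basis"
  define g where "g \<theta> (\<mu>::real) = complex_of_real (f \<theta> \<bullet> b)" for \<theta> \<mu>
  have g: "continuous_on UNIV (\<lambda>\<theta>. g \<theta> 0)" "torus_periodic (\<lambda>\<theta>. g \<theta> 0)"
    unfolding g_def using c p by (auto intro!: continuous_intros simp: torus_periodic_def)
  have "f integrable_on cbox 0 1" by (intro integrable_continuous continuous_on_subset[OF c]) auto
  then have "((\<lambda>\<theta>. complex_of_real (f \<theta> \<bullet> b)) has_integral of_real (0 \<bullet> b)) (cbox 0 1)"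
    using has_integral_linear[OF integrable_integral bounded_linear_compose[OF bounded_linear_of_real bounded_linear_inner_left[of b]], of f "cbox 0 1"]
      avg by (simp add: o_def)
  then have "fco g 0 0 = 0" by (simp add: fco_def g_def integral_unique)
  moreover have "fco g q 0 = 0" if "q \<noteq> 0" for q
  proof -
    have "fco g q 0 = fco (\<lambda>\<theta>. g (\<theta> + \<omega>)) q 0" by (simp add: fco_def g_def inv)
    also have "\<dots> = chr q \<omega> * fco g q 0" by (rule fco_rotate[of g 0, OF g])
    finally show ?thesis using small_divisor_slow_weight(2)[OF \<omega> that] by simp
  qed
  ultimately have z: "fco g q 0 = fco (\<lambda>_ _. 0) q 0" for q
    by (cases "q = 0") (auto simp: fco_def)
  have "g \<theta> 0 = (\<lambda>_ _. 0) \<theta> 0"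
    by (rule fco_all_eq_imp_eq[where g = g and \<mu> = 0 and h = "\<lambda>_ _. 0", OF g _ _ z]) (auto simp: torus_periodic_def)
  then show "f \<theta> \<bullet> b = 0 \<bullet> b" by (simp add: g_def)
qed

lemma SD_props:
  fixes h :: "real ^ 'd => 'p::euclidean_space => 'b::euclidean_space"
  assumes h: "torus_analytic_on h \<Lambda>" and avg: "\<And>\<mu>. \<mu> \<in> \<Lambda> ==> torus_avg h \<mu> = 0" and \<omega>: "diophantine \<omega>"
  shows "torus_analytic_on (SD \<omega> \<Lambda> h) \<Lambda>" "\<And>\<mu>. \<mu> \<in> \<Lambda> ==> torus_avg (SD \<omega> \<Lambda> h) \<mu> = 0"
    "\<And>\<mu> \<theta>. \<mu> \<in> \<Lambda> ==> SD \<omega> \<Lambda> h (\<theta> + \<omega>) \<mu> - SD \<omega> \<Lambda> h \<theta> \<mu> = h \<theta> \<mu>"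
proof -
  let ?P = "\<lambda>\<phi>. torus_analytic_on \<phi> \<Lambda> \<and> (\<forall>\<mu>\<in>\<Lambda>. torus_avg \<phi> \<mu> = 0) \<and>
     (\<forall>\<mu>\<in>\<Lambda>. \<forall>\<theta>. \<phi> (\<theta> + \<omega>) \<mu> - \<phi> \<theta> \<mu> = h \<theta> \<mu>) \<and> (\<forall>\<mu>. \<mu> \<notin> \<Lambda> \<longrightarrow> (\<forall>\<theta>. \<phi> \<theta> \<mu> = 0))"
  obtain \<phi> where \<phi>: "?P \<phi>" using SD_exists[OF assms] by blast
  have uni: "\<psi> = \<phi>" if \<psi>: "?P \<psi>" for \<psi>
  proof (intro ext)
    fix \<theta> \<mu>
    show "\<psi> \<theta> \<mu> = \<phi> \<theta> \<mu>"
    proof (cases "\<mu> \<in> \<Lambda>")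
      case True
      have t: "torus_analytic_on (\<lambda>\<theta> \<mu>. \<psi> \<theta> \<mu> - \<phi> \<theta> \<mu>) \<Lambda>" using \<phi> \<psi> by (intro ta_diff) auto
      have "\<psi> \<theta> \<mu> - \<phi> \<theta> \<mu> = 0"
      proof (rule invariant_zero_avg_imp_zero[OF ta_continuous(1,2)[OF t True] _ _ \<omega>])
        show "\<psi> (\<theta> + \<omega>) \<mu> - \<phi> (\<theta> + \<omega>) \<mu> = \<psi> \<theta> \<mu> - \<phi> \<theta> \<mu>" for \<theta>
        proof -
          have "\<psi> (\<theta> + \<omega>) \<mu> - \<psi> \<theta> \<mu> = \<phi> (\<theta> + \<omega>) \<mu> - \<phi> \<theta> \<mu>" using \<phi> \<psi> True by simp
          then show ?thesis by (simp add: algebra_simps)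
        qed
        show "integral (cbox 0 1) (\<lambda>\<theta>. \<psi> \<theta> \<mu> - \<phi> \<theta> \<mu>) = 0"
          using torus_avg_diff[of \<psi> \<Lambda> \<phi> \<mu>] \<phi> \<psi> True by (simp add: torus_avg_def)
      qed
      then show ?thesis by simp
    next
      case False then show ?thesis using \<phi> \<psi> by simp
    qed
  qed
  have "?P (SD \<omega> \<Lambda> h)" unfolding SD_def by (rule theI[where P = ?P, OF \<phi> uni])
  then show "torus_analytic_on (SD \<omega> \<Lambda> h) \<Lambda>" "\<And>\<mu>. \<mu> \<in> \<Lambda> ==> torus_avg (SD \<omega> \<Lambda> h) \<mu> = 0"
    "\<And>\<mu> \<theta>. \<mu> \<in> \<Lambda> ==> SD \<omega> \<Lambda> h (\<theta> + \<omega>) \<mu> - SD \<omega> \<Lambda> h \<theta> \<mu> = h \<theta> \<mu>"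
    by blast+
qed

text \<open>
  Coefficients independent of the angles are treated as functions on the torus, so that one calculus
  serves both kinds of coefficients.
\<close>

lemma bar_coeff_iff: "bar_coeff \<Lambda> h \<longleftrightarrow> torus_analytic_on (\<lambda>\<theta>::real^'d. h) \<Lambda>"
proof
  assume "bar_coeff \<Lambda> h"
  then obtain V g where g: "open V" "\<Lambda> \<subseteq> V" "\<forall>\<mu>\<in>\<Lambda>. h \<mu> = g \<mu>" "\<And>\<mu>. \<mu> \<in> V ==> an_at g \<mu>"
    unfolding bar_coeff_def real_analytic_on_iff by blast
  have "tan_on (\<lambda>\<theta>::real^'d. g) V"
    by (rule tan_onI[OF g(1)]) (auto simp: torus_periodic_def intro!: an_at_compose[where f = g] an_at_bl[OF bounded_linear_snd] g)
  then show "torus_analytic_on (\<lambda>\<theta>::real^'d. h) \<Lambda>" using g unfolding torus_analytic_on_iff by blast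
next
  assume "torus_analytic_on (\<lambda>\<theta>::real^'d. h) \<Lambda>"
  then obtain V and g :: "real ^ 'd => real ^ 'a => 'b" where g: "\<Lambda> \<subseteq> V" "tan_on g V" "\<And>\<theta> \<mu>. \<mu> \<in> \<Lambda> ==> h \<mu> = g \<theta> \<mu>"
    unfolding torus_analytic_on_iff by blast
  have "an_at (\<lambda>\<mu>. g 0 \<mu>) \<mu>" if "\<mu> \<in> V" for \<mu>
  proof -
    have "an_at (\<lambda>\<mu>. g (fst (0::real^'d, \<mu>)) (snd (0::real^'d, \<mu>))) \<mu>"
      by (rule an_at_compose[where f = "\<lambda>z. g (fst z) (snd z)"])
         (use tan_onD(3)[OF g(2) that] in \<open>auto intro!: an_at_Pair an_at_ident\<close>)
    then show ?thesis by simp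
  qed
  then show "bar_coeff \<Lambda> h" unfolding bar_coeff_def real_analytic_on_iff
    using g tan_onD(1)[OF g(2)] by (intro exI[of _ V] exI[of _ "g 0"]) auto
qed

lemma bar_coeff_powr:
  fixes h :: "real ^ 'm => real"
  assumes "bar_coeff \<Lambda> h" "\<And>\<mu>. \<mu> \<in> \<Lambda> ==> h \<mu> > 0"
  shows "bar_coeff \<Lambda> (\<lambda>\<mu>. h \<mu> powr e)"
proof -
  obtain V g where g: "open V" "\<Lambda> \<subseteq> V" "\<forall>\<mu>\<in>\<Lambda>. h \<mu> = g \<mu>" "\<And>\<mu>. \<mu> \<in> V ==> an_at g \<mu>"
    using assms(1) unfolding bar_coeff_def real_analytic_on_iff by blast
  have "continuous_on V g" by (intro continuous_at_imp_continuous_on ballI an_at_isCont g)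
  then have "open (V \<inter> g -` {0<..})" using g(1) by (rule continuous_open_preimage) auto
  then show ?thesis unfolding bar_coeff_def real_analytic_on_iff using g assms(2)
    by (intro exI[of _ "V \<inter> g -` {0<..}"] exI[of _ "\<lambda>\<mu>. g \<mu> powr e"]) (auto intro!: an_at_powr)
qed

text \<open>
  Expansion in the auxiliary variables \<open>z\<close> at \<open>0\<close>, with coefficients that are analytic on the torus. By
  compactness, radius and bound are uniform in the angles and locally uniform in the parameters; the
  estimates \<open>O_pow\<close> rest on this.
\<close>

lemma taylor_expansion:
  fixes f :: "real ^ 'd => 'z::euclidean_space \<times> 'p::euclidean_space => 'b::euclidean_space"
  assumes f: "torus_analytic_on f (Z \<times> \<Lambda>)" and Z: "0 \<in> interior Z"
  obtains C where "\<And>\<gamma>. \<gamma> \<in> midx ==> torus_analytic_on (C \<gamma>) \<Lambda>"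
    "\<And>L. compact L ==> L \<subseteq> \<Lambda> ==> \<exists>\<rho>>0. \<exists>M. \<forall>\<theta>. \<forall>\<mu>\<in>L. psf \<rho> M (\<lambda>\<gamma>. C \<gamma> \<theta> \<mu>) (\<lambda>z. f \<theta> (z, \<mu>))"
proof -
  obtain W g where g: "Z \<times> \<Lambda> \<subseteq> W" "tan_on g W" "\<And>\<theta> \<zeta>. \<zeta> \<in> Z \<times> \<Lambda> ==> f \<theta> \<zeta> = g \<theta> \<zeta>"
    using f unfolding torus_analytic_on_iff by blast
  define W0 where "W0 = Pair 0 -` W"
  have W0: "open W0" "\<Lambda> \<subseteq> W0"
    using g(1) interior_subset[of Z] Z tan_onD(1)[OF g(2)]
    by (auto simp: W0_def intro!: open_vimage continuous_intros)
  define C where "C \<gamma> \<theta> \<mu> = tcoef (\<lambda>z. g \<theta> (z, \<mu>)) \<gamma>" for \<gamma> \<theta> \<mu>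
  define \<Phi> where "\<Phi> x = g (fst (fst (snd x), (fst x, snd (snd x)))) (snd (fst (snd x), (fst x, snd (snd x))))"
    for x :: "'z \<times> ((real ^ 'd) \<times> 'p)"
  have \<Phi>: "(\<lambda>z. \<Phi> (z, w)) = (\<lambda>z. g (fst w) (z, snd w))" for w by (simp add: \<Phi>_def)
  have an: "an_at \<Phi> (0, (\<theta>, \<mu>))" if "\<mu> \<in> W0" for \<theta> \<mu>
    unfolding \<Phi>_def
    by (rule an_at_compose[where f = "\<lambda>z. g (fst z) (snd z)"])
       (use that tan_onD(3)[OF g(2)] in \<open>auto simp: W0_def intro!: an_at_bl bounded_linear_intros\<close>)
  have per: "g (\<theta> + ivec q) \<zeta> = g \<theta> \<zeta>" for \<theta> q \<zeta>
    using torus_periodicD[OF tan_onD(2)[OF g(2), of \<zeta>]] .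
  have "torus_analytic_on (C \<gamma>) \<Lambda>" if \<gamma>: "\<gamma> \<in> midx" for \<gamma>
  proof -
    have "tan_on (C \<gamma>) W0"
    proof (rule tan_onI[OF W0(1)])
      show "torus_periodic (\<lambda>\<theta>. C \<gamma> \<theta> \<mu>)" for \<mu> by (simp add: torus_periodic_def C_def per)
      show "an_at (\<lambda>z. C \<gamma> (fst z) (snd z)) (\<theta>, \<mu>)" if "\<mu> \<in> W0" for \<theta> \<mu>
        unfolding C_def using an_at_extract[OF an[OF that, of \<theta>]] \<gamma> unfolding \<Phi> by blast
    qed
    then show ?thesis using W0 unfolding torus_analytic_on_iff by blast
  qed
  moreover have "\<exists>\<rho>>0. \<exists>M. \<forall>\<theta>. \<forall>\<mu>\<in>L. psf \<rho> M (\<lambda>\<gamma>. C \<gamma> \<theta> \<mu>) (\<lambda>z. f \<theta> (z, \<mu>))"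
    if L: "compact L" "L \<subseteq> \<Lambda>" for L
  proof -
    have "\<exists>\<rho>>0. \<exists>M. \<forall>y\<in>pbox \<rho>. psf \<rho> M (tcoef (\<lambda>z. g (fst (w + y)) (z, snd (w + y)))) (\<lambda>z. g (fst (w + y)) (z, snd (w + y)))"
      if w: "w \<in> cbox 0 1 \<times> L" for w
    proof -
      obtain \<theta> \<mu> where w: "w = (\<theta>, \<mu>)" "\<mu> \<in> W0" using w L W0 by auto
      show ?thesis
        by (rule an_at_extract[OF an[OF w(2), of \<theta>]]) (unfold \<Phi> w(1), blast)
    qed
    from pbox_compact_cover_uniform[OF compact_Times[OF compact_cbox L(1)] this]
    obtain \<rho> M where \<rho>: "\<rho> > 0" and P: "\<And>w. w \<in> cbox 0 1 \<times> L ==> psf \<rho> M (tcoef (\<lambda>z. g (fst w) (z, snd w))) (\<lambda>z. g (fst w) (z, snd w))"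
      by metis
    obtain \<delta> where \<delta>: "\<delta> > 0" "\<And>s. s \<in> pbox \<delta> ==> 0 + s \<in> interior Z"
      using pbox_in_open[OF open_interior Z] by blast
    define r where "r = min \<rho> \<delta>"
    have r: "r > 0" "r \<le> \<rho>" "r \<le> \<delta>" using \<rho> \<delta> by (auto simp: r_def)
    have "psf r M (\<lambda>\<gamma>. C \<gamma> \<theta> \<mu>) (\<lambda>z. f \<theta> (z, \<mu>))" if \<mu>: "\<mu> \<in> L" for \<theta> \<mu>
    proof -
      obtain \<theta>' q where \<theta>': "\<theta>' \<in> cbox 0 1" "\<theta> = \<theta>' + ivec q" using periodic_cube_rep by blast
      have "psf \<rho> M (tcoef (\<lambda>z. g \<theta> (z, \<mu>))) (\<lambda>z. g \<theta> (z, \<mu>))"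
        using P[of "(\<theta>', \<mu>)"] \<theta>' \<mu> by (simp add: per)
      then have "psf r M (\<lambda>\<gamma>. C \<gamma> \<theta> \<mu>) (\<lambda>z. g \<theta> (z, \<mu>))"
        unfolding C_def by (rule psf_radius_mono) (use r in auto)
      then show ?thesis
      proof (rule psf_cong)
        fix z :: 'z assume "z \<in> pbox r"
        then have "z \<in> Z" using \<delta>(2)[of z] pbox_mono[OF r(3)] interior_subset[of Z] by auto
        then show "g \<theta> (z, \<mu>) = f \<theta> (z, \<mu>)" using g(3)[of "(z, \<mu>)" \<theta>] \<mu> L by auto
      qed
    qed
    then show ?thesis using r by blast
  qed
  ultimately show ?thesis using that by blast
qed

lemma ta_translate_param:
  fixes f :: "real ^ 'd => 'p::euclidean_space => 'b::euclidean_space"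
  assumes "torus_analytic_on f P"
  shows "torus_analytic_on (\<lambda>\<theta> (z, \<mu>). f (\<theta> + z) \<mu>) (UNIV \<times> P)"
proof -
  obtain V g where g: "P \<subseteq> V" "tan_on g V" "\<And>\<theta> \<mu>. \<mu> \<in> P ==> f \<theta> \<mu> = g \<theta> \<mu>"
    using assms unfolding torus_analytic_on_iff by blast
  have "tan_on (\<lambda>\<theta> z. g (\<theta> + fst z) (snd z)) (UNIV \<times> V)"
  proof (rule tan_onI)
    show "open (UNIV \<times> V)" using tan_onD(1)[OF g(2)] by (intro open_Times) auto
    show "torus_periodic (\<lambda>\<theta>. g (\<theta> + fst z) (snd z))" for z :: "(real ^ 'd) \<times> 'p"
      by (rule torus_periodic_shift[OF tan_onD(2)[OF g(2)]])
    show "an_at (\<lambda>x. g (fst x + fst (snd x)) (snd (snd x))) (\<theta>, z)" if z: "z \<in> UNIV \<times> V" for \<theta> z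
    proof -
      have "an_at (\<lambda>x. g (fst (fst x + fst (snd x), snd (snd x))) (snd (fst x + fst (snd x), snd (snd x)))) (\<theta>, z)"
      proof (rule an_at_compose[where f = "\<lambda>z. g (fst z) (snd z)"])
        show "an_at (\<lambda>z. g (fst z) (snd z)) (fst (\<theta>, z) + fst (snd (\<theta>, z)), snd (snd (\<theta>, z)))"
          by (rule tan_onD(3)[OF g(2)]) (use z in auto)
      qed (intro an_at_bl bounded_linear_intros)
      then show ?thesis by simp
    qed
  qed
  then show ?thesis unfolding torus_analytic_on_iff using g
    by (intro exI[of _ "UNIV \<times> V"] exI[of _ "\<lambda>\<theta> z. g (\<theta> + fst z) (snd z)"]) (auto simp: case_prod_unfold)
qed

section \<open>Orders of vanishing in the variable u\<close>

lemma eventually_prod_principal: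
  "eventually P (F \<times>\<^sub>F principal S) \<longleftrightarrow> eventually (\<lambda>u. \<forall>s\<in>S. P (u, s)) F"
proof
  assume "eventually P (F \<times>\<^sub>F principal S)"
  then show "eventually (\<lambda>u. \<forall>s\<in>S. P (u, s)) F"
    unfolding eventually_prod_filter eventually_principal by (auto elim: eventually_mono)
next
  assume "eventually (\<lambda>u. \<forall>s\<in>S. P (u, s)) F"
  then show "eventually P (F \<times>\<^sub>F principal S)"
    unfolding eventually_prod_filter eventually_principal
    by (intro exI[of _ "\<lambda>u. \<forall>s\<in>S. P (u, s)"] exI[of _ "\<lambda>s. s \<in> S"]) auto
qed

lemma O_pow_iff:
  "O_pow \<Lambda> N G \<longleftrightarrow> (\<forall>L. compact L \<and> L \<subseteq> \<Lambda> \<longrightarrow>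
     (\<exists>C. \<exists>\<delta>>0. \<forall>u. 0 < u \<and> u < \<delta> \<longrightarrow> (\<forall>\<theta>. \<forall>\<mu>\<in>L. norm (G u \<theta> \<mu>) \<le> C * u ^ N)))"
proof -
  have "(\<lambda>(u, \<theta>, \<mu>). norm (G u \<theta> \<mu>)) \<in> O[at_right 0 \<times>\<^sub>F principal (UNIV \<times> L)](\<lambda>(u, \<theta>, \<mu>). u ^ N) \<longleftrightarrow>
     (\<exists>C. \<exists>\<delta>>0. \<forall>u. 0 < u \<and> u < \<delta> \<longrightarrow> (\<forall>\<theta>. \<forall>\<mu>\<in>L. norm (G u \<theta> \<mu>) \<le> C * u ^ N))" for L
  proof
    assume "(\<lambda>(u, \<theta>, \<mu>). norm (G u \<theta> \<mu>)) \<in> O[at_right 0 \<times>\<^sub>F principal (UNIV \<times> L)](\<lambda>(u, \<theta>, \<mu>). u ^ N)"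
    then obtain C where "eventually (\<lambda>u. \<forall>s\<in>UNIV \<times> L. norm (norm (G u (fst s) (snd s))) \<le> C * norm (u ^ N)) (at_right 0)"
      by (elim landau_o.bigE) (auto simp: eventually_prod_principal case_prod_unfold)
    then obtain \<delta> where "\<delta> > 0" "\<And>u. 0 < u ==> u < \<delta> ==> \<forall>s\<in>UNIV \<times> L. norm (norm (G u (fst s) (snd s))) \<le> C * norm (u ^ N)"
      unfolding eventually_at_right_field by auto
    then show "\<exists>C. \<exists>\<delta>>0. \<forall>u. 0 < u \<and> u < \<delta> \<longrightarrow> (\<forall>\<theta>. \<forall>\<mu>\<in>L. norm (G u \<theta> \<mu>) \<le> C * u ^ N)"
      by (intro exI[of _ C] exI[of _ \<delta>]) auto
  next
    assume "\<exists>C. \<exists>\<delta>>0. \<forall>u. 0 < u \<and> u < \<delta> \<longrightarrow> (\<forall>\<theta>. \<forall>\<mu>\<in>L. norm (G u \<theta> \<mu>) \<le> C * u ^ N)"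
    then obtain C \<delta> where C: "\<delta> > 0" "\<And>u \<theta> \<mu>. 0 < u ==> u < \<delta> ==> \<mu> \<in> L ==> norm (G u \<theta> \<mu>) \<le> C * u ^ N"
      by blast
    show "(\<lambda>(u, \<theta>, \<mu>). norm (G u \<theta> \<mu>)) \<in> O[at_right 0 \<times>\<^sub>F principal (UNIV \<times> L)](\<lambda>(u, \<theta>, \<mu>). u ^ N)"
    proof (rule landau_o.bigI[of "max C 1"])
      have "eventually (\<lambda>u::real. 0 < u \<and> u < \<delta>) (at_right 0)"
        using C(1) unfolding eventually_at_right_field by auto
      then show "\<forall>\<^sub>F x in at_right 0 \<times>\<^sub>F principal (UNIV \<times> L).
          norm (case x of (u, \<theta>, \<mu>) => norm (G u \<theta> \<mu>)) \<le> max C 1 * norm (case x of (u, \<theta>, \<mu>) => u ^ N)"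
        unfolding eventually_prod_principal
      proof eventually_elim
        case (elim u)
        have "norm (G u \<theta> \<mu>) \<le> max C 1 * u ^ N" if "\<mu> \<in> L" for \<theta> \<mu>
        proof -
          have "C * u ^ N \<le> max C 1 * u ^ N" using elim by (intro mult_right_mono) auto
          then show ?thesis using C(2)[of u \<mu> \<theta>] elim that by linarith
        qed
        then show ?case using elim by auto
      qed
    qed simp
  qed
  then show ?thesis unfolding O_pow_def by simp
qed

lemma O_powI:
  assumes "\<And>L. compact L ==> L \<subseteq> \<Lambda> ==>
     \<exists>C. \<exists>\<delta>>0. \<forall>u. 0 < u \<and> u < \<delta> \<longrightarrow> (\<forall>\<theta>. \<forall>\<mu>\<in>L. norm (G u \<theta> \<mu>) \<le> C * u ^ N)"
  shows "O_pow \<Lambda> N G"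
  using assms unfolding O_pow_iff by blast

lemma O_powE:
  assumes "O_pow \<Lambda> N G" "compact L" "L \<subseteq> \<Lambda>"
  obtains C \<delta> where "C > 0" "\<delta> > 0" "\<delta> \<le> 1" "\<And>u \<theta> \<mu>. 0 < u ==> u < \<delta> ==> \<mu> \<in> L ==> norm (G u \<theta> \<mu>) \<le> C * u ^ N"
proof -
  have "\<exists>C. \<exists>\<delta>>0. \<forall>u. 0 < u \<and> u < \<delta> \<longrightarrow> (\<forall>\<theta>. \<forall>\<mu>\<in>L. norm (G u \<theta> \<mu>) \<le> C * u ^ N)"
    using assms(1)[unfolded O_pow_iff, rule_format, OF conjI[OF assms(2,3)]] .
  then obtain C \<delta> where C: "\<delta> > 0" "\<And>u \<theta> \<mu>. 0 < u ==> u < \<delta> ==> \<mu> \<in> L ==> norm (G u \<theta> \<mu>) \<le> C * u ^ N"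
    by blast
  show ?thesis
  proof (rule that[of "max C 1" "min \<delta> 1"])
    fix u \<theta> \<mu> assume u: "0 < u" "u < min \<delta> 1" "\<mu> \<in> L"
    have "norm (G u \<theta> \<mu>) \<le> C * u ^ N" using C(2) u by simp
    also have "\<dots> \<le> max C 1 * u ^ N" using u by (intro mult_right_mono) auto
    finally show "norm (G u \<theta> \<mu>) \<le> max C 1 * u ^ N" .
  qed (use C in auto)
qed

lemma O_powD_at:
  assumes "O_pow \<Lambda> N G" "\<mu> \<in> \<Lambda>"
  shows "\<exists>C. \<exists>\<delta>>0. \<forall>u. 0 < u \<and> u < \<delta> \<longrightarrow> norm (G u \<theta> \<mu>) \<le> C * u ^ N"
proof -
  have "{\<mu>} \<subseteq> \<Lambda>" using assms(2) by simp
  then have "\<exists>C. \<exists>\<delta>>0. \<forall>u. 0 < u \<and> u < \<delta> \<longrightarrow> (\<forall>\<theta>. \<forall>\<mu>\<in>{\<mu>}. norm (G u \<theta> \<mu>) \<le> C * u ^ N)"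
    using assms(1)[unfolded O_pow_iff, rule_format, OF conjI[OF compact_sing]] by blast
  then show ?thesis by simp blast
qed

lemma O_cong_ev:
  assumes f: "O_pow \<Lambda> N f"
    and eq: "\<And>L. compact L ==> L \<subseteq> \<Lambda> ==> \<exists>\<delta>>0. \<forall>u. 0 < u \<and> u < \<delta> \<longrightarrow> (\<forall>\<theta>. \<forall>\<mu>\<in>L. f u \<theta> \<mu> = g u \<theta> \<mu>)"
  shows "O_pow \<Lambda> N g"
proof (rule O_powI)
  fix L assume L: "compact L" "L \<subseteq> \<Lambda>"
  obtain C \<delta> where C: "\<delta> > 0" "\<And>u \<theta> \<mu>. 0 < u ==> u < \<delta> ==> \<mu> \<in> L ==> norm (f u \<theta> \<mu>) \<le> C * u ^ N"
    using O_powE[OF f L] by metis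
  obtain \<epsilon> where "\<epsilon> > 0" "\<forall>u. 0 < u \<and> u < \<epsilon> \<longrightarrow> (\<forall>\<theta>. \<forall>\<mu>\<in>L. f u \<theta> \<mu> = g u \<theta> \<mu>)" using eq[OF L] by blast
  then show "\<exists>C. \<exists>\<delta>>0. \<forall>u. 0 < u \<and> u < \<delta> \<longrightarrow> (\<forall>\<theta>. \<forall>\<mu>\<in>L. norm (g u \<theta> \<mu>) \<le> C * u ^ N)"
    using C by (intro exI[of _ C] exI[of _ "min \<delta> \<epsilon>"]) fastforce
qed

lemma O_cong:
  assumes "O_pow \<Lambda> N f" "\<And>u \<theta> \<mu>. u > 0 ==> \<mu> \<in> \<Lambda> ==> f u \<theta> \<mu> = g u \<theta> \<mu>"
  shows "O_pow \<Lambda> N g"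
  by (rule O_cong_ev[OF assms(1)]) (use assms(2) in \<open>auto intro!: exI[of _ 1]\<close>)

lemma O_mono:
  assumes f: "O_pow \<Lambda> N f" and "M \<le> N" shows "O_pow \<Lambda> M f"
proof (rule O_powI)
  fix L assume L: "compact L" "L \<subseteq> \<Lambda>"
  obtain C \<delta> where C: "C > 0" "\<delta> > 0" "\<delta> \<le> 1" "\<And>u \<theta> \<mu>. 0 < u ==> u < \<delta> ==> \<mu> \<in> L ==> norm (f u \<theta> \<mu>) \<le> C * u ^ N"
    using O_powE[OF f L] by metis
  have "norm (f u \<theta> \<mu>) \<le> C * u ^ M" if "0 < u" "u < \<delta>" "\<mu> \<in> L" for u \<theta> \<mu>
  proof -
    have "C * u ^ N \<le> C * u ^ M" using that C assms(2) by (intro mult_left_mono power_decreasing) auto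
    then show ?thesis using C(4)[OF that, of \<theta>] by linarith
  qed
  then show "\<exists>C. \<exists>\<delta>>0. \<forall>u. 0 < u \<and> u < \<delta> \<longrightarrow> (\<forall>\<theta>. \<forall>\<mu>\<in>L. norm (f u \<theta> \<mu>) \<le> C * u ^ M)"
    using C by blast
qed

lemma O_zero [simp, intro]: "O_pow \<Lambda> N (\<lambda>_ _ _. 0)"
  by (rule O_powI) (auto intro!: exI[of _ 0] exI[of _ 1])

lemma O_add:
  assumes f: "O_pow \<Lambda> N f" and g: "O_pow \<Lambda> N g" shows "O_pow \<Lambda> N (\<lambda>u \<theta> \<mu>. f u \<theta> \<mu> + g u \<theta> \<mu>)"
proof (rule O_powI)
  fix L assume L: "compact L" "L \<subseteq> \<Lambda>"
  obtain C \<delta> where C: "\<delta> > 0" "\<And>u \<theta> \<mu>. 0 < u ==> u < \<delta> ==> \<mu> \<in> L ==> norm (f u \<theta> \<mu>) \<le> C * u ^ N"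
    using O_powE[OF f L] by metis
  obtain D \<epsilon> where D: "\<epsilon> > 0" "\<And>u \<theta> \<mu>. 0 < u ==> u < \<epsilon> ==> \<mu> \<in> L ==> norm (g u \<theta> \<mu>) \<le> D * u ^ N"
    using O_powE[OF g L] by metis
  have "norm (f u \<theta> \<mu> + g u \<theta> \<mu>) \<le> (C + D) * u ^ N" if "0 < u" "u < min \<delta> \<epsilon>" "\<mu> \<in> L" for u \<theta> \<mu>
    using norm_triangle_le[of "f u \<theta> \<mu>" "g u \<theta> \<mu>"] C(2)[of u \<mu> \<theta>] D(2)[of u \<mu> \<theta>] that
    by (simp add: distrib_right)
  then show "\<exists>C. \<exists>\<delta>>0. \<forall>u. 0 < u \<and> u < \<delta> \<longrightarrow> (\<forall>\<theta>. \<forall>\<mu>\<in>L. norm (f u \<theta> \<mu> + g u \<theta> \<mu>) \<le> C * u ^ N)"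
    using C(1) D(1) by (intro exI[of _ "C + D"] exI[of _ "min \<delta> \<epsilon>"]) auto
qed

lemma O_minus: "O_pow \<Lambda> N f ==> O_pow \<Lambda> N (\<lambda>u \<theta> \<mu>. - f u \<theta> \<mu>)"
  by (simp add: O_pow_def)

lemma O_diff: "O_pow \<Lambda> N f ==> O_pow \<Lambda> N g ==> O_pow \<Lambda> N (\<lambda>u \<theta> \<mu>. f u \<theta> \<mu> - g u \<theta> \<mu>)"
  using O_add[of \<Lambda> N f "\<lambda>u \<theta> \<mu>. - g u \<theta> \<mu>"] O_minus by auto

lemma O_sum:
  assumes "\<And>i. i \<in> I ==> O_pow \<Lambda> N (f i)" shows "O_pow \<Lambda> N (\<lambda>u \<theta> \<mu>. \<Sum>i\<in>I. f i u \<theta> \<mu>)"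
  using assms by (induction I rule: infinite_finite_induct) (auto intro: O_add)

lemma O_mult:
  fixes f g :: "real => real ^ 'd => real ^ 'm => real"
  assumes f: "O_pow \<Lambda> N f" and g: "O_pow \<Lambda> M g" shows "O_pow \<Lambda> (N + M) (\<lambda>u \<theta> \<mu>. f u \<theta> \<mu> * g u \<theta> \<mu>)"
proof (rule O_powI)
  fix L assume L: "compact L" "L \<subseteq> \<Lambda>"
  obtain C \<delta> where C: "C > 0" "\<delta> > 0" "\<And>u \<theta> \<mu>. 0 < u ==> u < \<delta> ==> \<mu> \<in> L ==> norm (f u \<theta> \<mu>) \<le> C * u ^ N"
    using O_powE[OF f L] by metis
  obtain D \<epsilon> where D: "\<epsilon> > 0" "\<And>u \<theta> \<mu>. 0 < u ==> u < \<epsilon> ==> \<mu> \<in> L ==> norm (g u \<theta> \<mu>) \<le> D * u ^ M"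
    using O_powE[OF g L] by metis
  have "norm (f u \<theta> \<mu> * g u \<theta> \<mu>) \<le> (C * D) * u ^ (N + M)" if "0 < u" "u < min \<delta> \<epsilon>" "\<mu> \<in> L" for u \<theta> \<mu>
  proof -
    have "norm (f u \<theta> \<mu>) * norm (g u \<theta> \<mu>) \<le> (C * u ^ N) * (D * u ^ M)"
      using C(1) C(3)[of u \<mu> \<theta>] D(2)[of u \<mu> \<theta>] that by (intro mult_mono) auto
    then show ?thesis by (simp add: abs_mult power_add mult_ac)
  qed
  then show "\<exists>C. \<exists>\<delta>>0. \<forall>u. 0 < u \<and> u < \<delta> \<longrightarrow> (\<forall>\<theta>. \<forall>\<mu>\<in>L. norm (f u \<theta> \<mu> * g u \<theta> \<mu>) \<le> C * u ^ (N + M))"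
    using C(2) D(1) by (intro exI[of _ "C * D"] exI[of _ "min \<delta> \<epsilon>"]) auto
qed

lemma O_mult_le:
  fixes f g :: "real => real ^ 'd => real ^ 'm => real"
  shows "O_pow \<Lambda> N f ==> O_pow \<Lambda> M g ==> K \<le> N + M ==> O_pow \<Lambda> K (\<lambda>u \<theta> \<mu>. f u \<theta> \<mu> * g u \<theta> \<mu>)"
  using O_mono[OF O_mult] by blast

lemma O_u: "O_pow \<Lambda> n (\<lambda>u _ _. u ^ n :: real)"
  by (rule O_powI) (auto intro!: exI[of _ 1])

lemma O_coef:
  fixes f :: "real ^ 'd => real ^ 'm => 'b::euclidean_space"
  assumes "torus_analytic_on f \<Lambda>" shows "O_pow \<Lambda> 0 (\<lambda>u \<theta> \<mu>. f \<theta> \<mu>)"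
proof (rule O_powI)
  fix L assume L: "compact L" "L \<subseteq> \<Lambda>"
  obtain V g where g: "\<Lambda> \<subseteq> V" "tan_on g V" "\<And>\<theta> \<mu>. \<mu> \<in> \<Lambda> ==> f \<theta> \<mu> = g \<theta> \<mu>"
    using assms unfolding torus_analytic_on_iff by blast
  have "continuous_on (cbox 0 1 \<times> L) (\<lambda>z. g (fst z) (snd z))"
    by (intro continuous_at_imp_continuous_on ballI an_at_isCont)
       (use L g tan_onD(3)[OF g(2)] in auto)
  then have "compact ((\<lambda>z. g (fst z) (snd z)) ` (cbox 0 1 \<times> L))"
    by (intro compact_continuous_image compact_Times compact_cbox L)
  from compact_imp_bounded[OF this]
  obtain C where C: "\<And>z. z \<in> cbox 0 1 \<times> L ==> norm (g (fst z) (snd z)) \<le> C"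
    unfolding bounded_iff by blast
  have "norm (f \<theta> \<mu>) \<le> C" if "\<mu> \<in> L" for \<theta> \<mu>
  proof -
    have p: "torus_periodic (\<lambda>\<theta>. g \<theta> \<mu>)" by (rule tan_onD(2)[OF g(2)])
    have "norm (g \<theta> \<mu>) \<le> C"
      by (rule torus_periodic_bounded_by[OF p, of "\<lambda>x. norm x \<le> C"]) (use C that in force)
    then show ?thesis using g(3) L that by auto
  qed
  then show "\<exists>C. \<exists>\<delta>>0. \<forall>u. 0 < u \<and> u < \<delta> \<longrightarrow> (\<forall>\<theta>. \<forall>\<mu>\<in>L. norm (f \<theta> \<mu>) \<le> C * u ^ 0)"
    by (intro exI[of _ C] exI[of _ 1]) auto
qed

lemma O_coef_u:
  fixes f :: "real ^ 'd => real ^ 'm => real"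
  assumes "torus_analytic_on f \<Lambda>" "N \<le> n" shows "O_pow \<Lambda> N (\<lambda>u \<theta> \<mu>. f \<theta> \<mu> * u ^ n)"
  by (rule O_mult_le[OF O_coef[OF assms(1)] O_u[of \<Lambda> n]]) (use assms in simp)

lemma O_power:
  fixes f :: "real => real ^ 'd => real ^ 'm => real"
  assumes "O_pow \<Lambda> N f" shows "O_pow \<Lambda> (N * j) (\<lambda>u \<theta> \<mu>. f u \<theta> \<mu> ^ j)"
proof (induction j)
  case 0 then show ?case using O_u[of \<Lambda> 0] by simp
next
  case (Suc j) then show ?case using O_mult[OF assms Suc] by simp
qed

lemma O_prod:
  fixes f :: "'i => real => real ^ 'd => real ^ 'm => real"
  assumes "\<And>i. i \<in> I ==> O_pow \<Lambda> 0 (f i)" shows "O_pow \<Lambda> 0 (\<lambda>u \<theta> \<mu>. \<Prod>i\<in>I. f i u \<theta> \<mu>)"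
  using assms
proof (induction I rule: infinite_finite_induct)
  case (insert i I)
  then show ?case using O_mult[of \<Lambda> 0 "f i" 0 "\<lambda>u \<theta> \<mu>. \<Prod>i\<in>I. f i u \<theta> \<mu>"] by simp
qed (use O_u[of _ 0] in auto)

lemma O_vec:
  fixes f :: "real => real ^ 'd => real ^ 'm => real ^ 'n"
  shows "O_pow \<Lambda> N f \<longleftrightarrow> (\<forall>i. O_pow \<Lambda> N (\<lambda>u \<theta> \<mu>. f u \<theta> \<mu> $ i))"
proof
  assume f: "O_pow \<Lambda> N f"
  show "\<forall>i. O_pow \<Lambda> N (\<lambda>u \<theta> \<mu>. f u \<theta> \<mu> $ i)"
  proof (intro allI O_powI)
    fix i and L assume L: "compact L" "L \<subseteq> \<Lambda>"
    obtain C \<delta> where C: "\<delta> > 0" "\<And>u \<theta> \<mu>. 0 < u ==> u < \<delta> ==> \<mu> \<in> L ==> norm (f u \<theta> \<mu>) \<le> C * u ^ N"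
      using O_powE[OF f L] by metis
    then have "norm (f u \<theta> \<mu> $ i) \<le> C * u ^ N" if "0 < u" "u < \<delta>" "\<mu> \<in> L" for u \<theta> \<mu>
      using component_le_norm_cart[of "f u \<theta> \<mu>" i] C(2)[OF that, of \<theta>] by simp
    then show "\<exists>C. \<exists>\<delta>>0. \<forall>u. 0 < u \<and> u < \<delta> \<longrightarrow> (\<forall>\<theta>. \<forall>\<mu>\<in>L. norm (f u \<theta> \<mu> $ i) \<le> C * u ^ N)"
      using C(1) by blast
  qed
next
  assume f: "\<forall>i. O_pow \<Lambda> N (\<lambda>u \<theta> \<mu>. f u \<theta> \<mu> $ i)"
  have s: "O_pow \<Lambda> N (\<lambda>u \<theta> \<mu>. \<Sum>i\<in>UNIV. \<bar>f u \<theta> \<mu> $ i\<bar>)"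
    by (intro O_sum) (use f in \<open>simp add: O_pow_def\<close>)
  show "O_pow \<Lambda> N f"
  proof (rule O_powI)
    fix L assume L: "compact L" "L \<subseteq> \<Lambda>"
    obtain C \<delta> where C: "\<delta> > 0" "\<And>u \<theta> \<mu>. 0 < u ==> u < \<delta> ==> \<mu> \<in> L ==> norm (\<Sum>i\<in>UNIV. \<bar>f u \<theta> \<mu> $ i\<bar>) \<le> C * u ^ N"
      using O_powE[OF s L] by metis
    then have "norm (f u \<theta> \<mu>) \<le> C * u ^ N" if "0 < u" "u < \<delta>" "\<mu> \<in> L" for u \<theta> \<mu>
      using norm_le_l1_cart[of "f u \<theta> \<mu>"] C(2)[OF that, of \<theta>] by simp
    then show "\<exists>C. \<exists>\<delta>>0. \<forall>u. 0 < u \<and> u < \<delta> \<longrightarrow> (\<forall>\<theta>. \<forall>\<mu>\<in>L. norm (f u \<theta> \<mu>) \<le> C * u ^ N)"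
      using C(1) by blast
  qed
qed

definition eqm :: "(real ^ 'm) set => nat => (real => real ^ 'd => real ^ 'm => real) =>
    (real => real ^ 'd => real ^ 'm => real) => bool" where
  "eqm \<Lambda> N f g \<longleftrightarrow> O_pow \<Lambda> N (\<lambda>u \<theta> \<mu>. f u \<theta> \<mu> - g u \<theta> \<mu>)"

lemma eqm_refl [simp, intro]: "eqm \<Lambda> N f f"
  by (simp add: eqm_def)

lemma eqm_sym: "eqm \<Lambda> N f g ==> eqm \<Lambda> N g f"
  unfolding eqm_def by (drule O_minus) simp

lemma eqm_trans: "eqm \<Lambda> N f g ==> eqm \<Lambda> N g h ==> eqm \<Lambda> N f h"
  unfolding eqm_def by (drule (1) O_add) simp

lemma eqm_mono: "eqm \<Lambda> N f g ==> M \<le> N ==> eqm \<Lambda> M f g"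
  unfolding eqm_def by (rule O_mono)

lemma eqm_add: "eqm \<Lambda> N f f' ==> eqm \<Lambda> N g g' ==> eqm \<Lambda> N (\<lambda>u \<theta> \<mu>. f u \<theta> \<mu> + g u \<theta> \<mu>) (\<lambda>u \<theta> \<mu>. f' u \<theta> \<mu> + g' u \<theta> \<mu>)"
  unfolding eqm_def by (drule (1) O_add) (simp add: algebra_simps)

lemma eqm_diff: "eqm \<Lambda> N f f' ==> eqm \<Lambda> N g g' ==> eqm \<Lambda> N (\<lambda>u \<theta> \<mu>. f u \<theta> \<mu> - g u \<theta> \<mu>) (\<lambda>u \<theta> \<mu>. f' u \<theta> \<mu> - g' u \<theta> \<mu>)"
  unfolding eqm_def by (drule (1) O_diff) (simp add: algebra_simps)

lemma eqm_sum:
  assumes "\<And>i. i \<in> I ==> eqm \<Lambda> N (f i) (g i)"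
  shows "eqm \<Lambda> N (\<lambda>u \<theta> \<mu>. \<Sum>i\<in>I. f i u \<theta> \<mu>) (\<lambda>u \<theta> \<mu>. \<Sum>i\<in>I. g i u \<theta> \<mu>)"
  using O_sum[of I \<Lambda> N "\<lambda>i u \<theta> \<mu>. f i u \<theta> \<mu> - g i u \<theta> \<mu>"] assms by (simp add: eqm_def sum_subtractf)

text \<open>
  From \<open>f g - f' g' = (f - f') g + f' (g - g')\<close>: the order of each factor improves the congruence of the
  other one.
\<close>

lemma eqm_mult:
  assumes "eqm \<Lambda> N f f'" "O_pow \<Lambda> b g" "O_pow \<Lambda> a f'" "eqm \<Lambda> M g g'" "K \<le> N + b" "K \<le> a + M"
  shows "eqm \<Lambda> K (\<lambda>u \<theta> \<mu>. f u \<theta> \<mu> * g u \<theta> \<mu>) (\<lambda>u \<theta> \<mu>. f' u \<theta> \<mu> * g' u \<theta> \<mu>)"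
  using O_add[OF O_mult_le[OF assms(1)[unfolded eqm_def] assms(2,5)] O_mult_le[OF assms(3) assms(4)[unfolded eqm_def] assms(6)]]
  by (simp add: eqm_def algebra_simps)

lemma eqm_O: "eqm \<Lambda> N f g ==> O_pow \<Lambda> N g ==> O_pow \<Lambda> N f"
  unfolding eqm_def by (drule (1) O_add) simp

lemma eqm_O_le: "eqm \<Lambda> N f g ==> O_pow \<Lambda> M g ==> M \<le> N ==> O_pow \<Lambda> M f"
  by (rule eqm_O[OF eqm_mono])

lemma eqm_of_O: "O_pow \<Lambda> N f ==> eqm \<Lambda> N f (\<lambda>_ _ _. 0)"
  by (simp add: eqm_def)

lemma eqm_cong:
  assumes "eqm \<Lambda> N f g" "\<And>u \<theta> \<mu>. u > 0 ==> \<mu> \<in> \<Lambda> ==> f u \<theta> \<mu> = f' u \<theta> \<mu>"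
    "\<And>u \<theta> \<mu>. u > 0 ==> \<mu> \<in> \<Lambda> ==> g u \<theta> \<mu> = g' u \<theta> \<mu>"
  shows "eqm \<Lambda> N f' g'"
  using assms(1) unfolding eqm_def by (rule O_cong) (simp add: assms)

lemma eqm_power_weak:
  assumes "eqm \<Lambda> N f g" "O_pow \<Lambda> 0 f" "O_pow \<Lambda> 0 g"
  shows "eqm \<Lambda> N (\<lambda>u \<theta> \<mu>. f u \<theta> \<mu> ^ j) (\<lambda>u \<theta> \<mu>. g u \<theta> \<mu> ^ j)"
proof (induction j)
  case (Suc j)
  have "O_pow \<Lambda> 0 (\<lambda>u \<theta> \<mu>. f u \<theta> \<mu> ^ j)" using O_power[OF assms(2), of j] by simp
  then show ?case using eqm_mult[OF assms(1) _ assms(3) Suc, of 0 N] by simp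
qed simp

lemma eqm_prod_weak:
  assumes "\<And>i. i \<in> I ==> eqm \<Lambda> N (f i) (g i)" "\<And>i. i \<in> I ==> O_pow \<Lambda> 0 (f i)" "\<And>i. i \<in> I ==> O_pow \<Lambda> 0 (g i)"
  shows "eqm \<Lambda> N (\<lambda>u \<theta> \<mu>. \<Prod>i\<in>I. f i u \<theta> \<mu>) (\<lambda>u \<theta> \<mu>. \<Prod>i\<in>I. g i u \<theta> \<mu>)"
  using assms
proof (induction I rule: infinite_finite_induct)
  case (insert i I)
  have "eqm \<Lambda> N (\<lambda>u \<theta> \<mu>. f i u \<theta> \<mu> * (\<Prod>i\<in>I. f i u \<theta> \<mu>)) (\<lambda>u \<theta> \<mu>. g i u \<theta> \<mu> * (\<Prod>i\<in>I. g i u \<theta> \<mu>))"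
    by (rule eqm_mult[where b = 0 and a = 0 and N = N and M = N]) (use insert in \<open>auto intro!: O_prod\<close>)
  then show ?case using insert by simp
qed auto

section \<open>Asymptotic expansions in the variable u\<close>

inductive upoly :: "(real ^ 'm) set => (real => real ^ 'd => real ^ 'm => real) => bool" for \<Lambda> where
  upoly_coef: "torus_analytic_on f \<Lambda> ==> upoly \<Lambda> (\<lambda>u \<theta> \<mu>. f \<theta> \<mu> * u ^ n)"
| upoly_add: "upoly \<Lambda> f ==> upoly \<Lambda> g ==> upoly \<Lambda> (\<lambda>u \<theta> \<mu>. f u \<theta> \<mu> + g u \<theta> \<mu>)"

lemma upoly_mult:
  assumes "upoly \<Lambda> f" "upoly \<Lambda> g" shows "upoly \<Lambda> (\<lambda>u \<theta> \<mu>. f u \<theta> \<mu> * g u \<theta> \<mu>)"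
  using assms(1)
proof induction
  case f: (upoly_coef f n)
  show ?case using assms(2)
  proof induction
    case (upoly_coef g m)
    have "upoly \<Lambda> (\<lambda>u \<theta> \<mu>. (f \<theta> \<mu> * g \<theta> \<mu>) * u ^ (n + m))" by (intro upoly.upoly_coef ta_mult f upoly_coef)
    then show ?case by (simp add: power_add mult_ac)
  next
    case (upoly_add g h)
    from upoly.upoly_add[OF upoly_add(3,4)] show ?case by (simp add: distrib_left)
  qed
next
  case (upoly_add f h)
  from upoly.upoly_add[OF upoly_add(3,4)] show ?case by (simp add: distrib_right)
qed

lemma upoly_O: "upoly \<Lambda> f ==> O_pow \<Lambda> 0 f"
  by (induction rule: upoly.induct) (auto intro: O_coef_u O_add)

lemma upoly_expand:
  assumes "upoly \<Lambda> f"
  shows "\<exists>F. (\<forall>i. torus_analytic_on (F i) \<Lambda>) \<and> eqm \<Lambda> N f (\<lambda>u \<theta> \<mu>. \<Sum>i<N. F i \<theta> \<mu> * u ^ i)"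
  using assms
proof induction
  case (upoly_coef f n)
  show ?case
  proof (intro exI conjI allI)
    show "torus_analytic_on (\<lambda>\<theta> \<mu>. if i = n then f \<theta> \<mu> else 0) \<Lambda>" for i
      using upoly_coef by (cases "i = n") auto
    have "(\<Sum>i<N. (if i = n then f \<theta> \<mu> else 0) * u ^ i) = (if n < N then f \<theta> \<mu> * u ^ n else 0)" for u \<theta> \<mu>
      by (simp add: if_distrib[of "\<lambda>x. x * _"] cong: if_cong)
    then show "eqm \<Lambda> N (\<lambda>u \<theta> \<mu>. f \<theta> \<mu> * u ^ n) (\<lambda>u \<theta> \<mu>. \<Sum>i<N. (if i = n then f \<theta> \<mu> else 0) * u ^ i)"
      using upoly_coef by (cases "n < N") (auto intro!: eqm_of_O O_coef_u)
  qed
next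
  case (upoly_add f g)
  then obtain F G where F: "\<forall>i. torus_analytic_on (F i) \<Lambda>" "eqm \<Lambda> N f (\<lambda>u \<theta> \<mu>. \<Sum>i<N. F i \<theta> \<mu> * u ^ i)"
    and G: "\<forall>i. torus_analytic_on (G i) \<Lambda>" "eqm \<Lambda> N g (\<lambda>u \<theta> \<mu>. \<Sum>i<N. G i \<theta> \<mu> * u ^ i)" by blast
  show ?case
    by (intro exI[of _ "\<lambda>i \<theta> \<mu>. F i \<theta> \<mu> + G i \<theta> \<mu>"] conjI allI ta_add)
       (use F G eqm_add[OF F(2) G(2)] in \<open>auto simp: distrib_right sum.distrib\<close>)
qed

text \<open>
  Asymptotic expandability in powers of \<open>u\<close> to every order. It is preserved by all operations that form the
  residual, and provides the residual with a leading coefficient (\<open>xpd_leading\<close>).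
\<close>

definition xpd :: "(real ^ 'm) set => (real => real ^ 'd => real ^ 'm => real) => bool" where
  "xpd \<Lambda> f \<longleftrightarrow> (\<forall>N. \<exists>g. upoly \<Lambda> g \<and> eqm \<Lambda> N f g)"

lemma xpd_coef_u: "torus_analytic_on f \<Lambda> ==> xpd \<Lambda> (\<lambda>u \<theta> \<mu>. f \<theta> \<mu> * u ^ n)"
  unfolding xpd_def using upoly_coef by blast

lemma xpd_coef: "torus_analytic_on f \<Lambda> ==> xpd \<Lambda> (\<lambda>u \<theta> \<mu>. f \<theta> \<mu>)"
  using xpd_coef_u[of f \<Lambda> 0] by simp

lemma xpd_const: "xpd \<Lambda> (\<lambda>u \<theta> \<mu>. c)"
  by (rule xpd_coef) simp

lemma xpd_u: "xpd \<Lambda> (\<lambda>u \<theta> \<mu>. u ^ n)"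
  using xpd_coef_u[of "\<lambda>_ _. 1" \<Lambda> n] by simp

lemma xpd_O: assumes "xpd \<Lambda> f" shows "O_pow \<Lambda> 0 f"
  using assms unfolding xpd_def by (metis eqm_O upoly_O)

lemma xpd_add:
  assumes "xpd \<Lambda> f" "xpd \<Lambda> g" shows "xpd \<Lambda> (\<lambda>u \<theta> \<mu>. f u \<theta> \<mu> + g u \<theta> \<mu>)"
  unfolding xpd_def
proof
  fix N
  obtain f' g' where "upoly \<Lambda> f'" "eqm \<Lambda> N f f'" "upoly \<Lambda> g'" "eqm \<Lambda> N g g'"
    using assms unfolding xpd_def by metis
  then show "\<exists>h. upoly \<Lambda> h \<and> eqm \<Lambda> N (\<lambda>u \<theta> \<mu>. f u \<theta> \<mu> + g u \<theta> \<mu>) h"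
    by (intro exI[of _ "\<lambda>u \<theta> \<mu>. f' u \<theta> \<mu> + g' u \<theta> \<mu>"] conjI upoly_add eqm_add)
qed

lemma xpd_mult:
  assumes "xpd \<Lambda> f" "xpd \<Lambda> g" shows "xpd \<Lambda> (\<lambda>u \<theta> \<mu>. f u \<theta> \<mu> * g u \<theta> \<mu>)"
  unfolding xpd_def
proof
  fix N
  obtain f' g' where h: "upoly \<Lambda> f'" "eqm \<Lambda> N f f'" "upoly \<Lambda> g'" "eqm \<Lambda> N g g'"
    using assms unfolding xpd_def by metis
  have "eqm \<Lambda> N (\<lambda>u \<theta> \<mu>. f u \<theta> \<mu> * g u \<theta> \<mu>) (\<lambda>u \<theta> \<mu>. f' u \<theta> \<mu> * g' u \<theta> \<mu>)"
    by (rule eqm_mult[OF h(2) xpd_O[OF assms(2)] upoly_O[OF h(1)] h(4)]) auto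
  then show "\<exists>h. upoly \<Lambda> h \<and> eqm \<Lambda> N (\<lambda>u \<theta> \<mu>. f u \<theta> \<mu> * g u \<theta> \<mu>) h"
    using upoly_mult[OF h(1,3)] by blast
qed

lemma xpd_minus: "xpd \<Lambda> f ==> xpd \<Lambda> (\<lambda>u \<theta> \<mu>. - f u \<theta> \<mu>)"
  using xpd_mult[OF xpd_const[of \<Lambda> "-1"]] by simp

lemma xpd_diff: "xpd \<Lambda> f ==> xpd \<Lambda> g ==> xpd \<Lambda> (\<lambda>u \<theta> \<mu>. f u \<theta> \<mu> - g u \<theta> \<mu>)"
  using xpd_add[of \<Lambda> f "\<lambda>u \<theta> \<mu>. - g u \<theta> \<mu>"] xpd_minus by auto

lemma xpd_sum: "(\<And>i. i \<in> I ==> xpd \<Lambda> (f i)) ==> xpd \<Lambda> (\<lambda>u \<theta> \<mu>. \<Sum>i\<in>I. f i u \<theta> \<mu>)"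
  by (induction I rule: infinite_finite_induct) (auto intro: xpd_add xpd_const)

lemma xpd_prod: "(\<And>i. i \<in> I ==> xpd \<Lambda> (f i)) ==> xpd \<Lambda> (\<lambda>u \<theta> \<mu>. \<Prod>i\<in>I. f i u \<theta> \<mu>)"
  by (induction I rule: infinite_finite_induct) (auto intro: xpd_mult xpd_const)

lemma xpd_power: "xpd \<Lambda> f ==> xpd \<Lambda> (\<lambda>u \<theta> \<mu>. f u \<theta> \<mu> ^ n)"
  by (induction n) (auto intro: xpd_mult xpd_const)

lemma xpd_approx:
  assumes "\<And>N. \<exists>g. xpd \<Lambda> g \<and> eqm \<Lambda> N f g" shows "xpd \<Lambda> f"
  using assms unfolding xpd_def by (metis eqm_trans)

lemma poly_small_imp_zero:
  fixes a :: "nat => real"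
  assumes "\<delta> > 0" "\<And>u. 0 < u ==> u < \<delta> ==> \<bar>\<Sum>i<n. a i * u ^ i\<bar> \<le> C * u ^ n" "i < n"
  shows "a i = 0"
  using assms
proof (induction n arbitrary: a i)
  case (Suc n)
  have split: "(\<Sum>i<Suc n. a i * u ^ i) = a 0 + u * (\<Sum>i<n. a (Suc i) * u ^ i)" for u
    unfolding sum.lessThan_Suc_shift by (simp add: sum_distrib_left mult_ac)
  have "a 0 = 0"
  proof -
    have ev: "eventually (\<lambda>u. norm (a 0 + u * (\<Sum>i<n. a (Suc i) * u ^ i)) \<le> C * u ^ Suc n) (at_right (0::real))"
      unfolding eventually_at_right_field using Suc.prems(1,2) split by (intro exI[of _ \<delta>]) auto
    have "((\<lambda>u. C * u ^ Suc n) \<longlongrightarrow> C * 0 ^ Suc n) (at_right 0)" by (intro tendsto_intros)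
    then have "((\<lambda>u. a 0 + u * (\<Sum>i<n. a (Suc i) * u ^ i)) \<longlongrightarrow> 0) (at_right 0)"
      by (intro Lim_null_comparison[OF ev]) simp
    moreover have "((\<lambda>u. a 0 + u * (\<Sum>i<n. a (Suc i) * u ^ i)) \<longlongrightarrow> a 0 + 0 * (\<Sum>i<n. a (Suc i) * 0 ^ i)) (at_right 0)"
      by (intro tendsto_intros)
    ultimately show ?thesis using tendsto_unique[of "at_right (0::real)"] by fastforce
  qed
  have "\<bar>\<Sum>i<n. a (Suc i) * u ^ i\<bar> \<le> C * u ^ n" if "0 < u" "u < \<delta>" for u
  proof -
    have "u * \<bar>\<Sum>i<n. a (Suc i) * u ^ i\<bar> \<le> u * (C * u ^ n)"
      using Suc.prems(2)[OF that] that unfolding split \<open>a 0 = 0\<close> by (simp add: abs_mult mult_ac)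
    then show ?thesis using that by simp
  qed
  from Suc.IH[OF Suc.prems(1) this] have "a (Suc i) = 0" if "i < n" for i using that by blast
  then show ?case using \<open>a 0 = 0\<close> Suc.prems(3) by (cases i) auto
qed simp

text \<open>
  The coefficients below order \<open>n\<close> vanish, because the truncated expansion is \<open>O(u\<^sup>n)\<close> as well.
\<close>

lemma xpd_leading:
  assumes f: "xpd \<Lambda> f" "O_pow \<Lambda> n f"
  obtains g where "torus_analytic_on g \<Lambda>" "eqm \<Lambda> (n + 1) f (\<lambda>u \<theta> \<mu>. g \<theta> \<mu> * u ^ n)"
proof -
  obtain h where h: "upoly \<Lambda> h" "eqm \<Lambda> (n + 1) f h" using f(1) unfolding xpd_def by blast
  obtain F where F: "\<And>i. torus_analytic_on (F i) \<Lambda>" "eqm \<Lambda> (n + 1) h (\<lambda>u \<theta> \<mu>. \<Sum>i<n + 1. F i \<theta> \<mu> * u ^ i)"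
    using upoly_expand[OF h(1), of "n + 1"] by blast
  have E: "eqm \<Lambda> (n + 1) f (\<lambda>u \<theta> \<mu>. \<Sum>i<n + 1. F i \<theta> \<mu> * u ^ i)" by (rule eqm_trans[OF h(2) F(2)])
  have "O_pow \<Lambda> n (\<lambda>u \<theta> \<mu>. (\<Sum>i<n + 1. F i \<theta> \<mu> * u ^ i) - F n \<theta> \<mu> * u ^ n)"
    by (intro O_diff O_coef_u F eqm_O_le[OF eqm_sym[OF E] f(2)]) auto
  then have O: "O_pow \<Lambda> n (\<lambda>u \<theta> \<mu>. \<Sum>i<n. F i \<theta> \<mu> * u ^ i)" by simp
  have z: "F i \<theta> \<mu> = 0" if i: "i < n" "\<mu> \<in> \<Lambda>" for i \<theta> \<mu>
  proof -
    obtain C \<delta> where "\<delta> > 0" "\<And>u. 0 < u ==> u < \<delta> ==> norm (\<Sum>i<n. F i \<theta> \<mu> * u ^ i) \<le> C * u ^ n"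
      using O_powD_at[OF O i(2), of \<theta>] by blast
    then show ?thesis by (intro poly_small_imp_zero[of \<delta> "\<lambda>i. F i \<theta> \<mu>" n C i] i(1)) auto
  qed
  show ?thesis
    by (rule that[OF F(1)[of n]], rule eqm_cong[OF E]) (auto simp: z)
qed

section \<open>Composition with analytic functions\<close>

lemma finite_midx_less: "finite {\<gamma> \<in> midx. mdeg \<gamma> < N}"
proof (rule finite_subset)
  show "{\<gamma> \<in> midx. mdeg \<gamma> < N} \<subseteq> (Basis :: 'a set) \<rightarrow>\<^sub>E {..<N}"
  proof
    fix \<gamma> :: "'a => nat" assume \<gamma>: "\<gamma> \<in> {\<gamma> \<in> midx. mdeg \<gamma> < N}"
    then have "\<gamma> b < N" if "b \<in> Basis" for b
      using member_le_sum[of b Basis \<gamma>] that by (auto simp: mdeg_def)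
    then show "\<gamma> \<in> Basis \<rightarrow>\<^sub>E {..<N}" using \<gamma> by (auto simp: midx_def PiE_iff)
  qed
qed (auto intro: finite_PiE)

text \<open>
  Each omitted monomial carries at least \<open>N\<close> factors \<open>s / \<rho>\<close>.
\<close>

lemma psf_tail:
  fixes f :: "'a::euclidean_space => 'b::banach"
  assumes c: "psf \<rho> M c f" and z: "z \<in> pbox s" and s: "0 \<le> s" "s \<le> \<rho>" and \<rho>: "\<rho> > 0"
  shows "norm (f z - (\<Sum>\<gamma>\<in>{\<gamma> \<in> midx. mdeg \<gamma> < N}. mon z \<gamma> *\<^sub>R c \<gamma>)) \<le> (s / \<rho>) ^ N * M"
proof -
  let ?A = "{\<gamma> \<in> midx. mdeg \<gamma> < N} :: ('a => nat) set" and ?B = "{\<gamma> \<in> midx. \<not> mdeg \<gamma> < N} :: ('a => nat) set"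
  have "z \<in> pbox \<rho>" using z s pbox_mono by blast
  then have hs: "((\<lambda>\<gamma>. mon z \<gamma> *\<^sub>R c \<gamma>) has_sum f z) midx" by (rule psf_has_sum[OF c])
  have sB: "(\<lambda>\<gamma>. mon z \<gamma> *\<^sub>R c \<gamma>) summable_on ?B"
    by (rule summable_on_subset_banach[OF has_sum_imp_summable[OF hs]]) auto
  have "((\<lambda>\<gamma>. mon z \<gamma> *\<^sub>R c \<gamma>) has_sum ((\<Sum>\<gamma>\<in>?A. mon z \<gamma> *\<^sub>R c \<gamma>) + infsum (\<lambda>\<gamma>. mon z \<gamma> *\<^sub>R c \<gamma>) ?B)) (?A \<union> ?B)"
    by (intro has_sum_Un_disjoint has_sum_infsum sB has_sum_finite finite_midx_less) auto
  moreover have "?A \<union> ?B = midx" by auto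
  ultimately have "((\<lambda>\<gamma>. mon z \<gamma> *\<^sub>R c \<gamma>) has_sum ((\<Sum>\<gamma>\<in>?A. mon z \<gamma> *\<^sub>R c \<gamma>) + infsum (\<lambda>\<gamma>. mon z \<gamma> *\<^sub>R c \<gamma>) ?B)) midx"
    by (simp only:)
  from has_sum_unique[OF hs this] have "f z - (\<Sum>\<gamma>\<in>?A. mon z \<gamma> *\<^sub>R c \<gamma>) = infsum (\<lambda>\<gamma>. mon z \<gamma> *\<^sub>R c \<gamma>) ?B"
    by simp
  also have "norm \<dots> \<le> (s / \<rho>) ^ N * (\<Sum>\<^sub>\<infinity>\<gamma>\<in>?B. norm (c \<gamma>) * \<rho> ^ mdeg \<gamma>)"
  proof (rule norm_infsum_le[OF has_sum_infsum[OF sB]])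
    have "(\<lambda>\<gamma>. norm (c \<gamma>) * \<rho> ^ mdeg \<gamma>) summable_on ?B"
      by (rule summable_on_subset_banach[of _ midx]) (use c in \<open>auto simp: psf_def\<close>)
    then show "((\<lambda>\<gamma>. (s / \<rho>) ^ N * (norm (c \<gamma>) * \<rho> ^ mdeg \<gamma>)) has_sum (s / \<rho>) ^ N * (\<Sum>\<^sub>\<infinity>\<gamma>\<in>?B. norm (c \<gamma>) * \<rho> ^ mdeg \<gamma>)) ?B"
      by (intro has_sum_cmult_right has_sum_infsum)
    fix \<gamma> :: "'a => nat" assume \<gamma>: "\<gamma> \<in> ?B"
    have "norm (mon z \<gamma> *\<^sub>R c \<gamma>) \<le> s ^ mdeg \<gamma> * norm (c \<gamma>)"
      using abs_mon_le[OF z, of \<gamma>] by (simp add: mult_right_mono)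
    also have "s ^ mdeg \<gamma> = (s / \<rho>) ^ mdeg \<gamma> * \<rho> ^ mdeg \<gamma>" using \<rho> by (simp add: power_divide)
    also have "\<dots> * norm (c \<gamma>) \<le> (s / \<rho>) ^ N * \<rho> ^ mdeg \<gamma> * norm (c \<gamma>)"
      using \<gamma> s \<rho> by (intro mult_right_mono power_decreasing) auto
    finally show "norm (mon z \<gamma> *\<^sub>R c \<gamma>) \<le> (s / \<rho>) ^ N * (norm (c \<gamma>) * \<rho> ^ mdeg \<gamma>)" by (simp add: mult_ac)
  qed
  also have "\<dots> \<le> (s / \<rho>) ^ N * M"
  proof (rule mult_left_mono)
    have "(\<Sum>\<^sub>\<infinity>\<gamma>\<in>?B. norm (c \<gamma>) * \<rho> ^ mdeg \<gamma>) \<le> (\<Sum>\<^sub>\<infinity>\<gamma>\<in>midx. norm (c \<gamma>) * \<rho> ^ mdeg \<gamma>)"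
      by (rule infsum_mono2) (use c \<rho> in \<open>auto simp: psf_def intro!: summable_on_subset_banach[of _ midx]\<close>)
    then show "(\<Sum>\<^sub>\<infinity>\<gamma>\<in>?B. norm (c \<gamma>) * \<rho> ^ mdeg \<gamma>) \<le> M" using c by (auto simp: psf_def)
  qed (use s \<rho> in auto)
  finally show ?thesis .
qed

text \<open>
  The uniformity of the expansions in the angles lets the angle be a function of \<open>u\<close> as well, as in
  \<open>f(\<theta> + \<kappa>)\<close>.
\<close>

lemma taylor_O:
  fixes f :: "real ^ 'd => 'z::euclidean_space \<times> (real ^ 'm) => real"
    and z :: "real => real ^ 'd => real ^ 'm => 'z" and \<theta>' :: "real => real ^ 'd => real ^ 'm => real ^ 'd"
  assumes C: "\<And>L. compact L ==> L \<subseteq> \<Lambda> ==> \<exists>\<rho>>0. \<exists>M. \<forall>\<theta>. \<forall>\<mu>\<in>L. psf \<rho> M (\<lambda>\<gamma>. C \<gamma> \<theta> \<mu>) (\<lambda>z. f \<theta> (z, \<mu>))"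
    and z: "\<And>b. b \<in> Basis ==> O_pow \<Lambda> 1 (\<lambda>u \<theta> \<mu>. z u \<theta> \<mu> \<bullet> b)"
  shows "eqm \<Lambda> N (\<lambda>u \<theta> \<mu>. f (\<theta>' u \<theta> \<mu>) (z u \<theta> \<mu>, \<mu>))
    (\<lambda>u \<theta> \<mu>. \<Sum>\<gamma>\<in>{\<gamma> \<in> midx. mdeg \<gamma> < N}. C \<gamma> (\<theta>' u \<theta> \<mu>) \<mu> * mon (z u \<theta> \<mu>) \<gamma>)"
  unfolding eqm_def
proof (rule O_powI)
  fix L assume L: "compact L" "L \<subseteq> \<Lambda>"
  obtain \<rho> M where \<rho>: "\<rho> > 0" and P: "\<And>\<theta> \<mu>. \<mu> \<in> L ==> psf \<rho> M (\<lambda>\<gamma>. C \<gamma> \<theta> \<mu>) (\<lambda>z. f \<theta> (z, \<mu>))"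
    using C[OF L] by blast
  have zO: "O_pow \<Lambda> 1 (\<lambda>u \<theta> \<mu>. \<Sum>b\<in>Basis. \<bar>z u \<theta> \<mu> \<bullet> b\<bar>)" by (intro O_sum) (use z in \<open>simp add: O_pow_def\<close>)
  obtain D \<delta> where D: "D > 0" "\<delta> > 0" "\<And>u \<theta> \<mu>. 0 < u ==> u < \<delta> ==> \<mu> \<in> L ==> norm (\<Sum>b\<in>Basis. \<bar>z u \<theta> \<mu> \<bullet> b\<bar>) \<le> D * u ^ 1"
    using O_powE[OF zO L] by metis
  define \<epsilon> where "\<epsilon> = min \<delta> (\<rho> / D)"
  have \<epsilon>: "\<epsilon> > 0" using D \<rho> by (simp add: \<epsilon>_def)
  have "norm (f (\<theta>' u \<theta> \<mu>) (z u \<theta> \<mu>, \<mu>) - (\<Sum>\<gamma>\<in>{\<gamma> \<in> midx. mdeg \<gamma> < N}. C \<gamma> (\<theta>' u \<theta> \<mu>) \<mu> * mon (z u \<theta> \<mu>) \<gamma>)) \<le> ((D / \<rho>) ^ N * M) * u ^ N"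
    if u: "0 < u" "u < \<epsilon>" and \<mu>: "\<mu> \<in> L" for u \<theta> \<mu>
  proof -
    have "z u \<theta> \<mu> \<in> pbox (D * u)" unfolding pbox_def
    proof (intro CollectI ballI)
      fix b :: 'z assume b: "b \<in> Basis"
      have "\<bar>z u \<theta> \<mu> \<bullet> b\<bar> \<le> (\<Sum>b\<in>Basis. \<bar>z u \<theta> \<mu> \<bullet> b\<bar>)" by (rule member_le_sum[OF b]) auto
      also have "\<dots> \<le> D * u" using D(3)[of u \<mu> \<theta>] u \<mu> by (simp add: \<epsilon>_def)
      finally show "\<bar>z u \<theta> \<mu> \<bullet> b\<bar> \<le> D * u" .
    qed
    moreover have "D * u \<le> \<rho>" using u D by (simp add: \<epsilon>_def field_simps)
    ultimately show ?thesis using psf_tail[OF P[OF \<mu>], of "z u \<theta> \<mu>" "D * u" "\<theta>' u \<theta> \<mu>" N] u D \<rho>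
      by (simp add: power_mult_distrib power_divide mult_ac)
  qed
  then show "\<exists>C'. \<exists>\<delta>>0. \<forall>u. 0 < u \<and> u < \<delta> \<longrightarrow> (\<forall>\<theta>. \<forall>\<mu>\<in>L. norm (f (\<theta>' u \<theta> \<mu>) (z u \<theta> \<mu>, \<mu>) -
      (\<Sum>\<gamma>\<in>{\<gamma> \<in> midx. mdeg \<gamma> < N}. C \<gamma> (\<theta>' u \<theta> \<mu>) \<mu> * mon (z u \<theta> \<mu>) \<gamma>)) \<le> C' * u ^ N)"
    using \<epsilon> by blast
qed

lemma inner_Basis_vec: "b \<in> (Basis :: (real ^ 'd) set) ==> \<exists>i. \<forall>x. x \<bullet> b = x $ i"
  by (auto simp: Basis_vec_def inner_axis)

lemma shift_taylor:
  fixes f :: "real ^ 'd => real ^ 'm => real"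
  assumes f: "torus_analytic_on f \<Lambda>"
  obtains C where "\<And>\<gamma>. \<gamma> \<in> midx ==> torus_analytic_on (C \<gamma>) \<Lambda>"
    "\<And>N \<kappa>. O_pow \<Lambda> 1 \<kappa> ==>
      eqm \<Lambda> N (\<lambda>u \<theta> \<mu>. f (\<theta> + \<kappa> u \<theta> \<mu>) \<mu>) (\<lambda>u \<theta> \<mu>. \<Sum>\<gamma>\<in>{\<gamma> \<in> midx. mdeg \<gamma> < N}. C \<gamma> \<theta> \<mu> * mon (\<kappa> u \<theta> \<mu>) \<gamma>)"
proof -
  have z0: "(0 :: real ^ 'd) \<in> interior UNIV" by simp
  obtain C where C1: "\<And>\<gamma>. \<gamma> \<in> midx ==> torus_analytic_on (C \<gamma>) \<Lambda>"
    and C2: "\<And>L. compact L ==> L \<subseteq> \<Lambda> ==> \<exists>\<rho>>0. \<exists>M. \<forall>\<theta>. \<forall>\<mu>\<in>L. psf \<rho> M (\<lambda>\<gamma>. C \<gamma> \<theta> \<mu>) (\<lambda>z. (\<lambda>\<theta> (z, \<mu>). f (\<theta> + z) \<mu>) \<theta> (z, \<mu>))"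
    by (rule taylor_expansion[OF ta_translate_param[OF f] z0]) (rule that)
  show ?thesis
  proof (rule that[OF C1])
    fix N and \<kappa> :: "real => real ^ 'd => real ^ 'm => real ^ 'd"
    assume \<kappa>: "O_pow \<Lambda> 1 \<kappa>"
    have "O_pow \<Lambda> 1 (\<lambda>u \<theta> \<mu>. \<kappa> u \<theta> \<mu> \<bullet> b)" if "b \<in> Basis" for b
      using inner_Basis_vec[OF that] \<kappa>[unfolded O_vec] by auto
    from taylor_O[OF C2 this, where \<theta>' = "\<lambda>u \<theta> \<mu>. \<theta>" and N = N]
    show "eqm \<Lambda> N (\<lambda>u \<theta> \<mu>. f (\<theta> + \<kappa> u \<theta> \<mu>) \<mu>) (\<lambda>u \<theta> \<mu>. \<Sum>\<gamma>\<in>{\<gamma> \<in> midx. mdeg \<gamma> < N}. C \<gamma> \<theta> \<mu> * mon (\<kappa> u \<theta> \<mu>) \<gamma>)"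
      by simp
  qed
qed

lemma xpd_shift:
  fixes f :: "real ^ 'd => real ^ 'm => real"
  assumes f: "torus_analytic_on f \<Lambda>" and \<kappa>: "\<And>i. xpd \<Lambda> (\<lambda>u \<theta> \<mu>. \<kappa> u \<theta> \<mu> $ i)" "O_pow \<Lambda> 1 \<kappa>"
  shows "xpd \<Lambda> (\<lambda>u \<theta> \<mu>. f (\<theta> + \<kappa> u \<theta> \<mu>) \<mu>)"
proof (rule xpd_approx)
  fix N
  obtain C where C: "\<And>\<gamma>. \<gamma> \<in> midx ==> torus_analytic_on (C \<gamma>) \<Lambda>"
    and T: "\<And>N \<kappa>. O_pow \<Lambda> 1 \<kappa> ==>
      eqm \<Lambda> N (\<lambda>u \<theta> \<mu>. f (\<theta> + \<kappa> u \<theta> \<mu>) \<mu>) (\<lambda>u \<theta> \<mu>. \<Sum>\<gamma>\<in>{\<gamma> \<in> midx. mdeg \<gamma> < N}. C \<gamma> \<theta> \<mu> * mon (\<kappa> u \<theta> \<mu>) \<gamma>)"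
    by (rule shift_taylor[OF f]) (rule that)
  have "xpd \<Lambda> (\<lambda>u \<theta> \<mu>. \<kappa> u \<theta> \<mu> \<bullet> b)" if "b \<in> Basis" for b
    using inner_Basis_vec[OF that] \<kappa>(1) by auto
  then have "xpd \<Lambda> (\<lambda>u \<theta> \<mu>. \<Sum>\<gamma>\<in>{\<gamma> \<in> midx. mdeg \<gamma> < N}. C \<gamma> \<theta> \<mu> * mon (\<kappa> u \<theta> \<mu>) \<gamma>)"
    unfolding mon_def by (intro xpd_sum xpd_mult xpd_prod xpd_power xpd_coef C) auto
  then show "\<exists>g. xpd \<Lambda> g \<and> eqm \<Lambda> N (\<lambda>u \<theta> \<mu>. f (\<theta> + \<kappa> u \<theta> \<mu>) \<mu>) g"
    using T[OF \<kappa>(2), of N] by blast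
qed

lemma eqm_shift:
  fixes f :: "real ^ 'd => real ^ 'm => real"
  assumes f: "torus_analytic_on f \<Lambda>" and \<kappa>: "O_pow \<Lambda> 1 \<kappa>" "O_pow \<Lambda> 1 \<kappa>'"
    and d: "O_pow \<Lambda> N (\<lambda>u \<theta> \<mu>. \<kappa> u \<theta> \<mu> - \<kappa>' u \<theta> \<mu>)"
  shows "eqm \<Lambda> N (\<lambda>u \<theta> \<mu>. f (\<theta> + \<kappa> u \<theta> \<mu>) \<mu>) (\<lambda>u \<theta> \<mu>. f (\<theta> + \<kappa>' u \<theta> \<mu>) \<mu>)"
proof -
  obtain C where C: "\<And>\<gamma>. \<gamma> \<in> midx ==> torus_analytic_on (C \<gamma>) \<Lambda>"
    and T: "\<And>N \<kappa>. O_pow \<Lambda> 1 \<kappa> ==>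
      eqm \<Lambda> N (\<lambda>u \<theta> \<mu>. f (\<theta> + \<kappa> u \<theta> \<mu>) \<mu>) (\<lambda>u \<theta> \<mu>. \<Sum>\<gamma>\<in>{\<gamma> \<in> midx. mdeg \<gamma> < N}. C \<gamma> \<theta> \<mu> * mon (\<kappa> u \<theta> \<mu>) \<gamma>)"
    by (rule shift_taylor[OF f]) (rule that)
  have O: "O_pow \<Lambda> 0 (\<lambda>u \<theta> \<mu>. \<kappa> u \<theta> \<mu> \<bullet> b)" "O_pow \<Lambda> 0 (\<lambda>u \<theta> \<mu>. \<kappa>' u \<theta> \<mu> \<bullet> b)"
    "eqm \<Lambda> N (\<lambda>u \<theta> \<mu>. \<kappa> u \<theta> \<mu> \<bullet> b) (\<lambda>u \<theta> \<mu>. \<kappa>' u \<theta> \<mu> \<bullet> b)" if "b \<in> Basis" for b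
  proof -
    obtain i where i: "\<And>x. x \<bullet> b = x $ i" using inner_Basis_vec[OF \<open>b \<in> Basis\<close>] by blast
    show "O_pow \<Lambda> 0 (\<lambda>u \<theta> \<mu>. \<kappa> u \<theta> \<mu> \<bullet> b)" "O_pow \<Lambda> 0 (\<lambda>u \<theta> \<mu>. \<kappa>' u \<theta> \<mu> \<bullet> b)"
      unfolding i using \<kappa>[unfolded O_vec] O_mono[of \<Lambda> 1 _ 0] by auto
    show "eqm \<Lambda> N (\<lambda>u \<theta> \<mu>. \<kappa> u \<theta> \<mu> \<bullet> b) (\<lambda>u \<theta> \<mu>. \<kappa>' u \<theta> \<mu> \<bullet> b)"
      unfolding i eqm_def using d[unfolded O_vec] by simp
  qed
  have Op: "O_pow \<Lambda> 0 (\<lambda>u \<theta> \<mu>. (\<kappa> u \<theta> \<mu> \<bullet> b) ^ n)" "O_pow \<Lambda> 0 (\<lambda>u \<theta> \<mu>. (\<kappa>' u \<theta> \<mu> \<bullet> b) ^ n)"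
    if "b \<in> Basis" for b n
    using O_power[OF O(1)[OF that], of n] O_power[OF O(2)[OF that], of n] by simp_all
  have M: "eqm \<Lambda> N (\<lambda>u \<theta> \<mu>. mon (\<kappa> u \<theta> \<mu>) \<gamma>) (\<lambda>u \<theta> \<mu>. mon (\<kappa>' u \<theta> \<mu>) \<gamma>)" for \<gamma>
    unfolding mon_def
    by (rule eqm_prod_weak) (intro eqm_power_weak O Op; assumption)+
  have MO: "O_pow \<Lambda> 0 (\<lambda>u \<theta> \<mu>. mon (\<kappa> u \<theta> \<mu>) \<gamma>)" for \<gamma>
    unfolding mon_def by (rule O_prod) (rule Op)
  have "eqm \<Lambda> N (\<lambda>u \<theta> \<mu>. \<Sum>\<gamma>\<in>{\<gamma> \<in> midx. mdeg \<gamma> < N}. C \<gamma> \<theta> \<mu> * mon (\<kappa> u \<theta> \<mu>) \<gamma>)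
     (\<lambda>u \<theta> \<mu>. \<Sum>\<gamma>\<in>{\<gamma> \<in> midx. mdeg \<gamma> < N}. C \<gamma> \<theta> \<mu> * mon (\<kappa>' u \<theta> \<mu>) \<gamma>)"
  proof (rule eqm_sum)
    fix \<gamma> :: "real ^ 'd => nat" assume "\<gamma> \<in> {\<gamma> \<in> midx. mdeg \<gamma> < N}"
    then have "O_pow \<Lambda> 0 (\<lambda>u \<theta> \<mu>. C \<gamma> \<theta> \<mu>)" by (intro O_coef C) auto
    from eqm_mult[OF eqm_refl MO this M, of N N]
    show "eqm \<Lambda> N (\<lambda>u \<theta> \<mu>. C \<gamma> \<theta> \<mu> * mon (\<kappa> u \<theta> \<mu>) \<gamma>) (\<lambda>u \<theta> \<mu>. C \<gamma> \<theta> \<mu> * mon (\<kappa>' u \<theta> \<mu>) \<gamma>)" by simp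
  qed
  from eqm_trans[OF eqm_trans[OF T[OF \<kappa>(1)] this] eqm_sym[OF T[OF \<kappa>(2)]]] show ?thesis .
qed

section \<open>The remainders\<close>

lemma mon_pair: "mon (x, y) \<gamma> = x ^ \<gamma> (1, 0) * y ^ \<gamma> (0, 1)"
  by (simp add: mon_def prod_Basis_prod)

lemma mdeg_pair: "mdeg \<gamma> = \<gamma> (1, 0) + \<gamma> (0 :: real, 1 :: real)"
  by (simp add: mdeg_def sum_Basis_prod)

lemma midx_pair_eqI:
  assumes "\<gamma> \<in> midx" "\<gamma>' \<in> midx" "\<gamma> (1, 0) = \<gamma>' (1, 0)" "\<gamma> (0, 1) = \<gamma>' (0 :: real, 1 :: real)"
  shows "\<gamma> = \<gamma>'"
proof (rule PiE_ext)
  show "\<gamma> \<in> Basis \<rightarrow>\<^sub>E UNIV" "\<gamma>' \<in> Basis \<rightarrow>\<^sub>E UNIV" using assms by (auto simp: midx_def)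
  show "\<gamma> b = \<gamma>' b" if "b \<in> Basis" for b using that assms by (auto simp: Basis_prod_def)
qed

text \<open>
  Along each ray the part of degree below \<open>j\<close> is a polynomial in one variable of order \<open>j\<close>, hence zero.
  So this part vanishes as a function, and uniqueness of the coefficients applies.
\<close>

lemma psf_low_order_zero:
  fixes f :: "real \<times> real => real"
  assumes c: "psf \<rho> M c f" and \<rho>: "\<rho> > 0"
    and O: "eventually (\<lambda>z. \<bar>f z\<bar> \<le> K * norm z ^ j) (at 0)"
    and \<gamma>: "\<gamma> \<in> midx" "mdeg \<gamma> < j"
  shows "c \<gamma> = 0"
proof -
  let ?A = "{\<gamma> \<in> midx. mdeg \<gamma> < j} :: (real \<times> real => nat) set"
  define P where "P n z = (\<Sum>\<gamma>\<in>{\<gamma> \<in> midx. mdeg \<gamma> = n}. mon z \<gamma> * c \<gamma>)" for n and z :: "real \<times> real"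
  define T where "T z = (\<Sum>\<gamma>\<in>?A. mon z \<gamma> * c \<gamma>)" for z
  obtain d where d: "d > 0" "\<And>z. z \<noteq> 0 ==> norm z < d ==> \<bar>f z\<bar> \<le> K * norm z ^ j"
    using O unfolding eventually_at by (auto simp: dist_norm)
  have Thom: "T (t *\<^sub>R z) = (\<Sum>n<j. P n z * t ^ n)" for t z
  proof -
    have hom: "mon (t *\<^sub>R z) \<gamma> = t ^ mdeg \<gamma> * mon z \<gamma>" for \<gamma>
      by (cases z) (simp add: mon_pair mdeg_pair power_mult_distrib power_add mult_ac)
    have "(\<Sum>n<j. P n z * t ^ n) = (\<Sum>n<j. \<Sum>\<gamma>\<in>{\<gamma> \<in> ?A. mdeg \<gamma> = n}. mon (t *\<^sub>R z) \<gamma> * c \<gamma>)"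
      unfolding P_def sum_distrib_right by (intro sum.cong) (auto simp: hom mult_ac)
    also have "\<dots> = T (t *\<^sub>R z)" unfolding T_def
      by (rule sum.group) (auto simp: finite_midx_less)
    finally show ?thesis by simp
  qed
  have P0: "P n z = 0" if n: "n < j" and z: "z \<noteq> 0" for n z
  proof -
    define B where "B = norm z + 1"
    have B: "B > 0" "norm z \<le> B" by (auto simp: B_def add_nonneg_pos)
    have "\<bar>\<Sum>n<j. P n z * t ^ n\<bar> \<le> (\<bar>K\<bar> * B ^ j + (B / \<rho>) ^ j * M) * t ^ j"
      if t: "0 < t" "t < min (d / B) (\<rho> / B)" for t
    proof -
      have nz: "norm (t *\<^sub>R z) \<le> t * B" using t B by simp
      have tB: "t * B < d" "t * B \<le> \<rho>" using t B by (auto simp: field_simps)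
      have "\<bar>f (t *\<^sub>R z)\<bar> \<le> K * norm (t *\<^sub>R z) ^ j" by (rule d(2)) (use t z in simp, use nz tB in linarith)
      also have "\<dots> \<le> \<bar>K\<bar> * (t * B) ^ j" using nz by (intro mult_mono power_mono) auto
      finally have 1: "\<bar>f (t *\<^sub>R z)\<bar> \<le> \<bar>K\<bar> * B ^ j * t ^ j" by (simp add: power_mult_distrib mult_ac)
      have "t *\<^sub>R z \<in> pbox (t * B)" unfolding pbox_def
      proof (intro CollectI ballI)
        fix b :: "real \<times> real" assume "b \<in> Basis"
        then show "\<bar>(t *\<^sub>R z) \<bullet> b\<bar> \<le> t * B" using Basis_le_norm[of b "t *\<^sub>R z"] nz by linarith
      qed
      from psf_tail[OF c this _ tB(2) \<rho>, of j]
      have "\<bar>f (t *\<^sub>R z) - T (t *\<^sub>R z)\<bar> \<le> (B / \<rho>) ^ j * M * t ^ j"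
        using t B by (simp add: T_def power_mult_distrib power_divide mult_ac)
      with 1 have "\<bar>T (t *\<^sub>R z)\<bar> \<le> \<bar>K\<bar> * B ^ j * t ^ j + (B / \<rho>) ^ j * M * t ^ j" by linarith
      then show ?thesis unfolding Thom by (simp add: distrib_right)
    qed
    then show ?thesis using d(1) B \<rho> n
      by (intro poly_small_imp_zero[of "min (d / B) (\<rho> / B)" "\<lambda>n. P n z" j]) auto
  qed
  have T0: "T z = 0" for z
  proof (cases "z = 0")
    case False
    then show ?thesis using Thom[of 1 z] P0 by simp
  next
    case True
    have "T 0 = (\<Sum>n<j. P n (1, 1) * 0 ^ n)" using Thom[of 0 "(1, 1)"] by (simp add: zero_prod_def)
    also have "\<dots> = 0" using P0[of _ "(1, 1)"] by (simp add: zero_prod_def)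
    finally show ?thesis using True by simp
  qed
  define c' where "c' \<gamma> = (if mdeg \<gamma> < j then c \<gamma> else 0)" for \<gamma>
  have "psf \<rho> (\<Sum>\<^sub>\<infinity>\<gamma>\<in>midx. norm (c' \<gamma>) * \<rho> ^ mdeg \<gamma>) c' (\<lambda>_. 0)"
    unfolding psf_def
  proof (intro conjI ballI order_refl)
    show "(\<lambda>\<gamma>. norm (c' \<gamma>) * \<rho> ^ mdeg \<gamma>) summable_on midx"
      by (rule summable_on_comparison_test[of "\<lambda>\<gamma>. norm (c \<gamma>) * \<rho> ^ mdeg \<gamma>"])
         (use c \<rho> in \<open>auto simp: psf_def c'_def\<close>)
    have s: "(\<Sum>\<gamma>\<in>?A. mon z \<gamma> *\<^sub>R c' \<gamma>) = 0" for z using T0[of z] by (simp add: T_def c'_def)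
    show "((\<lambda>\<gamma>. mon z \<gamma> *\<^sub>R c' \<gamma>) has_sum 0) midx" for z
      by (rule has_sum_finite_neutralI[where B = ?A])
         (use s[of z] in \<open>auto simp: finite_midx_less c'_def\<close>)
  qed
  from psf_zero_coeff[OF this \<rho> _ \<gamma>(1)] show ?thesis using \<gamma>(2) by (simp add: c'_def)
qed

text \<open>
  The bound \<open>O(\<parallel>z\<parallel>\<^sup>j)\<close> removes the degrees below \<open>j\<close>. The coefficient of \<open>x\<^sup>j\<close> is visible on the axis
  \<open>y = 0\<close>, where the remainder reduces to its part of order \<open>j + 1\<close>.
\<close>

lemma remainder_order_coeff_zero:
  fixes f :: "real \<times> real => real"
  assumes c: "psf \<rho> M c f" and \<rho>: "\<rho> > 0"
    and r: "remainder_order j U (\<lambda>x y. f (x, y))" and U: "(0, 0) \<in> interior U"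
    and j: "j \<ge> 1"
    and \<gamma>: "\<gamma> \<in> midx" "mdeg \<gamma> < j \<or> mdeg \<gamma> = j \<and> \<gamma> (0, 1) = 0"
  shows "c \<gamma> = 0"
proof -
  obtain g h where gh0: "\<forall>(x, y)\<in>U. f (x, y) = y *\<^sub>R g (x, y) + h (x, y)"
    and g: "(\<lambda>z. norm (g z)) \<in> O[at (0, 0)](\<lambda>z. norm z ^ (j - 1))"
    and h: "(\<lambda>z. norm (h z)) \<in> O[at (0, 0)](\<lambda>z. norm z ^ (j + 1))"
    using r unfolding remainder_order_def by blast
  have gh: "f (x, y) = y * g (x, y) + h (x, y)" if "(x, y) \<in> U" for x y using gh0 that by auto
  obtain G where G: "G > 0" "eventually (\<lambda>z. \<bar>g z\<bar> \<le> G * norm z ^ (j - 1)) (at 0)"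
    using g by (elim landau_o.bigE) (auto simp: zero_prod_def)
  obtain H where H: "H > 0" "eventually (\<lambda>z. \<bar>h z\<bar> \<le> H * norm z ^ (j + 1)) (at 0)"
    using h by (elim landau_o.bigE) (auto simp: zero_prod_def)
  have U': "eventually (\<lambda>z. z \<in> U) (at 0)"
    using U eventually_nhds_in_open[OF open_interior, of 0 U] interior_subset[of U]
    by (auto simp: eventually_at_filter zero_prod_def elim!: eventually_mono)
  have n1: "eventually (\<lambda>z :: real \<times> real. norm z < 1) (at 0)"
    unfolding eventually_at by (intro exI[of _ 1]) (auto simp: dist_norm)
  have f: "eventually (\<lambda>z. \<bar>f z\<bar> \<le> (G + H) * norm z ^ j) (at 0)"
    using G(2) H(2) U' n1
  proof eventually_elim
    case (elim z)
    obtain x y where z: "z = (x, y)" by (cases z)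
    have y: "\<bar>y\<bar> \<le> norm z" unfolding z using norm_snd_le[of y x] by simp
    have "\<bar>f z\<bar> \<le> \<bar>y\<bar> * \<bar>g z\<bar> + \<bar>h z\<bar>"
      using gh[of x y] elim(3) abs_triangle_ineq[of "y * g z" "h z"] by (simp add: z abs_mult)
    also have "\<bar>y\<bar> * \<bar>g z\<bar> \<le> norm z * (G * norm z ^ (j - 1))" using y elim(1) by (intro mult_mono) auto
    also have "norm z * (G * norm z ^ (j - 1)) = G * norm z ^ j"
      using j by (cases j) auto
    also have "\<bar>h z\<bar> \<le> H * norm z ^ j"
    proof -
      have "norm z ^ (j + 1) \<le> norm z ^ j" using elim(4) by (intro power_decreasing) auto
      then show ?thesis using elim(2) H(1) by (meson mult_left_mono less_imp_le order_trans)
    qed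
    finally show ?case by (simp add: distrib_right)
  qed
  have low: "c \<gamma> = 0" if "\<gamma> \<in> midx" "mdeg \<gamma> < j" for \<gamma>
    by (rule psf_low_order_zero[OF c \<rho> f that])
  show ?thesis
  proof (cases "mdeg \<gamma> < j")
    case True then show ?thesis using low \<gamma> by blast
  next
    case False
    then have \<gamma>j: "\<gamma> (1, 0) = j" "\<gamma> (0, 1) = 0" using \<gamma> by (auto simp: mdeg_pair)
    \<comment> \<open>On the axis \<open>y = 0\<close> the monomials of degree \<open>j\<close> other than \<open>x\<^sup>j\<close> vanish.\<close>
    obtain d where d: "d > 0" "\<And>z. z \<noteq> 0 ==> norm z < d ==> \<bar>h z\<bar> \<le> H * norm z ^ (j + 1) \<and> z \<in> U"
      using eventually_conj[OF H(2) U'] unfolding eventually_at by (auto simp: dist_norm)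
    let ?A = "{\<gamma> \<in> midx. mdeg \<gamma> < j + 1} :: (real \<times> real => nat) set"
    have "\<bar>\<Sum>n<j + 1. (if n = j then c \<gamma> else 0) * t ^ n\<bar> \<le> (H + (1 / \<rho>) ^ (j + 1) * M) * t ^ (j + 1)"
      if t: "0 < t" "t < min d \<rho>" for t
    proof -
      have "\<bar>f (t, 0)\<bar> \<le> H * t ^ (j + 1)"
        using gh[of t 0] d(2)[of "(t, 0)"] t by (auto simp: norm_Pair zero_prod_def)
      moreover have "(t, 0) \<in> pbox t" unfolding pbox_Pair using t by (simp add: pbox_def)
      from psf_tail[OF c this _ _ \<rho>, of "j + 1"] t
      have "\<bar>f (t, 0) - (\<Sum>\<gamma>\<in>?A. mon (t, 0) \<gamma> * c \<gamma>)\<bar> \<le> (1 / \<rho>) ^ (j + 1) * M * t ^ (j + 1)"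
        by (simp add: power_divide mult_ac)
      moreover have "(\<Sum>\<gamma>\<in>?A. mon (t, 0) \<gamma> * c \<gamma>) = (\<Sum>\<gamma>'\<in>?A. if \<gamma>' = \<gamma> then t ^ j * c \<gamma> else 0)"
      proof (rule sum.cong)
        fix \<gamma>' assume \<gamma>': "\<gamma>' \<in> ?A"
        show "mon (t, 0) \<gamma>' * c \<gamma>' = (if \<gamma>' = \<gamma> then t ^ j * c \<gamma> else 0)"
        proof (cases "\<gamma>' = \<gamma>")
          case True then show ?thesis using \<gamma>j by (simp add: mon_pair)
        next
          case neq: False
          show ?thesis
          proof (cases "mdeg \<gamma>' < j")
            case True then show ?thesis using low \<gamma>' neq by auto
          next
            case False
            then have "\<gamma>' (0, 1) \<noteq> 0" using midx_pair_eqI[of \<gamma>' \<gamma>] \<gamma>' \<gamma> \<gamma>j neq by (auto simp: mdeg_pair)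
            then show ?thesis using neq by (simp add: mon_pair)
          qed
        qed
      qed simp
      moreover have "\<gamma> \<in> ?A" using \<gamma> by auto
      then have "(\<Sum>\<gamma>'\<in>?A. if \<gamma>' = \<gamma> then t ^ j * c \<gamma> else 0) = t ^ j * c \<gamma>" by (simp add: finite_midx_less)
      ultimately have "\<bar>t ^ j * c \<gamma>\<bar> \<le> H * t ^ (j + 1) + (1 / \<rho>) ^ (j + 1) * M * t ^ (j + 1)" by linarith
      moreover have "(\<Sum>n<j + 1. (if n = j then c \<gamma> else 0) * t ^ n) = t ^ j * c \<gamma>" by (simp add: mult.commute)
      ultimately show ?thesis by (simp only: distrib_right)
    qed
    then have "(if j = j then c \<gamma> else 0) = 0" using d(1) \<rho>
      by (intro poly_small_imp_zero[of "min d \<rho>" "\<lambda>n. if n = j then c \<gamma> else 0" "j + 1"]) auto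
    then show ?thesis by simp
  qed
qed

lemma O_coef_sub:
  fixes f :: "real ^ 'd => real ^ 'm => 'b::euclidean_space"
  assumes "torus_analytic_on f \<Lambda>" shows "O_pow \<Lambda> 0 (\<lambda>u \<theta> \<mu>. f (\<theta>' u \<theta> \<mu>) \<mu>)"
  using O_coef[OF assms] unfolding O_pow_iff by meson

lemma eqm_pow:
  assumes x: "O_pow \<Lambda> a x" "O_pow \<Lambda> a x'" and e: "eqm \<Lambda> (a + e) x x'"
  shows "eqm \<Lambda> (a * i + e) (\<lambda>u \<theta> \<mu>. x u \<theta> \<mu> ^ i) (\<lambda>u \<theta> \<mu>. x' u \<theta> \<mu> ^ i)"
proof (induction i)
  case (Suc i)
  have "eqm \<Lambda> (a * Suc i + e) (\<lambda>u \<theta> \<mu>. x u \<theta> \<mu> * x u \<theta> \<mu> ^ i) (\<lambda>u \<theta> \<mu>. x' u \<theta> \<mu> * x' u \<theta> \<mu> ^ i)"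
    by (rule eqm_mult[OF e O_power[OF x(1)] x(2) Suc]) auto
  then show ?case by simp
qed simp

text \<open>
  With \<open>x = O(u\<^sup>2)\<close> and \<open>y = O(u\<^sup>k\<^sup>+\<^sup>1)\<close>, a monomial \<open>x\<^sup>a y\<^sup>b\<close> has the weight \<open>2 a + (k + 1) b\<close>. As \<open>k \<ge> 2\<close>, a
  weight below \<open>2 j + 1\<close> forces degree below \<open>j\<close> or the monomial \<open>x\<^sup>j\<close>, neither of which occurs in a
  remainder of order \<open>j\<close>.
\<close>

lemma remainder_taylor:
  fixes f :: "real => real => real ^ 'd => real ^ 'm => real"
  assumes f: "torus_analytic_on (\<lambda>\<theta> ((x, y), \<mu>). f x y \<theta> \<mu>) (U \<times> \<Lambda>)"
    and r: "\<And>\<theta> \<mu>. \<mu> \<in> \<Lambda> ==> remainder_order j U (\<lambda>x y. f x y \<theta> \<mu>)"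
    and U: "(0, 0) \<in> interior U" and j: "j \<ge> 1" and k: "k \<ge> 2"
  obtains C :: "(real \<times> real => nat) => real ^ 'd => real ^ 'm => real" where "\<And>\<gamma>. \<gamma> \<in> midx ==> torus_analytic_on (C \<gamma>) \<Lambda>"
    "\<And>\<gamma> \<theta> \<mu>. \<gamma> \<in> midx ==> \<mu> \<in> \<Lambda> ==> 2 * \<gamma> (1, 0) + (k + 1) * \<gamma> (0, 1) < 2 * j + 1 ==> C \<gamma> \<theta> \<mu> = 0"
    "\<And>N (x :: real => real ^ 'd => real ^ 'm => real) y \<theta>'. O_pow \<Lambda> 1 x ==> O_pow \<Lambda> 1 y ==>
      eqm \<Lambda> N (\<lambda>u \<theta> \<mu>. f (x u \<theta> \<mu>) (y u \<theta> \<mu>) (\<theta>' u \<theta> \<mu>) \<mu>)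
       (\<lambda>u \<theta> \<mu>. \<Sum>\<gamma>\<in>{\<gamma> \<in> midx. mdeg \<gamma> < N}. C \<gamma> (\<theta>' u \<theta> \<mu>) \<mu> * (x u \<theta> \<mu> ^ \<gamma> (1, 0) * y u \<theta> \<mu> ^ \<gamma> (0, 1)))"
proof -
  have U0: "0 \<in> interior U" using U by (simp add: zero_prod_def)
  obtain C where C1: "\<And>\<gamma>. \<gamma> \<in> midx ==> torus_analytic_on (C \<gamma>) \<Lambda>"
    and C2: "\<And>L. compact L ==> L \<subseteq> \<Lambda> ==> \<exists>\<rho>>0. \<exists>M. \<forall>\<theta>. \<forall>\<mu>\<in>L. psf \<rho> M (\<lambda>\<gamma>. C \<gamma> \<theta> \<mu>)
        (\<lambda>z. (\<lambda>\<theta> ((x, y), \<mu>). f x y \<theta> \<mu>) \<theta> (z, \<mu>))"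
    by (rule taylor_expansion[OF f U0]) (rule that)
  show ?thesis
  proof (rule that[OF C1])
    fix \<gamma> :: "real \<times> real => nat" and \<theta> \<mu>
    assume \<gamma>: "\<gamma> \<in> midx" and \<mu>: "\<mu> \<in> \<Lambda>" and \<gamma>2: "2 * \<gamma> (1, 0) + (k + 1) * \<gamma> (0, 1) < 2 * j + 1"
    have "3 * \<gamma> (0, 1) \<le> (k + 1) * \<gamma> (0, 1)" using k by (intro mult_right_mono) auto
    then have small: "mdeg \<gamma> < j \<or> mdeg \<gamma> = j \<and> \<gamma> (0, 1) = 0" using \<gamma>2 unfolding mdeg_pair by linarith
    obtain \<rho> M where \<rho>: "\<rho> > 0" and P: "psf \<rho> M (\<lambda>\<gamma>. C \<gamma> \<theta> \<mu>) (\<lambda>z. f (fst z) (snd z) \<theta> \<mu>)"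
      using C2[OF compact_sing[of \<mu>]] \<mu> by (auto simp: case_prod_unfold)
    have "remainder_order j U (\<lambda>x y. (\<lambda>z. f (fst z) (snd z) \<theta> \<mu>) (x, y))" using r[OF \<mu>] by simp
    from remainder_order_coeff_zero[OF P \<rho> this U j \<gamma> small] show "C \<gamma> \<theta> \<mu> = 0" .
  next
    fix N and x y :: "real => real ^ 'd => real ^ 'm => real" and \<theta>' :: "real => real ^ 'd => real ^ 'm => real ^ 'd"
    assume x: "O_pow \<Lambda> 1 x" and y: "O_pow \<Lambda> 1 y"
    have "O_pow \<Lambda> 1 (\<lambda>u \<theta> \<mu>. (x u \<theta> \<mu>, y u \<theta> \<mu>) \<bullet> b)" if "b \<in> Basis" for b
      using that x y by (auto simp: Basis_prod_def)
    from taylor_O[OF C2 this, where \<theta>' = \<theta>' and N = N]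
    show "eqm \<Lambda> N (\<lambda>u \<theta> \<mu>. f (x u \<theta> \<mu>) (y u \<theta> \<mu>) (\<theta>' u \<theta> \<mu>) \<mu>)
       (\<lambda>u \<theta> \<mu>. \<Sum>\<gamma>\<in>{\<gamma> \<in> midx. mdeg \<gamma> < N}. C \<gamma> (\<theta>' u \<theta> \<mu>) \<mu> * (x u \<theta> \<mu> ^ \<gamma> (1, 0) * y u \<theta> \<mu> ^ \<gamma> (0, 1)))"
      by (simp add: mon_pair)
  qed
qed

context
  fixes f :: "real => real => real ^ 'd => real ^ 'm => real" and U \<Lambda> j k
  assumes f: "torus_analytic_on (\<lambda>\<theta> ((x, y), \<mu>). f x y \<theta> \<mu>) (U \<times> \<Lambda>)"
    and r: "\<And>\<theta> \<mu>. \<mu> \<in> \<Lambda> ==> remainder_order j U (\<lambda>x y. f x y \<theta> \<mu>)"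
    and U: "(0, 0) \<in> interior U" and j: "j \<ge> 1" and k: "k \<ge> (2::nat)"
begin

lemma remainder_xpd:
  assumes x: "xpd \<Lambda> x" "O_pow \<Lambda> 1 x" and y: "xpd \<Lambda> y" "O_pow \<Lambda> 1 y"
    and \<kappa>: "\<And>i. xpd \<Lambda> (\<lambda>u \<theta> \<mu>. \<kappa> u \<theta> \<mu> $ i)" "O_pow \<Lambda> 1 \<kappa>"
  shows "xpd \<Lambda> (\<lambda>u \<theta> \<mu>. f (x u \<theta> \<mu>) (y u \<theta> \<mu>) (\<theta> + \<kappa> u \<theta> \<mu>) \<mu>)"
proof (rule remainder_taylor[OF f r U j k])
  fix C :: "(real \<times> real => nat) => real ^ 'd => real ^ 'm => real"
  assume C: "\<And>\<gamma>. \<gamma> \<in> midx ==> torus_analytic_on (C \<gamma>) \<Lambda>"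
    and T: "\<And>N (x :: real => real ^ 'd => real ^ 'm => real) y \<theta>'. O_pow \<Lambda> 1 x ==> O_pow \<Lambda> 1 y ==>
      eqm \<Lambda> N (\<lambda>u \<theta> \<mu>. f (x u \<theta> \<mu>) (y u \<theta> \<mu>) (\<theta>' u \<theta> \<mu>) \<mu>)
       (\<lambda>u \<theta> \<mu>. \<Sum>\<gamma>\<in>{\<gamma> \<in> midx. mdeg \<gamma> < N}. C \<gamma> (\<theta>' u \<theta> \<mu>) \<mu> * (x u \<theta> \<mu> ^ \<gamma> (1, 0) * y u \<theta> \<mu> ^ \<gamma> (0, 1)))"
  show ?thesis
  proof (rule xpd_approx)
    fix N
    have "xpd \<Lambda> (\<lambda>u \<theta> \<mu>. \<Sum>\<gamma>\<in>{\<gamma> \<in> midx. mdeg \<gamma> < N}. C \<gamma> (\<theta> + \<kappa> u \<theta> \<mu>) \<mu> * (x u \<theta> \<mu> ^ \<gamma> (1, 0) * y u \<theta> \<mu> ^ \<gamma> (0, 1)))"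
      by (intro xpd_sum xpd_mult xpd_power x y xpd_shift C \<kappa>) auto
    then show "\<exists>g. xpd \<Lambda> g \<and> eqm \<Lambda> N (\<lambda>u \<theta> \<mu>. f (x u \<theta> \<mu>) (y u \<theta> \<mu>) (\<theta> + \<kappa> u \<theta> \<mu>) \<mu>) g"
      using T[OF x(2) y(2), of N "\<lambda>u \<theta> \<mu>. \<theta> + \<kappa> u \<theta> \<mu>"] by blast
  qed
qed

lemma remainder_O:
  fixes x y :: "real => real ^ 'd => real ^ 'm => real"
  assumes x: "O_pow \<Lambda> 2 x" and y: "O_pow \<Lambda> (k + 1) y"
  shows "O_pow \<Lambda> (2 * j + 1) (\<lambda>u \<theta> \<mu>. f (x u \<theta> \<mu>) (y u \<theta> \<mu>) (\<theta>' u \<theta> \<mu>) \<mu>)"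
proof (rule remainder_taylor[OF f r U j k])
  fix C :: "(real \<times> real => nat) => real ^ 'd => real ^ 'm => real"
  assume C: "\<And>\<gamma>. \<gamma> \<in> midx ==> torus_analytic_on (C \<gamma>) \<Lambda>"
    and Z: "\<And>\<gamma> \<theta> \<mu>. \<gamma> \<in> midx ==> \<mu> \<in> \<Lambda> ==> 2 * \<gamma> (1, 0) + (k + 1) * \<gamma> (0, 1) < 2 * j + 1 ==> C \<gamma> \<theta> \<mu> = 0"
    and T: "\<And>N (x :: real => real ^ 'd => real ^ 'm => real) y \<theta>'. O_pow \<Lambda> 1 x ==> O_pow \<Lambda> 1 y ==>
      eqm \<Lambda> N (\<lambda>u \<theta> \<mu>. f (x u \<theta> \<mu>) (y u \<theta> \<mu>) (\<theta>' u \<theta> \<mu>) \<mu>)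
       (\<lambda>u \<theta> \<mu>. \<Sum>\<gamma>\<in>{\<gamma> \<in> midx. mdeg \<gamma> < N}. C \<gamma> (\<theta>' u \<theta> \<mu>) \<mu> * (x u \<theta> \<mu> ^ \<gamma> (1, 0) * y u \<theta> \<mu> ^ \<gamma> (0, 1)))"
  have x1: "O_pow \<Lambda> 1 x" and y1: "O_pow \<Lambda> 1 y" using O_mono[OF x] O_mono[OF y] by auto
  show ?thesis
  proof (rule eqm_O[OF T[OF x1 y1]], rule O_sum)
    fix \<gamma> :: "real \<times> real => nat" assume \<gamma>: "\<gamma> \<in> {\<gamma> \<in> midx. mdeg \<gamma> < 2 * j + 1}"
    show "O_pow \<Lambda> (2 * j + 1) (\<lambda>u \<theta> \<mu>. C \<gamma> (\<theta>' u \<theta> \<mu>) \<mu> * (x u \<theta> \<mu> ^ \<gamma> (1, 0) * y u \<theta> \<mu> ^ \<gamma> (0, 1)))"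
    proof (cases "2 * \<gamma> (1, 0) + (k + 1) * \<gamma> (0, 1) < 2 * j + 1")
      case True
      then show ?thesis using \<gamma> by (intro O_cong[OF O_zero]) (simp add: Z)
    next
      case False
      show ?thesis
        by (rule O_mult_le[OF O_coef_sub[OF C] O_mult[OF O_power[OF x] O_power[OF y]]]) (use \<gamma> False in auto)
    qed
  qed
qed

text \<open>
  The increments of \<open>x\<close> and \<open>y\<close> are smaller than \<open>x\<close> and \<open>y\<close> by \<open>u\<^sup>n\<^sup>-\<^sup>1\<close>. The same holds for the monomials, whose
  weights are at least \<open>2 j + 1\<close>.
\<close>

lemma remainder_eqm:
  assumes x: "O_pow \<Lambda> 2 x" "O_pow \<Lambda> 2 x'" "eqm \<Lambda> (n + 1) x x'"
    and y: "O_pow \<Lambda> (k + 1) y" "O_pow \<Lambda> (k + 1) y'" "eqm \<Lambda> (n + k) y y'"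
    and \<kappa>: "O_pow \<Lambda> 1 \<kappa>" "O_pow \<Lambda> 1 \<kappa>'" "O_pow \<Lambda> n (\<lambda>u \<theta> \<mu>. \<kappa> u \<theta> \<mu> - \<kappa>' u \<theta> \<mu>)"
    and n: "n \<ge> 1"
  shows "eqm \<Lambda> (n + 2 * j) (\<lambda>u \<theta> \<mu>. f (x u \<theta> \<mu>) (y u \<theta> \<mu>) (\<theta> + \<kappa> u \<theta> \<mu>) \<mu>) (\<lambda>u \<theta> \<mu>. f (x' u \<theta> \<mu>) (y' u \<theta> \<mu>) (\<theta> + \<kappa>' u \<theta> \<mu>) \<mu>)"
proof (rule remainder_taylor[OF f r U j k])
  fix C :: "(real \<times> real => nat) => real ^ 'd => real ^ 'm => real"
  assume C: "\<And>\<gamma>. \<gamma> \<in> midx ==> torus_analytic_on (C \<gamma>) \<Lambda>"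
    and Z: "\<And>\<gamma> \<theta> \<mu>. \<gamma> \<in> midx ==> \<mu> \<in> \<Lambda> ==> 2 * \<gamma> (1, 0) + (k + 1) * \<gamma> (0, 1) < 2 * j + 1 ==> C \<gamma> \<theta> \<mu> = 0"
    and T: "\<And>N (x :: real => real ^ 'd => real ^ 'm => real) y \<theta>'. O_pow \<Lambda> 1 x ==> O_pow \<Lambda> 1 y ==>
      eqm \<Lambda> N (\<lambda>u \<theta> \<mu>. f (x u \<theta> \<mu>) (y u \<theta> \<mu>) (\<theta>' u \<theta> \<mu>) \<mu>)
       (\<lambda>u \<theta> \<mu>. \<Sum>\<gamma>\<in>{\<gamma> \<in> midx. mdeg \<gamma> < N}. C \<gamma> (\<theta>' u \<theta> \<mu>) \<mu> * (x u \<theta> \<mu> ^ \<gamma> (1, 0) * y u \<theta> \<mu> ^ \<gamma> (0, 1)))"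
  have x1: "O_pow \<Lambda> 1 x" "O_pow \<Lambda> 1 x'" and y1: "O_pow \<Lambda> 1 y" "O_pow \<Lambda> 1 y'"
    using O_mono[OF x(1)] O_mono[OF y(1)] O_mono[OF x(2)] O_mono[OF y(2)] by auto
  let ?I = "{\<gamma> \<in> midx. mdeg \<gamma> < n + 2 * j} :: (real \<times> real => nat) set"
  have "eqm \<Lambda> (n + 2 * j)
      (\<lambda>u \<theta> \<mu>. \<Sum>\<gamma>\<in>?I. C \<gamma> (\<theta> + \<kappa> u \<theta> \<mu>) \<mu> * (x u \<theta> \<mu> ^ \<gamma> (1, 0) * y u \<theta> \<mu> ^ \<gamma> (0, 1)))
      (\<lambda>u \<theta> \<mu>. \<Sum>\<gamma>\<in>?I. C \<gamma> (\<theta> + \<kappa>' u \<theta> \<mu>) \<mu> * (x' u \<theta> \<mu> ^ \<gamma> (1, 0) * y' u \<theta> \<mu> ^ \<gamma> (0, 1)))"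
  proof (rule eqm_sum)
    fix \<gamma> assume \<gamma>: "\<gamma> \<in> ?I"
    show "eqm \<Lambda> (n + 2 * j)
      (\<lambda>u \<theta> \<mu>. C \<gamma> (\<theta> + \<kappa> u \<theta> \<mu>) \<mu> * (x u \<theta> \<mu> ^ \<gamma> (1, 0) * y u \<theta> \<mu> ^ \<gamma> (0, 1)))
      (\<lambda>u \<theta> \<mu>. C \<gamma> (\<theta> + \<kappa>' u \<theta> \<mu>) \<mu> * (x' u \<theta> \<mu> ^ \<gamma> (1, 0) * y' u \<theta> \<mu> ^ \<gamma> (0, 1)))"
    proof (cases "2 * \<gamma> (1, 0) + (k + 1) * \<gamma> (0, 1) < 2 * j + 1")
      case True
      then show ?thesis using \<gamma> by (intro eqm_cong[OF eqm_refl[of _ _ "\<lambda>_ _ _. 0"]]) (simp_all add: Z)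
    next
      case False
      have ex: "eqm \<Lambda> (2 + (n - 1)) x x'" "eqm \<Lambda> (k + 1 + (n - 1)) y y'"
        using x(3) y(3) n by (simp_all add: add.commute)
      have xy: "eqm \<Lambda> (2 * \<gamma> (1, 0) + (k + 1) * \<gamma> (0, 1) + (n - 1))
          (\<lambda>u \<theta> \<mu>. x u \<theta> \<mu> ^ \<gamma> (1, 0) * y u \<theta> \<mu> ^ \<gamma> (0, 1)) (\<lambda>u \<theta> \<mu>. x' u \<theta> \<mu> ^ \<gamma> (1, 0) * y' u \<theta> \<mu> ^ \<gamma> (0, 1))"
        by (rule eqm_mult[OF eqm_pow[OF x(1,2) ex(1)] O_power[OF y(1)] O_power[OF x(2)] eqm_pow[OF y(1,2) ex(2)]]) auto
      show ?thesis
        by (rule eqm_mult[OF eqm_shift[OF C \<kappa>] O_mult[OF O_power[OF x(1)] O_power[OF y(1)]] O_coef_sub[OF C] xy])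
           (use \<gamma> False n in auto)
    qed
  qed
  from eqm_trans[OF eqm_trans[OF T[OF x1(1) y1(1)] this] eqm_sym[OF T[OF x1(2) y1(2)]]] show ?thesis .
qed

end

section \<open>The reduced dynamics\<close>

context
  fixes \<Lambda> :: "(real ^ 'm) set" and k :: nat and R :: "real ^ 'm => real"
  assumes k: "k \<ge> 2" and R: "torus_analytic_on (\<lambda>\<theta> :: real ^ 'd. R) \<Lambda>"
begin

text \<open>
  The first component of the reduced map, regarded as a function of the same variables as the
  parametrization.
\<close>

definition rdyn :: "(real ^ 'm => real) => real => real ^ 'd => real ^ 'm => real" where
  "rdyn S u \<theta> \<mu> = u + R \<mu> * u ^ k + S \<mu> * u ^ (2 * k - 1)"

lemma rdyn_eqm:
  assumes S: "torus_analytic_on (\<lambda>\<theta> :: real ^ 'd. S) \<Lambda>"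
  shows "eqm \<Lambda> (k + 1) (rdyn S) (\<lambda>u \<theta> \<mu>. u + R \<mu> * u ^ k)"
    "eqm \<Lambda> 2 (rdyn S) (\<lambda>u \<theta> \<mu>. u)" "O_pow \<Lambda> 1 (rdyn S)" "xpd \<Lambda> (rdyn S)"
proof -
  have "O_pow \<Lambda> (k + 1) (\<lambda>u (\<theta> :: real ^ 'd) \<mu>. S \<mu> * u ^ (2 * k - 1))"
    by (rule O_coef_u[OF S]) (use k in auto)
  then show 1: "eqm \<Lambda> (k + 1) (rdyn S) (\<lambda>u \<theta> \<mu>. u + R \<mu> * u ^ k)"
    by (simp add: eqm_def rdyn_def)
  have "O_pow \<Lambda> 2 (\<lambda>u (\<theta> :: real ^ 'd) \<mu>. R \<mu> * u ^ k)" by (rule O_coef_u[OF R k])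
  then have l: "eqm \<Lambda> 2 (\<lambda>u (\<theta> :: real ^ 'd) \<mu>. u + R \<mu> * u ^ k) (\<lambda>u \<theta> \<mu>. u)" by (simp add: eqm_def)
  show 2: "eqm \<Lambda> 2 (rdyn S) (\<lambda>u \<theta> \<mu>. u)" by (rule eqm_trans[OF eqm_mono[OF 1] l]) (use k in simp)
  have u1: "O_pow \<Lambda> 1 (\<lambda>u (\<theta> :: real ^ 'd) \<mu>. u)" using O_u[of \<Lambda> 1] by simp
  then show "O_pow \<Lambda> 1 (rdyn S)" by (rule eqm_O_le[OF 2]) simp
  have "xpd \<Lambda> (\<lambda>u (\<theta> :: real ^ 'd) \<mu>. u ^ 1 + R \<mu> * u ^ k + S \<mu> * u ^ (2 * k - 1))"
    by (intro xpd_add xpd_u xpd_coef_u[OF R] xpd_coef_u[OF S])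
  then show "xpd \<Lambda> (rdyn S)" by (simp add: rdyn_def[abs_def])
qed

lemma rdyn_pow:
  assumes S: "torus_analytic_on (\<lambda>\<theta> :: real ^ 'd. S) \<Lambda>"
  shows "eqm \<Lambda> (i + k) (\<lambda>u \<theta> \<mu>. rdyn S u \<theta> \<mu> ^ i) (\<lambda>u \<theta> \<mu>. u ^ i + real i * R \<mu> * u ^ (i + k - 1))"
proof (induction i)
  case (Suc i)
  have Ru: "O_pow \<Lambda> k (\<lambda>u (\<theta> :: real ^ 'd) \<mu>. R \<mu> * u ^ k)" by (rule O_coef_u[OF R order_refl])
  have iR: "torus_analytic_on (\<lambda>(\<theta> :: real ^ 'd) \<mu>. real i * R \<mu>) \<Lambda>" by (intro ta_mult R ta_const)
  have u1: "O_pow \<Lambda> 1 (\<lambda>u (\<theta> :: real ^ 'd) \<mu>. u)" using O_u[of \<Lambda> 1] by simp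
  have lin: "O_pow \<Lambda> 1 (\<lambda>u (\<theta> :: real ^ 'd) \<mu>. u + R \<mu> * u ^ k)" by (intro O_add u1 O_mono[OF Ru]) (use k in auto)
  have a: "eqm \<Lambda> (Suc i + k) (\<lambda>u \<theta> \<mu>. rdyn S u \<theta> \<mu> * rdyn S u \<theta> \<mu> ^ i)
      (\<lambda>u \<theta> \<mu>. (u + R \<mu> * u ^ k) * (u ^ i + real i * R \<mu> * u ^ (i + k - 1)))"
    by (rule eqm_mult[OF rdyn_eqm(1)[OF S] O_power[OF rdyn_eqm(3)[OF S]] lin Suc]) auto
  have b: "eqm \<Lambda> (Suc i + k) (\<lambda>u (\<theta> :: real ^ 'd) \<mu>. (u + R \<mu> * u ^ k) * (u ^ i + real i * R \<mu> * u ^ (i + k - 1)))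
      (\<lambda>u \<theta> \<mu>. u ^ Suc i + real (Suc i) * R \<mu> * u ^ (Suc i + k - 1))"
  proof -
    have "O_pow \<Lambda> (Suc i + k) (\<lambda>u (\<theta> :: real ^ 'd) \<mu>. (R \<mu> * u ^ k) * (real i * R \<mu> * u ^ (i + k - 1)))"
      by (rule O_mult_le[OF Ru O_coef_u[OF iR order_refl]]) (use k in auto)
    then show ?thesis unfolding eqm_def
    proof (rule O_cong)
      fix u :: real and \<theta> :: "real ^ 'd" and \<mu>
      have "u * u ^ (i + k - 1) = u ^ (i + k)" using k by (simp flip: power_Suc)
      then show "R \<mu> * u ^ k * (real i * R \<mu> * u ^ (i + k - 1)) = (u + R \<mu> * u ^ k) * (u ^ i + real i * R \<mu> * u ^ (i + k - 1)) -
         (u ^ Suc i + real (Suc i) * R \<mu> * u ^ (Suc i + k - 1))"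
        by (simp add: algebra_simps power_add)
    qed
  qed
  from eqm_trans[OF a b] show ?case by simp
qed simp

lemma rdyn_pow_weak:
  assumes S: "torus_analytic_on (\<lambda>\<theta> :: real ^ 'd. S) \<Lambda>"
  shows "eqm \<Lambda> (i + k - 1) (\<lambda>u \<theta> \<mu>. rdyn S u \<theta> \<mu> ^ i) (\<lambda>u \<theta> \<mu>. u ^ i)" "O_pow \<Lambda> i (\<lambda>u \<theta> \<mu>. rdyn S u \<theta> \<mu> ^ i)"
proof -
  have iR: "torus_analytic_on (\<lambda>(\<theta> :: real ^ 'd) \<mu>. real i * R \<mu>) \<Lambda>" by (intro ta_mult R ta_const)
  have h: "eqm \<Lambda> (i + k - 1) (\<lambda>u (\<theta> :: real ^ 'd) \<mu>. u ^ i + real i * R \<mu> * u ^ (i + k - 1)) (\<lambda>u \<theta> \<mu>. u ^ i)"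
    unfolding eqm_def using O_coef_u[OF iR order_refl, of "i + k - 1"] by simp
  show "eqm \<Lambda> (i + k - 1) (\<lambda>u \<theta> \<mu>. rdyn S u \<theta> \<mu> ^ i) (\<lambda>u \<theta> \<mu>. u ^ i)"
    by (rule eqm_trans[OF eqm_mono[OF rdyn_pow[OF S]] h]) simp
  show "O_pow \<Lambda> i (\<lambda>u \<theta> \<mu>. rdyn S u \<theta> \<mu> ^ i)" using O_power[OF rdyn_eqm(3)[OF S], of i] by simp
qed

lemma rdyn_pow_diff:
  assumes S: "torus_analytic_on (\<lambda>\<theta> :: real ^ 'd. S) \<Lambda>" and S': "torus_analytic_on (\<lambda>\<theta> :: real ^ 'd. S') \<Lambda>"
  shows "eqm \<Lambda> (i + 2 * k - 1) (\<lambda>u \<theta> \<mu>. rdyn S' u \<theta> \<mu> ^ i - rdyn S u \<theta> \<mu> ^ i)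
    (\<lambda>u \<theta> \<mu>. real i * (S' \<mu> - S \<mu>) * u ^ (i + 2 * k - 2))"
proof (induction i)
  case (Suc i)
  let ?r = "rdyn S" and ?r' = "rdyn S'"
  have D: "torus_analytic_on (\<lambda>(\<theta> :: real ^ 'd) \<mu>. S' \<mu> - S \<mu>) \<Lambda>" by (intro ta_diff S S')
  have iD: "torus_analytic_on (\<lambda>(\<theta> :: real ^ 'd) \<mu>. real i * (S' \<mu> - S \<mu>)) \<Lambda>" by (intro ta_mult D ta_const)
  have u1: "O_pow \<Lambda> 1 (\<lambda>u (\<theta> :: real ^ 'd) \<mu>. u)" using O_u[of \<Lambda> 1] by simp
  have d0: "?r' u \<theta> \<mu> - ?r u \<theta> \<mu> = (S' \<mu> - S \<mu>) * u ^ (2 * k - 1)" for u \<theta> \<mu> by (simp add: rdyn_def algebra_simps)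
  have oi: "O_pow \<Lambda> (i + 2 * k - 2) (\<lambda>u (\<theta> :: real ^ 'd) \<mu>. real i * (S' \<mu> - S \<mu>) * u ^ (i + 2 * k - 2))"
    by (rule O_coef_u[OF iD order_refl])
  have od: "O_pow \<Lambda> (i + 2 * k - 2) (\<lambda>u \<theta> \<mu>. ?r' u \<theta> \<mu> ^ i - ?r u \<theta> \<mu> ^ i)"
    by (rule eqm_O_le[OF Suc oi]) simp
  have 1: "eqm \<Lambda> (Suc i + 2 * k - 1) (\<lambda>u \<theta> \<mu>. ?r' u \<theta> \<mu> * (?r' u \<theta> \<mu> ^ i - ?r u \<theta> \<mu> ^ i))
      (\<lambda>u \<theta> \<mu>. u * (real i * (S' \<mu> - S \<mu>) * u ^ (i + 2 * k - 2)))"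
    by (rule eqm_mult[OF rdyn_eqm(2)[OF S'] od u1 Suc]) (use k in auto)
  have 2: "eqm \<Lambda> (Suc i + 2 * k - 1) (\<lambda>u \<theta> \<mu>. ((S' \<mu> - S \<mu>) * u ^ (2 * k - 1)) * ?r u \<theta> \<mu> ^ i)
      (\<lambda>u \<theta> \<mu>. ((S' \<mu> - S \<mu>) * u ^ (2 * k - 1)) * u ^ i)"
    by (rule eqm_mult[OF eqm_refl rdyn_pow_weak(2)[OF S] O_coef_u[OF D order_refl] rdyn_pow_weak(1)[OF S]]) (use k in auto)
  show ?case
  proof (rule eqm_cong[OF eqm_add[OF 1 2]])
    fix u :: real and \<theta> :: "real ^ 'd" and \<mu>
    show "?r' u \<theta> \<mu> * (?r' u \<theta> \<mu> ^ i - ?r u \<theta> \<mu> ^ i) + ((S' \<mu> - S \<mu>) * u ^ (2 * k - 1)) * ?r u \<theta> \<mu> ^ i = ?r' u \<theta> \<mu> ^ Suc i - ?r u \<theta> \<mu> ^ Suc i"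
      unfolding d0[symmetric, of _ _ \<theta>] by (simp add: algebra_simps)
    have e: "Suc (i + 2 * k - 2) = i + 2 * k - 1" "2 * k - 1 + i = i + 2 * k - 1" "Suc i + 2 * k - 2 = i + 2 * k - 1" using k by auto
    have p: "u * u ^ (i + 2 * k - 2) = u ^ (i + 2 * k - 1)" "u ^ (2 * k - 1) * u ^ i = u ^ (i + 2 * k - 1)"
      unfolding power_Suc[symmetric] power_add[symmetric] e by simp_all
    have "u * (real i * (S' \<mu> - S \<mu>) * u ^ (i + 2 * k - 2)) + ((S' \<mu> - S \<mu>) * u ^ (2 * k - 1)) * u ^ i
      = real i * (S' \<mu> - S \<mu>) * (u * u ^ (i + 2 * k - 2)) + (S' \<mu> - S \<mu>) * (u ^ (2 * k - 1) * u ^ i)" by (simp only: mult_ac)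
    then show "u * (real i * (S' \<mu> - S \<mu>) * u ^ (i + 2 * k - 2)) + ((S' \<mu> - S \<mu>) * u ^ (2 * k - 1)) * u ^ i
      = real (Suc i) * (S' \<mu> - S \<mu>) * u ^ (Suc i + 2 * k - 2)"
      unfolding p e by (simp add: algebra_simps)
  qed
qed simp

lemma rdyn_diff_coef:
  assumes S: "torus_analytic_on (\<lambda>\<theta> :: real ^ 'd. S) \<Lambda>" and S': "torus_analytic_on (\<lambda>\<theta> :: real ^ 'd. S') \<Lambda>"
    and w: "torus_analytic_on w \<Lambda>"
  shows "eqm \<Lambda> (i + 2 * k - 1) (\<lambda>u \<theta> \<mu>. w (\<theta> + \<omega>) \<mu> * rdyn S' u \<theta> \<mu> ^ i - w (\<theta> + \<omega>) \<mu> * rdyn S u \<theta> \<mu> ^ i)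
    (\<lambda>u \<theta> \<mu>. w (\<theta> + \<omega>) \<mu> * (real i * (S' \<mu> - S \<mu>) * u ^ (i + 2 * k - 2)))"
    "O_pow \<Lambda> (i + 2 * k - 2) (\<lambda>u \<theta> \<mu>. w (\<theta> + \<omega>) \<mu> * rdyn S' u \<theta> \<mu> ^ i - w (\<theta> + \<omega>) \<mu> * rdyn S u \<theta> \<mu> ^ i)"
proof -
  have iD: "torus_analytic_on (\<lambda>(\<theta> :: real ^ 'd) \<mu>. real i * (S' \<mu> - S \<mu>)) \<Lambda>" by (intro ta_mult ta_diff S S' ta_const)
  have oi: "O_pow \<Lambda> (i + 2 * k - 2) (\<lambda>u (\<theta> :: real ^ 'd) \<mu>. real i * (S' \<mu> - S \<mu>) * u ^ (i + 2 * k - 2))"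
    by (rule O_coef_u[OF iD order_refl])
  have od: "O_pow \<Lambda> (i + 2 * k - 2) (\<lambda>u \<theta> \<mu>. rdyn S' u \<theta> \<mu> ^ i - rdyn S u \<theta> \<mu> ^ i)"
    by (rule eqm_O_le[OF rdyn_pow_diff[OF S S'] oi]) simp
  have w0: "O_pow \<Lambda> 0 (\<lambda>u \<theta> \<mu>. w (\<theta> + \<omega>) \<mu>)" by (rule O_coef[OF ta_shift[OF w]])
  show 1: "eqm \<Lambda> (i + 2 * k - 1) (\<lambda>u \<theta> \<mu>. w (\<theta> + \<omega>) \<mu> * rdyn S' u \<theta> \<mu> ^ i - w (\<theta> + \<omega>) \<mu> * rdyn S u \<theta> \<mu> ^ i)
    (\<lambda>u \<theta> \<mu>. w (\<theta> + \<omega>) \<mu> * (real i * (S' \<mu> - S \<mu>) * u ^ (i + 2 * k - 2)))"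
    using eqm_mult[OF eqm_refl od w0 rdyn_pow_diff[OF S S'], of "i + 2 * k - 1" "i + 2 * k - 1"]
    by (simp add: right_diff_distrib)
  show "O_pow \<Lambda> (i + 2 * k - 2) (\<lambda>u \<theta> \<mu>. w (\<theta> + \<omega>) \<mu> * rdyn S' u \<theta> \<mu> ^ i - w (\<theta> + \<omega>) \<mu> * rdyn S u \<theta> \<mu> ^ i)"
    by (rule eqm_O_le[OF 1 O_mult_le[OF w0 oi]]) auto
qed

text \<open>
  Since \<open>rdyn\<close> is \<open>u + R u\<^sup>k + \<dots>\<close>, the difference \<open>e u\<^sup>m - e rdyn\<^sup>m\<close> gains \<open>k - 1\<close> orders, while the difference
  of an angle dependent term keeps its order. This is why the oscillatory coefficients enter \<open>k - 1\<close>
  orders later than the averaged ones.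
\<close>

lemma cohomological_leading:
  assumes S: "torus_analytic_on (\<lambda>\<theta> :: real ^ 'd. S) \<Lambda>"
    and e: "torus_analytic_on (\<lambda>\<theta> :: real ^ 'd. e) \<Lambda>" and e': "torus_analytic_on e' \<Lambda>" and m: "m \<ge> 1"
  shows "eqm \<Lambda> (m + k)
    (\<lambda>u \<theta> \<mu>. (e \<mu> * u ^ m + e' \<theta> \<mu> * u ^ (m + k - 1)) - (e \<mu> * rdyn S u \<theta> \<mu> ^ m + e' (\<theta> + \<omega>) \<mu> * rdyn S u \<theta> \<mu> ^ (m + k - 1)))
    (\<lambda>u \<theta> \<mu>. (e' \<theta> \<mu> - e' (\<theta> + \<omega>) \<mu> - real m * R \<mu> * e \<mu>) * u ^ (m + k - 1))"
proof -
  have e0: "O_pow \<Lambda> 0 (\<lambda>u (\<theta> :: real ^ 'd) \<mu>. e \<mu>)" "O_pow \<Lambda> 0 (\<lambda>u \<theta> \<mu>. e' (\<theta> + \<omega>) \<mu>)"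
    by (rule O_coef[OF e], rule O_coef[OF ta_shift[OF e']])
  have w: "eqm \<Lambda> (m + k) (\<lambda>u \<theta> \<mu>. rdyn S u \<theta> \<mu> ^ (m + k - 1)) (\<lambda>u \<theta> \<mu>. u ^ (m + k - 1))"
    by (rule eqm_mono[OF rdyn_pow_weak(1)[OF S]]) (use k m in auto)
  have r0: "O_pow \<Lambda> 0 (\<lambda>u \<theta> \<mu>. rdyn S u \<theta> \<mu> ^ i)" for i by (rule O_mono[OF rdyn_pow_weak(2)[OF S]]) simp
  have 1: "eqm \<Lambda> (m + k) (\<lambda>u \<theta> \<mu>. e \<mu> * rdyn S u \<theta> \<mu> ^ m) (\<lambda>u \<theta> \<mu>. e \<mu> * (u ^ m + real m * R \<mu> * u ^ (m + k - 1)))"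
    by (rule eqm_mult[OF eqm_refl r0 e0(1) rdyn_pow[OF S]]) auto
  have 2: "eqm \<Lambda> (m + k) (\<lambda>u \<theta> \<mu>. e' (\<theta> + \<omega>) \<mu> * rdyn S u \<theta> \<mu> ^ (m + k - 1)) (\<lambda>u \<theta> \<mu>. e' (\<theta> + \<omega>) \<mu> * u ^ (m + k - 1))"
    by (rule eqm_mult[OF eqm_refl r0 e0(2) w]) auto
  show ?thesis
    by (rule eqm_cong[OF eqm_diff[OF eqm_refl[of \<Lambda> "m + k" "\<lambda>u \<theta> \<mu>. e \<mu> * u ^ m + e' \<theta> \<mu> * u ^ (m + k - 1)"] eqm_add[OF 1 2]]])
       (simp_all add: algebra_simps)
qed

end

section \<open>Leading terms of increments\<close>

lemma pow_increment_leading: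
  assumes x: "eqm \<Lambda> 3 x (\<lambda>u \<theta> \<mu>. u ^ 2)" "eqm \<Lambda> 3 x' (\<lambda>u \<theta> \<mu>. u ^ 2)"
    and X: "torus_analytic_on X \<Lambda>" and d: "eqm \<Lambda> (n + 2) (\<lambda>u \<theta> \<mu>. x' u \<theta> \<mu> - x u \<theta> \<mu>) (\<lambda>u \<theta> \<mu>. X \<theta> \<mu> * u ^ (n + 1))"
    and n: "n \<ge> 1"
  shows "eqm \<Lambda> (n + 2 * j) (\<lambda>u \<theta> \<mu>. x' u \<theta> \<mu> ^ j - x u \<theta> \<mu> ^ j) (\<lambda>u \<theta> \<mu>. real j * X \<theta> \<mu> * u ^ (n + 2 * j - 1))"
proof (induction j)
  case (Suc j)
  have u2: "O_pow \<Lambda> 2 (\<lambda>u (\<theta> :: real ^ 'b) \<mu>. u ^ 2 :: real)" by (rule O_u)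
  have xO: "O_pow \<Lambda> 2 x" "O_pow \<Lambda> 2 x'" using eqm_O_le[OF x(1) u2] eqm_O_le[OF x(2) u2] by auto
  have jX: "torus_analytic_on (\<lambda>\<theta> \<mu>. real j * X \<theta> \<mu>) \<Lambda>" by (intro ta_mult X ta_const)
  have oj: "O_pow \<Lambda> (n + 2 * j - 1) (\<lambda>u \<theta> \<mu>. real j * X \<theta> \<mu> * u ^ (n + 2 * j - 1))" by (rule O_coef_u[OF jX order_refl])
  have od: "O_pow \<Lambda> (n + 2 * j - 1) (\<lambda>u \<theta> \<mu>. x' u \<theta> \<mu> ^ j - x u \<theta> \<mu> ^ j)" by (rule eqm_O_le[OF Suc oj]) simp
  have x'j: "eqm \<Lambda> (2 * j + 1) (\<lambda>u \<theta> \<mu>. x' u \<theta> \<mu> ^ j) (\<lambda>u \<theta> \<mu>. (u ^ 2) ^ j)"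
    by (rule eqm_pow[OF xO(2) u2]) (use x(2) in simp)
  have 1: "eqm \<Lambda> (n + 2 * Suc j) (\<lambda>u \<theta> \<mu>. (x' u \<theta> \<mu> - x u \<theta> \<mu>) * x' u \<theta> \<mu> ^ j) (\<lambda>u \<theta> \<mu>. (X \<theta> \<mu> * u ^ (n + 1)) * (u ^ 2) ^ j)"
    by (rule eqm_mult[OF d O_power[OF xO(2)] O_coef_u[OF X order_refl] x'j]) auto
  have 2: "eqm \<Lambda> (n + 2 * Suc j) (\<lambda>u \<theta> \<mu>. x u \<theta> \<mu> * (x' u \<theta> \<mu> ^ j - x u \<theta> \<mu> ^ j)) (\<lambda>u \<theta> \<mu>. u ^ 2 * (real j * X \<theta> \<mu> * u ^ (n + 2 * j - 1)))"
    by (rule eqm_mult[OF x(1) od u2 Suc]) (use n in auto)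
  show ?case
  proof (rule eqm_cong[OF eqm_add[OF 1 2]])
    fix u :: real and \<theta> :: "real ^ 'b" and \<mu>
    show "(x' u \<theta> \<mu> - x u \<theta> \<mu>) * x' u \<theta> \<mu> ^ j + x u \<theta> \<mu> * (x' u \<theta> \<mu> ^ j - x u \<theta> \<mu> ^ j) = x' u \<theta> \<mu> ^ Suc j - x u \<theta> \<mu> ^ Suc j"
      by (simp add: algebra_simps)
    have e: "n + 1 + 2 * j = n + 2 * Suc j - 1" "2 + (n + 2 * j - 1) = n + 2 * Suc j - 1" using n by auto
    have p: "u ^ (n + 1) * (u ^ 2) ^ j = u ^ (n + 2 * Suc j - 1)" "u ^ 2 * u ^ (n + 2 * j - 1) = u ^ (n + 2 * Suc j - 1)"
      unfolding power_mult[symmetric] power_add[symmetric] e by simp_all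
    have "(X \<theta> \<mu> * u ^ (n + 1)) * (u ^ 2) ^ j + u ^ 2 * (real j * X \<theta> \<mu> * u ^ (n + 2 * j - 1))
        = X \<theta> \<mu> * (u ^ (n + 1) * (u ^ 2) ^ j) + real j * X \<theta> \<mu> * (u ^ 2 * u ^ (n + 2 * j - 1))" by (simp only: mult_ac)
    then show "(X \<theta> \<mu> * u ^ (n + 1)) * (u ^ 2) ^ j + u ^ 2 * (real j * X \<theta> \<mu> * u ^ (n + 2 * j - 1)) = real (Suc j) * X \<theta> \<mu> * u ^ (n + 2 * Suc j - 1)"
      unfolding p by (simp add: algebra_simps)
  qed
qed simp

lemma monomial_leading:
  assumes f: "torus_analytic_on f \<Lambda>" and \<kappa>: "O_pow \<Lambda> 1 \<kappa>" and x: "eqm \<Lambda> 3 x (\<lambda>u \<theta> \<mu>. u ^ 2)"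
  shows "eqm \<Lambda> (2 * j + 1) (\<lambda>u \<theta> \<mu>. f (\<theta> + \<kappa> u \<theta> \<mu>) \<mu> * x u \<theta> \<mu> ^ j) (\<lambda>u \<theta> \<mu>. f \<theta> \<mu> * u ^ (2 * j))"
proof -
  have u2: "O_pow \<Lambda> 2 (\<lambda>u (\<theta> :: real ^ 'a) \<mu>. u ^ 2 :: real)" by (rule O_u)
  have xO: "O_pow \<Lambda> 2 x" using eqm_O_le[OF x u2] by auto
  have s: "eqm \<Lambda> 1 (\<lambda>u \<theta> \<mu>. f (\<theta> + \<kappa> u \<theta> \<mu>) \<mu>) (\<lambda>u \<theta> \<mu>. f \<theta> \<mu>)"
    using eqm_shift[OF f \<kappa> O_zero] \<kappa> by simp
  have xj: "eqm \<Lambda> (2 * j + 1) (\<lambda>u \<theta> \<mu>. x u \<theta> \<mu> ^ j) (\<lambda>u \<theta> \<mu>. (u ^ 2) ^ j)"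
    by (rule eqm_pow[OF xO u2]) (use x in simp)
  show ?thesis
    using eqm_mult[OF s O_power[OF xO, of j] O_coef[OF f] xj, of "2 * j + 1"] by (simp add: power_mult)
qed

lemma monomial_increment_leading:
  assumes f: "torus_analytic_on f \<Lambda>"
    and \<kappa>: "O_pow \<Lambda> 1 \<kappa>" "O_pow \<Lambda> 1 \<kappa>'" "O_pow \<Lambda> n (\<lambda>u \<theta> \<mu>. \<kappa>' u \<theta> \<mu> - \<kappa> u \<theta> \<mu>)"
    and x: "eqm \<Lambda> 3 x (\<lambda>u \<theta> \<mu>. u ^ 2)" "eqm \<Lambda> 3 x' (\<lambda>u \<theta> \<mu>. u ^ 2)"
    and X: "torus_analytic_on X \<Lambda>" and d: "eqm \<Lambda> (n + 2) (\<lambda>u \<theta> \<mu>. x' u \<theta> \<mu> - x u \<theta> \<mu>) (\<lambda>u \<theta> \<mu>. X \<theta> \<mu> * u ^ (n + 1))"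
    and n: "n \<ge> 1"
  shows "eqm \<Lambda> (n + 2 * j) (\<lambda>u \<theta> \<mu>. f (\<theta> + \<kappa>' u \<theta> \<mu>) \<mu> * x' u \<theta> \<mu> ^ j - f (\<theta> + \<kappa> u \<theta> \<mu>) \<mu> * x u \<theta> \<mu> ^ j)
     (\<lambda>u \<theta> \<mu>. real j * f \<theta> \<mu> * X \<theta> \<mu> * u ^ (n + 2 * j - 1))"
proof -
  have u2: "O_pow \<Lambda> 2 (\<lambda>u (\<theta> :: real ^ 'a) \<mu>. u ^ 2 :: real)" by (rule O_u)
  have xO: "O_pow \<Lambda> 2 x'" using eqm_O_le[OF x(2) u2] by auto
  have jX: "torus_analytic_on (\<lambda>\<theta> \<mu>. real j * X \<theta> \<mu>) \<Lambda>" by (intro ta_mult X ta_const)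
  have oj: "O_pow \<Lambda> (n + 2 * j - 1) (\<lambda>u \<theta> \<mu>. real j * X \<theta> \<mu> * u ^ (n + 2 * j - 1))" by (rule O_coef_u[OF jX order_refl])
  note P = pow_increment_leading[OF x X d n, of j]
  have od: "O_pow \<Lambda> (n + 2 * j - 1) (\<lambda>u \<theta> \<mu>. x' u \<theta> \<mu> ^ j - x u \<theta> \<mu> ^ j)" by (rule eqm_O_le[OF P oj]) simp
  have s1: "O_pow \<Lambda> n (\<lambda>u \<theta> \<mu>. f (\<theta> + \<kappa>' u \<theta> \<mu>) \<mu> - f (\<theta> + \<kappa> u \<theta> \<mu>) \<mu>)"
    using eqm_shift[OF f \<kappa>(2,1,3)] by (simp add: eqm_def)
  have s2: "eqm \<Lambda> 1 (\<lambda>u \<theta> \<mu>. f (\<theta> + \<kappa> u \<theta> \<mu>) \<mu>) (\<lambda>u \<theta> \<mu>. f \<theta> \<mu>)"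
    using eqm_shift[OF f \<kappa>(1) O_zero] \<kappa>(1) by simp
  have 1: "eqm \<Lambda> (n + 2 * j) (\<lambda>u \<theta> \<mu>. (f (\<theta> + \<kappa>' u \<theta> \<mu>) \<mu> - f (\<theta> + \<kappa> u \<theta> \<mu>) \<mu>) * x' u \<theta> \<mu> ^ j) (\<lambda>_ _ _. 0)"
    by (rule eqm_of_O[OF O_mult_le[OF s1 O_power[OF xO]]]) simp
  have 2: "eqm \<Lambda> (n + 2 * j) (\<lambda>u \<theta> \<mu>. f (\<theta> + \<kappa> u \<theta> \<mu>) \<mu> * (x' u \<theta> \<mu> ^ j - x u \<theta> \<mu> ^ j)) (\<lambda>u \<theta> \<mu>. f \<theta> \<mu> * (real j * X \<theta> \<mu> * u ^ (n + 2 * j - 1)))"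
    by (rule eqm_mult[OF s2 od O_coef[OF f] P]) (use n in auto)
  show ?thesis
    by (rule eqm_cong[OF eqm_add[OF 1 2]]) (simp_all add: algebra_simps)
qed

lemma product_increment_leading:
  assumes f: "torus_analytic_on f \<Lambda>"
    and \<kappa>: "O_pow \<Lambda> 1 \<kappa>" "O_pow \<Lambda> 1 \<kappa>'" "O_pow \<Lambda> n (\<lambda>u \<theta> \<mu>. \<kappa>' u \<theta> \<mu> - \<kappa> u \<theta> \<mu>)"
    and y: "O_pow \<Lambda> (k + 1) y'" and Y: "torus_analytic_on Y \<Lambda>"
    and d: "eqm \<Lambda> (n + k + 1) (\<lambda>u \<theta> \<mu>. y' u \<theta> \<mu> - y u \<theta> \<mu>) (\<lambda>u \<theta> \<mu>. Y \<theta> \<mu> * u ^ (n + k))"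
  shows "eqm \<Lambda> (n + k + 1) (\<lambda>u \<theta> \<mu>. f (\<theta> + \<kappa>' u \<theta> \<mu>) \<mu> * y' u \<theta> \<mu> - f (\<theta> + \<kappa> u \<theta> \<mu>) \<mu> * y u \<theta> \<mu>)
     (\<lambda>u \<theta> \<mu>. f \<theta> \<mu> * Y \<theta> \<mu> * u ^ (n + k))"
proof -
  have od: "O_pow \<Lambda> (n + k) (\<lambda>u \<theta> \<mu>. y' u \<theta> \<mu> - y u \<theta> \<mu>)"
    by (rule eqm_O_le[OF d O_coef_u[OF Y order_refl]]) simp
  have s1: "O_pow \<Lambda> n (\<lambda>u \<theta> \<mu>. f (\<theta> + \<kappa>' u \<theta> \<mu>) \<mu> - f (\<theta> + \<kappa> u \<theta> \<mu>) \<mu>)"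
    using eqm_shift[OF f \<kappa>(2,1,3)] by (simp add: eqm_def)
  have s2: "eqm \<Lambda> 1 (\<lambda>u \<theta> \<mu>. f (\<theta> + \<kappa> u \<theta> \<mu>) \<mu>) (\<lambda>u \<theta> \<mu>. f \<theta> \<mu>)"
    using eqm_shift[OF f \<kappa>(1) O_zero] \<kappa>(1) by simp
  have 1: "eqm \<Lambda> (n + k + 1) (\<lambda>u \<theta> \<mu>. (f (\<theta> + \<kappa>' u \<theta> \<mu>) \<mu> - f (\<theta> + \<kappa> u \<theta> \<mu>) \<mu>) * y' u \<theta> \<mu>) (\<lambda>_ _ _. 0)"
    by (rule eqm_of_O[OF O_mult_le[OF s1 y]]) simp
  have 2: "eqm \<Lambda> (n + k + 1) (\<lambda>u \<theta> \<mu>. f (\<theta> + \<kappa> u \<theta> \<mu>) \<mu> * (y' u \<theta> \<mu> - y u \<theta> \<mu>)) (\<lambda>u \<theta> \<mu>. f \<theta> \<mu> * (Y \<theta> \<mu> * u ^ (n + k)))"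
    by (rule eqm_mult[OF s2 od O_coef[OF f] d]) auto
  show ?thesis
    by (rule eqm_cong[OF eqm_add[OF 1 2]]) (simp_all add: algebra_simps)
qed

section \<open>Quotients, roots and components of coefficients\<close>

text \<open>
  As powers with negative exponents are analytic for positive bases, write \<open>1 / g = g * (g\<^sup>2)\<^sup>-\<^sup>1\<close>.
\<close>

lemma ta_inverse:
  fixes g :: "real ^ 'm => real"
  assumes g: "torus_analytic_on (\<lambda>\<theta> :: real ^ 'd. g) \<Lambda>" and nz: "\<And>\<mu>. \<mu> \<in> \<Lambda> ==> g \<mu> \<noteq> 0"
  shows "torus_analytic_on (\<lambda>(\<theta> :: real ^ 'd) \<mu>. inverse (g \<mu>)) \<Lambda>"
proof -
  have "bar_coeff \<Lambda> (\<lambda>\<mu>. g \<mu> * g \<mu>)"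
    unfolding bar_coeff_iff[where 'd = 'd] by (rule ta_mult[OF g g])
  then have "bar_coeff \<Lambda> (\<lambda>\<mu>. (g \<mu> * g \<mu>) powr (- 1))"
    by (rule bar_coeff_powr) (use nz in \<open>auto simp: zero_less_mult_iff linorder_neq_iff\<close>)
  then have "torus_analytic_on (\<lambda>(\<theta> :: real ^ 'd) \<mu>. g \<mu> * (g \<mu> * g \<mu>) powr (- 1)) \<Lambda>"
    unfolding bar_coeff_iff[where 'd = 'd] by (rule ta_mult[OF g])
  then show ?thesis
  proof (rule ta_cong)
    fix \<mu> assume "\<mu> \<in> \<Lambda>"
    then have "g \<mu> * g \<mu> > 0" using nz[of \<mu>] by (auto simp: zero_less_mult_iff linorder_neq_iff)
    then show "g \<mu> * (g \<mu> * g \<mu>) powr (- 1) = inverse (g \<mu>)" by (simp add: powr_minus field_simps)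
  qed
qed

lemma ta_divide:
  fixes g :: "real ^ 'm => real"
  assumes "torus_analytic_on f \<Lambda>" "torus_analytic_on (\<lambda>\<theta> :: real ^ 'd. g) \<Lambda>" "\<And>\<mu>. \<mu> \<in> \<Lambda> ==> g \<mu> \<noteq> 0"
  shows "torus_analytic_on (\<lambda>(\<theta> :: real ^ 'd) \<mu>. f \<theta> \<mu> / g \<mu>) \<Lambda>"
  unfolding divide_inverse by (intro ta_mult ta_inverse assms)

lemma ta_sqrt:
  fixes g :: "real ^ 'm => real"
  assumes g: "torus_analytic_on (\<lambda>\<theta> :: real ^ 'd. g) \<Lambda>" and pos: "\<And>\<mu>. \<mu> \<in> \<Lambda> ==> g \<mu> > 0"
  shows "torus_analytic_on (\<lambda>(\<theta> :: real ^ 'd) \<mu>. sqrt (g \<mu>)) \<Lambda>"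
proof -
  have "bar_coeff \<Lambda> (\<lambda>\<mu>. g \<mu> powr (1 / 2))"
    by (rule bar_coeff_powr) (use g pos in \<open>auto simp: bar_coeff_iff[where 'd = 'd]\<close>)
  then have "torus_analytic_on (\<lambda>(\<theta> :: real ^ 'd) \<mu>. g \<mu> powr (1 / 2)) \<Lambda>"
    unfolding bar_coeff_iff[where 'd = 'd] .
  then show ?thesis
    by (rule ta_cong) (use pos in \<open>auto simp: powr_half_sqrt less_imp_le\<close>)
qed

lemma ta_nth: "torus_analytic_on f \<Lambda> ==> torus_analytic_on (\<lambda>\<theta> \<mu>. f \<theta> \<mu> $ i) \<Lambda>"
  by (rule ta_linear[OF _ bounded_linear_vec_nth])

lemma ta_vec:
  fixes f :: "'n::finite => real ^ 'd => real ^ 'm => real"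
  assumes "\<And>i. torus_analytic_on (f i) \<Lambda>" shows "torus_analytic_on (\<lambda>\<theta> \<mu>. \<chi> i. f i \<theta> \<mu>) \<Lambda>"
proof (rule ta_cong)
  show "torus_analytic_on (\<lambda>\<theta> \<mu>. \<Sum>i\<in>UNIV. f i \<theta> \<mu> *\<^sub>R (axis i 1 :: real ^ 'n)) \<Lambda>"
    by (intro ta_sum ta_scaleR assms ta_const)
  show "(\<Sum>i\<in>UNIV. f i \<theta> \<mu> *\<^sub>R (axis i 1 :: real ^ 'n)) = (\<chi> i. f i \<theta> \<mu>)" for \<theta> \<mu>
    by (simp add: vec_eq_iff axis_def if_distrib[of "(*) _"] sum.delta cong: if_cong)
qed

lemma torus_avg_nth:
  fixes f :: "real ^ 'd => 'p::euclidean_space => real ^ 'n"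
  assumes "torus_analytic_on f \<Lambda>" "\<mu> \<in> \<Lambda>"
  shows "torus_avg f \<mu> $ i = torus_avg (\<lambda>\<theta> \<mu>. f \<theta> \<mu> $ i) \<mu>"
  using torus_avg_inner[OF assms, of "axis i 1"] by (simp add: inner_axis)

lemma remainder_order_nth:
  fixes f :: "real => real => real ^ 'n"
  assumes "remainder_order j U f" shows "remainder_order j U (\<lambda>x y. f x y $ i)"
proof -
  obtain g h where gh: "\<forall>(x, y)\<in>U. f x y = y *\<^sub>R g (x, y) + h (x, y)"
    and g: "(\<lambda>z. norm (g z)) \<in> O[at (0, 0)](\<lambda>z. norm z ^ (j - 1))"
    and h: "(\<lambda>z. norm (h z)) \<in> O[at (0, 0)](\<lambda>z. norm z ^ (j + 1))"
    using assms unfolding remainder_order_def by blast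
  have nth: "(\<lambda>z. norm (w z $ i)) \<in> O[at (0, 0)](\<lambda>z. norm (w z))" for w :: "real \<times> real => real ^ 'n"
    by (rule bigoI[of _ 1]) (simp add: component_le_norm_cart)
  show ?thesis unfolding remainder_order_def
    by (rule exI[of _ "\<lambda>z. g z $ i"], rule exI[of _ "\<lambda>z. h z $ i"])
       (use gh landau_o.big.trans[OF nth g] landau_o.big.trans[OF nth h] in auto)
qed

section \<open>Polynomials along the reduced dynamics\<close>

definition usum :: "nat => nat => (nat => real ^ 'd => real ^ 'm => real) => real => real ^ 'd => real ^ 'm => real" where
  "usum l h f u \<theta> \<mu> = (\<Sum>i = l..h. f i \<theta> \<mu> * u ^ i)"

lemma usum_O: "(\<And>i. torus_analytic_on (f i) \<Lambda>) ==> N \<le> l ==> O_pow \<Lambda> N (usum l h f)"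
  unfolding usum_def[abs_def] by (intro O_sum O_coef_u) auto

lemma usum_xpd: "(\<And>i. torus_analytic_on (f i) \<Lambda>) ==> xpd \<Lambda> (usum l h f)"
  unfolding usum_def[abs_def] by (intro xpd_sum xpd_coef_u) auto

lemma usum_upd:
  assumes "l \<le> Suc h"
  shows "usum l (Suc h) (f(Suc h := g)) u \<theta> \<mu> = usum l h f u \<theta> \<mu> + g \<theta> \<mu> * u ^ Suc h"
proof -
  have "(\<Sum>i = l..h. (f(Suc h := g)) i \<theta> \<mu> * u ^ i) = (\<Sum>i = l..h. f i \<theta> \<mu> * u ^ i)"
    by (rule sum.cong) auto
  then show ?thesis using assms by (simp add: usum_def)
qed

lemma usum_first: "l \<le> h ==> usum l h f u \<theta> \<mu> = f l \<theta> \<mu> * u ^ l + usum (Suc l) h f u \<theta> \<mu>"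
  by (simp add: usum_def sum.atLeast_Suc_atMost)

lemma usum_rdyn_xpd:
  fixes f :: "nat => real ^ 'd => real ^ 'm => real"
  assumes k: "k \<ge> 2" and R: "torus_analytic_on (\<lambda>\<theta> :: real ^ 'd. R) \<Lambda>" and S: "torus_analytic_on (\<lambda>\<theta> :: real ^ 'd. S) \<Lambda>"
    and f: "\<And>i. torus_analytic_on (f i) \<Lambda>"
  shows "xpd \<Lambda> (\<lambda>u \<theta> \<mu>. usum l h f (rdyn k R S u \<theta> \<mu>) (\<theta> + \<omega>) \<mu>)"
  unfolding usum_def by (intro xpd_sum xpd_mult xpd_coef ta_shift f xpd_power rdyn_eqm(4)[OF k R S])

context
  fixes \<Lambda> :: "(real ^ 'm) set" and k :: nat and R S S' :: "real ^ 'm => real"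
    and f :: "nat => real ^ 'd => real ^ 'm => real"
  assumes k: "k \<ge> 2" and R: "torus_analytic_on (\<lambda>\<theta> :: real ^ 'd. R) \<Lambda>"
    and S: "torus_analytic_on (\<lambda>\<theta> :: real ^ 'd. S) \<Lambda>" and S': "torus_analytic_on (\<lambda>\<theta> :: real ^ 'd. S') \<Lambda>"
    and f: "\<And>i. torus_analytic_on (f i) \<Lambda>"
begin

lemma usum_rdyn_diff:
  assumes "N \<le> l + 2 * k - 2"
  shows "O_pow \<Lambda> N (\<lambda>u \<theta> \<mu>. usum l h f (rdyn k R S' u \<theta> \<mu>) (\<theta> + \<omega>) \<mu> - usum l h f (rdyn k R S u \<theta> \<mu>) (\<theta> + \<omega>) \<mu>)"
  unfolding usum_def sum_subtractf[symmetric]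
proof (rule O_sum)
  fix i assume "i \<in> {l..h}"
  then show "O_pow \<Lambda> N (\<lambda>u \<theta> \<mu>. f i (\<theta> + \<omega>) \<mu> * rdyn k R S' u \<theta> \<mu> ^ i - f i (\<theta> + \<omega>) \<mu> * rdyn k R S u \<theta> \<mu> ^ i)"
    by (intro O_mono[OF rdyn_diff_coef(2)[OF k R S S' f]]) (use assms in auto)
qed

end

lemma eqm_absorb: "eqm \<Lambda> N f g ==> O_pow \<Lambda> N h ==> eqm \<Lambda> N (\<lambda>u \<theta> \<mu>. f u \<theta> \<mu> + h u \<theta> \<mu>) g"
  using O_add[of \<Lambda> N "\<lambda>u \<theta> \<mu>. f u \<theta> \<mu> - g u \<theta> \<mu>" h] unfolding eqm_def by (simp add: algebra_simps)

section \<open>The leading coefficients and the averaged equations\<close>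

text \<open>
  The sign \<open>s\<close> distinguishes the two solutions.
\<close>

locale reduced_map =
  fixes k p :: nat and \<omega> :: "real ^ 'd" and U :: "(real \<times> real) set" and \<Lambda> :: "(real ^ 'm) set"
    and c a :: "real ^ 'd => real ^ 'm => real" and d :: "real ^ 'd => real ^ 'm => real ^ 'd"
    and A :: "real => real => real ^ 'd => real ^ 'm => real"
    and B :: "real => real => real ^ 'd => real ^ 'm => real ^ 'd"
    and s :: real
  assumes k: "k \<ge> 2" and p: "p \<ge> 1" and kp: "k \<le> 2 * p" and U: "(0, 0) \<in> interior U"
    and c: "torus_analytic_on c \<Lambda>" and a: "torus_analytic_on a \<Lambda>" and d: "torus_analytic_on d \<Lambda>"
    and A: "torus_analytic_on (\<lambda>\<theta> ((x, y), \<mu>). A x y \<theta> \<mu>) (U \<times> \<Lambda>)"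
    and B: "torus_analytic_on (\<lambda>\<theta> ((x, y), \<mu>). B x y \<theta> \<mu>) (U \<times> \<Lambda>)"
    and A_order: "\<And>\<theta> \<mu>. \<mu> \<in> \<Lambda> ==> remainder_order k U (\<lambda>x y. A x y \<theta> \<mu>)"
    and B_order: "\<And>\<theta> \<mu>. \<mu> \<in> \<Lambda> ==> remainder_order p U (\<lambda>x y. B x y \<theta> \<mu>)"
    and c_pos: "\<And>\<mu>. \<mu> \<in> \<Lambda> ==> torus_avg c \<mu> > 0" and a_pos: "\<And>\<mu>. \<mu> \<in> \<Lambda> ==> torus_avg a \<mu> > 0"
    and \<omega>: "diophantine \<omega>" and s: "s = 1 \<or> s = - 1"
begin

definition R1 :: "real ^ 'm => real" where
  "R1 \<mu> = s * sqrt (torus_avg c \<mu> * torus_avg a \<mu> / (2 * real (k + 1)))"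

definition Y1 :: "real ^ 'm => real" where
  "Y1 \<mu> = s * sqrt (2 * torus_avg a \<mu> / (torus_avg c \<mu> * real (k + 1)))"

definition T1 :: "real ^ 'm => real ^ 'd" where
  "T1 \<mu> = (s * (1 / real (2 * p + 1 - k)) * sqrt (2 * real (k + 1) / (torus_avg c \<mu> * torus_avg a \<mu>))) *\<^sub>R torus_avg d \<mu>"

text \<open>
  The invariance equation at lowest order, averaged over the torus.
\<close>

lemma leading_relations:
  assumes \<mu>: "\<mu> \<in> \<Lambda>"
  shows "R1 \<mu> \<noteq> 0" "R1 \<mu> * R1 \<mu> = torus_avg c \<mu> * torus_avg a \<mu> / (2 * real (k + 1))"
    "torus_avg c \<mu> * Y1 \<mu> = 2 * R1 \<mu>" "real (k + 1) * R1 \<mu> * Y1 \<mu> = torus_avg a \<mu>"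
    "real (2 * p + 1 - k) * R1 \<mu> * T1 \<mu> $ i = torus_avg d \<mu> $ i"
proof -
  define C D K where "C = torus_avg c \<mu>" "D = torus_avg a \<mu>" "K = real (k + 1)"
  note CDK = this
  define q where "q = sqrt (C * D / (2 * K))"
  have pos: "C > 0" "D > 0" "K > 0" using c_pos a_pos \<mu> by (auto simp: CDK)
  have q: "q > 0" "q * q = C * D / (2 * K)" using pos by (auto simp: q_def)
  have ss: "s * s = 1" and s0: "s \<noteq> 0" using s by auto
  have R: "R1 \<mu> = s * q" by (simp add: R1_def q_def CDK)
  have "2 * D / (C * K) = (C * D / (2 * K)) * (2 / C)\<^sup>2" using pos by (simp add: field_simps power2_eq_square)
  then have "sqrt (2 * D / (C * K)) = q * sqrt ((2 / C)\<^sup>2)" by (simp only: q_def real_sqrt_mult)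
  then have "sqrt (2 * D / (C * K)) = q * (2 / C)" using pos by (simp only: real_sqrt_abs) simp
  then have Y: "Y1 \<mu> = s * (q * (2 / C))" by (simp add: Y1_def CDK)
  have "2 * K / (C * D) = inverse (C * D / (2 * K))" by simp
  then have "sqrt (2 * K / (C * D)) = inverse q" by (simp only: q_def real_sqrt_inverse)
  then have T: "T1 \<mu> = (s * (1 / real (2 * p + 1 - k)) * inverse q) *\<^sub>R torus_avg d \<mu>" by (simp add: T1_def CDK)
  have n0: "real (2 * p + 1 - k) \<noteq> 0" using kp by simp
  show "R1 \<mu> \<noteq> 0" using q s0 by (simp add: R)
  have "R1 \<mu> * R1 \<mu> = (s * s) * (q * q)" by (simp add: R)
  then show "R1 \<mu> * R1 \<mu> = torus_avg c \<mu> * torus_avg a \<mu> / (2 * real (k + 1))" by (simp add: ss q CDK)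
  show "torus_avg c \<mu> * Y1 \<mu> = 2 * R1 \<mu>" using pos by (simp add: R Y CDK(1)[symmetric])
  have "K * R1 \<mu> * Y1 \<mu> = (s * s) * (q * q) * (2 * K / C)" by (simp add: R Y)
  also have "\<dots> = D" using pos by (simp add: ss q(2))
  finally show "real (k + 1) * R1 \<mu> * Y1 \<mu> = torus_avg a \<mu>" by (simp add: CDK)
  have "real (2 * p + 1 - k) * R1 \<mu> * T1 \<mu> $ i = (s * s) * (q * inverse q) * torus_avg d \<mu> $ i"
    using n0 unfolding R T by (simp del: of_nat_diff)
  then show "real (2 * p + 1 - k) * R1 \<mu> * T1 \<mu> $ i = torus_avg d \<mu> $ i" using q by (simp add: ss)
qed

lemmas c_avg = ta_avg[OF c] and a_avg = ta_avg[OF a] and d_avg = ta_avg[OF d]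

lemma R1_an: "torus_analytic_on (\<lambda>\<theta> :: real ^ 'd. R1) \<Lambda>"
  unfolding R1_def[abs_def]
  by (intro ta_mult ta_const ta_sqrt ta_divide c_avg a_avg) (auto simp: c_pos a_pos)

lemma Y1_an: "torus_analytic_on (\<lambda>\<theta> :: real ^ 'd. Y1) \<Lambda>"
  unfolding Y1_def[abs_def]
  by (intro ta_mult ta_const ta_sqrt ta_divide c_avg a_avg) (auto simp: c_pos a_pos less_imp_neq[OF c_pos, symmetric])

lemma T1_an: "torus_analytic_on (\<lambda>\<theta> :: real ^ 'd. T1) \<Lambda>"
  unfolding T1_def[abs_def]
  by (intro ta_scaleR d_avg ta_mult ta_const ta_sqrt ta_divide c_avg a_avg)
     (auto simp: c_pos a_pos less_imp_neq[OF c_pos, symmetric] less_imp_neq[OF a_pos, symmetric])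

text \<open>
  A linear system for \<open>x\<close> and \<open>y\<close> with determinant
  \<open>(n + 1) (n + k) R\<^sup>2 - k c a = c a (n - k) (n + 2 k + 1) / (2 (k + 1))\<close>, up to sign, where
  \<open>c\<close> and \<open>a\<close> stand for the averages. At the resonance \<open>n = k\<close> it is
  singular; then \<open>x = 0\<close> is prescribed and \<open>\<sigma>\<close>, the coefficient of \<open>u\<^sup>2\<^sup>k\<^sup>-\<^sup>1\<close> in the reduced dynamics, is the
  second unknown.
\<close>

lemma averaged_equations:
  assumes gx: "torus_analytic_on (\<lambda>\<theta> :: real ^ 'd. gx) \<Lambda>" and gy: "torus_analytic_on (\<lambda>\<theta> :: real ^ 'd. gy) \<Lambda>"
    and n: "n \<ge> 2"
  obtains x y \<sigma> :: "real ^ 'm => real" where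
    "torus_analytic_on (\<lambda>\<theta> :: real ^ 'd. x) \<Lambda>" "torus_analytic_on (\<lambda>\<theta> :: real ^ 'd. y) \<Lambda>"
    "torus_analytic_on (\<lambda>\<theta> :: real ^ 'd. \<sigma>) \<Lambda>" "n \<noteq> k ==> \<sigma> = (\<lambda>_. 0)"
    "\<And>\<mu>. \<mu> \<in> \<Lambda> ==> gx \<mu> + torus_avg c \<mu> * y \<mu> - real (n + 1) * R1 \<mu> * x \<mu> - 2 * \<sigma> \<mu> = 0"
    "\<And>\<mu>. \<mu> \<in> \<Lambda> ==> gy \<mu> + real k * torus_avg a \<mu> * x \<mu> - real (n + k) * R1 \<mu> * y \<mu> - real (k + 1) * Y1 \<mu> * \<sigma> \<mu> = 0"
proof (cases "n = k")
  case False
  define D where "D \<mu> = real (n + 1) * real (n + k) * (R1 \<mu> * R1 \<mu>) - real k * (torus_avg c \<mu> * torus_avg a \<mu>)" for \<mu>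
  have D0: "D \<mu> \<noteq> 0" if \<mu>: "\<mu> \<in> \<Lambda>" for \<mu>
  proof
    assume D: "D \<mu> = 0"
    have P: "torus_avg c \<mu> * torus_avg a \<mu> > 0" using c_pos a_pos \<mu> by simp
    from D have E: "torus_avg c \<mu> * torus_avg a \<mu> * (real (n + 1) * real (n + k)) = torus_avg c \<mu> * torus_avg a \<mu> * (2 * real k * real (k + 1))"
      unfolding D_def leading_relations(2)[OF \<mu>] by (simp add: field_simps)
    have "real (n + 1) * real (n + k) = 2 * real k * real (k + 1)"
      by (rule mult_left_cancel[THEN iffD1, OF _ E]) (use P in auto)
    then have "(real n - real k) * (real n + 2 * real k + 1) = 0" by (simp add: algebra_simps)
    then show False using False by simp
  qed
  define x where "x \<mu> = (real (n + k) * R1 \<mu> * gx \<mu> + torus_avg c \<mu> * gy \<mu>) / D \<mu>" for \<mu>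
  define y where "y \<mu> = (real (n + 1) * R1 \<mu> * gy \<mu> + real k * torus_avg a \<mu> * gx \<mu>) / D \<mu>" for \<mu>
  have Dt: "torus_analytic_on (\<lambda>\<theta> :: real ^ 'd. D) \<Lambda>"
    unfolding D_def[abs_def] by (intro ta_diff ta_mult ta_const R1_an c_avg a_avg)
  have xt: "torus_analytic_on (\<lambda>\<theta> :: real ^ 'd. x) \<Lambda>"
    unfolding x_def[abs_def] by (intro ta_divide ta_add ta_mult ta_const R1_an c_avg gx gy Dt D0)
  have yt: "torus_analytic_on (\<lambda>\<theta> :: real ^ 'd. y) \<Lambda>"
    unfolding y_def[abs_def] by (intro ta_divide ta_add ta_mult ta_const R1_an a_avg gx gy Dt D0)
  show ?thesis
  proof (rule that[OF xt yt ta_const[of 0]])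
    fix \<mu> assume \<mu>: "\<mu> \<in> \<Lambda>"
    have x: "D \<mu> * x \<mu> = real (n + k) * R1 \<mu> * gx \<mu> + torus_avg c \<mu> * gy \<mu>" using D0[OF \<mu>] by (simp add: x_def)
    have y: "D \<mu> * y \<mu> = real (n + 1) * R1 \<mu> * gy \<mu> + real k * torus_avg a \<mu> * gx \<mu>" using D0[OF \<mu>] by (simp add: y_def)
    have "D \<mu> * (gx \<mu> + torus_avg c \<mu> * y \<mu> - real (n + 1) * R1 \<mu> * x \<mu>)
        = D \<mu> * gx \<mu> + torus_avg c \<mu> * (D \<mu> * y \<mu>) - real (n + 1) * R1 \<mu> * (D \<mu> * x \<mu>)" by (simp add: algebra_simps)
    also have "\<dots> = 0" unfolding x y by (simp add: D_def algebra_simps)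
    finally show "gx \<mu> + torus_avg c \<mu> * y \<mu> - real (n + 1) * R1 \<mu> * x \<mu> - 2 * 0 = 0" using D0[OF \<mu>] by simp
    have "D \<mu> * (gy \<mu> + real k * torus_avg a \<mu> * x \<mu> - real (n + k) * R1 \<mu> * y \<mu>)
        = D \<mu> * gy \<mu> + real k * torus_avg a \<mu> * (D \<mu> * x \<mu>) - real (n + k) * R1 \<mu> * (D \<mu> * y \<mu>)" by (simp add: algebra_simps)
    also have "\<dots> = 0" unfolding x y by (simp add: D_def algebra_simps)
    finally show "gy \<mu> + real k * torus_avg a \<mu> * x \<mu> - real (n + k) * R1 \<mu> * y \<mu> - real (k + 1) * Y1 \<mu> * 0 = 0" using D0[OF \<mu>] by simp
  qed simp
next
  case True
  define y where "y \<mu> = (gy \<mu> - real (k + 1) * Y1 \<mu> * gx \<mu> / 2) / (real (3 * k + 1) * R1 \<mu>)" for \<mu>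
  define \<sigma> where "\<sigma> \<mu> = (torus_avg c \<mu> * y \<mu> + gx \<mu>) / 2" for \<mu>
  have yt: "torus_analytic_on (\<lambda>\<theta> :: real ^ 'd. y) \<Lambda>"
    unfolding y_def[abs_def] by (intro ta_divide ta_diff ta_mult ta_const R1_an Y1_an gx gy) (auto simp: leading_relations(1))
  have \<sigma>t: "torus_analytic_on (\<lambda>\<theta> :: real ^ 'd. \<sigma>) \<Lambda>"
    unfolding \<sigma>_def[abs_def] by (intro ta_divide ta_add ta_mult ta_const c_avg yt gx) auto
  show ?thesis
  proof (rule that[OF ta_const[of 0] yt \<sigma>t])
    fix \<mu> assume \<mu>: "\<mu> \<in> \<Lambda>"
    show "gx \<mu> + torus_avg c \<mu> * y \<mu> - real (n + 1) * R1 \<mu> * 0 - 2 * \<sigma> \<mu> = 0" by (simp add: \<sigma>_def)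
    have "real (3 * k + 1) * R1 \<mu> * y \<mu> = gy \<mu> - real (k + 1) * Y1 \<mu> * gx \<mu> / 2"
      using leading_relations(1)[OF \<mu>] by (simp add: y_def)
    moreover have "real (k + 1) * Y1 \<mu> * \<sigma> \<mu> = real (k + 1) * y \<mu> / 2 * (torus_avg c \<mu> * Y1 \<mu>) + real (k + 1) * Y1 \<mu> * gx \<mu> / 2"
      by (simp add: \<sigma>_def field_simps)
    then have "real (k + 1) * Y1 \<mu> * \<sigma> \<mu> = real (k + 1) * R1 \<mu> * y \<mu> + real (k + 1) * Y1 \<mu> * gx \<mu> / 2"
      unfolding leading_relations(3)[OF \<mu>] by simp
    ultimately show "gy \<mu> + real k * torus_avg a \<mu> * 0 - real (n + k) * R1 \<mu> * y \<mu> - real (k + 1) * Y1 \<mu> * \<sigma> \<mu> = 0"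
      using True by (simp add: algebra_simps)
  qed (use True in simp)
qed

lemma cohomological_solution:
  fixes h :: "real ^ 'd => real ^ 'm => real"
  assumes h: "torus_analytic_on h \<Lambda>" and avg: "\<And>\<mu>. \<mu> \<in> \<Lambda> ==> torus_avg h \<mu> = 0"
  obtains w where "tilde_coeff \<Lambda> w" "\<And>\<theta> \<mu>. \<mu> \<in> \<Lambda> ==> h \<theta> \<mu> + w \<theta> \<mu> - w (\<theta> + \<omega>) \<mu> = 0"
proof (rule that[of "SD \<omega> \<Lambda> h"])
  show "tilde_coeff \<Lambda> (SD \<omega> \<Lambda> h)" using SD_props[OF h avg \<omega>] by (simp add: tilde_coeff_def)
  show "h \<theta> \<mu> + SD \<omega> \<Lambda> h \<theta> \<mu> - SD \<omega> \<Lambda> h (\<theta> + \<omega>) \<mu> = 0" if "\<mu> \<in> \<Lambda>" for \<theta> \<mu>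
    using SD_props(3)[OF h avg \<omega> that, of \<theta>] by simp
qed

lemma B_nth: "torus_analytic_on (\<lambda>\<theta> ((x, y), \<mu>). B x y \<theta> \<mu> $ i) (U \<times> \<Lambda>)"
  by (rule ta_cong[OF ta_nth[OF B, of i]]) auto

lemma B_nth_order: "\<mu> \<in> \<Lambda> ==> remainder_order p U (\<lambda>x y. B x y \<theta> \<mu> $ i)"
  by (rule remainder_order_nth[OF B_order])

end

section \<open>The residual under a change of the coefficients\<close>

lemma eqm_iff_diff_zero: "eqm \<Lambda> N f g \<longleftrightarrow> eqm \<Lambda> N (\<lambda>u \<theta> \<mu>. f u \<theta> \<mu> - g u \<theta> \<mu>) (\<lambda>_ _ _. 0)"
  by (simp add: eqm_def)

text \<open>
  The increment of a residual consists of that of the parametrization, \<open>e\<close>, of that of a nonlinear term, \<open>f\<close>,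
  and of that of the composition with the reduced dynamics, \<open>q\<close>. The first and the last are not small
  separately; only \<open>e - e'\<close> is.
\<close>

lemma eqm_balance:
  assumes C: "eqm \<Lambda> N (\<lambda>u \<theta> \<mu>. e u \<theta> \<mu> - e' u \<theta> \<mu>) g1" and P: "eqm \<Lambda> N f g2"
    and Q: "eqm \<Lambda> N q (\<lambda>u \<theta> \<mu>. e' u \<theta> \<mu> + g3 u \<theta> \<mu>)"
    and eq: "\<And>u \<theta> \<mu>. w u \<theta> \<mu> = e u \<theta> \<mu> + f u \<theta> \<mu> - q u \<theta> \<mu>"
    and g: "\<And>u \<theta> \<mu>. g u \<theta> \<mu> = g1 u \<theta> \<mu> + g2 u \<theta> \<mu> - g3 u \<theta> \<mu>"
  shows "eqm \<Lambda> N w g"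
proof -
  have "O_pow \<Lambda> N (\<lambda>u \<theta> \<mu>. (e u \<theta> \<mu> - e' u \<theta> \<mu> - g1 u \<theta> \<mu>) + (f u \<theta> \<mu> - g2 u \<theta> \<mu>) - (q u \<theta> \<mu> - (e' u \<theta> \<mu> + g3 u \<theta> \<mu>)))"
    using O_diff[OF O_add[OF C[unfolded eqm_def] P[unfolded eqm_def]] Q[unfolded eqm_def]] .
  then show ?thesis unfolding eqm_def by (rule O_cong) (simp add: eq g)
qed

lemma O_cancel:
  assumes "eqm \<Lambda> N (\<lambda>u \<theta> \<mu>. f' u \<theta> \<mu> - f u \<theta> \<mu>) (\<lambda>u \<theta> \<mu>. q \<theta> \<mu> * u ^ M)"
    and "eqm \<Lambda> N f (\<lambda>u \<theta> \<mu>. g \<theta> \<mu> * u ^ M)" and z: "\<And>\<theta> \<mu>. \<mu> \<in> \<Lambda> ==> g \<theta> \<mu> + q \<theta> \<mu> = 0"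
  shows "O_pow \<Lambda> N f'"
proof -
  have "O_pow \<Lambda> N (\<lambda>u \<theta> \<mu>. (f' u \<theta> \<mu> - f u \<theta> \<mu> - q \<theta> \<mu> * u ^ M) + (f u \<theta> \<mu> - g \<theta> \<mu> * u ^ M))"
    using O_add[OF assms(1,2)[unfolded eqm_def]] .
  then show ?thesis
  proof (rule O_cong)
    fix u :: real and \<theta> \<mu> assume "\<mu> \<in> \<Lambda>"
    then have "g \<theta> \<mu> * u ^ M + q \<theta> \<mu> * u ^ M = 0" using z[of \<mu> \<theta>] by (simp add: distrib_right[symmetric])
    then show "(f' u \<theta> \<mu> - f u \<theta> \<mu> - q \<theta> \<mu> * u ^ M) + (f u \<theta> \<mu> - g \<theta> \<mu> * u ^ M) = f' u \<theta> \<mu>" by linarith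
  qed
qed

lemma torus_avg_affine:
  assumes g: "torus_analytic_on g \<Lambda>" and f: "torus_analytic_on f \<Lambda>"
    and v: "torus_analytic_on (\<lambda>\<theta> :: real ^ 'd. v) \<Lambda>" and w: "torus_analytic_on (\<lambda>\<theta> :: real ^ 'd. w) \<Lambda>" and \<mu>: "\<mu> \<in> \<Lambda>"
  shows "torus_avg (\<lambda>(\<theta> :: real ^ 'd) \<mu>. g \<theta> \<mu> + f \<theta> \<mu> * v \<mu> - w \<mu>) \<mu> = torus_avg g \<mu> + torus_avg f \<mu> * v \<mu> - (w \<mu> :: real)"
  using torus_avg_diff[OF ta_add[OF g ta_mult[OF f v]] w \<mu>] torus_avg_add[OF g ta_mult[OF f v] \<mu>]
  by (simp add: torus_avg_mult_right torus_avg_bar[of w])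

context reduced_map
begin

text \<open>
  The components of the residual. The last argument is the composition of the parametrization with the
  reduced map; it evaluates the parametrization at another point and is therefore kept apart.
\<close>

definition Ex :: "(real => real ^ 'd => real ^ 'm => real) => (real => real ^ 'd => real ^ 'm => real) =>
    (real => real ^ 'd => real ^ 'm => real ^ 'd) => (real => real ^ 'd => real ^ 'm => real) => real => real ^ 'd => real ^ 'm => real" where
  "Ex X Y \<kappa> Xr u \<theta> \<mu> = X u \<theta> \<mu> + c (\<theta> + \<kappa> u \<theta> \<mu>) \<mu> * Y u \<theta> \<mu> - Xr u \<theta> \<mu>"

definition Ey :: "(real => real ^ 'd => real ^ 'm => real) => (real => real ^ 'd => real ^ 'm => real) =>
    (real => real ^ 'd => real ^ 'm => real ^ 'd) => (real => real ^ 'd => real ^ 'm => real) => real => real ^ 'd => real ^ 'm => real" where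
  "Ey X Y \<kappa> Yr u \<theta> \<mu> = Y u \<theta> \<mu> + (a (\<theta> + \<kappa> u \<theta> \<mu>) \<mu> * X u \<theta> \<mu> ^ k + A (X u \<theta> \<mu>) (Y u \<theta> \<mu>) (\<theta> + \<kappa> u \<theta> \<mu>) \<mu>) - Yr u \<theta> \<mu>"

definition Et :: "'d => (real => real ^ 'd => real ^ 'm => real) => (real => real ^ 'd => real ^ 'm => real) =>
    (real => real ^ 'd => real ^ 'm => real ^ 'd) => (real => real ^ 'd => real ^ 'm => real ^ 'd) => real => real ^ 'd => real ^ 'm => real" where
  "Et j X Y \<kappa> \<kappa>r u \<theta> \<mu> = \<kappa> u \<theta> \<mu> $ j + (d (\<theta> + \<kappa> u \<theta> \<mu>) \<mu> $ j * X u \<theta> \<mu> ^ p + B (X u \<theta> \<mu>) (Y u \<theta> \<mu>) (\<theta> + \<kappa> u \<theta> \<mu>) \<mu> $ j)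
     - \<kappa>r u \<theta> \<mu> $ j"

lemma residual_xpd:
  assumes X: "xpd \<Lambda> X" "O_pow \<Lambda> 1 X" and Y: "xpd \<Lambda> Y" "O_pow \<Lambda> 1 Y"
    and \<kappa>: "\<And>i. xpd \<Lambda> (\<lambda>u \<theta> \<mu>. \<kappa> u \<theta> \<mu> $ i)" "O_pow \<Lambda> 1 \<kappa>"
  shows "xpd \<Lambda> Xr ==> xpd \<Lambda> (Ex X Y \<kappa> Xr)" "xpd \<Lambda> Yr ==> xpd \<Lambda> (Ey X Y \<kappa> Yr)"
    "xpd \<Lambda> (\<lambda>u \<theta> \<mu>. \<kappa>r u \<theta> \<mu> $ j) ==> xpd \<Lambda> (Et j X Y \<kappa> \<kappa>r)"
proof -
  show "xpd \<Lambda> Xr ==> xpd \<Lambda> (Ex X Y \<kappa> Xr)"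
    unfolding Ex_def[abs_def] by (intro xpd_add xpd_diff xpd_mult X Y xpd_shift[OF c] \<kappa>)
  show "xpd \<Lambda> Yr ==> xpd \<Lambda> (Ey X Y \<kappa> Yr)"
    unfolding Ey_def[abs_def]
    by (intro xpd_add xpd_diff xpd_mult xpd_power X Y xpd_shift[OF a] \<kappa> remainder_xpd[OF A A_order U _ k]) (use k in auto)
  show "xpd \<Lambda> (\<lambda>u \<theta> \<mu>. \<kappa>r u \<theta> \<mu> $ j) ==> xpd \<Lambda> (Et j X Y \<kappa> \<kappa>r)"
    unfolding Et_def[abs_def]
    by (intro xpd_add xpd_diff xpd_mult xpd_power X Y xpd_shift[OF ta_nth[OF d]] \<kappa> remainder_xpd[OF B_nth B_nth_order U p k])
qed

lemma coh_leading:
  assumes S: "torus_analytic_on (\<lambda>\<theta> :: real ^ 'd. S) \<Lambda>"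
    and e: "torus_analytic_on (\<lambda>\<theta> :: real ^ 'd. e) \<Lambda>" and e': "torus_analytic_on e' \<Lambda>" and m: "m \<ge> 1"
    and M: "M = m + k - 1" and N: "N = m + k"
  shows "eqm \<Lambda> N
    (\<lambda>u \<theta> \<mu>. (e \<mu> * u ^ m + e' \<theta> \<mu> * u ^ M) - (e \<mu> * rdyn k R1 S u \<theta> \<mu> ^ m + e' (\<theta> + \<omega>) \<mu> * rdyn k R1 S u \<theta> \<mu> ^ M))
    (\<lambda>u \<theta> \<mu>. (e' \<theta> \<mu> - e' (\<theta> + \<omega>) \<mu> - real m * R1 \<mu> * e \<mu>) * u ^ M)"
  unfolding M N by (rule cohomological_leading[OF k R1_an S e e' m])

text \<open>
  A change of the coefficient of \<open>u\<^sup>2\<^sup>k\<^sup>-\<^sup>1\<close> in the reduced dynamics is felt at order \<open>l + 2 k - 2\<close> by the lowest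
  power \<open>u\<^sup>l\<close>, and later by the others.
\<close>

lemma lead_rdyn_diff:
  assumes S: "torus_analytic_on (\<lambda>\<theta> :: real ^ 'd. S) \<Lambda>" and S': "torus_analytic_on (\<lambda>\<theta> :: real ^ 'd. S') \<Lambda>"
    and w: "torus_analytic_on (\<lambda>\<theta> :: real ^ 'd. w) \<Lambda>"
    and P: "\<And>v \<theta> \<mu>. P v \<theta> \<mu> = w \<mu> * v ^ l + Q v \<theta> \<mu>"
    and Q: "O_pow \<Lambda> (l + 2 * k - 1) (\<lambda>u \<theta> \<mu>. Q (rdyn k R1 S' u \<theta> \<mu>) (\<theta> + \<omega>) \<mu> - Q (rdyn k R1 S u \<theta> \<mu>) (\<theta> + \<omega>) \<mu>)"
    and SS: "\<And>\<mu>. S' \<mu> - S \<mu> = \<sigma> \<mu>" and n: "n \<noteq> k ==> \<sigma> = (\<lambda>_. 0)" "n = k ==> M = l + 2 * k - 2"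
    and N: "N = Suc M"
  shows "eqm \<Lambda> N (\<lambda>u \<theta> \<mu>. P (rdyn k R1 S' u \<theta> \<mu>) (\<theta> + \<omega>) \<mu> - P (rdyn k R1 S u \<theta> \<mu>) (\<theta> + \<omega>) \<mu>)
    (\<lambda>u \<theta> \<mu>. (real l * w \<mu> * \<sigma> \<mu>) * u ^ M)"
proof (cases "n = k")
  case True
  have M: "l + 2 * k - 2 = M" "l + 2 * k - 1 = N" using n(2)[OF True] N k by auto
  note D = rdyn_diff_coef(1)[OF k R1_an S S' w, where i = l]
  show ?thesis
    by (rule eqm_cong[OF eqm_absorb[OF D Q, unfolded M]]) (simp_all add: P SS algebra_simps)
next
  case False
  have "S' \<mu> = S \<mu>" for \<mu> using SS[of \<mu>] n(1)[OF False] by simp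
  then have "S' = S" by auto
  then show ?thesis using n(1)[OF False] by simp
qed

context
  fixes n :: nat and X X' Y Y' Xr Xr' Yr Yr' :: "real => real ^ 'd => real ^ 'm => real"
    and \<kappa> \<kappa>' \<kappa>r \<kappa>r' :: "real => real ^ 'd => real ^ 'm => real ^ 'd"
    and x y \<sigma> S' :: "real ^ 'm => real" and t :: "real ^ 'm => real ^ 'd"
    and xt yt :: "real ^ 'd => real ^ 'm => real" and tt :: "real ^ 'd => real ^ 'm => real ^ 'd"
  assumes n: "n \<ge> 2"
    and X2: "eqm \<Lambda> 3 X (\<lambda>u \<theta> \<mu>. u ^ 2)" "eqm \<Lambda> 3 X' (\<lambda>u \<theta> \<mu>. u ^ 2)"
    and YO: "O_pow \<Lambda> (k + 1) Y" "O_pow \<Lambda> (k + 1) Y'" and \<kappa>O: "O_pow \<Lambda> 1 \<kappa>" "O_pow \<Lambda> 1 \<kappa>'"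
    and S': "torus_analytic_on (\<lambda>\<theta> :: real ^ 'd. S') \<Lambda>"
    and bars: "torus_analytic_on (\<lambda>\<theta> :: real ^ 'd. x) \<Lambda>" "torus_analytic_on (\<lambda>\<theta> :: real ^ 'd. y) \<Lambda>" "torus_analytic_on (\<lambda>\<theta> :: real ^ 'd. t) \<Lambda>"
    and tildes: "torus_analytic_on xt \<Lambda>" "torus_analytic_on yt \<Lambda>" "torus_analytic_on tt \<Lambda>"
    and dX: "\<And>u \<theta> \<mu>. X' u \<theta> \<mu> = X u \<theta> \<mu> + (x \<mu> * u ^ (n + 1) + xt \<theta> \<mu> * u ^ (n + k))"
    and dY: "\<And>u \<theta> \<mu>. Y' u \<theta> \<mu> = Y u \<theta> \<mu> + (y \<mu> * u ^ (n + k) + yt \<theta> \<mu> * u ^ (n + 2 * k - 1))"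
    and d\<kappa>: "\<And>u \<theta> \<mu> j. \<kappa>' u \<theta> \<mu> $ j = \<kappa> u \<theta> \<mu> $ j + (t \<mu> $ j * u ^ (n + 2 * p - k) + tt \<theta> \<mu> $ j * u ^ (n + 2 * p - 1))"
    and dXr: "eqm \<Lambda> (n + k + 1) (\<lambda>u \<theta> \<mu>. Xr' u \<theta> \<mu> - Xr u \<theta> \<mu>)
      (\<lambda>u \<theta> \<mu>. (x \<mu> * rdyn k R1 S' u \<theta> \<mu> ^ (n + 1) + xt (\<theta> + \<omega>) \<mu> * rdyn k R1 S' u \<theta> \<mu> ^ (n + k)) + (2 * \<sigma> \<mu>) * u ^ (n + k))"
    and dYr: "eqm \<Lambda> (n + 2 * k) (\<lambda>u \<theta> \<mu>. Yr' u \<theta> \<mu> - Yr u \<theta> \<mu>)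
      (\<lambda>u \<theta> \<mu>. (y \<mu> * rdyn k R1 S' u \<theta> \<mu> ^ (n + k) + yt (\<theta> + \<omega>) \<mu> * rdyn k R1 S' u \<theta> \<mu> ^ (n + 2 * k - 1))
         + (real (k + 1) * Y1 \<mu> * \<sigma> \<mu>) * u ^ (n + 2 * k - 1))"
    and d\<kappa>r: "\<And>j. eqm \<Lambda> (n + 2 * p) (\<lambda>u \<theta> \<mu>. \<kappa>r' u \<theta> \<mu> $ j - \<kappa>r u \<theta> \<mu> $ j)
      (\<lambda>u \<theta> \<mu>. (t \<mu> $ j * rdyn k R1 S' u \<theta> \<mu> ^ (n + 2 * p - k) + tt (\<theta> + \<omega>) \<mu> $ j * rdyn k R1 S' u \<theta> \<mu> ^ (n + 2 * p - 1))
         + (real (2 * p + 1 - k) * T1 \<mu> $ j * \<sigma> \<mu>) * u ^ (n + 2 * p - 1))"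
begin

lemma increment_orders:
  "eqm \<Lambda> (n + 2) (\<lambda>u \<theta> \<mu>. X' u \<theta> \<mu> - X u \<theta> \<mu>) (\<lambda>u \<theta> \<mu>. x \<mu> * u ^ (n + 1))"
  "eqm \<Lambda> (n + 1) X' X"
  "eqm \<Lambda> (n + k + 1) (\<lambda>u \<theta> \<mu>. Y' u \<theta> \<mu> - Y u \<theta> \<mu>) (\<lambda>u \<theta> \<mu>. y \<mu> * u ^ (n + k))"
  "eqm \<Lambda> (n + k) Y' Y"
  "O_pow \<Lambda> n (\<lambda>u \<theta> \<mu>. \<kappa>' u \<theta> \<mu> - \<kappa> u \<theta> \<mu>)"
proof -
  have "O_pow \<Lambda> (n + 2) (\<lambda>u \<theta> \<mu>. xt \<theta> \<mu> * u ^ (n + k))" by (rule O_coef_u[OF tildes(1)]) (use k in auto)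
  then show "eqm \<Lambda> (n + 2) (\<lambda>u \<theta> \<mu>. X' u \<theta> \<mu> - X u \<theta> \<mu>) (\<lambda>u \<theta> \<mu>. x \<mu> * u ^ (n + 1))" by (simp add: eqm_def dX)
  have "O_pow \<Lambda> (n + 1) (\<lambda>u \<theta> \<mu>. x \<mu> * u ^ (n + 1) + xt \<theta> \<mu> * u ^ (n + k))"
    by (intro O_add O_coef_u tildes bars) (use k in auto)
  then show "eqm \<Lambda> (n + 1) X' X" by (simp add: eqm_def dX)
  have "O_pow \<Lambda> (n + k + 1) (\<lambda>u \<theta> \<mu>. yt \<theta> \<mu> * u ^ (n + 2 * k - 1))" by (rule O_coef_u[OF tildes(2)]) (use k in auto)
  then show "eqm \<Lambda> (n + k + 1) (\<lambda>u \<theta> \<mu>. Y' u \<theta> \<mu> - Y u \<theta> \<mu>) (\<lambda>u \<theta> \<mu>. y \<mu> * u ^ (n + k))" by (simp add: eqm_def dY)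
  have "O_pow \<Lambda> (n + k) (\<lambda>u \<theta> \<mu>. y \<mu> * u ^ (n + k) + yt \<theta> \<mu> * u ^ (n + 2 * k - 1))"
    by (intro O_add O_coef_u tildes bars) (use k in auto)
  then show "eqm \<Lambda> (n + k) Y' Y" by (simp add: eqm_def dY)
  have "O_pow \<Lambda> n (\<lambda>u \<theta> \<mu>. t \<mu> $ j * u ^ (n + 2 * p - k) + tt \<theta> \<mu> $ j * u ^ (n + 2 * p - 1))" for j
    by (intro O_add O_coef_u ta_nth tildes bars) (use kp p in auto)
  then show "O_pow \<Lambda> n (\<lambda>u \<theta> \<mu>. \<kappa>' u \<theta> \<mu> - \<kappa> u \<theta> \<mu>)" by (simp add: O_vec d\<kappa>)
qed

text \<open>
  The linear operator of the induction: how the corrections change the leading coefficients of the residual.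
  The remainders contribute to higher orders only (\<open>remainder_eqm\<close>).
\<close>

lemma residual_increment:
  "eqm \<Lambda> (n + k + 1) (\<lambda>u \<theta> \<mu>. Ex X' Y' \<kappa>' Xr' u \<theta> \<mu> - Ex X Y \<kappa> Xr u \<theta> \<mu>)
     (\<lambda>u \<theta> \<mu>. (xt \<theta> \<mu> - xt (\<theta> + \<omega>) \<mu> - real (n + 1) * R1 \<mu> * x \<mu> + c \<theta> \<mu> * y \<mu> - 2 * \<sigma> \<mu>) * u ^ (n + k))"
  "eqm \<Lambda> (n + 2 * k) (\<lambda>u \<theta> \<mu>. Ey X' Y' \<kappa>' Yr' u \<theta> \<mu> - Ey X Y \<kappa> Yr u \<theta> \<mu>)
     (\<lambda>u \<theta> \<mu>. (yt \<theta> \<mu> - yt (\<theta> + \<omega>) \<mu> - real (n + k) * R1 \<mu> * y \<mu> + real k * a \<theta> \<mu> * x \<mu> - real (k + 1) * Y1 \<mu> * \<sigma> \<mu>) * u ^ (n + 2 * k - 1))"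
  "eqm \<Lambda> (n + 2 * p) (\<lambda>u \<theta> \<mu>. Et j X' Y' \<kappa>' \<kappa>r' u \<theta> \<mu> - Et j X Y \<kappa> \<kappa>r u \<theta> \<mu>)
     (\<lambda>u \<theta> \<mu>. (tt \<theta> \<mu> $ j - tt (\<theta> + \<omega>) \<mu> $ j - real (n + 2 * p - k) * R1 \<mu> * t \<mu> $ j + real p * d \<theta> \<mu> $ j * x \<mu>
        - real (2 * p + 1 - k) * T1 \<mu> $ j * \<sigma> \<mu>) * u ^ (n + 2 * p - 1))"
proof -
  have n1: "n \<ge> 1" using n by simp
  have u2: "O_pow \<Lambda> 2 (\<lambda>u (\<theta> :: real ^ 'd) \<mu>. u ^ 2 :: real)" by (rule O_u)
  have XO: "O_pow \<Lambda> 2 X'" "O_pow \<Lambda> 2 X" using eqm_O_le[OF X2(1) u2] eqm_O_le[OF X2(2) u2] by auto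
  have p1: "eqm \<Lambda> (n + k + 1) (\<lambda>u \<theta> \<mu>. c (\<theta> + \<kappa>' u \<theta> \<mu>) \<mu> * Y' u \<theta> \<mu> - c (\<theta> + \<kappa> u \<theta> \<mu>) \<mu> * Y u \<theta> \<mu>)
     (\<lambda>u \<theta> \<mu>. c \<theta> \<mu> * y \<mu> * u ^ (n + k))"
    by (rule product_increment_leading[OF c \<kappa>O increment_orders(5) YO(2) bars(2) increment_orders(3)])
  have c1: "eqm \<Lambda> (n + k + 1)
    (\<lambda>u \<theta> \<mu>. (x \<mu> * u ^ (n + 1) + xt \<theta> \<mu> * u ^ (n + k)) - (x \<mu> * rdyn k R1 S' u \<theta> \<mu> ^ (n + 1) + xt (\<theta> + \<omega>) \<mu> * rdyn k R1 S' u \<theta> \<mu> ^ (n + k)))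
    (\<lambda>u \<theta> \<mu>. (xt \<theta> \<mu> - xt (\<theta> + \<omega>) \<mu> - real (n + 1) * R1 \<mu> * x \<mu>) * u ^ (n + k))"
    by (rule coh_leading[OF S' bars(1) tildes(1)]) auto
  show "eqm \<Lambda> (n + k + 1) (\<lambda>u \<theta> \<mu>. Ex X' Y' \<kappa>' Xr' u \<theta> \<mu> - Ex X Y \<kappa> Xr u \<theta> \<mu>)
     (\<lambda>u \<theta> \<mu>. (xt \<theta> \<mu> - xt (\<theta> + \<omega>) \<mu> - real (n + 1) * R1 \<mu> * x \<mu> + c \<theta> \<mu> * y \<mu> - 2 * \<sigma> \<mu>) * u ^ (n + k))"
    by (rule eqm_balance[OF c1 p1 dXr]) (simp_all add: Ex_def dX left_diff_distrib distrib_right)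
  have m2: "eqm \<Lambda> (n + 2 * k) (\<lambda>u \<theta> \<mu>. a (\<theta> + \<kappa>' u \<theta> \<mu>) \<mu> * X' u \<theta> \<mu> ^ k - a (\<theta> + \<kappa> u \<theta> \<mu>) \<mu> * X u \<theta> \<mu> ^ k)
     (\<lambda>u \<theta> \<mu>. real k * a \<theta> \<mu> * x \<mu> * u ^ (n + 2 * k - 1))"
    by (rule monomial_increment_leading[OF a \<kappa>O increment_orders(5) X2 bars(1) increment_orders(1) n1])
  have r2: "eqm \<Lambda> (n + 2 * k) (\<lambda>u \<theta> \<mu>. A (X' u \<theta> \<mu>) (Y' u \<theta> \<mu>) (\<theta> + \<kappa>' u \<theta> \<mu>) \<mu>) (\<lambda>u \<theta> \<mu>. A (X u \<theta> \<mu>) (Y u \<theta> \<mu>) (\<theta> + \<kappa> u \<theta> \<mu>) \<mu>)"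
    by (rule remainder_eqm[OF A A_order U _ k XO increment_orders(2) YO(2,1) increment_orders(4) \<kappa>O(2,1) increment_orders(5) n1]) (use k in auto)
  have c2: "eqm \<Lambda> (n + 2 * k)
    (\<lambda>u \<theta> \<mu>. (y \<mu> * u ^ (n + k) + yt \<theta> \<mu> * u ^ (n + 2 * k - 1)) - (y \<mu> * rdyn k R1 S' u \<theta> \<mu> ^ (n + k) + yt (\<theta> + \<omega>) \<mu> * rdyn k R1 S' u \<theta> \<mu> ^ (n + 2 * k - 1)))
    (\<lambda>u \<theta> \<mu>. (yt \<theta> \<mu> - yt (\<theta> + \<omega>) \<mu> - real (n + k) * R1 \<mu> * y \<mu>) * u ^ (n + 2 * k - 1))"
    by (rule coh_leading[OF S' bars(2) tildes(2)]) (use n in auto)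
  show "eqm \<Lambda> (n + 2 * k) (\<lambda>u \<theta> \<mu>. Ey X' Y' \<kappa>' Yr' u \<theta> \<mu> - Ey X Y \<kappa> Yr u \<theta> \<mu>)
     (\<lambda>u \<theta> \<mu>. (yt \<theta> \<mu> - yt (\<theta> + \<omega>) \<mu> - real (n + k) * R1 \<mu> * y \<mu> + real k * a \<theta> \<mu> * x \<mu> - real (k + 1) * Y1 \<mu> * \<sigma> \<mu>) * u ^ (n + 2 * k - 1))"
    by (rule eqm_balance[OF c2 eqm_add[OF m2 r2[unfolded eqm_iff_diff_zero[of _ _ "\<lambda>u \<theta> \<mu>. A (X' u \<theta> \<mu>) (Y' u \<theta> \<mu>) (\<theta> + \<kappa>' u \<theta> \<mu>) \<mu>"]]] dYr])
       (simp_all add: Ey_def dY left_diff_distrib distrib_right)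
  have m3: "eqm \<Lambda> (n + 2 * p) (\<lambda>u \<theta> \<mu>. d (\<theta> + \<kappa>' u \<theta> \<mu>) \<mu> $ j * X' u \<theta> \<mu> ^ p - d (\<theta> + \<kappa> u \<theta> \<mu>) \<mu> $ j * X u \<theta> \<mu> ^ p)
     (\<lambda>u \<theta> \<mu>. real p * d \<theta> \<mu> $ j * x \<mu> * u ^ (n + 2 * p - 1))"
    by (rule monomial_increment_leading[OF ta_nth[OF d] \<kappa>O increment_orders(5) X2 bars(1) increment_orders(1) n1])
  have r3: "eqm \<Lambda> (n + 2 * p) (\<lambda>u \<theta> \<mu>. B (X' u \<theta> \<mu>) (Y' u \<theta> \<mu>) (\<theta> + \<kappa>' u \<theta> \<mu>) \<mu> $ j) (\<lambda>u \<theta> \<mu>. B (X u \<theta> \<mu>) (Y u \<theta> \<mu>) (\<theta> + \<kappa> u \<theta> \<mu>) \<mu> $ j)"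
    by (rule remainder_eqm[OF B_nth B_nth_order U p k XO increment_orders(2) YO(2,1) increment_orders(4) \<kappa>O(2,1) increment_orders(5) n1])
  have c3: "eqm \<Lambda> (n + 2 * p)
    (\<lambda>u \<theta> \<mu>. (t \<mu> $ j * u ^ (n + 2 * p - k) + tt \<theta> \<mu> $ j * u ^ (n + 2 * p - 1)) - (t \<mu> $ j * rdyn k R1 S' u \<theta> \<mu> ^ (n + 2 * p - k) + tt (\<theta> + \<omega>) \<mu> $ j * rdyn k R1 S' u \<theta> \<mu> ^ (n + 2 * p - 1)))
    (\<lambda>u \<theta> \<mu>. (tt \<theta> \<mu> $ j - tt (\<theta> + \<omega>) \<mu> $ j - real (n + 2 * p - k) * R1 \<mu> * t \<mu> $ j) * u ^ (n + 2 * p - 1))"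
    by (rule coh_leading[OF S' ta_nth[OF bars(3)] ta_nth[OF tildes(3)]]) (use n kp in auto)
  show "eqm \<Lambda> (n + 2 * p) (\<lambda>u \<theta> \<mu>. Et j X' Y' \<kappa>' \<kappa>r' u \<theta> \<mu> - Et j X Y \<kappa> \<kappa>r u \<theta> \<mu>)
     (\<lambda>u \<theta> \<mu>. (tt \<theta> \<mu> $ j - tt (\<theta> + \<omega>) \<mu> $ j - real (n + 2 * p - k) * R1 \<mu> * t \<mu> $ j + real p * d \<theta> \<mu> $ j * x \<mu>
        - real (2 * p + 1 - k) * T1 \<mu> $ j * \<sigma> \<mu>) * u ^ (n + 2 * p - 1))"
    by (rule eqm_balance[OF c3 eqm_add[OF m3 r3[unfolded eqm_iff_diff_zero[of _ _ "\<lambda>u \<theta> \<mu>. B (X' u \<theta> \<mu>) (Y' u \<theta> \<mu>) (\<theta> + \<kappa>' u \<theta> \<mu>) \<mu> $ j"]]] d\<kappa>r])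
       (simp_all add: Et_def d\<kappa> left_diff_distrib distrib_right)
qed

end

end

lemma eqm_add_zero: "eqm \<Lambda> N q (\<lambda>u \<theta> \<mu>. q u \<theta> \<mu> + 0)"
  by simp

context reduced_map
begin

section \<open>Induction on the order of the approximation\<close>

text \<open>
  The components of the parametrization, with \<open>\<theta>\<close> subtracted from the last one; see \<open>K_poly_eq\<close>.
\<close>

definition fx :: "nat => (nat => real ^ 'm => real) => (nat => real ^ 'd => real ^ 'm => real) => real => real ^ 'd => real ^ 'm => real" where
  "fx n Kx Kx' u \<theta> \<mu> = u ^ 2 + usum 3 n (\<lambda>i \<theta>. Kx i) u \<theta> \<mu> + usum (k + 1) (n + k - 1) Kx' u \<theta> \<mu>"

definition fy :: "nat => (nat => real ^ 'm => real) => (nat => real ^ 'd => real ^ 'm => real) => real => real ^ 'd => real ^ 'm => real" where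
  "fy n Ky Ky' u \<theta> \<mu> = usum (k + 1) (n + k - 1) (\<lambda>i \<theta>. Ky i) u \<theta> \<mu> + usum (2 * k) (n + 2 * k - 2) Ky' u \<theta> \<mu>"

definition ft :: "nat => (nat => real ^ 'm => real ^ 'd) => (nat => real ^ 'd => real ^ 'm => real ^ 'd) => real => real ^ 'd => real ^ 'm => real ^ 'd" where
  "ft n Kt Kt' u \<theta> \<mu> = (\<chi> j. usum (2 * p + 1 - k) (n + 2 * p - k - 1) (\<lambda>i \<theta> \<mu>. Kt i \<mu> $ j) u \<theta> \<mu>
     + usum (2 * p) (n + 2 * p - 2) (\<lambda>i \<theta> \<mu>. Kt' i \<theta> \<mu> $ j) u \<theta> \<mu>)"

lemma fx_upd:
  assumes "n \<ge> 2"
  shows "fx (Suc n) (Kx(n + 1 := x)) (Kx'(n + k := xt)) u \<theta> \<mu> = fx n Kx Kx' u \<theta> \<mu> + (x \<mu> * u ^ (n + 1) + xt \<theta> \<mu> * u ^ (n + k))"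
proof -
  have e: "(\<lambda>i \<theta> :: real ^ 'd. (Kx(n + 1 := x)) i) = (\<lambda>i \<theta>. Kx i)(Suc n := \<lambda>\<theta>. x)" by (auto simp: fun_eq_iff)
  have E: "Suc n + k - 1 = Suc (n + k - 1)" "n + k = Suc (n + k - 1)" using assms by auto
  have 1: "usum 3 (Suc n) ((\<lambda>i \<theta>. Kx i)(Suc n := \<lambda>\<theta>. x)) u \<theta> \<mu> = usum 3 n (\<lambda>i \<theta>. Kx i) u \<theta> \<mu> + x \<mu> * u ^ Suc n"
    by (rule usum_upd) (use assms in auto)
  have 2: "usum (k + 1) (Suc (n + k - 1)) (Kx'(Suc (n + k - 1) := xt)) u \<theta> \<mu> = usum (k + 1) (n + k - 1) Kx' u \<theta> \<mu> + xt \<theta> \<mu> * u ^ Suc (n + k - 1)"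
    by (rule usum_upd) (use assms k in auto)
  have "fx (Suc n) (Kx(n + 1 := x)) (Kx'(n + k := xt)) u \<theta> \<mu>
      = u ^ 2 + (usum 3 n (\<lambda>i \<theta>. Kx i) u \<theta> \<mu> + x \<mu> * u ^ Suc n) + (usum (k + 1) (n + k - 1) Kx' u \<theta> \<mu> + xt \<theta> \<mu> * u ^ (n + k))"
    unfolding fx_def e E(1) 1 using 2 unfolding E(2)[symmetric] by simp
  then show ?thesis by (simp add: fx_def)
qed

lemma fy_upd:
  assumes "n \<ge> 2"
  shows "fy (Suc n) (Ky(n + k := y)) (Ky'(n + 2 * k - 1 := yt)) u \<theta> \<mu>
    = fy n Ky Ky' u \<theta> \<mu> + (y \<mu> * u ^ (n + k) + yt \<theta> \<mu> * u ^ (n + 2 * k - 1))"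
proof -
  have e: "(\<lambda>i \<theta> :: real ^ 'd. (Ky(n + k := y)) i) = (\<lambda>i \<theta>. Ky i)(n + k := \<lambda>\<theta>. y)" by (auto simp: fun_eq_iff)
  have E: "Suc n + k - 1 = n + k" "Suc n + 2 * k - 2 = n + 2 * k - 1" "Suc (n + k - 1) = n + k" "Suc (n + 2 * k - 2) = n + 2 * k - 1"
    using assms k by auto
  have 1: "usum (k + 1) (n + k) ((\<lambda>i \<theta>. Ky i)(n + k := \<lambda>\<theta>. y)) u \<theta> \<mu> = usum (k + 1) (n + k - 1) (\<lambda>i \<theta>. Ky i) u \<theta> \<mu> + y \<mu> * u ^ (n + k)"
    using usum_upd[of "k + 1" "n + k - 1" "\<lambda>i \<theta>. Ky i" "\<lambda>\<theta>. y" u \<theta> \<mu>] assms unfolding E by simp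
  have 2: "usum (2 * k) (n + 2 * k - 1) (Ky'(n + 2 * k - 1 := yt)) u \<theta> \<mu> = usum (2 * k) (n + 2 * k - 2) Ky' u \<theta> \<mu> + yt \<theta> \<mu> * u ^ (n + 2 * k - 1)"
    using usum_upd[of "2 * k" "n + 2 * k - 2" Ky' yt u \<theta> \<mu>] assms k unfolding E by simp
  show ?thesis unfolding fy_def e E 1 2 by simp
qed

lemma ft_upd:
  assumes "n \<ge> 2"
  shows "ft (Suc n) (Kt(n + 2 * p - k := t)) (Kt'(n + 2 * p - 1 := tt)) u \<theta> \<mu> $ j
    = ft n Kt Kt' u \<theta> \<mu> $ j + (t \<mu> $ j * u ^ (n + 2 * p - k) + tt \<theta> \<mu> $ j * u ^ (n + 2 * p - 1))"
proof -
  have e: "(\<lambda>i (\<theta> :: real ^ 'd) \<mu>. (Kt(n + 2 * p - k := t)) i \<mu> $ j) = (\<lambda>i \<theta> \<mu>. Kt i \<mu> $ j)(n + 2 * p - k := \<lambda>\<theta> \<mu>. t \<mu> $ j)"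
    "(\<lambda>i \<theta> \<mu>. (Kt'(n + 2 * p - 1 := tt)) i \<theta> \<mu> $ j) = (\<lambda>i \<theta> \<mu>. Kt' i \<theta> \<mu> $ j)(n + 2 * p - 1 := \<lambda>\<theta> \<mu>. tt \<theta> \<mu> $ j)"
    by (auto simp: fun_eq_iff)
  have E: "Suc n + 2 * p - k - 1 = n + 2 * p - k" "Suc n + 2 * p - 2 = n + 2 * p - 1" "Suc (n + 2 * p - k - 1) = n + 2 * p - k" "Suc (n + 2 * p - 2) = n + 2 * p - 1"
    using assms kp p by auto
  have 1: "usum (2 * p + 1 - k) (n + 2 * p - k) ((\<lambda>i \<theta> \<mu>. Kt i \<mu> $ j)(n + 2 * p - k := \<lambda>\<theta> \<mu>. t \<mu> $ j)) u \<theta> \<mu>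
      = usum (2 * p + 1 - k) (n + 2 * p - k - 1) (\<lambda>i \<theta> \<mu>. Kt i \<mu> $ j) u \<theta> \<mu> + t \<mu> $ j * u ^ (n + 2 * p - k)"
    using usum_upd[of "2 * p + 1 - k" "n + 2 * p - k - 1" "\<lambda>i \<theta> \<mu>. Kt i \<mu> $ j" "\<lambda>\<theta> \<mu>. t \<mu> $ j" u \<theta> \<mu>] assms unfolding E by simp
  have 2: "usum (2 * p) (n + 2 * p - 1) ((\<lambda>i \<theta> \<mu>. Kt' i \<theta> \<mu> $ j)(n + 2 * p - 1 := \<lambda>\<theta> \<mu>. tt \<theta> \<mu> $ j)) u \<theta> \<mu>
      = usum (2 * p) (n + 2 * p - 2) (\<lambda>i \<theta> \<mu>. Kt' i \<theta> \<mu> $ j) u \<theta> \<mu> + tt \<theta> \<mu> $ j * u ^ (n + 2 * p - 1)"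
    using usum_upd[of "2 * p" "n + 2 * p - 2" "\<lambda>i \<theta> \<mu>. Kt' i \<theta> \<mu> $ j" "\<lambda>\<theta> \<mu>. tt \<theta> \<mu> $ j" u \<theta> \<mu>] assms p unfolding E by simp
  show ?thesis unfolding ft_def vec_lambda_beta e E 1 2 by simp
qed

context
  fixes Kx Ky :: "nat => real ^ 'm => real" and Kt :: "nat => real ^ 'm => real ^ 'd"
    and Kx' Ky' :: "nat => real ^ 'd => real ^ 'm => real" and Kt' :: "nat => real ^ 'd => real ^ 'm => real ^ 'd"
  assumes bars: "\<And>i. torus_analytic_on (\<lambda>\<theta> :: real ^ 'd. Kx i) \<Lambda>" "\<And>i. torus_analytic_on (\<lambda>\<theta> :: real ^ 'd. Ky i) \<Lambda>"
      "\<And>i. torus_analytic_on (\<lambda>\<theta> :: real ^ 'd. Kt i) \<Lambda>"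
    and tildes: "\<And>i. torus_analytic_on (Kx' i) \<Lambda>" "\<And>i. torus_analytic_on (Ky' i) \<Lambda>" "\<And>i. torus_analytic_on (Kt' i) \<Lambda>"
begin

lemma profile_orders:
  "eqm \<Lambda> 3 (fx n Kx Kx') (\<lambda>u \<theta> \<mu>. u ^ 2)" "O_pow \<Lambda> (k + 1) (fy n Ky Ky')" "O_pow \<Lambda> 1 (ft n Kt Kt')"
  "O_pow \<Lambda> 2 (fx n Kx Kx')" "O_pow \<Lambda> 1 (fx n Kx Kx')" "O_pow \<Lambda> 1 (fy n Ky Ky')"
proof -
  have "O_pow \<Lambda> 3 (\<lambda>u \<theta> \<mu>. usum 3 n (\<lambda>i (\<theta> :: real ^ 'd). Kx i) u \<theta> \<mu> + usum (k + 1) (n + k - 1) Kx' u \<theta> \<mu>)"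
    by (intro O_add usum_O bars tildes) (use k in auto)
  then show 1: "eqm \<Lambda> 3 (fx n Kx Kx') (\<lambda>u \<theta> \<mu>. u ^ 2)" by (simp add: eqm_def fx_def algebra_simps)
  show 2: "O_pow \<Lambda> (k + 1) (fy n Ky Ky')"
    unfolding fy_def[abs_def] by (intro O_add usum_O bars tildes) (use k in auto)
  show "O_pow \<Lambda> 1 (ft n Kt Kt')"
    unfolding O_vec ft_def vec_lambda_beta by (intro allI O_add usum_O ta_nth bars tildes) (use p kp in auto)
  show 3: "O_pow \<Lambda> 2 (fx n Kx Kx')" by (rule eqm_O_le[OF 1 O_u]) simp
  show "O_pow \<Lambda> 1 (fx n Kx Kx')" by (rule O_mono[OF 3]) simp
  show "O_pow \<Lambda> 1 (fy n Ky Ky')" by (rule O_mono[OF 2]) simp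
qed

lemma profile_xpd:
  "xpd \<Lambda> (fx n Kx Kx')" "xpd \<Lambda> (fy n Ky Ky')" "xpd \<Lambda> (\<lambda>u \<theta> \<mu>. ft n Kt Kt' u \<theta> \<mu> $ j)"
  unfolding fx_def[abs_def] fy_def[abs_def] ft_def vec_lambda_beta
  by (intro xpd_add xpd_u usum_xpd ta_nth bars tildes)+

lemma profile_rdyn_xpd:
  assumes S: "torus_analytic_on (\<lambda>\<theta> :: real ^ 'd. S) \<Lambda>"
  shows "xpd \<Lambda> (\<lambda>u \<theta> \<mu>. fx n Kx Kx' (rdyn k R1 S u \<theta> \<mu>) (\<theta> + \<omega>) \<mu>)"
    "xpd \<Lambda> (\<lambda>u \<theta> \<mu>. fy n Ky Ky' (rdyn k R1 S u \<theta> \<mu>) (\<theta> + \<omega>) \<mu>)"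
    "xpd \<Lambda> (\<lambda>u \<theta> \<mu>. ft n Kt Kt' (rdyn k R1 S u \<theta> \<mu>) (\<theta> + \<omega>) \<mu> $ j)"
  unfolding fx_def fy_def ft_def vec_lambda_beta
  by (intro xpd_add xpd_power rdyn_eqm(4)[OF k R1_an S] usum_rdyn_xpd[OF k R1_an S] ta_nth bars tildes)+

lemma profile_rdyn_diff:
  assumes S: "torus_analytic_on (\<lambda>\<theta> :: real ^ 'd. S) \<Lambda>" and S': "torus_analytic_on (\<lambda>\<theta> :: real ^ 'd. S') \<Lambda>"
    and SS: "\<And>\<mu>. S' \<mu> - S \<mu> = \<sigma> \<mu>" and nk: "n \<noteq> k ==> \<sigma> = (\<lambda>_. 0)" and n: "n \<ge> 2"
    and low: "Ky (k + 1) = Y1" "Kt (2 * p + 1 - k) = T1"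
  shows "eqm \<Lambda> (n + k + 1) (\<lambda>u \<theta> \<mu>. fx n Kx Kx' (rdyn k R1 S' u \<theta> \<mu>) (\<theta> + \<omega>) \<mu> - fx n Kx Kx' (rdyn k R1 S u \<theta> \<mu>) (\<theta> + \<omega>) \<mu>)
      (\<lambda>u \<theta> \<mu>. (real 2 * 1 * \<sigma> \<mu>) * u ^ (n + k))"
    "eqm \<Lambda> (n + 2 * k) (\<lambda>u \<theta> \<mu>. fy n Ky Ky' (rdyn k R1 S' u \<theta> \<mu>) (\<theta> + \<omega>) \<mu> - fy n Ky Ky' (rdyn k R1 S u \<theta> \<mu>) (\<theta> + \<omega>) \<mu>)
      (\<lambda>u \<theta> \<mu>. (real (k + 1) * Y1 \<mu> * \<sigma> \<mu>) * u ^ (n + 2 * k - 1))"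
    "eqm \<Lambda> (n + 2 * p) (\<lambda>u \<theta> \<mu>. ft n Kt Kt' (rdyn k R1 S' u \<theta> \<mu>) (\<theta> + \<omega>) \<mu> $ j - ft n Kt Kt' (rdyn k R1 S u \<theta> \<mu>) (\<theta> + \<omega>) \<mu> $ j)
      (\<lambda>u \<theta> \<mu>. (real (2 * p + 1 - k) * T1 \<mu> $ j * \<sigma> \<mu>) * u ^ (n + 2 * p - 1))"
proof -
  have split: "(f + g) - (f' + g') = (f - f') + (g - g')" for f g f' g' :: real by simp
  note D = usum_rdyn_diff[OF k R1_an S S', where \<omega> = \<omega>]
  show "eqm \<Lambda> (n + k + 1) (\<lambda>u \<theta> \<mu>. fx n Kx Kx' (rdyn k R1 S' u \<theta> \<mu>) (\<theta> + \<omega>) \<mu> - fx n Kx Kx' (rdyn k R1 S u \<theta> \<mu>) (\<theta> + \<omega>) \<mu>)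
      (\<lambda>u \<theta> \<mu>. (real 2 * 1 * \<sigma> \<mu>) * u ^ (n + k))"
    by (rule lead_rdyn_diff[OF S S' ta_const, where n = n and
          Q = "\<lambda>v \<theta> \<mu>. usum 3 n (\<lambda>i \<theta>. Kx i) v \<theta> \<mu> + usum (k + 1) (n + k - 1) Kx' v \<theta> \<mu>"], unfold split)
       (use k in \<open>auto simp: fx_def SS nk intro!: O_add D bars tildes\<close>)
  show "eqm \<Lambda> (n + 2 * k) (\<lambda>u \<theta> \<mu>. fy n Ky Ky' (rdyn k R1 S' u \<theta> \<mu>) (\<theta> + \<omega>) \<mu> - fy n Ky Ky' (rdyn k R1 S u \<theta> \<mu>) (\<theta> + \<omega>) \<mu>)
      (\<lambda>u \<theta> \<mu>. (real (k + 1) * Y1 \<mu> * \<sigma> \<mu>) * u ^ (n + 2 * k - 1))"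
  proof (rule lead_rdyn_diff[OF S S' Y1_an _ _ SS nk])
    show "fy n Ky Ky' v \<theta> \<mu> = Y1 \<mu> * v ^ (k + 1) + (usum (Suc (k + 1)) (n + k - 1) (\<lambda>i \<theta>. Ky i) v \<theta> \<mu> + usum (2 * k) (n + 2 * k - 2) Ky' v \<theta> \<mu>)" for v \<theta> \<mu>
      unfolding fy_def low(1)[symmetric] by (subst usum_first) (use n in auto)
    show "O_pow \<Lambda> (k + 1 + 2 * k - 1) (\<lambda>u \<theta> \<mu>.
        (usum (Suc (k + 1)) (n + k - 1) (\<lambda>i \<theta>. Ky i) (rdyn k R1 S' u \<theta> \<mu>) (\<theta> + \<omega>) \<mu> + usum (2 * k) (n + 2 * k - 2) Ky' (rdyn k R1 S' u \<theta> \<mu>) (\<theta> + \<omega>) \<mu>) -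
        (usum (Suc (k + 1)) (n + k - 1) (\<lambda>i \<theta>. Ky i) (rdyn k R1 S u \<theta> \<mu>) (\<theta> + \<omega>) \<mu> + usum (2 * k) (n + 2 * k - 2) Ky' (rdyn k R1 S u \<theta> \<mu>) (\<theta> + \<omega>) \<mu>))"
      unfolding split by (intro O_add D bars tildes) (use k in auto)
  qed (use k n in auto)
  show "eqm \<Lambda> (n + 2 * p) (\<lambda>u \<theta> \<mu>. ft n Kt Kt' (rdyn k R1 S' u \<theta> \<mu>) (\<theta> + \<omega>) \<mu> $ j - ft n Kt Kt' (rdyn k R1 S u \<theta> \<mu>) (\<theta> + \<omega>) \<mu> $ j)
      (\<lambda>u \<theta> \<mu>. (real (2 * p + 1 - k) * T1 \<mu> $ j * \<sigma> \<mu>) * u ^ (n + 2 * p - 1))"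
  proof (rule lead_rdyn_diff[OF S S' ta_nth[OF T1_an] _ _ SS nk, where P = "\<lambda>v \<theta> \<mu>. ft n Kt Kt' v \<theta> \<mu> $ j"])
    show "ft n Kt Kt' v \<theta> \<mu> $ j = T1 \<mu> $ j * v ^ (2 * p + 1 - k) + (usum (Suc (2 * p + 1 - k)) (n + 2 * p - k - 1) (\<lambda>i \<theta> \<mu>. Kt i \<mu> $ j) v \<theta> \<mu>
        + usum (2 * p) (n + 2 * p - 2) (\<lambda>i \<theta> \<mu>. Kt' i \<theta> \<mu> $ j) v \<theta> \<mu>)" for v \<theta> \<mu>
      unfolding ft_def low(2)[symmetric] vec_lambda_beta by (subst usum_first) (use n kp in auto)
    show "O_pow \<Lambda> (2 * p + 1 - k + 2 * k - 1) (\<lambda>u \<theta> \<mu>.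
        (usum (Suc (2 * p + 1 - k)) (n + 2 * p - k - 1) (\<lambda>i \<theta> \<mu>. Kt i \<mu> $ j) (rdyn k R1 S' u \<theta> \<mu>) (\<theta> + \<omega>) \<mu> + usum (2 * p) (n + 2 * p - 2) (\<lambda>i \<theta> \<mu>. Kt' i \<theta> \<mu> $ j) (rdyn k R1 S' u \<theta> \<mu>) (\<theta> + \<omega>) \<mu>) -
        (usum (Suc (2 * p + 1 - k)) (n + 2 * p - k - 1) (\<lambda>i \<theta> \<mu>. Kt i \<mu> $ j) (rdyn k R1 S u \<theta> \<mu>) (\<theta> + \<omega>) \<mu> + usum (2 * p) (n + 2 * p - 2) (\<lambda>i \<theta> \<mu>. Kt' i \<theta> \<mu> $ j) (rdyn k R1 S u \<theta> \<mu>) (\<theta> + \<omega>) \<mu>))"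
      unfolding split by (intro O_add D ta_nth bars tildes) (use k kp in auto)
  qed (use k n p kp in auto)
qed

end

text \<open>
  The coefficient of \<open>u\<^sup>2\<^sup>k\<^sup>-\<^sup>1\<close> in the reduced dynamics, which is present from \<open>n = k + 1\<close> on.
\<close>

definition R2 :: "nat => (nat => real ^ 'm => real) => real ^ 'm => real" where
  "R2 n Rx = (if n \<le> k then (\<lambda>_. 0) else Rx (2 * k - 1))"

text \<open>
  The induction hypothesis. It includes the values of the lowest coefficients, on which the linearized
  equations depend.
\<close>

definition solves where
  "solves n Kx Kx' Ky Ky' Kt Kt' Rx \<longleftrightarrow>
     (\<forall>i. torus_analytic_on (\<lambda>\<theta> :: real ^ 'd. Kx i) \<Lambda> \<and> torus_analytic_on (\<lambda>\<theta> :: real ^ 'd. Ky i) \<Lambda> \<and>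
        torus_analytic_on (\<lambda>\<theta> :: real ^ 'd. Kt i) \<Lambda> \<and> torus_analytic_on (\<lambda>\<theta> :: real ^ 'd. Rx i) \<Lambda>) \<and>
     (\<forall>i. tilde_coeff \<Lambda> (Kx' i) \<and> tilde_coeff \<Lambda> (Ky' i) \<and> tilde_coeff \<Lambda> (Kt' i)) \<and>
     Ky (k + 1) = Y1 \<and> Kt (2 * p + 1 - k) = T1 \<and> Rx k = R1 \<and>
     Kx' (k + 1) = (\<lambda>\<theta> \<mu>. SD \<omega> \<Lambda> (torus_osc c) \<theta> \<mu> * Y1 \<mu>) \<and> Ky' (2 * k) = SD \<omega> \<Lambda> (torus_osc a) \<and>
     Kt' (2 * p) = SD \<omega> \<Lambda> (torus_osc d) \<and>
     O_pow \<Lambda> (n + k) (Ex (fx n Kx Kx') (fy n Ky Ky') (ft n Kt Kt') (\<lambda>u \<theta> \<mu>. fx n Kx Kx' (rdyn k R1 (R2 n Rx) u \<theta> \<mu>) (\<theta> + \<omega>) \<mu>)) \<and>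
     O_pow \<Lambda> (n + 2 * k - 1) (Ey (fx n Kx Kx') (fy n Ky Ky') (ft n Kt Kt') (\<lambda>u \<theta> \<mu>. fy n Ky Ky' (rdyn k R1 (R2 n Rx) u \<theta> \<mu>) (\<theta> + \<omega>) \<mu>)) \<and>
     (\<forall>j. O_pow \<Lambda> (n + 2 * p - 1) (Et j (fx n Kx Kx') (fy n Ky Ky') (ft n Kt Kt') (\<lambda>u \<theta> \<mu>. ft n Kt Kt' (rdyn k R1 (R2 n Rx) u \<theta> \<mu>) (\<theta> + \<omega>) \<mu>)))"

text \<open>
  The leading coefficients of the residual are cancelled by one new coefficient of each kind, at an index that
  exceeds, as \<open>n \<ge> 2\<close>, that of the corresponding lowest coefficient.
\<close>

lemma solves_step:
  fixes Kx Ky Rx :: "nat => real ^ 'm => real" and Kt :: "nat => real ^ 'm => real ^ 'd"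
  assumes sol: "solves n Kx Kx' Ky Ky' Kt Kt' Rx" and n: "n \<ge> 2"
  shows "\<exists>Kx Kx' Ky Ky' Kt Kt' Rx. solves (Suc n) Kx Kx' Ky Ky' Kt Kt' Rx"
proof -
  have bars: "torus_analytic_on (\<lambda>\<theta> :: real ^ 'd. Kx i) \<Lambda>" "torus_analytic_on (\<lambda>\<theta> :: real ^ 'd. Ky i) \<Lambda>"
      "torus_analytic_on (\<lambda>\<theta> :: real ^ 'd. Kt i) \<Lambda>" "torus_analytic_on (\<lambda>\<theta> :: real ^ 'd. Rx i) \<Lambda>" for i
    using sol unfolding solves_def by blast+
  have tildes: "tilde_coeff \<Lambda> (Kx' i)" "tilde_coeff \<Lambda> (Ky' i)" "tilde_coeff \<Lambda> (Kt' i)" for i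
    using sol unfolding solves_def by blast+
  have low: "Ky (k + 1) = Y1" "Kt (2 * p + 1 - k) = T1" "Rx k = R1"
      "Kx' (k + 1) = (\<lambda>\<theta> \<mu>. SD \<omega> \<Lambda> (torus_osc c) \<theta> \<mu> * Y1 \<mu>)" "Ky' (2 * k) = SD \<omega> \<Lambda> (torus_osc a)" "Kt' (2 * p) = SD \<omega> \<Lambda> (torus_osc d)"
    using sol unfolding solves_def by blast+
  have tt: "torus_analytic_on (Kx' i) \<Lambda>" "torus_analytic_on (Ky' i) \<Lambda>" "torus_analytic_on (Kt' i) \<Lambda>" for i
    using tildes[of i] by (simp_all add: tilde_coeff_def)
  define S where "S = R2 n Rx"
  have S: "torus_analytic_on (\<lambda>\<theta> :: real ^ 'd. S) \<Lambda>" using bars(4) by (simp add: S_def R2_def)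
  define X where "X = fx n Kx Kx'" define Y where "Y = fy n Ky Ky'" define \<kappa> where "\<kappa> = ft n Kt Kt'"
  define Xr where "Xr = (\<lambda>u \<theta> \<mu>. fx n Kx Kx' (rdyn k R1 S u \<theta> \<mu>) (\<theta> + \<omega>) \<mu>)"
  define Yr where "Yr = (\<lambda>u \<theta> \<mu>. fy n Ky Ky' (rdyn k R1 S u \<theta> \<mu>) (\<theta> + \<omega>) \<mu>)"
  define \<kappa>r where "\<kappa>r = (\<lambda>u \<theta> \<mu>. ft n Kt Kt' (rdyn k R1 S u \<theta> \<mu>) (\<theta> + \<omega>) \<mu>)"
  have O: "O_pow \<Lambda> (n + k) (Ex X Y \<kappa> Xr)" "O_pow \<Lambda> (n + 2 * k - 1) (Ey X Y \<kappa> Yr)" "O_pow \<Lambda> (n + 2 * p - 1) (Et j X Y \<kappa> \<kappa>r)" for j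
    using sol unfolding solves_def X_def Y_def \<kappa>_def Xr_def Yr_def \<kappa>r_def S_def by blast+
  note PO = profile_orders[where Kx = Kx and Kx' = Kx' and Ky = Ky and Ky' = Ky' and Kt = Kt and Kt' = Kt', OF bars(1-3) tt, of n, folded X_def Y_def \<kappa>_def]
  note PX = profile_xpd[where Kx = Kx and Kx' = Kx' and Ky = Ky and Ky' = Ky' and Kt = Kt and Kt' = Kt', OF bars(1-3) tt, of n, folded X_def Y_def \<kappa>_def]
  note PR = profile_rdyn_xpd[where Kx = Kx and Kx' = Kx' and Ky = Ky and Ky' = Ky' and Kt = Kt and Kt' = Kt', OF bars(1-3) tt S, of n, folded Xr_def Yr_def]
  have PR3: "xpd \<Lambda> (\<lambda>u \<theta> \<mu>. \<kappa>r u \<theta> \<mu> $ j)" for j unfolding \<kappa>r_def by (rule PR(3))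
  note RX = residual_xpd[OF PX(1) PO(5) PX(2) PO(6) PX(3) PO(3)]
  obtain gx where gx: "torus_analytic_on gx \<Lambda>" "eqm \<Lambda> (n + k + 1) (Ex X Y \<kappa> Xr) (\<lambda>u \<theta> \<mu>. gx \<theta> \<mu> * u ^ (n + k))"
    by (rule xpd_leading[OF RX(1)[OF PR(1)] O(1)])
  obtain gy where gy: "torus_analytic_on gy \<Lambda>" "eqm \<Lambda> (n + 2 * k - 1 + 1) (Ey X Y \<kappa> Yr) (\<lambda>u \<theta> \<mu>. gy \<theta> \<mu> * u ^ (n + 2 * k - 1))"
    by (rule xpd_leading[OF RX(2)[OF PR(2)] O(2)])
  have "\<exists>g. torus_analytic_on g \<Lambda> \<and> eqm \<Lambda> (n + 2 * p - 1 + 1) (Et j X Y \<kappa> \<kappa>r) (\<lambda>u \<theta> \<mu>. g \<theta> \<mu> * u ^ (n + 2 * p - 1))" for j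
    by (rule xpd_leading[OF RX(3)[OF PR3] O(3)[of j]]) blast
  then obtain gt where gt: "\<And>j. torus_analytic_on (gt j) \<Lambda>"
      "\<And>j. eqm \<Lambda> (n + 2 * p - 1 + 1) (Et j X Y \<kappa> \<kappa>r) (\<lambda>u \<theta> \<mu>. gt j \<theta> \<mu> * u ^ (n + 2 * p - 1))" by metis
  have E: "n + 2 * k - 1 + 1 = n + 2 * k" "n + 2 * p - 1 + 1 = n + 2 * p" using k p by auto
  obtain x y \<sigma> where xys: "torus_analytic_on (\<lambda>\<theta> :: real ^ 'd. x) \<Lambda>" "torus_analytic_on (\<lambda>\<theta> :: real ^ 'd. y) \<Lambda>"
    "torus_analytic_on (\<lambda>\<theta> :: real ^ 'd. \<sigma>) \<Lambda>" and \<sigma>: "n \<noteq> k ==> \<sigma> = (\<lambda>_. 0)"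
    and eqs: "\<And>\<mu>. \<mu> \<in> \<Lambda> ==> torus_avg gx \<mu> + torus_avg c \<mu> * y \<mu> - real (n + 1) * R1 \<mu> * x \<mu> - 2 * \<sigma> \<mu> = 0"
    "\<And>\<mu>. \<mu> \<in> \<Lambda> ==> torus_avg gy \<mu> + real k * torus_avg a \<mu> * x \<mu> - real (n + k) * R1 \<mu> * y \<mu> - real (k + 1) * Y1 \<mu> * \<sigma> \<mu> = 0"
    by (rule averaged_equations[OF ta_avg[OF gx(1)] ta_avg[OF gy(1)] n]) (rule that, assumption+)
  define t :: "real ^ 'm => real ^ 'd" where "t \<mu> = (\<chi> j. (torus_avg (gt j) \<mu> + torus_avg d \<mu> $ j * (real p * x \<mu>) - real (2 * p + 1 - k) * T1 \<mu> $ j * \<sigma> \<mu>)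
      / (real (n + 2 * p - k) * R1 \<mu>))" for \<mu>
  have m0: "real (n + 2 * p - k) \<noteq> 0" using n kp by simp
  have t: "torus_analytic_on (\<lambda>\<theta> :: real ^ 'd. t) \<Lambda>" unfolding t_def[abs_def]
    by (intro ta_vec ta_divide ta_diff ta_add ta_mult ta_const ta_nth ta_avg d_avg gt xys T1_an R1_an)
       (use m0 leading_relations(1) in \<open>simp del: of_nat_diff\<close>)
  \<comment> \<open>The oscillatory corrections solve cohomological equations whose right-hand sides
    have average zero by the choice of the averaged corrections.\<close>
  define wx where "wx \<mu> = real (n + 1) * R1 \<mu> * x \<mu> + 2 * \<sigma> \<mu>" for \<mu>
  define wy where "wy \<mu> = real (n + k) * R1 \<mu> * y \<mu> + real (k + 1) * Y1 \<mu> * \<sigma> \<mu>" for \<mu>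
  define wt where "wt j \<mu> = real (n + 2 * p - k) * R1 \<mu> * t \<mu> $ j + real (2 * p + 1 - k) * T1 \<mu> $ j * \<sigma> \<mu>" for j \<mu>
  have w: "torus_analytic_on (\<lambda>\<theta> :: real ^ 'd. wx) \<Lambda>" "torus_analytic_on (\<lambda>\<theta> :: real ^ 'd. wy) \<Lambda>" "torus_analytic_on (\<lambda>\<theta> :: real ^ 'd. wt j) \<Lambda>" for j
    unfolding wx_def[abs_def] wy_def[abs_def] wt_def[abs_def]
    by (intro ta_add ta_mult ta_const ta_nth R1_an Y1_an T1_an xys t)+
  have kx: "torus_analytic_on (\<lambda>(\<theta> :: real ^ 'd) \<mu>. real k * x \<mu>) \<Lambda>" "torus_analytic_on (\<lambda>(\<theta> :: real ^ 'd) \<mu>. real p * x \<mu>) \<Lambda>"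
    by (intro ta_mult ta_const xys)+
  have hx: "torus_analytic_on (\<lambda>\<theta> \<mu>. gx \<theta> \<mu> + c \<theta> \<mu> * y \<mu> - wx \<mu>) \<Lambda>" by (intro ta_diff ta_add ta_mult gx c xys w)
  obtain xt where xt: "tilde_coeff \<Lambda> xt" "\<And>\<theta> \<mu>. \<mu> \<in> \<Lambda> ==> gx \<theta> \<mu> + c \<theta> \<mu> * y \<mu> - wx \<mu> + xt \<theta> \<mu> - xt (\<theta> + \<omega>) \<mu> = 0"
  proof (rule cohomological_solution[OF hx])
    show "torus_avg (\<lambda>\<theta> \<mu>. gx \<theta> \<mu> + c \<theta> \<mu> * y \<mu> - wx \<mu>) \<mu> = 0" if "\<mu> \<in> \<Lambda>" for \<mu>
      unfolding torus_avg_affine[OF gx(1) c xys(2) w(1) that] using eqs(1)[OF that] by (simp add: wx_def)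
  qed (rule that, assumption+)
  have hy: "torus_analytic_on (\<lambda>\<theta> \<mu>. gy \<theta> \<mu> + a \<theta> \<mu> * (real k * x \<mu>) - wy \<mu>) \<Lambda>" by (intro ta_diff ta_add ta_mult ta_const gy a xys w)
  obtain yt where yt: "tilde_coeff \<Lambda> yt" "\<And>\<theta> \<mu>. \<mu> \<in> \<Lambda> ==> gy \<theta> \<mu> + a \<theta> \<mu> * (real k * x \<mu>) - wy \<mu> + yt \<theta> \<mu> - yt (\<theta> + \<omega>) \<mu> = 0"
  proof (rule cohomological_solution[OF hy])
    show "torus_avg (\<lambda>\<theta> \<mu>. gy \<theta> \<mu> + a \<theta> \<mu> * (real k * x \<mu>) - wy \<mu>) \<mu> = 0" if "\<mu> \<in> \<Lambda>" for \<mu>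
      unfolding torus_avg_affine[OF gy(1) a kx(1) w(2) that] using eqs(2)[OF that] by (simp add: wy_def mult_ac)
  qed (rule that, assumption+)
  have ht: "torus_analytic_on (\<lambda>\<theta> \<mu>. gt j \<theta> \<mu> + d \<theta> \<mu> $ j * (real p * x \<mu>) - wt j \<mu>) \<Lambda>" for j
    by (intro ta_diff ta_add ta_mult ta_const ta_nth gt d xys w)
  have "\<exists>v. tilde_coeff \<Lambda> v \<and> (\<forall>\<theta>. \<forall>\<mu>\<in>\<Lambda>. gt j \<theta> \<mu> + d \<theta> \<mu> $ j * (real p * x \<mu>) - wt j \<mu> + v \<theta> \<mu> - v (\<theta> + \<omega>) \<mu> = 0)" for j
  proof (rule cohomological_solution[OF ht[of j]])
    show "torus_avg (\<lambda>\<theta> \<mu>. gt j \<theta> \<mu> + d \<theta> \<mu> $ j * (real p * x \<mu>) - wt j \<mu>) \<mu> = 0" if \<mu>: "\<mu> \<in> \<Lambda>" for \<mu>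
      unfolding torus_avg_affine[OF gt(1) ta_nth[OF d] kx(2) w(3) \<mu>] torus_avg_nth[OF d \<mu>, symmetric]
      using leading_relations(1)[OF \<mu>] m0 by (simp add: wt_def t_def del: of_nat_diff)
  qed blast
  then obtain v where v: "\<And>j. tilde_coeff \<Lambda> (v j)"
      "\<And>j \<theta> \<mu>. \<mu> \<in> \<Lambda> ==> gt j \<theta> \<mu> + d \<theta> \<mu> $ j * (real p * x \<mu>) - wt j \<mu> + v j \<theta> \<mu> - v j (\<theta> + \<omega>) \<mu> = 0" by metis
  define ts :: "real ^ 'd => real ^ 'm => real ^ 'd" where "ts \<theta> \<mu> = (\<chi> j. v j \<theta> \<mu>)" for \<theta> \<mu>
  have ts_an: "torus_analytic_on ts \<Lambda>" unfolding ts_def[abs_def]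
    by (intro ta_vec) (use v(1) in \<open>simp add: tilde_coeff_def\<close>)
  have "torus_avg ts \<mu> = 0" if "\<mu> \<in> \<Lambda>" for \<mu>
    using v(1) that by (simp add: vec_eq_iff torus_avg_nth[OF ts_an that] ts_def tilde_coeff_def)
  then have ts: "tilde_coeff \<Lambda> ts" using ts_an by (simp add: tilde_coeff_def)
  \<comment> \<open>\<open>\<sigma>\<close> enters the reduced dynamics at the resonance \<open>n = k\<close> only.\<close>
  define Mx where "Mx = Kx(n + 1 := x)" define Mx' where "Mx' = Kx'(n + k := xt)"
  define My where "My = Ky(n + k := y)" define My' where "My' = Ky'(n + 2 * k - 1 := yt)"
  define Mt where "Mt = Kt(n + 2 * p - k := t)" define Mt' where "Mt' = Kt'(n + 2 * p - 1 := ts)"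
  define Qx where "Qx = (if n = k then Rx(2 * k - 1 := \<sigma>) else Rx)"
  define S' where "S' = R2 (Suc n) Qx"
  have Mb: "torus_analytic_on (\<lambda>\<theta> :: real ^ 'd. Mx i) \<Lambda>" "torus_analytic_on (\<lambda>\<theta> :: real ^ 'd. My i) \<Lambda>"
      "torus_analytic_on (\<lambda>\<theta> :: real ^ 'd. Mt i) \<Lambda>" "torus_analytic_on (\<lambda>\<theta> :: real ^ 'd. Qx i) \<Lambda>" for i
    using bars[of i] xys t by (auto simp: Mx_def My_def Mt_def Qx_def)
  have Mt: "tilde_coeff \<Lambda> (Mx' i)" "tilde_coeff \<Lambda> (My' i)" "tilde_coeff \<Lambda> (Mt' i)" for i
    using tildes[of i] xt yt ts by (auto simp: Mx'_def My'_def Mt'_def)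
  have Mta: "torus_analytic_on (Mx' i) \<Lambda>" "torus_analytic_on (My' i) \<Lambda>" "torus_analytic_on (Mt' i) \<Lambda>" for i
    using Mt[of i] by (simp_all add: tilde_coeff_def)
  have S': "torus_analytic_on (\<lambda>\<theta> :: real ^ 'd. S') \<Lambda>" using Mb(4) by (simp add: S'_def R2_def)
  have SS: "S' \<mu> - S \<mu> = \<sigma> \<mu>" for \<mu> using \<sigma> by (cases "n = k") (auto simp: S'_def S_def R2_def Qx_def)
  define X' where "X' = fx (Suc n) Mx Mx'" define Y' where "Y' = fy (Suc n) My My'" define \<kappa>' where "\<kappa>' = ft (Suc n) Mt Mt'"
  define Xr' where "Xr' = (\<lambda>u \<theta> \<mu>. fx (Suc n) Mx Mx' (rdyn k R1 S' u \<theta> \<mu>) (\<theta> + \<omega>) \<mu>)"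
  define Yr' where "Yr' = (\<lambda>u \<theta> \<mu>. fy (Suc n) My My' (rdyn k R1 S' u \<theta> \<mu>) (\<theta> + \<omega>) \<mu>)"
  define \<kappa>r' where "\<kappa>r' = (\<lambda>u \<theta> \<mu>. ft (Suc n) Mt Mt' (rdyn k R1 S' u \<theta> \<mu>) (\<theta> + \<omega>) \<mu>)"
  note PO' = profile_orders[where Kx = Mx and Kx' = Mx' and Ky = My and Ky' = My' and Kt = Mt and Kt' = Mt', OF Mb(1-3) Mta, of "Suc n", folded X'_def Y'_def \<kappa>'_def]
  note DR = profile_rdyn_diff[where Kx = Kx and Kx' = Kx' and Ky = Ky and Ky' = Ky' and Kt = Kt and Kt' = Kt', OF bars(1-3) tt S S' SS \<sigma> n low(1,2)]
  note upd = fx_upd[OF n] fy_upd[OF n] ft_upd[OF n]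
  have dX: "X' u \<theta> \<mu> = X u \<theta> \<mu> + (x \<mu> * u ^ (n + 1) + xt \<theta> \<mu> * u ^ (n + k))" for u \<theta> \<mu>
    unfolding X'_def X_def Mx_def Mx'_def by (rule upd)
  have dY: "Y' u \<theta> \<mu> = Y u \<theta> \<mu> + (y \<mu> * u ^ (n + k) + yt \<theta> \<mu> * u ^ (n + 2 * k - 1))" for u \<theta> \<mu>
    unfolding Y'_def Y_def My_def My'_def by (rule upd)
  have d\<kappa>: "\<kappa>' u \<theta> \<mu> $ j = \<kappa> u \<theta> \<mu> $ j + (t \<mu> $ j * u ^ (n + 2 * p - k) + ts \<theta> \<mu> $ j * u ^ (n + 2 * p - 1))" for u \<theta> \<mu> j
    unfolding \<kappa>'_def \<kappa>_def Mt_def Mt'_def by (rule upd)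
  have dXr: "eqm \<Lambda> (n + k + 1) (\<lambda>u \<theta> \<mu>. Xr' u \<theta> \<mu> - Xr u \<theta> \<mu>)
      (\<lambda>u \<theta> \<mu>. (x \<mu> * rdyn k R1 S' u \<theta> \<mu> ^ (n + 1) + xt (\<theta> + \<omega>) \<mu> * rdyn k R1 S' u \<theta> \<mu> ^ (n + k)) + (2 * \<sigma> \<mu>) * u ^ (n + k))"
    by (rule eqm_cong[OF eqm_add[OF eqm_refl[of _ _ "\<lambda>u \<theta> \<mu>. x \<mu> * rdyn k R1 S' u \<theta> \<mu> ^ (n + 1) + xt (\<theta> + \<omega>) \<mu> * rdyn k R1 S' u \<theta> \<mu> ^ (n + k)"] DR(1)]])
       (simp_all add: Xr'_def Xr_def Mx_def Mx'_def upd(1)[unfolded add_Suc_right add_0_right One_nat_def])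
  have dYr: "eqm \<Lambda> (n + 2 * k) (\<lambda>u \<theta> \<mu>. Yr' u \<theta> \<mu> - Yr u \<theta> \<mu>)
      (\<lambda>u \<theta> \<mu>. (y \<mu> * rdyn k R1 S' u \<theta> \<mu> ^ (n + k) + yt (\<theta> + \<omega>) \<mu> * rdyn k R1 S' u \<theta> \<mu> ^ (n + 2 * k - 1))
         + (real (k + 1) * Y1 \<mu> * \<sigma> \<mu>) * u ^ (n + 2 * k - 1))"
    by (rule eqm_cong[OF eqm_add[OF eqm_refl[of _ _ "\<lambda>u \<theta> \<mu>. y \<mu> * rdyn k R1 S' u \<theta> \<mu> ^ (n + k) + yt (\<theta> + \<omega>) \<mu> * rdyn k R1 S' u \<theta> \<mu> ^ (n + 2 * k - 1)"] DR(2)]])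
       (simp_all only: Yr'_def Yr_def My_def My'_def upd(2), simp_all)
  have d\<kappa>r: "eqm \<Lambda> (n + 2 * p) (\<lambda>u \<theta> \<mu>. \<kappa>r' u \<theta> \<mu> $ j - \<kappa>r u \<theta> \<mu> $ j)
      (\<lambda>u \<theta> \<mu>. (t \<mu> $ j * rdyn k R1 S' u \<theta> \<mu> ^ (n + 2 * p - k) + ts (\<theta> + \<omega>) \<mu> $ j * rdyn k R1 S' u \<theta> \<mu> ^ (n + 2 * p - 1))
         + (real (2 * p + 1 - k) * T1 \<mu> $ j * \<sigma> \<mu>) * u ^ (n + 2 * p - 1))" for j
    by (rule eqm_cong[OF eqm_add[OF eqm_refl[of _ _ "\<lambda>u \<theta> \<mu>. t \<mu> $ j * rdyn k R1 S' u \<theta> \<mu> ^ (n + 2 * p - k) + ts (\<theta> + \<omega>) \<mu> $ j * rdyn k R1 S' u \<theta> \<mu> ^ (n + 2 * p - 1)"] DR(3)]])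
       (simp_all only: \<kappa>r'_def \<kappa>r_def Mt_def Mt'_def upd(3), simp_all)
  note inc = residual_increment[OF n PO(1) PO'(1) PO(2) PO'(2) PO(3) PO'(3) S' xys(1,2) t xt(1)[unfolded tilde_coeff_def, THEN conjunct1]
      yt(1)[unfolded tilde_coeff_def, THEN conjunct1] ts_an dX dY d\<kappa> dXr dYr d\<kappa>r]
  have "O_pow \<Lambda> (Suc n + k) (Ex X' Y' \<kappa>' Xr')"
  proof -
    have "O_pow \<Lambda> (n + k + 1) (Ex X' Y' \<kappa>' Xr')"
      by (rule O_cancel[OF inc(1) gx(2)]) (use xt(2) in \<open>simp add: wx_def algebra_simps\<close>)
    then show ?thesis by simp
  qed
  moreover have "O_pow \<Lambda> (Suc n + 2 * k - 1) (Ey X' Y' \<kappa>' Yr')"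
  proof -
    have "O_pow \<Lambda> (n + 2 * k) (Ey X' Y' \<kappa>' Yr')"
      by (rule O_cancel[OF inc(2) gy(2)[unfolded E]]) (use yt(2) in \<open>simp add: wy_def algebra_simps\<close>)
    then show ?thesis by simp
  qed
  moreover have "O_pow \<Lambda> (Suc n + 2 * p - 1) (Et j X' Y' \<kappa>' \<kappa>r')" for j
  proof -
    have "O_pow \<Lambda> (n + 2 * p) (Et j X' Y' \<kappa>' \<kappa>r')"
      by (rule O_cancel[OF inc(3) gt(2)[unfolded E]]) (use v(2) in \<open>simp add: wt_def ts_def algebra_simps del: of_nat_diff\<close>)
    then show ?thesis by simp
  qed
  moreover have "My (k + 1) = Y1 \<and> Mt (2 * p + 1 - k) = T1 \<and> Qx k = R1 \<and>
     Mx' (k + 1) = (\<lambda>\<theta> \<mu>. SD \<omega> \<Lambda> (torus_osc c) \<theta> \<mu> * Y1 \<mu>) \<and> My' (2 * k) = SD \<omega> \<Lambda> (torus_osc a) \<and> Mt' (2 * p) = SD \<omega> \<Lambda> (torus_osc d)"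
  proof -
    have ne: "k + 1 \<noteq> n + k" "2 * p + 1 - k \<noteq> n + 2 * p - k" "k \<noteq> 2 * k - 1" "2 * k \<noteq> n + 2 * k - 1" "2 * p \<noteq> n + 2 * p - 1"
      using n k kp by auto
    have "Qx k = R1" using low(3) ne(3) by (cases "n = k") (simp_all only: Qx_def fun_upd_apply if_True if_False simp_thms)
    then show ?thesis unfolding My_def Mt_def Mx'_def My'_def Mt'_def by (simp only: fun_upd_apply ne low if_False simp_thms)
  qed
  ultimately have "solves (Suc n) Mx Mx' My My' Mt Mt' Qx"
    unfolding solves_def X'_def Y'_def \<kappa>'_def Xr'_def Yr'_def \<kappa>r'_def S'_def using Mb Mt by blast
  then show ?thesis by blast
qed

lemma SD_osc:
  fixes h :: "real ^ 'd => real ^ 'm => 'b::euclidean_space"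
  assumes h: "torus_analytic_on h \<Lambda>"
  shows "torus_analytic_on (SD \<omega> \<Lambda> (torus_osc h)) \<Lambda>" "\<mu> \<in> \<Lambda> ==> torus_avg (SD \<omega> \<Lambda> (torus_osc h)) \<mu> = 0"
    "\<mu> \<in> \<Lambda> ==> SD \<omega> \<Lambda> (torus_osc h) (\<theta> + \<omega>) \<mu> - SD \<omega> \<Lambda> (torus_osc h) \<theta> \<mu> = torus_osc h \<theta> \<mu>"
proof -
  have avg: "torus_avg (torus_osc h) \<mu> = 0" if "\<mu> \<in> \<Lambda>" for \<mu> by (rule torus_avg_osc[OF h that])
  show "torus_analytic_on (SD \<omega> \<Lambda> (torus_osc h)) \<Lambda>"
    by (rule SD_props(1)[OF ta_osc[OF h] _ \<omega>]) (rule avg)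
  show "torus_avg (SD \<omega> \<Lambda> (torus_osc h)) \<mu> = 0" if "\<mu> \<in> \<Lambda>"
    by (rule SD_props(2)[OF ta_osc[OF h] _ \<omega> that]) (rule avg)
  show "SD \<omega> \<Lambda> (torus_osc h) (\<theta> + \<omega>) \<mu> - SD \<omega> \<Lambda> (torus_osc h) \<theta> \<mu> = torus_osc h \<theta> \<mu>" if "\<mu> \<in> \<Lambda>"
    by (rule SD_props(3)[OF ta_osc[OF h] _ \<omega> that]) (rule avg)
qed

text \<open>
  With the prescribed lowest coefficients, the leading coefficients of the residual vanish: their averages by
  \<open>leading_relations\<close>, their oscillatory parts by the equation for \<open>SD\<close>.
\<close>

lemma solves_base:
  "\<exists>Kx Kx' Ky Ky' Kt Kt' Rx. solves 2 Kx Kx' Ky Ky' Kt Kt' Rx"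
proof -
  note Sc = SD_osc[OF c] and Sa = SD_osc[OF a] and Sd = SD_osc[OF d]
  define xt where "xt \<theta> \<mu> = SD \<omega> \<Lambda> (torus_osc c) \<theta> \<mu> * Y1 \<mu>" for \<theta> \<mu>
  define yt where "yt = SD \<omega> \<Lambda> (torus_osc a)"
  define ts where "ts = SD \<omega> \<Lambda> (torus_osc d)"
  have tc: "tilde_coeff \<Lambda> xt" "tilde_coeff \<Lambda> yt" "tilde_coeff \<Lambda> ts"
    unfolding tilde_coeff_def xt_def[abs_def] yt_def ts_def
    by (auto intro!: ta_mult Y1_an Sc(1) Sa Sd simp: torus_avg_mult_right Sc(2))
  have ta: "torus_analytic_on xt \<Lambda>" "torus_analytic_on yt \<Lambda>" "torus_analytic_on ts \<Lambda>" using tc by (simp_all add: tilde_coeff_def)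
  define Kx :: "nat => real ^ 'm => real" where "Kx = (\<lambda>_ _. 0)"
  define Ky where "Ky = (\<lambda>_ :: nat. Y1)"
  define Kt where "Kt = (\<lambda>_ :: nat. T1)"
  define Rx where "Rx = (\<lambda>_ :: nat. R1)"
  define Kx' where "Kx' = (\<lambda>_ :: nat. xt)"
  define Ky' where "Ky' = (\<lambda>_ :: nat. yt)"
  define Kt' where "Kt' = (\<lambda>_ :: nat. ts)"
  note defs = Kx_def Ky_def Kt_def Rx_def Kx'_def Ky'_def Kt'_def
  have bars: "torus_analytic_on (\<lambda>\<theta> :: real ^ 'd. Kx i) \<Lambda>" "torus_analytic_on (\<lambda>\<theta> :: real ^ 'd. Ky i) \<Lambda>"
      "torus_analytic_on (\<lambda>\<theta> :: real ^ 'd. Kt i) \<Lambda>" "torus_analytic_on (\<lambda>\<theta> :: real ^ 'd. Rx i) \<Lambda>" for i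
    using Y1_an T1_an R1_an by (simp_all add: defs)
  have tildes: "torus_analytic_on (Kx' i) \<Lambda>" "torus_analytic_on (Ky' i) \<Lambda>" "torus_analytic_on (Kt' i) \<Lambda>" for i
    using ta by (simp_all add: defs)
  let ?X = "fx 2 Kx Kx'" and ?Y = "fy 2 Ky Ky'" and ?\<kappa> = "ft 2 Kt Kt'"
  have X: "?X u \<theta> \<mu> = 1 * u ^ 2 + xt \<theta> \<mu> * u ^ (k + 1)" for u \<theta> \<mu>
    by (simp add: fx_def usum_def defs)
  have Y: "?Y u \<theta> \<mu> = Y1 \<mu> * u ^ (k + 1) + yt \<theta> \<mu> * u ^ (2 * k)" for u \<theta> \<mu>
    by (simp add: fy_def usum_def defs)
  have \<kappa>: "?\<kappa> u \<theta> \<mu> $ j = T1 \<mu> $ j * u ^ (2 * p + 1 - k) + ts \<theta> \<mu> $ j * u ^ (2 * p)" for u \<theta> \<mu> j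
  proof -
    have "2 + 2 * p - k - 1 = 2 * p + 1 - k" using kp by simp
    then show ?thesis by (simp add: ft_def usum_def defs)
  qed
  define S where "S = R2 2 Rx"
  have S0: "S = (\<lambda>_. 0)" using k by (simp add: S_def R2_def)
  have S: "torus_analytic_on (\<lambda>\<theta> :: real ^ 'd. S) \<Lambda>" by (simp add: S0)
  note PO = profile_orders[where Kx = Kx and Kx' = Kx' and Ky = Ky and Ky' = Ky' and Kt = Kt and Kt' = Kt', OF bars(1-3) tildes, of 2]
  have lead: "O_pow \<Lambda> N w" if "eqm \<Lambda> N w (\<lambda>u \<theta> \<mu>. g \<theta> \<mu> * u ^ M)" "\<And>\<theta> \<mu>. \<mu> \<in> \<Lambda> ==> g \<theta> \<mu> = 0"
    for N M w and g :: "real ^ 'd => real ^ 'm => real"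
    by (rule eqm_O[OF that(1)], rule O_cong[OF O_zero]) (simp add: that(2))
  have c0: "eqm \<Lambda> 1 (\<lambda>u \<theta> \<mu>. c (\<theta> + ?\<kappa> u \<theta> \<mu>) \<mu>) (\<lambda>u \<theta> \<mu>. c \<theta> \<mu>)"
    using eqm_shift[OF c PO(3) O_zero] PO(3) by simp
  have "O_pow \<Lambda> (k + 2) (\<lambda>u \<theta> \<mu>. yt \<theta> \<mu> * u ^ (2 * k))" by (rule O_coef_u[OF ta(2)]) (use k in auto)
  then have Y0: "eqm \<Lambda> (k + 2) ?Y (\<lambda>u \<theta> \<mu>. Y1 \<mu> * u ^ (k + 1))" by (simp add: eqm_def Y[abs_def])
  have p1: "eqm \<Lambda> (k + 2) (\<lambda>u \<theta> \<mu>. c (\<theta> + ?\<kappa> u \<theta> \<mu>) \<mu> * ?Y u \<theta> \<mu>) (\<lambda>u \<theta> \<mu>. c \<theta> \<mu> * (Y1 \<mu> * u ^ (k + 1)))"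
    by (rule eqm_mult[OF c0 PO(2) O_coef[OF c] Y0]) auto
  have c1: "eqm \<Lambda> (k + 2)
    (\<lambda>u \<theta> \<mu>. (1 * u ^ 2 + xt \<theta> \<mu> * u ^ (k + 1)) - (1 * rdyn k R1 S u \<theta> \<mu> ^ 2 + xt (\<theta> + \<omega>) \<mu> * rdyn k R1 S u \<theta> \<mu> ^ (k + 1)))
    (\<lambda>u \<theta> \<mu>. (xt \<theta> \<mu> - xt (\<theta> + \<omega>) \<mu> - real 2 * R1 \<mu> * 1) * u ^ (k + 1))"
    by (rule coh_leading[OF S ta_const ta(1)]) auto
  have "eqm \<Lambda> (k + 2) (Ex ?X ?Y ?\<kappa> (\<lambda>u \<theta> \<mu>. ?X (rdyn k R1 S u \<theta> \<mu>) (\<theta> + \<omega>) \<mu>))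
      (\<lambda>u \<theta> \<mu>. (xt \<theta> \<mu> - xt (\<theta> + \<omega>) \<mu> - 2 * R1 \<mu> + c \<theta> \<mu> * Y1 \<mu>) * u ^ (k + 1))"
    by (rule eqm_balance[OF c1 p1 eqm_add_zero])
       (simp_all add: Ex_def X left_diff_distrib distrib_right)
  then have Ox: "O_pow \<Lambda> (k + 2) (Ex ?X ?Y ?\<kappa> (\<lambda>u \<theta> \<mu>. ?X (rdyn k R1 S u \<theta> \<mu>) (\<theta> + \<omega>) \<mu>))"
  proof (rule lead)
    fix \<theta> \<mu> assume \<mu>: "\<mu> \<in> \<Lambda>"
    have "xt (\<theta> + \<omega>) \<mu> - xt \<theta> \<mu> = torus_osc c \<theta> \<mu> * Y1 \<mu>"
      unfolding xt_def left_diff_distrib[symmetric] Sc(3)[OF \<mu>] ..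
    then show "xt \<theta> \<mu> - xt (\<theta> + \<omega>) \<mu> - 2 * R1 \<mu> + c \<theta> \<mu> * Y1 \<mu> = 0"
      using leading_relations(3)[OF \<mu>] by (simp add: torus_osc_def algebra_simps)
  qed
  have r2: "O_pow \<Lambda> (2 * k + 1) (\<lambda>u \<theta> \<mu>. A (?X u \<theta> \<mu>) (?Y u \<theta> \<mu>) (\<theta> + ?\<kappa> u \<theta> \<mu>) \<mu>)"
    by (rule remainder_O[OF A A_order U _ k PO(4,2)]) (use k in auto)
  have c2: "eqm \<Lambda> (2 * k + 1)
    (\<lambda>u \<theta> \<mu>. (Y1 \<mu> * u ^ (k + 1) + yt \<theta> \<mu> * u ^ (2 * k)) - (Y1 \<mu> * rdyn k R1 S u \<theta> \<mu> ^ (k + 1) + yt (\<theta> + \<omega>) \<mu> * rdyn k R1 S u \<theta> \<mu> ^ (2 * k)))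
    (\<lambda>u \<theta> \<mu>. (yt \<theta> \<mu> - yt (\<theta> + \<omega>) \<mu> - real (k + 1) * R1 \<mu> * Y1 \<mu>) * u ^ (2 * k))"
    by (rule coh_leading[OF S Y1_an ta(2)]) auto
  have "eqm \<Lambda> (2 * k + 1) (Ey ?X ?Y ?\<kappa> (\<lambda>u \<theta> \<mu>. ?Y (rdyn k R1 S u \<theta> \<mu>) (\<theta> + \<omega>) \<mu>))
      (\<lambda>u \<theta> \<mu>. (yt \<theta> \<mu> - yt (\<theta> + \<omega>) \<mu> - real (k + 1) * R1 \<mu> * Y1 \<mu> + a \<theta> \<mu>) * u ^ (2 * k))"
    by (rule eqm_balance[OF c2 eqm_add[OF monomial_leading[OF a PO(3,1)] eqm_of_O[OF r2]] eqm_add_zero])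
       (simp_all add: Ey_def Y left_diff_distrib distrib_right)
  then have Oy: "O_pow \<Lambda> (2 * k + 1) (Ey ?X ?Y ?\<kappa> (\<lambda>u \<theta> \<mu>. ?Y (rdyn k R1 S u \<theta> \<mu>) (\<theta> + \<omega>) \<mu>))"
  proof (rule lead)
    fix \<theta> \<mu> assume \<mu>: "\<mu> \<in> \<Lambda>"
    show "yt \<theta> \<mu> - yt (\<theta> + \<omega>) \<mu> - real (k + 1) * R1 \<mu> * Y1 \<mu> + a \<theta> \<mu> = 0"
      using Sa(3)[OF \<mu>, of \<theta>, folded yt_def] unfolding leading_relations(4)[OF \<mu>] by (simp add: torus_osc_def)
  qed
  have Ot: "O_pow \<Lambda> (2 * p + 1) (Et j ?X ?Y ?\<kappa> (\<lambda>u \<theta> \<mu>. ?\<kappa> (rdyn k R1 S u \<theta> \<mu>) (\<theta> + \<omega>) \<mu>))" for j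
  proof -
    have r3: "O_pow \<Lambda> (2 * p + 1) (\<lambda>u \<theta> \<mu>. B (?X u \<theta> \<mu>) (?Y u \<theta> \<mu>) (\<theta> + ?\<kappa> u \<theta> \<mu>) \<mu> $ j)"
      by (rule remainder_O[OF B_nth B_nth_order U p k PO(4,2)])
    have c3: "eqm \<Lambda> (2 * p + 1)
      (\<lambda>u \<theta> \<mu>. (T1 \<mu> $ j * u ^ (2 * p + 1 - k) + ts \<theta> \<mu> $ j * u ^ (2 * p))
         - (T1 \<mu> $ j * rdyn k R1 S u \<theta> \<mu> ^ (2 * p + 1 - k) + ts (\<theta> + \<omega>) \<mu> $ j * rdyn k R1 S u \<theta> \<mu> ^ (2 * p)))
      (\<lambda>u \<theta> \<mu>. (ts \<theta> \<mu> $ j - ts (\<theta> + \<omega>) \<mu> $ j - real (2 * p + 1 - k) * R1 \<mu> * T1 \<mu> $ j) * u ^ (2 * p))"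
      by (rule coh_leading[OF S ta_nth[OF T1_an] ta_nth[OF ta(3)]]) (use kp in auto)
    have "eqm \<Lambda> (2 * p + 1) (Et j ?X ?Y ?\<kappa> (\<lambda>u \<theta> \<mu>. ?\<kappa> (rdyn k R1 S u \<theta> \<mu>) (\<theta> + \<omega>) \<mu>))
        (\<lambda>u \<theta> \<mu>. (ts \<theta> \<mu> $ j - ts (\<theta> + \<omega>) \<mu> $ j - real (2 * p + 1 - k) * R1 \<mu> * T1 \<mu> $ j + d \<theta> \<mu> $ j) * u ^ (2 * p))"
      by (rule eqm_balance[OF c3 eqm_add[OF monomial_leading[OF ta_nth[OF d, of j] PO(3,1)] eqm_of_O[OF r3]] eqm_add_zero])
         (simp_all add: Et_def \<kappa> left_diff_distrib distrib_right)
    then show ?thesis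
    proof (rule lead)
      fix \<theta> \<mu> assume \<mu>: "\<mu> \<in> \<Lambda>"
      have "ts (\<theta> + \<omega>) \<mu> $ j - ts \<theta> \<mu> $ j = torus_osc d \<theta> \<mu> $ j"
        using Sd(3)[OF \<mu>, of \<theta>] by (simp add: ts_def vec_eq_iff)
      then show "ts \<theta> \<mu> $ j - ts (\<theta> + \<omega>) \<mu> $ j - real (2 * p + 1 - k) * R1 \<mu> * T1 \<mu> $ j + d \<theta> \<mu> $ j = 0"
        unfolding leading_relations(5)[OF \<mu>] by (simp add: torus_osc_def)
    qed
  qed
  have "solves 2 Kx Kx' Ky Ky' Kt Kt' Rx"
    unfolding solves_def S_def[symmetric]
  proof (intro conjI allI)
    show "Kx' (k + 1) = (\<lambda>\<theta> \<mu>. SD \<omega> \<Lambda> (torus_osc c) \<theta> \<mu> * Y1 \<mu>)" by (simp add: defs xt_def[abs_def])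
    show "O_pow \<Lambda> (2 + k) (Ex ?X ?Y ?\<kappa> (\<lambda>u \<theta> \<mu>. ?X (rdyn k R1 S u \<theta> \<mu>) (\<theta> + \<omega>) \<mu>))" using Ox by simp
    show "O_pow \<Lambda> (2 + 2 * k - 1) (Ey ?X ?Y ?\<kappa> (\<lambda>u \<theta> \<mu>. ?Y (rdyn k R1 S u \<theta> \<mu>) (\<theta> + \<omega>) \<mu>))" using Oy by simp
    show "O_pow \<Lambda> (2 + 2 * p - 1) (Et j ?X ?Y ?\<kappa> (\<lambda>u \<theta> \<mu>. ?\<kappa> (rdyn k R1 S u \<theta> \<mu>) (\<theta> + \<omega>) \<mu>))" for j using Ot[of j] by simp
  qed (use tc bars in \<open>simp_all add: defs yt_def ts_def\<close>)
  then show ?thesis by blast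
qed

lemma solves_exists: "n \<ge> 2 ==> \<exists>Kx Kx' Ky Ky' Kt Kt' Rx. solves n Kx Kx' Ky Ky' Kt Kt' Rx"
proof (induction n rule: nat_induct_at_least)
  case base show ?case by (rule solves_base)
next
  case (Suc n) then show ?case using solves_step by blast
qed

lemma K_poly_eq: "K_poly k p n Kx Kx' Ky Ky' Kt Kt' (u, \<theta>) \<mu> = (fx n Kx Kx' u \<theta> \<mu>, fy n Ky Ky' u \<theta> \<mu>, \<theta> + ft n Kt Kt' u \<theta> \<mu>)"
  by (simp add: K_poly_def fx_def fy_def ft_def usum_def vec_eq_iff mult.commute)

lemma R_poly_eq: "Rx k = R1 ==> R_poly k n \<omega> Rx (u, \<theta>) \<mu> = (rdyn k R1 (R2 n Rx) u \<theta> \<mu>, \<theta> + \<omega>)"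
  by (simp add: R_poly_def rdyn_def[OF k R1_an] R2_def)

lemma small_in_domain:
  assumes X: "O_pow \<Lambda> 1 X" and Y: "O_pow \<Lambda> 1 Y" and L: "compact L" "L \<subseteq> \<Lambda>"
  shows "\<exists>\<delta>>0. \<forall>u. 0 < u \<and> u < \<delta> \<longrightarrow> (\<forall>\<theta> :: real ^ 'd. \<forall>\<mu>\<in>L. (X u \<theta> \<mu>, Y u \<theta> \<mu>) \<in> U)"
proof -
  obtain C \<delta> where C: "C > 0" "\<delta> > 0" "\<And>u \<theta> \<mu>. 0 < u ==> u < \<delta> ==> \<mu> \<in> L ==> norm (X u \<theta> \<mu>) \<le> C * u ^ 1"
    using O_powE[OF X L] by metis
  obtain D \<epsilon> where D: "D > 0" "\<epsilon> > 0" "\<And>u \<theta> \<mu>. 0 < u ==> u < \<epsilon> ==> \<mu> \<in> L ==> norm (Y u \<theta> \<mu>) \<le> D * u ^ 1"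
    using O_powE[OF Y L] by metis
  obtain r where r: "r > 0" "ball (0, 0) r \<subseteq> U" using U unfolding mem_interior by blast
  have "(X u \<theta> \<mu>, Y u \<theta> \<mu>) \<in> U" if u: "0 < u" "u < min (min \<delta> \<epsilon>) (r / (C + D))" and "\<mu> \<in> L" for u \<theta> \<mu>
  proof -
    have "norm (X u \<theta> \<mu>, Y u \<theta> \<mu>) \<le> norm (X u \<theta> \<mu>) + norm (Y u \<theta> \<mu>)" by (rule norm_Pair_le)
    also have "\<dots> \<le> C * u ^ 1 + D * u ^ 1" by (rule add_mono[OF C(3) D(3)]) (use that in auto)
    also have "\<dots> < r" using u C(1) D(1) by (simp add: field_simps)
    finally have "(X u \<theta> \<mu>, Y u \<theta> \<mu>) \<in> ball (0, 0) r" by (simp add: dist_norm norm_Pair)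
    then show ?thesis using r by blast
  qed
  then show ?thesis using C D r by (intro exI[of _ "min (min \<delta> \<epsilon>) (r / (C + D))"]) auto
qed

lemma solves_residual:
  fixes F :: "real \<times> real \<times> (real ^ 'd) => real ^ 'm => real \<times> real \<times> (real ^ 'd)"
  assumes sol: "solves n Kx Kx' Ky Ky' Kt Kt' Rx"
    and F: "\<And>x y \<theta> \<mu>. (x, y) \<in> U ==> \<mu> \<in> \<Lambda> ==> F (x, y, \<theta>) \<mu> =
        (x + c \<theta> \<mu> * y, y + a \<theta> \<mu> * x ^ k + A x y \<theta> \<mu>, \<theta> + \<omega> + x ^ p *\<^sub>R d \<theta> \<mu> + B x y \<theta> \<mu>)"
    and G: "G = (\<lambda>u \<theta> \<mu>. F (K_poly k p n Kx Kx' Ky Ky' Kt Kt' (u, \<theta>) \<mu>) \<mu> - K_poly k p n Kx Kx' Ky Ky' Kt Kt' (R_poly k n \<omega> Rx (u, \<theta>) \<mu>) \<mu>)"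
  shows "O_pow \<Lambda> (n + k) (\<lambda>u \<theta> \<mu>. fst (G u \<theta> \<mu>))"
    "O_pow \<Lambda> (n + 2 * k - 1) (\<lambda>u \<theta> \<mu>. fst (snd (G u \<theta> \<mu>)))"
    "O_pow \<Lambda> (n + 2 * p - 1) (\<lambda>u \<theta> \<mu>. snd (snd (G u \<theta> \<mu>)))"
proof -
  have bars: "torus_analytic_on (\<lambda>\<theta> :: real ^ 'd. Kx i) \<Lambda>" "torus_analytic_on (\<lambda>\<theta> :: real ^ 'd. Ky i) \<Lambda>"
      "torus_analytic_on (\<lambda>\<theta> :: real ^ 'd. Kt i) \<Lambda>" for i
    using sol unfolding solves_def by blast+
  have tildes: "torus_analytic_on (Kx' i) \<Lambda>" "torus_analytic_on (Ky' i) \<Lambda>" "torus_analytic_on (Kt' i) \<Lambda>" for i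
    using sol unfolding solves_def tilde_coeff_def by blast+
  have R: "Rx k = R1" using sol unfolding solves_def by blast
  define X where "X = fx n Kx Kx'" define Y where "Y = fy n Ky Ky'" define \<kappa> where "\<kappa> = ft n Kt Kt'"
  define r :: "real => real ^ 'd => real ^ 'm => real" where "r = rdyn k R1 (R2 n Rx)"
  have O: "O_pow \<Lambda> (n + k) (Ex X Y \<kappa> (\<lambda>u \<theta> \<mu>. X (r u \<theta> \<mu>) (\<theta> + \<omega>) \<mu>))" "O_pow \<Lambda> (n + 2 * k - 1) (Ey X Y \<kappa> (\<lambda>u \<theta> \<mu>. Y (r u \<theta> \<mu>) (\<theta> + \<omega>) \<mu>))"
    "O_pow \<Lambda> (n + 2 * p - 1) (Et j X Y \<kappa> (\<lambda>u \<theta> \<mu>. \<kappa> (r u \<theta> \<mu>) (\<theta> + \<omega>) \<mu>))" for j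
    using sol unfolding solves_def X_def Y_def \<kappa>_def r_def by blast+
  note PO = profile_orders[where Kx = Kx and Kx' = Kx' and Ky = Ky and Ky' = Ky' and Kt = Kt and Kt' = Kt', OF bars tildes, of n, folded X_def Y_def]
  have G': "G u \<theta> \<mu> = (X u \<theta> \<mu> + c (\<theta> + \<kappa> u \<theta> \<mu>) \<mu> * Y u \<theta> \<mu> - X (r u \<theta> \<mu>) (\<theta> + \<omega>) \<mu>,
      Y u \<theta> \<mu> + a (\<theta> + \<kappa> u \<theta> \<mu>) \<mu> * X u \<theta> \<mu> ^ k + A (X u \<theta> \<mu>) (Y u \<theta> \<mu>) (\<theta> + \<kappa> u \<theta> \<mu>) \<mu> - Y (r u \<theta> \<mu>) (\<theta> + \<omega>) \<mu>,
      (\<theta> + \<kappa> u \<theta> \<mu>) + \<omega> + X u \<theta> \<mu> ^ p *\<^sub>R d (\<theta> + \<kappa> u \<theta> \<mu>) \<mu> + B (X u \<theta> \<mu>) (Y u \<theta> \<mu>) (\<theta> + \<kappa> u \<theta> \<mu>) \<mu>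
        - (\<theta> + \<omega> + \<kappa> (r u \<theta> \<mu>) (\<theta> + \<omega>) \<mu>))"
    if "(X u \<theta> \<mu>, Y u \<theta> \<mu>) \<in> U" "\<mu> \<in> \<Lambda>" for u \<theta> \<mu>
    using F[OF that] by (simp add: G K_poly_eq R_poly_eq[where Rx = Rx, OF R] X_def Y_def \<kappa>_def r_def)
  have ev: "\<exists>\<delta>>0. \<forall>u. 0 < u \<and> u < \<delta> \<longrightarrow> (\<forall>\<theta>. \<forall>\<mu>\<in>L. H u \<theta> \<mu>)"
    if L: "compact L" "L \<subseteq> \<Lambda>" and H: "\<And>u \<theta> \<mu>. (X u \<theta> \<mu>, Y u \<theta> \<mu>) \<in> U ==> \<mu> \<in> \<Lambda> ==> H u \<theta> \<mu>" for L and H :: "real => real ^ 'd => real ^ 'm => bool"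
    using small_in_domain[OF PO(5,6) L] H L(2) by (meson subsetD)
  show "O_pow \<Lambda> (n + k) (\<lambda>u \<theta> \<mu>. fst (G u \<theta> \<mu>))"
    by (rule O_cong_ev[OF O(1)], rule ev) (simp_all add: G' Ex_def)
  show "O_pow \<Lambda> (n + 2 * k - 1) (\<lambda>u \<theta> \<mu>. fst (snd (G u \<theta> \<mu>)))"
    by (rule O_cong_ev[OF O(2)], rule ev) (simp_all add: G' Ey_def)
  show "O_pow \<Lambda> (n + 2 * p - 1) (\<lambda>u \<theta> \<mu>. snd (snd (G u \<theta> \<mu>)))"
    unfolding O_vec
  proof
    show "O_pow \<Lambda> (n + 2 * p - 1) (\<lambda>u \<theta> \<mu>. snd (snd (G u \<theta> \<mu>)) $ j)" for j
      by (rule O_cong_ev[OF O(3)[of j]], rule ev) (simp_all add: G' Et_def)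
  qed
qed

end

section \<open>Approximate parametrizations of the invariant manifolds\<close>

theorem theorem3p2:
  fixes k p :: nat
    and \<omega> :: "real ^ 'd"
    and U :: "(real \<times> real) set"
    and \<Lambda> :: "(real ^ 'm) set"
    and c a :: "real ^ 'd \<Rightarrow> real ^ 'm \<Rightarrow> real"
    and d :: "real ^ 'd \<Rightarrow> real ^ 'm \<Rightarrow> real ^ 'd"
    and A :: "real \<Rightarrow> real \<Rightarrow> real ^ 'd \<Rightarrow> real ^ 'm \<Rightarrow> real"
    and B :: "real \<Rightarrow> real \<Rightarrow> real ^ 'd \<Rightarrow> real ^ 'm \<Rightarrow> real ^ 'd"
    and F :: "real \<times> real \<times> (real ^ 'd) \<Rightarrow> real ^ 'm \<Rightarrow> real \<times> real \<times> (real ^ 'd)"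
  assumes "k \<ge> 2" and "p \<ge> 1"
    and "(0, 0) \<in> interior U"
    and "reduced_form k p \<omega> U \<Lambda> c a d A B F"
    and "\<forall>\<mu>\<in>\<Lambda>. torus_avg d \<mu> \<noteq> 0"
    and "2 * int p > int k - 1"
    and "\<forall>\<mu>\<in>\<Lambda>. torus_avg c \<mu> > 0 \<and> torus_avg a \<mu> > 0"
    and "diophantine \<omega>"
  shows "\<forall>n\<ge>2. \<forall>s\<in>{1, -1 :: real}. \<exists>K R Kx Kx' Ky Ky' Kt Kt' Rx.
     K = K_poly k p n Kx Kx' Ky Ky' Kt Kt' \<and>
     R = R_poly k n \<omega> Rx \<and>
     (\<forall>i. bar_coeff \<Lambda> (Kx i) \<and> bar_coeff \<Lambda> (Ky i) \<and> bar_coeff \<Lambda> (Kt i) \<and> bar_coeff \<Lambda> (Rx i)) \<and>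
     (\<forall>i. tilde_coeff \<Lambda> (Kx' i) \<and> tilde_coeff \<Lambda> (Ky' i) \<and> tilde_coeff \<Lambda> (Kt' i)) \<and>
     (let G = (\<lambda>u \<theta> \<mu>. F (K (u, \<theta>) \<mu>) \<mu> - K (R (u, \<theta>) \<mu>) \<mu>) in
        O_pow \<Lambda> (n + k) (\<lambda>u \<theta> \<mu>. fst (G u \<theta> \<mu>)) \<and>
        O_pow \<Lambda> (n + 2 * k - 1) (\<lambda>u \<theta> \<mu>. fst (snd (G u \<theta> \<mu>))) \<and>
        O_pow \<Lambda> (n + 2 * p - 1) (\<lambda>u \<theta> \<mu>. snd (snd (G u \<theta> \<mu>)))) \<and>
     (\<forall>\<mu>\<in>\<Lambda>.
        Ky (k + 1) \<mu> = s * sqrt (2 * torus_avg a \<mu> / (torus_avg c \<mu> * real (k + 1))) \<and>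
        Kt (2 * p + 1 - k) \<mu> =
          (s * (1 / real (2 * p + 1 - k)) *
            sqrt (2 * real (k + 1) / (torus_avg c \<mu> * torus_avg a \<mu>))) *\<^sub>R torus_avg d \<mu> \<and>
        Rx k \<mu> = s * sqrt (torus_avg c \<mu> * torus_avg a \<mu> / (2 * real (k + 1))) \<and>
        (\<forall>\<theta>. Kx' (k + 1) \<theta> \<mu> = SD \<omega> \<Lambda> (torus_osc c) \<theta> \<mu> * Ky (k + 1) \<mu> \<and>
             Ky' (2 * k) \<theta> \<mu> = SD \<omega> \<Lambda> (torus_osc a) \<theta> \<mu> \<and>
             Kt' (2 * p) \<theta> \<mu> = SD \<omega> \<Lambda> (torus_osc d) \<theta> \<mu>))"
proof (intro allI impI ballI)
  fix n :: nat and s :: real assume n: "n \<ge> 2" and s: "s \<in> {1, - 1}"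
  note rf = assms(4)[unfolded reduced_form_def]
  interpret reduced_map k p \<omega> U \<Lambda> c a d A B s
  proof
    show "k \<le> 2 * p" using assms(6) by linarith
  qed (use assms s rf in auto)
  obtain Kx Kx' Ky Ky' Kt Kt' Rx where sol: "solves n Kx Kx' Ky Ky' Kt Kt' Rx" using solves_exists[OF n] by blast
  have F: "F (x, y, \<theta>) \<mu> = (x + c \<theta> \<mu> * y, y + a \<theta> \<mu> * x ^ k + A x y \<theta> \<mu>, \<theta> + \<omega> + x ^ p *\<^sub>R d \<theta> \<mu> + B x y \<theta> \<mu>)"
    if "(x, y) \<in> U" "\<mu> \<in> \<Lambda>" for x y \<theta> \<mu> using rf that by blast
  note G = solves_residual[OF sol F refl]
  show "\<exists>K R Kx Kx' Ky Ky' Kt Kt' Rx.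
     K = K_poly k p n Kx Kx' Ky Ky' Kt Kt' \<and>
     R = R_poly k n \<omega> Rx \<and>
     (\<forall>i. bar_coeff \<Lambda> (Kx i) \<and> bar_coeff \<Lambda> (Ky i) \<and> bar_coeff \<Lambda> (Kt i) \<and> bar_coeff \<Lambda> (Rx i)) \<and>
     (\<forall>i. tilde_coeff \<Lambda> (Kx' i) \<and> tilde_coeff \<Lambda> (Ky' i) \<and> tilde_coeff \<Lambda> (Kt' i)) \<and>
     (let G = (\<lambda>u \<theta> \<mu>. F (K (u, \<theta>) \<mu>) \<mu> - K (R (u, \<theta>) \<mu>) \<mu>) in
        O_pow \<Lambda> (n + k) (\<lambda>u \<theta> \<mu>. fst (G u \<theta> \<mu>)) \<and>
        O_pow \<Lambda> (n + 2 * k - 1) (\<lambda>u \<theta> \<mu>. fst (snd (G u \<theta> \<mu>))) \<and>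
        O_pow \<Lambda> (n + 2 * p - 1) (\<lambda>u \<theta> \<mu>. snd (snd (G u \<theta> \<mu>)))) \<and>
     (\<forall>\<mu>\<in>\<Lambda>.
        Ky (k + 1) \<mu> = s * sqrt (2 * torus_avg a \<mu> / (torus_avg c \<mu> * real (k + 1))) \<and>
        Kt (2 * p + 1 - k) \<mu> =
          (s * (1 / real (2 * p + 1 - k)) *
            sqrt (2 * real (k + 1) / (torus_avg c \<mu> * torus_avg a \<mu>))) *\<^sub>R torus_avg d \<mu> \<and>
        Rx k \<mu> = s * sqrt (torus_avg c \<mu> * torus_avg a \<mu> / (2 * real (k + 1))) \<and>
        (\<forall>\<theta>. Kx' (k + 1) \<theta> \<mu> = SD \<omega> \<Lambda> (torus_osc c) \<theta> \<mu> * Ky (k + 1) \<mu> \<and>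
             Ky' (2 * k) \<theta> \<mu> = SD \<omega> \<Lambda> (torus_osc a) \<theta> \<mu> \<and>
             Kt' (2 * p) \<theta> \<mu> = SD \<omega> \<Lambda> (torus_osc d) \<theta> \<mu>))"
  proof (intro exI conjI)
    show "\<forall>i. bar_coeff \<Lambda> (Kx i) \<and> bar_coeff \<Lambda> (Ky i) \<and> bar_coeff \<Lambda> (Kt i) \<and> bar_coeff \<Lambda> (Rx i)"
      using sol unfolding solves_def bar_coeff_iff[where 'd = 'd] by blast
    show "\<forall>i. tilde_coeff \<Lambda> (Kx' i) \<and> tilde_coeff \<Lambda> (Ky' i) \<and> tilde_coeff \<Lambda> (Kt' i)"
      using sol unfolding solves_def by blast
    have low: "Ky (k + 1) = Y1" "Kt (2 * p + 1 - k) = T1" "Rx k = R1" "Kx' (k + 1) = (\<lambda>\<theta> \<mu>. SD \<omega> \<Lambda> (torus_osc c) \<theta> \<mu> * Y1 \<mu>)"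
      "Ky' (2 * k) = SD \<omega> \<Lambda> (torus_osc a)" "Kt' (2 * p) = SD \<omega> \<Lambda> (torus_osc d)"
      using sol unfolding solves_def by blast+
    show "(\<forall>\<mu>\<in>\<Lambda>.
        Ky (k + 1) \<mu> = s * sqrt (2 * torus_avg a \<mu> / (torus_avg c \<mu> * real (k + 1))) \<and>
        Kt (2 * p + 1 - k) \<mu> =
          (s * (1 / real (2 * p + 1 - k)) *
            sqrt (2 * real (k + 1) / (torus_avg c \<mu> * torus_avg a \<mu>))) *\<^sub>R torus_avg d \<mu> \<and>
        Rx k \<mu> = s * sqrt (torus_avg c \<mu> * torus_avg a \<mu> / (2 * real (k + 1))) \<and>
        (\<forall>\<theta>. Kx' (k + 1) \<theta> \<mu> = SD \<omega> \<Lambda> (torus_osc c) \<theta> \<mu> * Ky (k + 1) \<mu> \<and>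
             Ky' (2 * k) \<theta> \<mu> = SD \<omega> \<Lambda> (torus_osc a) \<theta> \<mu> \<and>
             Kt' (2 * p) \<theta> \<mu> = SD \<omega> \<Lambda> (torus_osc d) \<theta> \<mu>))"
      unfolding low Y1_def T1_def R1_def by (intro ballI conjI allI refl)
    show "let G = (\<lambda>u \<theta> \<mu>. F (K_poly k p n Kx Kx' Ky Ky' Kt Kt' (u, \<theta>) \<mu>) \<mu> - K_poly k p n Kx Kx' Ky Ky' Kt Kt' (R_poly k n \<omega> Rx (u, \<theta>) \<mu>) \<mu>) in
        O_pow \<Lambda> (n + k) (\<lambda>u \<theta> \<mu>. fst (G u \<theta> \<mu>)) \<and>
        O_pow \<Lambda> (n + 2 * k - 1) (\<lambda>u \<theta> \<mu>. fst (snd (G u \<theta> \<mu>))) \<and>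
        O_pow \<Lambda> (n + 2 * p - 1) (\<lambda>u \<theta> \<mu>. snd (snd (G u \<theta> \<mu>)))"
      unfolding Let_def by (intro conjI G)
  qed (rule refl)+
qed

end
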